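(* Let $G_\infty=\varinjlim G_{(m,n)}=\bigcup_{m,n}G_{(m,n)}$ be the union of all the finite dimensional grassmannians $G_{(m,n)}$. Then $G_\infty$ is a projective ind-variety over $k$ (with filtration $X_n=G_{(n,n)}$, embedded by the Plücker embeddings), and its homogeneous coordinate ring $S(G_\infty)=\varprojlim_n S(X_n)$ is isomorphic to $\widehat{k[\delta_\infty]}=\varprojlim_{(m,n)}k[\delta_{m,n}]$.
   Context: $k$ is an algebraically closed field of characteristic $0$; $m,n$ are positive integers. $G_{(m,n)}$ is the grassmannian of $m$-dimensional subspaces of the vector space with basis $e_{-m},\dots,e_{n-1}$ (dimension $N=m+n$). For $m'\ge m$, $n'\ge n$, $G_{(m,n)}\to G_{(m',n')}$ is the closed immersion $W\mapsto \mathrm{span}(e_{-m'},\dots,e_{-m-1})\oplus W$. Let $k[a_{i,j}]_{m,n}$ be the polynomial ring in the entries of an $N\times N$ matrix with row and column indices from $-m$ to $n-1$. For $-m\le l_0<\dots<l_{m-1}\le n-1$, let $d_{l_0\dots l_{m-1}}$ be the determinant of the minor with rows $l_0,\dots,l_{m-1}$ and columns $-m,\dots,-1$; $k[\delta_{m,n}]$ is the subring of $k[a_{i,j}]_{m,n}$ generated over $k$ by these determinants; it is the homogeneous coordinate ring of $G_{(m,n)}$ in its Plücker embedding. For $m'\ge m$, $n'\ge n$ the ring homomorphism $e_{(m',n',m,n)}:k[\delta_{m',n'}]\to k[\delta_{m,n}]$ sends $d_{j_0\dots j_{m'-1}}$ to $d_{l_0\dots l_{m-1}}$ if $(j_0,\dots,j_{m'-1})=(-m',\dots,-m-1,l_0,\dots,l_{m-1})$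 with $-m\le l_0<\dots<l_{m-1}\le n-1$, and to $0$ otherwise. The inverse limit is over these maps. An ind-variety over $k$ is a set $X$ with a filtration $X_0\subset X_1\subset\cdots$ such that $\bigcup X_n=X$ and each $X_n$ is a finite dimensional variety over $k$ with $X_n\subset X_{n+1}$ a closed immersion; $U\subset X$ is open iff every $U\cap X_n$ is open, and $\mathcal O_X=\varprojlim\mathcal O_{X_n}$. $X$ is a projective ind-variety if it admits a filtration $X_n$ and a line bundle $L$ such that each $L|_{X_n}$ is very ample and each restriction map $H^0(X_n,L|_{X_n})\to H^0(X_{n-1},L|_{X_{n-1}})$ is surjective; this gives compatible closed immersions $X_n\hookrightarrow\mathbf P^{N_n}=\mathbf P(H^0(X_n,L|_{X_n})^\vee)$. With $S(X_n)=S(\mathbf P^{N_n})/I(X_n)$ the homogeneous coordinate ring of $X_n\subset \mathbf P^{N_n}$, the homogeneous coordinate ring of $X$ is $S(X):=\varprojlim S(X_n)$ (limit of rings along restriction maps). *)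

theory Defs
  imports
    "HOL-Library.Function_Algebras"
    "HOL-Library.Poly_Mapping"
    "HOL-Computational_Algebra.Polynomial"
    "HOL-Analysis.Abstract_Topology"
    "HOL-Algebra.QuotRing"
    "HOL-Algebra.Generated_Rings"
    "Jordan_Normal_Form.Determinant"
begin

section \<open>Linear algebra in spaces of functions\<close>

definition fscale :: "'k::field \<Rightarrow> ('a \<Rightarrow> 'k) \<Rightarrow> 'a \<Rightarrow> 'k" where
  "fscale c v = (\<lambda>a. c * v a)"

global_interpretation fun_vs: vector_space "fscale :: 'k::field \<Rightarrow> ('a \<Rightarrow> 'k) \<Rightarrow> 'a \<Rightarrow> 'k"
  by standard (auto simp: fscale_def fun_eq_iff algebra_simps)

definition coord_space :: "'a set \<Rightarrow> ('a \<Rightarrow> 'k::field) set" where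
  "coord_space I = {v. \<forall>a. a \<notin> I \<longrightarrow> v a = 0}"

definition finite_dim :: "('a \<Rightarrow> 'k::field) set \<Rightarrow> bool" where
  "finite_dim V \<longleftrightarrow> (\<exists>B. finite B \<and> B \<subseteq> V \<and> fun_vs.span B = V)"

text \<open>A functional on \<open>V\<close> is represented by its extension by \<open>0\<close> outside \<open>V\<close>.\<close>

definition dual_space :: "('a \<Rightarrow> 'k::field) set \<Rightarrow> (('a \<Rightarrow> 'k) \<Rightarrow> 'k) set" where
  "dual_space V = {\<phi>. (\<forall>v. v \<notin> V \<longrightarrow> \<phi> v = 0) \<and>
     (\<forall>v\<in>V. \<forall>w\<in>V. \<phi> (v + w) = \<phi> v + \<phi> w) \<and> (\<forall>c. \<forall>v\<in>V. \<phi> (fscale c v) = c * \<phi> v)}"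


section \<open>Commutative algebras over a field\<close>

record ('k, 'a) kalg = "'a ring" +
  scal :: "'k \<Rightarrow> 'a"

definition kalg_hom :: "('k, 'a) kalg \<Rightarrow> ('k, 'b) kalg \<Rightarrow> ('a \<Rightarrow> 'b) set" where
  "kalg_hom A B = {h \<in> Ring.ring_hom A B. \<forall>c. h (scal A c) = scal B c}"

definition kalg_isomorphic :: "('k, 'a) kalg \<Rightarrow> ('k, 'b) kalg \<Rightarrow> bool" where
  "kalg_isomorphic A B \<longleftrightarrow> (\<exists>h \<in> kalg_hom A B. bij_betw h (carrier A) (carrier B))"

text \<open>The unique homomorphism with \<open>x \<mapsto> y\<close> for \<open>(x, y) \<in> r\<close>; it is used only where the first
  components of \<open>r\<close> generate \<open>A\<close>.\<close>

definition the_kalg_hom :: "('k, 'a) kalg \<Rightarrow> ('k, 'b) kalg \<Rightarrow> ('a \<times> 'b) set \<Rightarrow> 'a \<Rightarrow> 'b" where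
  "the_kalg_hom A B r =
     (THE h. h \<in> kalg_hom A B \<and> h \<in> extensional (carrier A) \<and> (\<forall>(x, y) \<in> r. h x = y))"

definition kalg_quot :: "('k, 'a) kalg \<Rightarrow> 'a set \<Rightarrow> ('k, 'a set) kalg" where
  "kalg_quot A I = ring.extend (A Quot I) (kalg.fields (\<lambda>c. I +>\<^bsub>A\<^esub> scal A c))"

text \<open>Inverse limit of a system indexed by a preordered set, with \<open>f i j\<close>
  mapping \<open>A j\<close> to \<open>A i\<close> whenever \<open>rel i j\<close>.\<close>

definition inverse_limit ::
  "'i set \<Rightarrow> ('i \<Rightarrow> 'i \<Rightarrow> bool) \<Rightarrow> ('i \<Rightarrow> ('k, 'a) kalg) \<Rightarrow> ('i \<Rightarrow> 'i \<Rightarrow> 'a \<Rightarrow> 'a)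
    \<Rightarrow> ('k, 'i \<Rightarrow> 'a) kalg" where
  "inverse_limit I rel A f =
     \<lparr> carrier = {a \<in> (\<Pi>\<^sub>E i\<in>I. carrier (A i)). \<forall>i\<in>I. \<forall>j\<in>I. rel i j \<longrightarrow> f i j (a j) = a i},
       monoid.mult = (\<lambda>a b. \<lambda>i\<in>I. a i \<otimes>\<^bsub>A i\<^esub> b i),
       one = (\<lambda>i\<in>I. \<one>\<^bsub>A i\<^esub>),
       zero = (\<lambda>i\<in>I. \<zero>\<^bsub>A i\<^esub>),
       add = (\<lambda>a b. \<lambda>i\<in>I. a i \<oplus>\<^bsub>A i\<^esub> b i),
       scal = (\<lambda>c. \<lambda>i\<in>I. scal (A i) c) \<rparr>"


section \<open>Polynomials in arbitrarily many variables\<close>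

type_synonym ('v, 'k) mpoly = "('v \<Rightarrow>\<^sub>0 nat) \<Rightarrow>\<^sub>0 'k"

definition mp_const :: "'k::field \<Rightarrow> ('v, 'k) mpoly" where
  "mp_const c = Poly_Mapping.single 0 c"

definition mp_var :: "'v \<Rightarrow> ('v, 'k::field) mpoly" where
  "mp_var v = Poly_Mapping.single (Poly_Mapping.single v 1) 1"

definition mp_vars :: "('v, 'k::field) mpoly \<Rightarrow> 'v set" where
  "mp_vars p = (\<Union>\<mu> \<in> Poly_Mapping.keys p. Poly_Mapping.keys \<mu>)"

definition mp_eval :: "('v \<Rightarrow> 'k::field) \<Rightarrow> ('v, 'k) mpoly \<Rightarrow> 'k" where
  "mp_eval x p = (\<Sum>\<mu> \<in> Poly_Mapping.keys p. Poly_Mapping.lookup p \<mu> *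
     (\<Prod>v \<in> Poly_Mapping.keys \<mu>. x v ^ Poly_Mapping.lookup \<mu> v))"

definition homogeneous :: "nat \<Rightarrow> ('v, 'k::field) mpoly \<Rightarrow> bool" where
  "homogeneous d p \<longleftrightarrow>
     (\<forall>\<mu> \<in> Poly_Mapping.keys p. (\<Sum>v \<in> Poly_Mapping.keys \<mu>. Poly_Mapping.lookup \<mu> v) = d)"

definition poly_alg :: "'v set \<Rightarrow> ('k::field, ('v, 'k) mpoly) kalg" where
  "poly_alg V = \<lparr> carrier = {p. mp_vars p \<subseteq> V}, monoid.mult = (*), one = 1, zero = 0,
     add = (+), scal = mp_const \<rparr>"

definition sym_relations :: "('a \<Rightarrow> 'k::field) set \<Rightarrow> ('a \<Rightarrow> 'k, 'k) mpoly set" where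
  "sym_relations V =
     {mp_var (s + t) - mp_var s - mp_var t | s t. s \<in> V \<and> t \<in> V} \<union>
     {mp_var (fscale c s) - mp_const c * mp_var s | c s. s \<in> V}"

text \<open>The symmetric algebra of \<open>V\<close>, that is, the homogeneous coordinate ring of the projective
  space of lines in the dual of \<open>V\<close>: the polynomial ring with one variable for each vector
  of \<open>V\<close>, modulo the linear relations of \<open>V\<close>.\<close>

definition sym_alg :: "('a \<Rightarrow> 'k::field) set \<Rightarrow> ('k, ('a \<Rightarrow> 'k, 'k) mpoly set) kalg" where
  "sym_alg V = kalg_quot (poly_alg V) (genideal (poly_alg V) (sym_relations V))"

definition sym_incl :: "('a \<Rightarrow> 'k::field) set \<Rightarrow> ('a \<Rightarrow> 'k) \<Rightarrow> ('a \<Rightarrow> 'k, 'k) mpoly set" where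
  "sym_incl V s = genideal (poly_alg V) (sym_relations V) +>\<^bsub>poly_alg V\<^esub> mp_var s"


section \<open>Spaces with functions and varieties\<close>

text \<open>A topological space with a sheaf of \<open>k\<close>-valued functions. A function on \<open>U\<close> is
  represented by its extension by \<open>0\<close> outside \<open>U\<close>.\<close>

record ('x, 'k) kspace =
  ztop :: "'x topology"
  reg :: "'x set \<Rightarrow> ('x \<Rightarrow> 'k) set"

abbreviation pts :: "('x, 'k) kspace \<Rightarrow> 'x set" where
  "pts X \<equiv> topspace (ztop X)"

definition restr :: "'x set \<Rightarrow> ('x \<Rightarrow> 'k::zero) \<Rightarrow> 'x \<Rightarrow> 'k" where
  "restr U f = (\<lambda>x. if x \<in> U then f x else 0)"

definition is_kspace :: "('x, 'k::field) kspace \<Rightarrow> bool" where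
  "is_kspace X \<longleftrightarrow>
     (\<forall>U. openin (ztop X) U \<longrightarrow>
        (\<forall>f \<in> reg X U. restr U f = f) \<and>
        (\<forall>c. restr U (\<lambda>_. c) \<in> reg X U) \<and>
        (\<forall>f \<in> reg X U. \<forall>g \<in> reg X U.
           (\<lambda>x. f x + g x) \<in> reg X U \<and> (\<lambda>x. f x * g x) \<in> reg X U)) \<and>
     (\<forall>U V f. openin (ztop X) U \<and> openin (ztop X) V \<and> V \<subseteq> U \<and> f \<in> reg X U \<longrightarrow>
        restr V f \<in> reg X V) \<and>
     (\<forall>\<U> f. (\<forall>U\<in>\<U>. openin (ztop X) U \<and> restr U f \<in> reg X U) \<and> restr (\<Union>\<U>) f = f \<longrightarrow>
        f \<in> reg X (\<Union>\<U>))"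

definition morphism :: "('x \<Rightarrow> 'y) \<Rightarrow> ('x, 'k::field) kspace \<Rightarrow> ('y, 'k) kspace \<Rightarrow> bool" where
  "morphism f X Y \<longleftrightarrow> continuous_map (ztop X) (ztop Y) f \<and>
     (\<forall>V h. openin (ztop Y) V \<and> h \<in> reg Y V \<longrightarrow>
        restr (f -` V \<inter> pts X) (h \<circ> f) \<in> reg X (f -` V \<inter> pts X))"

definition isomorphism :: "('x \<Rightarrow> 'y) \<Rightarrow> ('x, 'k::field) kspace \<Rightarrow> ('y, 'k) kspace \<Rightarrow> bool" where
  "isomorphism f X Y \<longleftrightarrow> bij_betw f (pts X) (pts Y) \<and>
     morphism f X Y \<and> morphism (inv_into (pts X) f) Y X"

text \<open>The structure induced on \<open>A\<close> by a map \<open>f\<close> from \<open>A\<close> to \<open>Y\<close>: the regular functions are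
  those that are locally pullbacks of regular functions on \<open>Y\<close>.\<close>

definition induced_space :: "'x set \<Rightarrow> ('x \<Rightarrow> 'y) \<Rightarrow> ('y, 'k::field) kspace \<Rightarrow> ('x, 'k) kspace" where
  "induced_space A f Y =
     \<lparr> ztop = pullback_topology A f (ztop Y),
       reg = (\<lambda>U. {g. restr U g = g \<and>
         (\<forall>x\<in>U. \<exists>V h. openin (ztop Y) V \<and> h \<in> reg Y V \<and> f x \<in> V \<and> f -` V \<inter> A \<subseteq> U \<and>
            (\<forall>z \<in> f -` V \<inter> A. g z = h (f z)))}) \<rparr>"

abbreviation subspace_of :: "('y, 'k::field) kspace \<Rightarrow> 'y set \<Rightarrow> ('y, 'k) kspace" where
  "subspace_of Y Z \<equiv> induced_space Z (\<lambda>y. y) Y"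

definition closed_immersion :: "('x \<Rightarrow> 'y) \<Rightarrow> ('x, 'k::field) kspace \<Rightarrow> ('y, 'k) kspace \<Rightarrow> bool" where
  "closed_immersion f X Y \<longleftrightarrow>
     closedin (ztop Y) (f ` pts X) \<and> isomorphism f X (subspace_of Y (f ` pts X))"

definition affine_space :: "nat \<Rightarrow> (nat \<Rightarrow> 'k, 'k::field) kspace" where
  "affine_space d =
     (let E = coord_space {..<d};
          T = topology (\<lambda>U. U \<subseteq> E \<and> (\<exists>F. E - U = {x\<in>E. \<forall>p\<in>F. mp_eval x p = 0}))
      in \<lparr> ztop = T,
           reg = (\<lambda>U. {f. restr U f = f \<and>
             (\<forall>x\<in>U. \<exists>V p q. openin T V \<and> x \<in> V \<and> V \<subseteq> U \<and>
                (\<forall>y\<in>V. mp_eval y q \<noteq> 0 \<and> f y = mp_eval y p / mp_eval y q))}) \<rparr>)"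

definition vline :: "('v \<Rightarrow> 'k::field) \<Rightarrow> ('v \<Rightarrow> 'k) set" where
  "vline v = {fscale c v | c. True}"

text \<open>The projective space of lines in \<open>E\<close>, for \<open>E\<close> a linear subspace of a space of functions;
  the homogeneous coordinates of a line are the values of its nonzero elements. It is used for
  \<open>E = coord_space I\<close>, and for \<open>E\<close> the dual of a vector space \<open>V\<close>, where the
  coordinates are indexed by all vectors of \<open>V\<close>.\<close>

definition proj_space :: "('v \<Rightarrow> 'k::field) set \<Rightarrow> (('v \<Rightarrow> 'k) set, 'k) kspace" where
  "proj_space E =
     (let P = vline ` (E - {0});
          T = topology (\<lambda>U. U \<subseteq> P \<and> (\<exists>F. (\<forall>p\<in>F. \<exists>d. homogeneous d p) \<and>
                P - U = {l\<in>P. \<forall>p\<in>F. \<forall>v \<in> l - {0}. mp_eval v p = 0}))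
      in \<lparr> ztop = T,
           reg = (\<lambda>U. {f. restr U f = f \<and>
             (\<forall>l\<in>U. \<exists>V d p q. openin T V \<and> l \<in> V \<and> V \<subseteq> U \<and> homogeneous d p \<and> homogeneous d q \<and>
                (\<forall>l'\<in>V. \<forall>v \<in> l' - {0}.
                   mp_eval v q \<noteq> 0 \<and> f l' = mp_eval v p / mp_eval v q))}) \<rparr>)"

definition prevariety :: "('x, 'k::field) kspace \<Rightarrow> bool" where
  "prevariety X \<longleftrightarrow> is_kspace X \<and>
     (\<exists>\<U>. finite \<U> \<and> \<Union>\<U> = pts X \<and>
        (\<forall>U\<in>\<U>. openin (ztop X) U \<and>
           (\<exists>d Z f. closedin (ztop (affine_space d)) Z \<and>
              isomorphism f (subspace_of X U) (subspace_of (affine_space d) Z))))"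

definition separated :: "('x, 'k::field) kspace \<Rightarrow> bool" where
  "separated X \<longleftrightarrow>
     (\<forall>d Z f g. closedin (ztop (affine_space d)) Z \<and>
        morphism f (subspace_of (affine_space d) Z) X \<and>
        morphism g (subspace_of (affine_space d) Z) X \<longrightarrow>
        closedin (ztop (affine_space d)) {z\<in>Z. f z = g z})"

definition irreducible_top :: "'x topology \<Rightarrow> bool" where
  "irreducible_top T \<longleftrightarrow> topspace T \<noteq> {} \<and>
     (\<forall>U V. openin T U \<and> openin T V \<and> U \<noteq> {} \<and> V \<noteq> {} \<longrightarrow> U \<inter> V \<noteq> {})"

text \<open>Finite dimensionality is automatic: there is a finite cover by closed subsets of
  finite dimensional affine spaces.\<close>

definition variety :: "('x, 'k::field) kspace \<Rightarrow> bool" where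
  "variety X \<longleftrightarrow> prevariety X \<and> separated X \<and> irreducible_top (ztop X)"


section \<open>Line bundles and their sections\<close>

text \<open>A line bundle is given by an open cover and transition functions. Only the values of
  \<open>trans L i j\<close> on the overlap of the charts \<open>i\<close> and \<open>j\<close> are meaningful.\<close>

record ('i, 'x, 'k) lbundle =
  idx :: "'i set"
  chart :: "'i \<Rightarrow> 'x set"
  trans :: "'i \<Rightarrow> 'i \<Rightarrow> 'x \<Rightarrow> 'k"

definition line_bundle :: "('x, 'k::field) kspace \<Rightarrow> ('i, 'x, 'k) lbundle \<Rightarrow> bool" where
  "line_bundle X L \<longleftrightarrow>
     (\<forall>i\<in>idx L. openin (ztop X) (chart L i)) \<and>
     (\<Union>i\<in>idx L. chart L i) = pts X \<and>
     (\<forall>i\<in>idx L. \<forall>j\<in>idx L.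
        restr (chart L i \<inter> chart L j) (trans L i j) \<in> reg X (chart L i \<inter> chart L j)) \<and>
     (\<forall>i\<in>idx L. \<forall>x\<in>chart L i. trans L i i x = 1) \<and>
     (\<forall>i\<in>idx L. \<forall>j\<in>idx L. \<forall>k\<in>idx L. \<forall>x \<in> chart L i \<inter> chart L j \<inter> chart L k.
        trans L i j x * trans L j k x = trans L i k x)"

definition bundle_restrict :: "('i, 'x, 'k) lbundle \<Rightarrow> 'x set \<Rightarrow> ('i, 'x, 'k) lbundle" where
  "bundle_restrict L Z = L\<lparr>chart := (\<lambda>i. chart L i \<inter> Z)\<rparr>"

text \<open>A section is a family of regular functions \<open>s\<^sub>i\<close> on the charts with
  \<open>s\<^sub>i = trans i j * s\<^sub>j\<close> on overlaps, written as a function of the pair \<open>(i, x)\<close>.\<close>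

definition H0 :: "('x, 'k::field) kspace \<Rightarrow> ('i, 'x, 'k) lbundle \<Rightarrow> ('i \<times> 'x \<Rightarrow> 'k) set" where
  "H0 X L = {s.
     (\<forall>i x. i \<notin> idx L \<or> x \<notin> chart L i \<longrightarrow> s (i, x) = 0) \<and>
     (\<forall>i\<in>idx L. (\<lambda>x. s (i, x)) \<in> reg X (chart L i)) \<and>
     (\<forall>i\<in>idx L. \<forall>j\<in>idx L. \<forall>x \<in> chart L i \<inter> chart L j. s (i, x) = trans L i j x * s (j, x))}"

definition restrict_section :: "'x set \<Rightarrow> ('i \<times> 'x \<Rightarrow> 'k::zero) \<Rightarrow> 'i \<times> 'x \<Rightarrow> 'k" where
  "restrict_section Z s = (\<lambda>(i, x). if x \<in> Z then s (i, x) else 0)"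

text \<open>The line in the dual of \<open>H0 X L\<close> spanned by evaluation at \<open>x\<close> in any chart around \<open>x\<close>.\<close>

definition linear_system_map ::
  "('x, 'k::field) kspace \<Rightarrow> ('i, 'x, 'k) lbundle \<Rightarrow> 'x \<Rightarrow> (('i \<times> 'x \<Rightarrow> 'k) \<Rightarrow> 'k) set" where
  "linear_system_map X L x =
     {restr (H0 X L) (\<lambda>s. c * s (i, x)) | c i. i \<in> idx L \<and> x \<in> chart L i}"

text \<open>Very ampleness through the complete linear system. Base point freeness is part of it,
  since all values of the map have to be points of the projective space.\<close>

definition very_ample :: "('x, 'k::field) kspace \<Rightarrow> ('i, 'x, 'k) lbundle \<Rightarrow> bool" where
  "very_ample X L \<longleftrightarrow> line_bundle X L \<and> finite_dim (H0 X L) \<and>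
     closed_immersion (linear_system_map X L) X (proj_space (dual_space (H0 X L)))"


section \<open>Homogeneous coordinate rings\<close>

text \<open>The elements of \<open>sym_alg V\<close> are cosets of polynomials, all of whose members take the same
  value at a linear functional on \<open>V\<close>.\<close>

definition vanishing_ideal ::
  "('a \<Rightarrow> 'k::field) set \<Rightarrow> (('a \<Rightarrow> 'k) \<Rightarrow> 'k) set set \<Rightarrow> ('a \<Rightarrow> 'k, 'k) mpoly set set" where
  "vanishing_ideal V Y = genideal (sym_alg V)
     {A \<in> carrier (sym_alg V). (\<exists>d. \<exists>p\<in>A. homogeneous d p) \<and>
        (\<forall>l\<in>Y. \<forall>\<phi> \<in> l - {0}. \<forall>p\<in>A. mp_eval \<phi> p = 0)}"

definition coord_ring ::
  "('a \<Rightarrow> 'k::field) set \<Rightarrow> (('a \<Rightarrow> 'k) \<Rightarrow> 'k) set set \<Rightarrow> ('k, ('a \<Rightarrow> 'k, 'k) mpoly set set) kalg" where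
  "coord_ring V Y = kalg_quot (sym_alg V) (vanishing_ideal V Y)"

definition coord_form ::
  "('a \<Rightarrow> 'k::field) set \<Rightarrow> (('a \<Rightarrow> 'k) \<Rightarrow> 'k) set set \<Rightarrow> ('a \<Rightarrow> 'k) \<Rightarrow> ('a \<Rightarrow> 'k, 'k) mpoly set set" where
  "coord_form V Y s = vanishing_ideal V Y +>\<^bsub>sym_alg V\<^esub> sym_incl V s"


section \<open>Projective ind-varieties\<close>

definition ind_variety :: "'x set \<Rightarrow> (nat \<Rightarrow> ('x, 'k::field) kspace) \<Rightarrow> bool" where
  "ind_variety X Xs \<longleftrightarrow> (\<Union>n. pts (Xs n)) = X \<and> (\<forall>n. variety (Xs n)) \<and>
     (\<forall>n. pts (Xs n) \<subseteq> pts (Xs (Suc n)) \<and> closed_immersion (\<lambda>x. x) (Xs n) (Xs (Suc n)))"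

definition ind_space :: "(nat \<Rightarrow> ('x, 'k::field) kspace) \<Rightarrow> ('x, 'k) kspace" where
  "ind_space Xs =
     \<lparr> ztop = topology (\<lambda>U. U \<subseteq> (\<Union>n. pts (Xs n)) \<and> (\<forall>n. openin (ztop (Xs n)) (U \<inter> pts (Xs n)))),
       reg = (\<lambda>U. {f. restr U f = f \<and>
         (\<forall>n. restr (U \<inter> pts (Xs n)) f \<in> reg (Xs n) (U \<inter> pts (Xs n)))}) \<rparr>"

definition bundle_at ::
  "(nat \<Rightarrow> ('x, 'k::field) kspace) \<Rightarrow> ('i, 'x, 'k) lbundle \<Rightarrow> nat \<Rightarrow> ('i, 'x, 'k) lbundle" where
  "bundle_at Xs L n = bundle_restrict L (pts (Xs n))"

definition sections_at ::
  "(nat \<Rightarrow> ('x, 'k::field) kspace) \<Rightarrow> ('i, 'x, 'k) lbundle \<Rightarrow> nat \<Rightarrow> ('i \<times> 'x \<Rightarrow> 'k) set" where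
  "sections_at Xs L n = H0 (Xs n) (bundle_at Xs L n)"

definition embedding_at ::
  "(nat \<Rightarrow> ('x, 'k::field) kspace) \<Rightarrow> ('i, 'x, 'k) lbundle \<Rightarrow> nat \<Rightarrow> 'x
    \<Rightarrow> (('i \<times> 'x \<Rightarrow> 'k) \<Rightarrow> 'k) set" where
  "embedding_at Xs L n = linear_system_map (Xs n) (bundle_at Xs L n)"

text \<open>The ind-variety \<open>X\<close> is projective, as witnessed by the filtration \<open>Xs\<close> and the
  line bundle \<open>L\<close>.\<close>

definition projective_ind_variety ::
  "'x set \<Rightarrow> (nat \<Rightarrow> ('x, 'k::field) kspace) \<Rightarrow> ('i, 'x, 'k) lbundle \<Rightarrow> bool" where
  "projective_ind_variety X Xs L \<longleftrightarrow>
     ind_variety X Xs \<and> line_bundle (ind_space Xs) L \<and>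
     (\<forall>n. very_ample (Xs n) (bundle_at Xs L n)) \<and>
     (\<forall>n. restrict_section (pts (Xs n)) ` sections_at Xs L (Suc n) = sections_at Xs L n)"

definition coord_ring_at ::
  "(nat \<Rightarrow> ('x, 'k::field) kspace) \<Rightarrow> ('i, 'x, 'k) lbundle \<Rightarrow> nat
    \<Rightarrow> ('k, ('i \<times> 'x \<Rightarrow> 'k, 'k) mpoly set set) kalg" where
  "coord_ring_at Xs L n = coord_ring (sections_at Xs L n) (embedding_at Xs L n ` pts (Xs n))"

definition coord_form_at ::
  "(nat \<Rightarrow> ('x, 'k::field) kspace) \<Rightarrow> ('i, 'x, 'k) lbundle \<Rightarrow> nat
    \<Rightarrow> ('i \<times> 'x \<Rightarrow> 'k) \<Rightarrow> ('i \<times> 'x \<Rightarrow> 'k, 'k) mpoly set set" where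
  "coord_form_at Xs L n = coord_form (sections_at Xs L n) (embedding_at Xs L n ` pts (Xs n))"

text \<open>The restriction map from \<open>S(X\<^sub>n\<^sub>')\<close> to \<open>S(X\<^sub>n)\<close>, for \<open>n \<le> n'\<close>, is induced by the
  restriction of sections.\<close>

definition coord_restrict ::
  "(nat \<Rightarrow> ('x, 'k::field) kspace) \<Rightarrow> ('i, 'x, 'k) lbundle \<Rightarrow> nat \<Rightarrow> nat
    \<Rightarrow> ('i \<times> 'x \<Rightarrow> 'k, 'k) mpoly set set \<Rightarrow> ('i \<times> 'x \<Rightarrow> 'k, 'k) mpoly set set" where
  "coord_restrict Xs L n n' = the_kalg_hom (coord_ring_at Xs L n') (coord_ring_at Xs L n)
     {(coord_form_at Xs L n' s, coord_form_at Xs L n (restrict_section (pts (Xs n)) s)) | s.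
        s \<in> sections_at Xs L n'}"

definition homog_coord_ring ::
  "(nat \<Rightarrow> ('x, 'k::field) kspace) \<Rightarrow> ('i, 'x, 'k) lbundle
    \<Rightarrow> ('k, nat \<Rightarrow> ('i \<times> 'x \<Rightarrow> 'k, 'k) mpoly set set) kalg" where
  "homog_coord_ring Xs L = inverse_limit UNIV (\<le>) (coord_ring_at Xs L) (coord_restrict Xs L)"


section \<open>Grassmannians\<close>

text \<open>All grassmannians live in the space of functions on the integers, with standard
  vectors \<open>e\<^sub>i\<close>.\<close>

definition std_vec :: "int \<Rightarrow> int \<Rightarrow> 'k::field" where
  "std_vec i = (\<lambda>j. if j = i then 1 else 0)"

definition grassmannian :: "nat \<Rightarrow> nat \<Rightarrow> (int \<Rightarrow> 'k::field) set set" where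
  "grassmannian m n = {W. fun_vs.subspace W \<and>
     W \<subseteq> fun_vs.span (std_vec ` {- int m..<int n}) \<and> fun_vs.dim W = m}"

text \<open>The row indices \<open>l\<^sub>0 < \<dots> < l\<^sub>m\<^sub>-\<^sub>1\<close> of a minor are given by the set that they form.\<close>

definition minor_sets :: "nat \<Rightarrow> nat \<Rightarrow> int set set" where
  "minor_sets m n = {J. J \<subseteq> {- int m..<int n} \<and> card J = m}"

definition row_at :: "int set \<Rightarrow> nat \<Rightarrow> int" where
  "row_at J r = sorted_list_of_set J ! r"

text \<open>The Pluecker point of \<open>W\<close>, as the line of all its coordinate vectors: \<open>ws\<close> ranges over the
  ordered bases of \<open>W\<close>.\<close>

definition pluecker :: "nat \<Rightarrow> nat \<Rightarrow> (int \<Rightarrow> 'k::field) set \<Rightarrow> (int set \<Rightarrow> 'k) set" where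
  "pluecker m n W =
     {restr (minor_sets m n) (\<lambda>J. a * det (mat m m (\<lambda>(r, c). (ws ! c) (row_at J r)))) | a ws.
        length ws = m \<and> distinct ws \<and> \<not> fun_vs.dependent (set ws) \<and> fun_vs.span (set ws) = W}"

definition grassmann_space :: "nat \<Rightarrow> nat \<Rightarrow> ((int \<Rightarrow> 'k::field) set, 'k) kspace" where
  "grassmann_space m n =
     induced_space (grassmannian m n) (pluecker m n) (proj_space (coord_space (minor_sets m n)))"

definition subspace_sum :: "(int \<Rightarrow> 'k::field) set \<Rightarrow> (int \<Rightarrow> 'k) set \<Rightarrow> (int \<Rightarrow> 'k) set" where
  "subspace_sum U W = {u + w | u w. u \<in> U \<and> w \<in> W}"

text \<open>The embeddings of the grassmannians into each other (\<open>grass_emb m m'\<close>) and into their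
  union (\<open>grass_incl m\<close>).\<close>

definition grass_emb :: "nat \<Rightarrow> nat \<Rightarrow> (int \<Rightarrow> 'k::field) set \<Rightarrow> (int \<Rightarrow> 'k) set" where
  "grass_emb m m' W = subspace_sum (fun_vs.span (std_vec ` {- int m'..<- int m})) W"

definition grass_incl :: "nat \<Rightarrow> (int \<Rightarrow> 'k::field) set \<Rightarrow> (int \<Rightarrow> 'k) set" where
  "grass_incl m W = subspace_sum (fun_vs.span (std_vec ` {..<- int m})) W"

definition grass_inf :: "(int \<Rightarrow> 'k::field) set set" where
  "grass_inf = (\<Union>m\<in>{1..}. \<Union>n\<in>{1..}. grass_incl m ` grassmannian m n)"

text \<open>By \<open>grass_incl_emb\<close> and \<open>grass_incl_inj\<close>, the union \<open>grass_inf\<close> is the direct limit of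
  the grassmannians along \<open>grass_emb\<close>.\<close>

lemma subspace_sum_assoc: "subspace_sum (subspace_sum U V) W = subspace_sum U (subspace_sum V W)"
  unfolding subspace_sum_def
proof (intro equalityI subsetI)
  fix x assume "x \<in> {u + w |u w. u \<in> {u + w |u w. u \<in> U \<and> w \<in> V} \<and> w \<in> W}"
  then obtain u v w where "x = u + (v + w)" "u \<in> U" "v \<in> V" "w \<in> W"
    by (auto simp: add.assoc)
  then show "x \<in> {u + w |u w. u \<in> U \<and> w \<in> {u + w |u w. u \<in> V \<and> w \<in> W}}"
    by blast
next
  fix x assume "x \<in> {u + w |u w. u \<in> U \<and> w \<in> {u + w |u w. u \<in> V \<and> w \<in> W}}"
  then obtain u v w where "x = (u + v) + w" "u \<in> U" "v \<in> V" "w \<in> W"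
    by (auto simp: add.assoc)
  then show "x \<in> {u + w |u w. u \<in> {u + w |u w. u \<in> U \<and> w \<in> V} \<and> w \<in> W}"
    by blast
qed

lemma grass_incl_emb:
  assumes "m \<le> m'"
  shows "grass_incl m' (grass_emb m m' W) = grass_incl m W"
proof -
  have "{..<- int m'} \<union> {- int m'..<- int m} = {..<- int m}"
    using assms by auto
  then have "fun_vs.span (std_vec ` {..<- int m} :: (int \<Rightarrow> 'a) set) =
      subspace_sum (fun_vs.span (std_vec ` {..<- int m'})) (fun_vs.span (std_vec ` {- int m'..<- int m}))"
    unfolding subspace_sum_def fun_vs.span_Un[symmetric] image_Un[symmetric] by simp
  then show ?thesis
    unfolding grass_incl_def grass_emb_def by (simp only: subspace_sum_assoc)
qed

lemma span_std_vec_zero: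
  assumes "v \<in> fun_vs.span (std_vec ` I)" "i \<notin> I"
  shows "v i = 0"
  using assms(1)
  by (induction rule: fun_vs.span_induct_alt)
    (use assms(2) in \<open>auto simp: std_vec_def fscale_def split: if_splits\<close>)

lemma grass_incl_inj: "inj_on (grass_incl m) (grassmannian m n)"
proof -
  have rec: "W = {v \<in> grass_incl m W. \<forall>i < - int m. v i = 0}"
    if W: "W \<in> grassmannian m n" for W :: "(int \<Rightarrow> 'a) set"
  proof (intro equalityI subsetI)
    fix w assume w: "w \<in> W"
    then have "w \<in> fun_vs.span (std_vec ` {- int m..<int n})"
      using W by (auto simp: grassmannian_def)
    then have "\<forall>i < - int m. w i = 0"
      using span_std_vec_zero by fastforce
    moreover have "w \<in> grass_incl m W"
      unfolding grass_incl_def subspace_sum_def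
      using w fun_vs.span_zero by force
    ultimately show "w \<in> {v \<in> grass_incl m W. \<forall>i < - int m. v i = 0}"
      by simp
  next
    fix v assume v: "v \<in> {v \<in> grass_incl m W. \<forall>i < - int m. v i = 0}"
    then obtain u w where uw: "v = u + w" "u \<in> fun_vs.span (std_vec ` {..<- int m})" "w \<in> W"
      unfolding grass_incl_def subspace_sum_def by auto
    have w: "w \<in> fun_vs.span (std_vec ` {- int m..<int n})"
      using W uw(3) by (auto simp: grassmannian_def)
    have "u i = 0" for i
    proof (cases "i < - int m")
      case True
      then have "v i = 0" "w i = 0"
        using v span_std_vec_zero[OF w] by auto
      then show ?thesis using uw(1) by simp
    next
      case False
      then show ?thesis using span_std_vec_zero[OF uw(2)] by auto
    qed
    then have "u = 0" by (simp add: fun_eq_iff)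
    then show "v \<in> W" using uw by simp
  qed
  show ?thesis
  proof (rule inj_onI)
    fix V W :: "(int \<Rightarrow> 'a) set"
    assume "V \<in> grassmannian m n" "W \<in> grassmannian m n" "grass_incl m V = grass_incl m W"
    then show "V = W"
      using rec[of V] rec[of W] by simp
  qed
qed

text \<open>The filtration of \<open>grass_inf\<close> starts with \<open>m = n = 1\<close>.\<close>

definition grass_filt :: "nat \<Rightarrow> ((int \<Rightarrow> 'k::field) set, 'k) kspace" where
  "grass_filt i =
     (let n = Suc i in
      induced_space (grass_incl n ` grassmannian n n)
        (inv_into (grassmannian n n) (grass_incl n)) (grassmann_space n n))"

text \<open>In suitable linear coordinates, the embedding of the \<open>i\<close>-th filtration step given by
  \<open>L\<close> is the Pluecker embedding.\<close>

definition pluecker_embedded :: "('i, (int \<Rightarrow> 'k::field) set, 'k) lbundle \<Rightarrow> nat \<Rightarrow> bool" where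
  "pluecker_embedded L i \<longleftrightarrow>
     (let n = Suc i in
      \<exists>\<sigma>. inj_on \<sigma> (minor_sets n n) \<and> \<not> fun_vs.dependent (\<sigma> ` minor_sets n n) \<and>
          fun_vs.span (\<sigma> ` minor_sets n n) = sections_at grass_filt L i \<and>
          (\<forall>W \<in> grassmannian n n. \<forall>\<phi> \<in> embedding_at grass_filt L i (grass_incl n W).
             restr (minor_sets n n) (\<lambda>J. \<phi> (\<sigma> J)) \<in> pluecker n n W))"


section \<open>The rings generated by the minors\<close>

definition matrix_alg :: "nat \<Rightarrow> nat \<Rightarrow> ('k::field, (int \<times> int, 'k) mpoly) kalg" where
  "matrix_alg m n = poly_alg ({- int m..<int n} \<times> {- int m..<int n})"

text \<open>Rows \<open>J\<close> and columns \<open>-m, \<dots>, -1\<close> of the matrix of variables.\<close>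

definition minor_det :: "nat \<Rightarrow> int set \<Rightarrow> (int \<times> int, 'k::field) mpoly" where
  "minor_det m J = det (mat m m (\<lambda>(r, c). mp_var (row_at J r, int c - int m)))"

definition k_delta :: "nat \<Rightarrow> nat \<Rightarrow> ('k::field, (int \<times> int, 'k) mpoly) kalg" where
  "k_delta m n = (matrix_alg m n)
     \<lparr>carrier := generate_ring (matrix_alg m n) (range mp_const \<union> minor_det m ` minor_sets m n)\<rparr>"

definition delta_hom ::
  "nat \<times> nat \<Rightarrow> nat \<times> nat \<Rightarrow> (int \<times> int, 'k::field) mpoly \<Rightarrow> (int \<times> int, 'k) mpoly" where
  "delta_hom = (\<lambda>(m, n) (m', n'). the_kalg_hom (k_delta m' n') (k_delta m n)
     ({(minor_det m' ({- int m'..<- int m} \<union> J), minor_det m J) | J. J \<in> minor_sets m n} \<union>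
      {(minor_det m' J', 0) | J'. J' \<in> minor_sets m' n' \<and>
          \<not> (\<exists>J \<in> minor_sets m n. J' = {- int m'..<- int m} \<union> J)}))"

definition k_delta_inf :: "('k::field, nat \<times> nat \<Rightarrow> (int \<times> int, 'k) mpoly) kalg" where
  "k_delta_inf = inverse_limit ({1..} \<times> {1..}) (\<lambda>(m, n) (m', n'). m \<le> m' \<and> n \<le> n')
     (\<lambda>(m, n). k_delta m n) delta_hom"

end

theory Submission
  imports Defs
begin

text \<open>A point of level \<open>i\<close> is the column span of a frame, and its maximal minors, indexed by
  semi-infinite sets so that the coordinates of all levels agree, are its Pluecker coordinates. The
  bundle has these index sets as charts and the ratios of the coordinates as transition functions.
  A section of it over level \<open>i\<close> is a function on frames that is homogeneous of degree one in the
  minors; restricted to affine lines of frames it is a polynomial of degree at most one, so it is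
  alternating multilinear in the columns, hence a linear combination of the maximal minors. This
  gives the sections of every level, very ampleness and the surjectivity of the restrictions.
  Substituting the minors for the Pluecker sections identifies \<open>S(X\<^sub>i)\<close> with the ring of minors: a
  homogeneous polynomial vanishes on the Pluecker points of all frames iff it vanishes identically
  after the substitution, since the field is infinite. Restriction of sections then becomes the
  substitution of an identity block, so both limits are limits of the same system, the first one
  over the cofinal diagonal \<open>m = n\<close>.\<close>


section \<open>Evaluation of polynomials\<close>

text \<open>Regular functions and sections are only known to be fractions locally, with no global
  control of numerators and denominators. Normality and extension over codimension two are avoided
  by testing a section on lines all of whose points are frames: there algebraic closedness turns a
  function that is locally a fraction into a polynomial. On the other lines the minors of one
  summand are a multiple of those of the other, and additivity follows from homogeneity alone.
  Points of the union are infinite dimensional subspaces, and their coordinates exist only up to a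
  scalar. A vector \<open>pv\<close> is fixed by choice, and every use of it is homogeneous.
  Cramer's rule, in the form of \<open>exchange\<close>, recovers a frame from its minors by linear
  forms. This one device gives the injectivity of the coordinates, the affine charts, the closedness
  of each filtration step in the next and the equations of the image. In the inverse systems the
  maps are described by \<open>THE\<close>. Existence comes from explicit substitutions, uniqueness
  from generators, and neither is visible in the definitions.\<close>

abbreviation lkp :: "('a \<Rightarrow>\<^sub>0 'b::zero) \<Rightarrow> 'a \<Rightarrow> 'b" where "lkp \<equiv> Poly_Mapping.lookup"
abbreviation supp :: "('a \<Rightarrow>\<^sub>0 'b::zero) \<Rightarrow> 'a set" where "supp \<equiv> Poly_Mapping.keys"

definition mp_mon :: "('v \<Rightarrow> 'r::comm_ring_1) \<Rightarrow> ('v \<Rightarrow>\<^sub>0 nat) \<Rightarrow> 'r" where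
  "mp_mon x \<mu> = (\<Prod>v\<in>supp \<mu>. x v ^ lkp \<mu> v)"

definition mdeg :: "('v \<Rightarrow>\<^sub>0 nat) \<Rightarrow> nat" where
  "mdeg \<mu> = (\<Sum>v\<in>supp \<mu>. lkp \<mu> v)"

text \<open>Evaluation is defined over any commutative ring and along any map of coefficients: with
  the identity it is \<open>mp_eval\<close>, with \<open>mp_const\<close> it is substitution, and
  with \<open>\<lambda>c. [:c:]\<close> it follows a point that moves polynomially in one
  parameter.\<close>

definition mp_hom ::
  "('c::comm_ring_1 \<Rightarrow> 'r::comm_ring_1) \<Rightarrow> ('v \<Rightarrow> 'r) \<Rightarrow> (('v \<Rightarrow>\<^sub>0 nat) \<Rightarrow>\<^sub>0 'c) \<Rightarrow> 'r" where
  "mp_hom c x p = (\<Sum>\<mu>\<in>supp p. c (lkp p \<mu>) * mp_mon x \<mu>)"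

lemma mp_eval_hom: "mp_eval x = mp_hom (\<lambda>c. c) x"
  by (auto simp: fun_eq_iff mp_eval_def mp_hom_def mp_mon_def)

lemma mp_mon_superset:
  assumes "finite A" "supp \<mu> \<subseteq> A"
  shows "mp_mon x \<mu> = (\<Prod>v\<in>A. x v ^ lkp \<mu> v)"
  unfolding mp_mon_def using assms by (intro prod.mono_neutral_left) (auto simp: in_keys_iff)

lemma mdeg_superset:
  assumes "finite A" "supp \<mu> \<subseteq> A"
  shows "mdeg \<mu> = (\<Sum>v\<in>A. lkp \<mu> v)"
  unfolding mdeg_def using assms by (intro sum.mono_neutral_left) (auto simp: in_keys_iff)

lemma supp_add_nat: "supp (\<mu> + \<nu> :: 'v \<Rightarrow>\<^sub>0 nat) = supp \<mu> \<union> supp \<nu>"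
  by (auto simp: in_keys_iff lookup_add)

lemma mp_mon_add: "mp_mon x (\<mu> + \<nu>) = mp_mon x \<mu> * mp_mon x \<nu>"
  using mp_mon_superset[of "supp \<mu> \<union> supp \<nu>" "\<mu> + \<nu>" x] mp_mon_superset[of "supp \<mu> \<union> supp \<nu>" \<mu> x]
    mp_mon_superset[of "supp \<mu> \<union> supp \<nu>" \<nu> x]
  by (simp add: supp_add_nat lookup_add power_add prod.distrib)

lemma mdeg_add: "mdeg (\<mu> + \<nu>) = mdeg \<mu> + mdeg \<nu>"
  using mdeg_superset[of "supp \<mu> \<union> supp \<nu>" "\<mu> + \<nu>"] mdeg_superset[of "supp \<mu> \<union> supp \<nu>" \<mu>]
    mdeg_superset[of "supp \<mu> \<union> supp \<nu>" \<nu>]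
  by (simp add: supp_add_nat lookup_add sum.distrib)

lemma mp_mon_zero [simp]: "mp_mon x 0 = 1"
  by (simp add: mp_mon_def)

lemma mp_mon_single [simp]: "mp_mon x (Poly_Mapping.single v n) = x v ^ n"
  by (simp add: mp_mon_def)

lemma mpoly_sum_single:
  fixes p :: "'a \<Rightarrow>\<^sub>0 'b::comm_monoid_add"
  shows "p = (\<Sum>\<mu>\<in>supp p. Poly_Mapping.single \<mu> (lkp p \<mu>))"
  by (rule poly_mapping_eqI) (simp add: lookup_sum lookup_single when_def in_keys_iff)

text \<open>A polynomial is the sum of its terms; the empty sum is covered by \<open>single\<close>,
  as a term with coefficient 0.\<close>

lemma mpoly_induct [case_names single add]:
  fixes p :: "'a::comm_monoid_add \<Rightarrow>\<^sub>0 'b::comm_monoid_add"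
  assumes "\<And>\<mu> a. P (Poly_Mapping.single \<mu> a)" "\<And>p q. P p \<Longrightarrow> P q \<Longrightarrow> P (p + q)"
  shows "P p"
proof -
  have "P (\<Sum>\<mu>\<in>A. Poly_Mapping.single \<mu> (f \<mu>))" if "finite A" for A f
    using that by induction (use assms assms(1)[of 0 0] in auto)
  then show ?thesis
    using mpoly_sum_single[of p] by (metis finite_keys)
qed

context comm_ring_hom
begin

lemma mp_hom_add: "mp_hom hom x (p + q) = mp_hom hom x p + mp_hom hom x q"
  unfolding mp_hom_def
  by (rule setsum_keys_plus_distrib) (auto simp: hom_add algebra_simps)

lemma mp_hom_single: "mp_hom hom x (Poly_Mapping.single \<mu> a) = hom a * mp_mon x \<mu>"
  by (cases "a = 0") (auto simp: mp_hom_def)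

lemma mp_hom_mult: "mp_hom hom x (p * q) = mp_hom hom x p * mp_hom hom x q"
proof (induction p rule: mpoly_induct)
  case (single \<mu> a)
  show ?case
    by (induction q rule: mpoly_induct)
      (auto simp: mult_single mp_hom_single mp_hom_add mp_mon_add hom_mult algebra_simps)
qed (auto simp: algebra_simps mp_hom_add)

lemma mp_hom_const: "mp_hom hom x (Poly_Mapping.single 0 c) = hom c"
  by (simp add: mp_hom_single)

lemma mp_hom_var: "mp_hom hom x (Poly_Mapping.single (Poly_Mapping.single v 1) 1) = x v"
  by (simp add: mp_hom_single)

end

lemma mp_const_0 [simp]: "mp_const 0 = 0"
  and mp_const_1 [simp]: "mp_const 1 = 1"
  by (auto simp: mp_const_def)

context comm_ring_hom
begin

lemma comm_ring_hom_mp_hom: "comm_ring_hom (mp_hom hom x)"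
  using mp_hom_const[of x 0] mp_hom_const[of x 1]
  by unfold_locales (auto simp: mp_hom_add mp_hom_mult)

lemma mp_hom_comp: "hom (mp_hom c x p) = mp_hom (\<lambda>a. hom (c a)) (\<lambda>v. hom (x v)) p"
  by (simp add: mp_hom_def mp_mon_def hom_sum hom_mult hom_prod hom_power)

end

lemma mp_const_add: "mp_const (a + b) = mp_const a + mp_const b"
  and mp_const_mult: "mp_const (a * b) = mp_const a * mp_const b"
  and mp_const_uminus: "mp_const (- a) = - mp_const a"
  by (auto simp: mp_const_def single_add mult_single single_uminus)

lemma comm_ring_hom_mp_const: "comm_ring_hom mp_const"
  by unfold_locales (auto simp: mp_const_add mp_const_mult)

lemma comm_ring_hom_id: "comm_ring_hom (\<lambda>c. c)"
  by unfold_locales auto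

lemma comm_ring_hom_mp_eval: "comm_ring_hom (mp_eval x)"
  unfolding mp_eval_hom by (rule comm_ring_hom.comm_ring_hom_mp_hom[OF comm_ring_hom_id])

interpretation mp_eval: comm_ring_hom "mp_eval x" for x
  by (rule comm_ring_hom_mp_eval)

lemma mp_eval_const [simp]: "mp_eval x (mp_const c) = c"
  unfolding mp_eval_hom mp_const_def by (rule comm_ring_hom.mp_hom_const[OF comm_ring_hom_id])

lemma mp_eval_var [simp]: "mp_eval x (mp_var v) = x v"
  unfolding mp_eval_hom mp_var_def by (rule comm_ring_hom.mp_hom_var[OF comm_ring_hom_id])

definition mp_subst :: "('v \<Rightarrow> ('w, 'k::field) mpoly) \<Rightarrow> ('v, 'k) mpoly \<Rightarrow> ('w, 'k) mpoly" where
  "mp_subst = mp_hom mp_const"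

lemma comm_ring_hom_mp_subst: "comm_ring_hom (mp_subst L)"
  unfolding mp_subst_def by (rule comm_ring_hom.comm_ring_hom_mp_hom[OF comm_ring_hom_mp_const])

interpretation mp_subst: comm_ring_hom "mp_subst L" for L
  by (rule comm_ring_hom_mp_subst)

lemma mp_subst_const [simp]: "mp_subst L (mp_const c) = mp_const c"
  using comm_ring_hom.mp_hom_const[OF comm_ring_hom_mp_const, of L c]
  by (simp add: mp_subst_def mp_const_def)

lemma mp_subst_var [simp]: "mp_subst L (mp_var v) = L v"
  unfolding mp_subst_def mp_var_def by (rule comm_ring_hom.mp_hom_var[OF comm_ring_hom_mp_const])

lemma mp_eval_subst: "mp_eval x (mp_subst L p) = mp_eval (\<lambda>v. mp_eval x (L v)) p"
  unfolding mp_subst_def mp_eval.mp_hom_comp by (simp add: mp_eval_hom[of "\<lambda>v. mp_eval x (L v)"])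

text \<open>Evaluation at \<open>t\<close> is a ring homomorphism on \<open>poly\<close>, so a
  polynomial in the coordinates becomes one univariate polynomial along a curve with polynomial
  coordinates. Lines of frames are exploited in this way.\<close>

lemma mp_eval_poly:
  "mp_eval (\<lambda>v. poly (f v) t) p = poly (mp_hom (\<lambda>c. [:c:]) f p) t"
proof -
  interpret comm_ring_hom "\<lambda>q. poly q t" by unfold_locales auto
  show ?thesis by (simp add: mp_hom_comp mp_eval_hom)
qed

lemma mp_eval_cong:
  assumes "\<And>v. v \<in> mp_vars p \<Longrightarrow> x v = y v"
  shows "mp_eval x p = mp_eval y p"
  unfolding mp_eval_def
proof (intro sum.cong prod.cong arg_cong2[where f = "(*)"] refl)
  fix \<mu> v assume "\<mu> \<in> supp p" "v \<in> supp \<mu>"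
  then show "x v ^ lkp \<mu> v = y v ^ lkp \<mu> v"
    using assms[of v] by (metis UN_I mp_vars_def)
qed


subsection \<open>Variables\<close>

lemma mp_vars_const [simp]: "mp_vars (mp_const c) = {}"
  and mp_vars_var [simp]: "mp_vars (mp_var v :: ('v, 'k::field) mpoly) = {v}"
  and mp_vars_0 [simp]: "mp_vars 0 = {}"
  and mp_vars_1 [simp]: "mp_vars 1 = {}"
  and mp_vars_uminus [simp]: "mp_vars (- p) = mp_vars p"
  by (auto simp: mp_vars_def mp_const_def mp_var_def in_keys_iff)

lemma mp_vars_add: "mp_vars (p + q) \<subseteq> mp_vars p \<union> mp_vars q"
  unfolding mp_vars_def using keys_add[of p q] by blast

lemma mp_vars_mult: "mp_vars (p * q) \<subseteq> mp_vars p \<union> mp_vars q"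
  unfolding mp_vars_def using keys_mult[of p q] by (fastforce simp: supp_add_nat)

lemma finite_mp_vars [simp]: "finite (mp_vars p)"
  by (simp add: mp_vars_def)

lemma mp_mon_var: "mp_mon mp_var \<mu> = Poly_Mapping.single \<mu> (1 :: 'k::field)"
proof -
  have "(\<Prod>v\<in>A. mp_var v ^ lkp \<mu> v) = Poly_Mapping.single (\<Sum>v\<in>A. Poly_Mapping.single v (lkp \<mu> v)) (1 :: 'k)"
    if "finite A" for A
    using that
  proof induction
    case (insert v A)
    have "mp_var v ^ n = Poly_Mapping.single (Poly_Mapping.single v n) (1 :: 'k)" for n
      by (induction n) (auto simp: mp_var_def mult_single single_add[symmetric])
    then have "(\<Prod>v\<in>insert v A. mp_var v ^ lkp \<mu> v) = Poly_Mapping.single (Poly_Mapping.single v (lkp \<mu> v)) (1 :: 'k) *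
        Poly_Mapping.single (\<Sum>v\<in>A. Poly_Mapping.single v (lkp \<mu> v)) 1"
      using insert by simp
    also have "\<dots> = Poly_Mapping.single (\<Sum>v\<in>insert v A. Poly_Mapping.single v (lkp \<mu> v)) 1"
      using insert by (subst mult_single) simp
    finally show ?case .
  qed simp
  from this[of "supp \<mu>"] show ?thesis
    unfolding mp_mon_def using mpoly_sum_single[of \<mu>] by simp
qed

text \<open>The polynomials in the variables \<open>V\<close> are generated as a ring by the
  constants and these variables. Ring homomorphisms out of \<open>poly_alg V\<close> are compared by
  this rule.\<close>

lemma mpoly_var_induct [consumes 1, case_names const var add mult]:
  assumes "mp_vars p \<subseteq> V" and const: "\<And>c. P (mp_const c)" and var: "\<And>v. v \<in> V \<Longrightarrow> P (mp_var v)"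
    and add: "\<And>p q. P p \<Longrightarrow> P q \<Longrightarrow> P (p + q)" and mult: "\<And>p q. P p \<Longrightarrow> P q \<Longrightarrow> P (p * q)"
  shows "P p"
proof -
  have one: "P 1" and zero: "P 0" using const[of 1] const[of 0] by auto
  have pow: "P (q ^ n)" if "P q" for q n
    using that by (induction n) (auto intro: mult one)
  have prod: "P (\<Prod>v\<in>A. mp_var v ^ f v)" if "finite A" "A \<subseteq> V" for A f
    using that by induction (auto intro: mult one pow var)
  have mono: "P (Poly_Mapping.single \<mu> a)" if "supp \<mu> \<subseteq> V" for \<mu> a
  proof -
    have "Poly_Mapping.single \<mu> a = mp_const a * mp_mon mp_var \<mu>"
      by (simp add: mp_mon_var mp_const_def mult_single)
    then show ?thesis using prod[OF finite_keys that] by (auto simp: mp_mon_def intro: mult const)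
  qed
  have sum: "P (\<Sum>\<mu>\<in>A. Poly_Mapping.single \<mu> (lkp p \<mu>))" if "finite A" "A \<subseteq> supp p" for A
    using that
  proof induction
    case (insert \<mu> A)
    then have "supp \<mu> \<subseteq> V" using assms(1) by (auto simp: mp_vars_def)
    then show ?case using insert by (auto intro!: add mono)
  qed (use zero in auto)
  show ?thesis using sum[of "supp p"] mpoly_sum_single[of p] by simp
qed

lemma mp_subst_cong:
  assumes "\<And>v. v \<in> mp_vars p \<Longrightarrow> L v = L' v"
  shows "mp_subst L p = mp_subst L' p"
proof -
  have "mp_vars p \<subseteq> {v. L v = L' v}" using assms by auto
  then show ?thesis
    by (induction p rule: mpoly_var_induct) (auto simp: mp_subst.hom_add mp_subst.hom_mult)
qed

lemma mp_subst_id [simp]: "mp_subst mp_var p = p"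
proof -
  have "mp_vars p \<subseteq> UNIV" by simp
  then show ?thesis
    by (induction p rule: mpoly_var_induct) (auto simp: mp_subst.hom_add mp_subst.hom_mult)
qed


subsection \<open>Homogeneous polynomials\<close>

lemma homogeneous_alt: "homogeneous d p \<longleftrightarrow> (\<forall>\<mu>\<in>supp p. mdeg \<mu> = d)"
  by (simp add: homogeneous_def mdeg_def)

lemma homogeneous_0 [simp]: "homogeneous d 0"
  by (simp add: homogeneous_def)

lemma homogeneous_const [simp]: "homogeneous 0 (mp_const c)"
  by (simp add: homogeneous_def mp_const_def)

lemma homogeneous_one [simp]: "homogeneous 0 1"
  using homogeneous_const[of 1] by simp

lemma homogeneous_var [simp]: "homogeneous 1 (mp_var v)"
  by (simp add: homogeneous_def mp_var_def)

lemma homogeneous_add: "homogeneous d p \<Longrightarrow> homogeneous d q \<Longrightarrow> homogeneous d (p + q)"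
  unfolding homogeneous_def using keys_add[of p q] by blast

lemma homogeneous_mult: "homogeneous d p \<Longrightarrow> homogeneous e q \<Longrightarrow> homogeneous (d + e) (p * q)"
  unfolding homogeneous_alt using keys_mult[of p q] by (fastforce simp: mdeg_add)

lemma homogeneous_power: "homogeneous d p \<Longrightarrow> homogeneous (d * n) (p ^ n)"
  by (induction n) (auto dest: homogeneous_mult)

lemma homogeneous_cmult: "homogeneous d p \<Longrightarrow> homogeneous d (mp_const c * p)"
  using homogeneous_mult[of 0 "mp_const c" d p] by simp

lemma homogeneous_uminus: "homogeneous d p \<Longrightarrow> homogeneous d (- p)"
  by (simp add: homogeneous_def)

lemma homogeneous_diff: "homogeneous d p \<Longrightarrow> homogeneous d q \<Longrightarrow> homogeneous d (p - q)"
  using homogeneous_add[OF _ homogeneous_uminus, of d p q] by simp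

lemma homogeneous_sum: "(\<And>i. i \<in> A \<Longrightarrow> homogeneous d (f i)) \<Longrightarrow> homogeneous d (sum f A)"
  by (induction A rule: infinite_finite_induct) (auto intro: homogeneous_add)

lemma homogeneous_prod:
  "(\<And>i. i \<in> A \<Longrightarrow> homogeneous (d i) (f i)) \<Longrightarrow> homogeneous (sum d A) (prod f A)"
  by (induction A rule: infinite_finite_induct) (auto intro: homogeneous_mult)

text \<open>Substituting forms of degree \<open>e\<close> multiplies degrees by \<open>e\<close>;
  with \<open>e = 1\<close> these are the linear changes of homogeneous coordinates.\<close>

lemma homogeneous_subst:
  assumes "homogeneous d p" "\<And>v. homogeneous e (L v)"
  shows "homogeneous (d * e) (mp_subst L p)"
  unfolding mp_subst_def mp_hom_def
proof (rule homogeneous_sum)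
  fix \<mu> assume "\<mu> \<in> supp p"
  then have "mdeg \<mu> = d" using assms(1) by (simp add: homogeneous_alt)
  moreover have "homogeneous (\<Sum>v\<in>supp \<mu>. e * lkp \<mu> v) (mp_mon L \<mu>)"
    unfolding mp_mon_def by (intro homogeneous_prod homogeneous_power assms)
  ultimately show "homogeneous (d * e) (mp_const (lkp p \<mu>) * mp_mon L \<mu>)"
    by (intro homogeneous_cmult) (simp add: mdeg_def sum_distrib_left[symmetric] mult.commute)
qed

lemma mp_eval_homogeneous_scale:
  assumes "homogeneous d p"
  shows "mp_eval (\<lambda>v. c * x v) p = c ^ d * mp_eval x p"
proof -
  have "mp_mon (\<lambda>v. c * x v) \<mu> = c ^ mdeg \<mu> * mp_mon x \<mu>" for \<mu>
    by (simp add: mp_mon_def mdeg_def power_mult_distrib prod.distrib power_sum)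
  then show ?thesis
    using assms by (auto simp: mp_eval_hom mp_hom_def homogeneous_alt sum_distrib_left algebra_simps
        intro!: sum.cong)
qed

lemma mp_eval_fscale:
  assumes "homogeneous d p"
  shows "mp_eval (fscale c x) p = c ^ d * mp_eval x p"
  unfolding fscale_def by (rule mp_eval_homogeneous_scale[OF assms])

definition hpart :: "nat \<Rightarrow> ('v, 'k::field) mpoly \<Rightarrow> ('v, 'k) mpoly" where
  "hpart d p = (\<Sum>\<mu>\<in>{\<mu>\<in>supp p. mdeg \<mu> = d}. Poly_Mapping.single \<mu> (lkp p \<mu>))"

lemma lookup_hpart: "lkp (hpart d p) \<mu> = (if mdeg \<mu> = d then lkp p \<mu> else 0)"
  by (auto simp: hpart_def lookup_sum lookup_single when_def in_keys_iff)

lemma homogeneous_hpart [simp]: "homogeneous d (hpart d p)"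
  unfolding homogeneous_alt by (auto simp: in_keys_iff lookup_hpart split: if_splits)

lemma mp_vars_hpart: "mp_vars (hpart d p) \<subseteq> mp_vars p"
  by (auto simp: mp_vars_def in_keys_iff[of _ "hpart d p"] in_keys_iff[of _ p] lookup_hpart split: if_splits)

lemma sum_hpart: "p = (\<Sum>d\<in>mdeg ` supp p. hpart d p)"
  by (rule poly_mapping_eqI) (auto simp: lookup_sum lookup_hpart in_keys_iff)


subsection \<open>Polynomials that vanish everywhere\<close>

text \<open>The sum is the value at \<open>t\<close> of a univariate polynomial that vanishes on an
  infinite field.\<close>

lemma power_sum_eq_0:
  fixes b :: "nat \<Rightarrow> 'k::field_char_0"
  assumes "finite S" "\<And>t. (\<Sum>i\<in>S. b i * t ^ i) = 0" "i \<in> S"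
  shows "b i = 0"
proof -
  have "poly (\<Sum>i\<in>S. monom (b i) i) t = 0" for t
    using assms(2)[of t] by (simp add: poly_sum poly_monom)
  then have "(\<Sum>i\<in>S. monom (b i) i) = 0" using poly_all_0_iff_0 by blast
  then have "coeff (\<Sum>i\<in>S. monom (b i) i) i = 0" by simp
  then show ?thesis using assms by (simp add: coeff_sum coeff_monom)
qed

text \<open>Induction on the variables: the monomials are grouped by their exponent at the new
  variable, and the sum is read as a polynomial in that variable alone. Exponents are plain
  functions, so injectivity after restriction to \<open>V\<close> says that distinct elements of
  \<open>M\<close> are distinct monomials.\<close>

lemma monomials_independent:
  fixes a :: "('v \<Rightarrow> nat) \<Rightarrow> 'k::field_char_0"
  assumes "finite V" "finite M" "inj_on (\<lambda>\<mu>. restrict \<mu> V) M"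
    "\<And>x. (\<Sum>\<mu>\<in>M. a \<mu> * (\<Prod>v\<in>V. x v ^ \<mu> v)) = 0" "\<mu> \<in> M"
  shows "a \<mu> = 0"
  using assms
proof (induction V arbitrary: M \<mu>)
  case empty
  then have "\<nu> = \<mu>" if "\<nu> \<in> M" for \<nu> using that by (auto simp: inj_on_def)
  then have "M = {\<mu>}" using empty.prems(4) by blast
  then show ?case using empty.prems(3)[of "\<lambda>_. 0"] by simp
next
  case (insert v V)
  let ?M = "\<lambda>i. {\<mu>\<in>M. \<mu> v = i}"
  have fin: "finite ((\<lambda>\<mu>. \<mu> v) ` M)" using insert by simp
  have "(\<Sum>\<mu>\<in>?M i. a \<mu> * (\<Prod>u\<in>V. x u ^ \<mu> u)) = 0" if i: "i \<in> (\<lambda>\<mu>. \<mu> v) ` M" for x i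
  proof (rule power_sum_eq_0[OF fin _ i])
    \<comment> \<open>The coordinate \<open>x v\<close> is set to \<open>t\<close>; the group with
      exponent \<open>i\<close> contributes its sum times \<open>t ^ i\<close>.\<close>
    fix t
    have eq: "(\<Prod>u\<in>V. (x(v := t)) u ^ \<mu> u) = (\<Prod>u\<in>V. x u ^ \<mu> u)" for \<mu>
      using insert by (intro prod.cong) auto
    have "(\<Sum>i\<in>(\<lambda>\<mu>. \<mu> v) ` M. (\<Sum>\<mu>\<in>?M i. a \<mu> * (\<Prod>u\<in>V. x u ^ \<mu> u)) * t ^ i) =
      (\<Sum>i\<in>(\<lambda>\<mu>. \<mu> v) ` M. \<Sum>\<mu>\<in>?M i. a \<mu> * (\<Prod>u\<in>V. x u ^ \<mu> u) * t ^ \<mu> v)"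
      by (intro sum.cong) (auto simp: sum_distrib_right)
    also have "\<dots> = (\<Sum>\<mu>\<in>M. a \<mu> * (\<Prod>u\<in>V. x u ^ \<mu> u) * t ^ \<mu> v)"
      using insert by (intro sum.group) auto
    also have "\<dots> = (\<Sum>\<mu>\<in>M. a \<mu> * (\<Prod>u\<in>insert v V. (x(v := t)) u ^ \<mu> u))"
      by (intro sum.cong refl) (simp add: prod.insert[OF insert.hyps] eq del: fun_upd_apply, simp)
    also have "\<dots> = 0" by (rule insert.prems)
    finally show "(\<Sum>i\<in>(\<lambda>\<mu>. \<mu> v) ` M. (\<Sum>\<mu>\<in>?M i. a \<mu> * (\<Prod>u\<in>V. x u ^ \<mu> u)) * t ^ i) = 0" .
  qed
  moreover have "inj_on (\<lambda>\<mu>. restrict \<mu> V) (?M i)" for i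
  proof (rule inj_onI)
    fix \<alpha> \<beta> assume ab: "\<alpha> \<in> ?M i" "\<beta> \<in> ?M i" "restrict \<alpha> V = restrict \<beta> V"
    have "\<alpha> u = \<beta> u" if "u \<in> insert v V" for u
      using that ab(1,2) fun_cong[OF ab(3), of u] by auto
    then have "restrict \<alpha> (insert v V) = restrict \<beta> (insert v V)"
      by (auto simp: restrict_def)
    then show "\<alpha> = \<beta>" using ab(1,2) inj_onD[OF insert.prems(2), of \<alpha> \<beta>] by blast
  qed
  moreover have "finite (?M (\<mu> v))" "\<mu> \<in> ?M (\<mu> v)" "\<mu> v \<in> (\<lambda>\<mu>. \<mu> v) ` M"
    using insert.prems(1,4) by simp_all
  ultimately show ?case
    using insert.IH[of "?M (\<mu> v)" \<mu>] by blast
qed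

text \<open>The exponents of \<open>p\<close> become functions on its finite set of variables, where
  monomials are independent; \<open>Abs_poly_mapping\<close> undoes the passage.\<close>

lemma mp_eval_all_0:
  fixes p :: "('v, 'k::field_char_0) mpoly"
  assumes "\<And>x. mp_eval x p = 0"
  shows "p = 0"
proof (rule ccontr)
  assume "p \<noteq> 0"
  then obtain \<mu> where \<mu>: "\<mu> \<in> supp p"
    by (metis poly_mapping_eqI in_keys_iff lookup_zero)
  have inj: "inj_on lkp (supp p)" by (auto simp: inj_on_def lookup_inject)
  have sub: "supp \<nu> \<subseteq> mp_vars p" if "\<nu> \<in> supp p" for \<nu> using that by (auto simp: mp_vars_def)
  have "lkp p (Abs_poly_mapping (lkp \<mu>)) = 0"
  proof (rule monomials_independent[of "mp_vars p" "lkp ` supp p" "\<lambda>f. lkp p (Abs_poly_mapping f)"])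
    show "inj_on (\<lambda>\<mu>. restrict \<mu> (mp_vars p)) (lkp ` supp p)"
    proof (rule inj_onI, clarify)
      fix \<alpha> \<beta> assume ab: "\<alpha> \<in> supp p" "\<beta> \<in> supp p" "restrict (lkp \<alpha>) (mp_vars p) = restrict (lkp \<beta>) (mp_vars p)"
      have "lkp \<alpha> v = lkp \<beta> v" for v
      proof (cases "v \<in> mp_vars p")
        case True
        then show ?thesis using fun_cong[OF ab(3), of v] by simp
      next
        case False
        then show ?thesis using sub[OF ab(1)] sub[OF ab(2)] by (metis in_keys_iff subsetD)
      qed
      then show "lkp \<alpha> = lkp \<beta>" by (simp add: fun_eq_iff)
    qed
    fix x :: "'v \<Rightarrow> 'k"
    have "(\<Sum>f\<in>lkp ` supp p. lkp p (Abs_poly_mapping f) * (\<Prod>v\<in>mp_vars p. x v ^ f v)) =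
      (\<Sum>\<nu>\<in>supp p. lkp p \<nu> * mp_mon x \<nu>)"
      unfolding sum.reindex[OF inj] o_def
      by (intro sum.cong) (auto simp: Poly_Mapping.lookup_inverse mp_mon_superset[OF finite_mp_vars sub])
    also have "\<dots> = 0" using assms[of x] by (simp add: mp_eval_hom mp_hom_def)
    finally show "(\<Sum>f\<in>lkp ` supp p. lkp p (Abs_poly_mapping f) * (\<Prod>v\<in>mp_vars p. x v ^ f v)) = 0" .
  qed (use \<mu> in auto)
  then show False using \<mu> by (simp add: Poly_Mapping.lookup_inverse in_keys_iff)
qed


section \<open>Spaces presented by basic functions\<close>

text \<open>All spaces of functions that occur here have a basis of open sets \<open>D\<close> with distinguished
  functions \<open>g\<close> on them (in the applications, \<open>g = p / q\<close> and \<open>D = {q \<noteq> 0}\<close>), and the regular functions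
  are those that are locally distinguished. Only the values of \<open>reg X\<close> at open sets are
  constrained.\<close>

locale presented =
  fixes X :: "('x, 'k::field) kspace" and P :: "'x set" and Q :: "'x set \<Rightarrow> ('x \<Rightarrow> 'k) \<Rightarrow> bool"
  assumes basic_subset: "Q D g \<Longrightarrow> D \<subseteq> P"
    and basic_const: "Q P (\<lambda>_. c)"
    and basic_add: "Q D g \<Longrightarrow> Q E h \<Longrightarrow> Q (D \<inter> E) (\<lambda>x. g x + h x)"
    and basic_mult: "Q D g \<Longrightarrow> Q E h \<Longrightarrow> Q (D \<inter> E) (\<lambda>x. g x * h x)"
    and basic_nonzero: "Q D g \<Longrightarrow> \<exists>h. Q {x\<in>D. g x \<noteq> 0} h"
    and openin_iff: "openin (ztop X) U \<longleftrightarrow> (\<forall>x\<in>U. \<exists>D g. Q D g \<and> x \<in> D \<and> D \<subseteq> U)"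
    and reg_iff: "openin (ztop X) U \<Longrightarrow> f \<in> reg X U \<longleftrightarrow> restr U f = f \<and>
      (\<forall>x\<in>U. \<exists>D g. Q D g \<and> x \<in> D \<and> D \<subseteq> U \<and> (\<forall>y\<in>D. f y = g y))"
begin

lemma pts_eq: "pts X = P"
proof
  show "pts X \<subseteq> P"
    using openin_iff[of "pts X"] basic_subset by auto blast
  have "openin (ztop X) P" unfolding openin_iff using basic_const[of 0] by blast
  then show "P \<subseteq> pts X" by (rule openin_subset)
qed

lemma openE:
  assumes "openin (ztop X) U" "x \<in> U"
  obtains D g where "Q D g" "x \<in> D" "D \<subseteq> U"
proof -
  have "\<exists>D g. Q D g \<and> x \<in> D \<and> D \<subseteq> U" using assms unfolding openin_iff by (rule bspec)
  then show thesis using that by blast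
qed

lemma regE:
  assumes "openin (ztop X) U" "f \<in> reg X U" "x \<in> U"
  obtains D g where "Q D g" "x \<in> D" "D \<subseteq> U" "\<forall>y\<in>D. f y = g y"
proof -
  have "\<exists>D g. Q D g \<and> x \<in> D \<and> D \<subseteq> U \<and> (\<forall>y\<in>D. f y = g y)"
    using assms(2) unfolding reg_iff[OF assms(1)] by (elim conjE) (erule bspec[OF _ assms(3)])
  then show thesis using that by blast
qed

lemma reg_restr: "openin (ztop X) U \<Longrightarrow> f \<in> reg X U \<Longrightarrow> restr U f = f"
  by (simp add: reg_iff)

lemma basic_open: "Q D g \<Longrightarrow> openin (ztop X) D"
  unfolding openin_iff by blast

text \<open>The domains are intersected by adding 0 times the other function, so restriction follows
  from the axioms for sums and products.\<close>

lemma basic_restrict: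
  assumes "Q D g" "Q E h"
  shows "\<exists>g'. Q (D \<inter> E) g' \<and> (\<forall>x\<in>D \<inter> E. g' x = g x)"
proof (intro exI conjI ballI)
  have "Q (E \<inter> P) (\<lambda>x. h x * 0)" using basic_mult[OF assms(2) basic_const[of 0]] .
  then have "Q (D \<inter> (E \<inter> P)) (\<lambda>x. g x + h x * 0)" using basic_add[OF assms(1)] by blast
  moreover have "E \<inter> P = E" using basic_subset[OF assms(2)] by blast
  ultimately show "Q (D \<inter> E) (\<lambda>x. g x + h x * 0)" by simp
qed auto

lemma basic_const_on: "Q D g \<Longrightarrow> \<exists>g'. Q D g' \<and> (\<forall>x\<in>D. g' x = c)"
  using basic_restrict[OF basic_const[of c], of D g] basic_subset[of D g] by (simp add: inf.absorb2)

lemma basic_reg: "Q D g \<Longrightarrow> restr D g \<in> reg X D"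
  unfolding reg_iff[OF basic_open] by (auto simp: restr_def)

lemma is_kspace: "is_kspace X"
  unfolding is_kspace_def
proof (intro conjI allI impI ballI)
  fix U f assume U: "openin (ztop X) U" "f \<in> reg X U"
  then show "restr U f = f" by (rule reg_restr)
next
  fix U c assume U: "openin (ztop X) U"
  show "restr U (\<lambda>_. c) \<in> reg X U"
    unfolding reg_iff[OF U]
  proof (intro conjI ballI)
    fix x assume x: "x \<in> U"
    then obtain D g where D: "Q D g" "x \<in> D" "D \<subseteq> U" using openE[OF U] by blast
    then obtain g' where "Q D g'" "\<forall>x\<in>D. g' x = c" using basic_const_on by blast
    then show "\<exists>D g. Q D g \<and> x \<in> D \<and> D \<subseteq> U \<and> (\<forall>y\<in>D. restr U (\<lambda>_. c) y = g y)"
      using D by (intro exI[of _ D] exI[of _ g']) (auto simp: restr_def)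
  qed (auto simp: restr_def)
next
  fix U f g assume U: "openin (ztop X) U" and f: "f \<in> reg X U" and g: "g \<in> reg X U"
  have rf: "restr U f = f" "restr U g = g" using reg_restr[OF U] f g by blast+
  have z: "f x = 0" "g x = 0" if "x \<notin> U" for x
  proof -
    have "restr U f x = 0" "restr U g x = 0" using that by (simp_all add: restr_def)
    then show "f x = 0" "g x = 0" by (simp_all only: rf)
  qed
  \<comment> \<open>Basic functions that represent \<open>f\<close> and \<open>g\<close> near
    \<open>x\<close> are moved to a common basic set, where the axioms for sums and products
    apply.\<close>
  have loc: "\<exists>D d e. Q D d \<and> Q D e \<and> x \<in> D \<and> D \<subseteq> U \<and> (\<forall>y\<in>D. f y = d y \<and> g y = e y)" if x: "x \<in> U" for x
  proof -
    obtain D d where d: "Q D d" "x \<in> D" "D \<subseteq> U" "\<forall>y\<in>D. f y = d y"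
      using regE[OF U f x] by blast
    obtain E e where e: "Q E e" "x \<in> E" "E \<subseteq> U" "\<forall>y\<in>E. g y = e y"
      using regE[OF U g x] by blast
    obtain d' where "Q (D \<inter> E) d'" "\<forall>x\<in>D \<inter> E. d' x = d x" using basic_restrict[OF d(1) e(1)] by blast
    moreover obtain e' where "Q (D \<inter> E) e'" "\<forall>x\<in>D \<inter> E. e' x = e x"
      using basic_restrict[OF e(1) d(1)] by (auto simp: Int_commute)
    ultimately show ?thesis
      using d e by (intro exI[of _ "D \<inter> E"] exI[of _ d'] exI[of _ e']) auto
  qed
  show "(\<lambda>x. f x + g x) \<in> reg X U"
    unfolding reg_iff[OF U]
  proof (intro conjI ballI)
    show "restr U (\<lambda>x. f x + g x) = (\<lambda>x. f x + g x)"
      using z by (auto simp: restr_def fun_eq_iff)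
    fix x assume "x \<in> U"
    then obtain D d e where D: "Q D d" "Q D e" "x \<in> D" "D \<subseteq> U" "\<forall>y\<in>D. f y = d y \<and> g y = e y"
      using loc by blast
    then show "\<exists>D h. Q D h \<and> x \<in> D \<and> D \<subseteq> U \<and> (\<forall>y\<in>D. f y + g y = h y)"
      using basic_add[OF D(1,2)] by (intro exI[of _ D] exI[of _ "\<lambda>x. d x + e x"]) auto
  qed
  show "(\<lambda>x. f x * g x) \<in> reg X U"
    unfolding reg_iff[OF U]
  proof (intro conjI ballI)
    show "restr U (\<lambda>x. f x * g x) = (\<lambda>x. f x * g x)"
      using z by (auto simp: restr_def fun_eq_iff)
    fix x assume "x \<in> U"
    then obtain D d e where D: "Q D d" "Q D e" "x \<in> D" "D \<subseteq> U" "\<forall>y\<in>D. f y = d y \<and> g y = e y"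
      using loc by blast
    then show "\<exists>D h. Q D h \<and> x \<in> D \<and> D \<subseteq> U \<and> (\<forall>y\<in>D. f y * g y = h y)"
      using basic_mult[OF D(1,2)] by (intro exI[of _ D] exI[of _ "\<lambda>x. d x * e x"]) auto
  qed
next
  fix U V f assume UV: "openin (ztop X) U \<and> openin (ztop X) V \<and> V \<subseteq> U \<and> f \<in> reg X U"
  then have V: "openin (ztop X) V" by blast
  show "restr V f \<in> reg X V"
    unfolding reg_iff[OF V]
  proof (intro conjI ballI)
    fix x assume x: "x \<in> V"
    obtain D d where d: "Q D d" "x \<in> D" "\<forall>y\<in>D. f y = d y"
      using regE[of U f x] UV subsetD[of V U x] x by (elim conjE) metis
    obtain E e where e: "Q E e" "x \<in> E" "E \<subseteq> V" using openE[OF V x] by blast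
    obtain d' where "Q (D \<inter> E) d'" "\<forall>x\<in>D \<inter> E. d' x = d x" using basic_restrict[OF d(1) e(1)] by blast
    then show "\<exists>D g. Q D g \<and> x \<in> D \<and> D \<subseteq> V \<and> (\<forall>y\<in>D. restr V f y = g y)"
      using d e by (intro exI[of _ "D \<inter> E"] exI[of _ d']) (auto simp: restr_def)
  qed (auto simp: restr_def)
next
  fix \<U> f assume *: "(\<forall>U\<in>\<U>. openin (ztop X) U \<and> restr U f \<in> reg X U) \<and> restr (\<Union>\<U>) f = f"
  then have U: "openin (ztop X) (\<Union>\<U>)" by blast
  show "f \<in> reg X (\<Union>\<U>)"
    unfolding reg_iff[OF U]
  proof (intro conjI ballI)
    fix x assume "x \<in> \<Union>\<U>"
    then obtain V where V: "V \<in> \<U>" "x \<in> V" by blast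
    have "openin (ztop X) V" "restr V f \<in> reg X V" using * V(1) by simp_all
    then obtain D d where d: "Q D d" "x \<in> D" "D \<subseteq> V" "\<forall>y\<in>D. restr V f y = d y"
      using regE[OF _ _ V(2)] by metis
    then have "f y = d y" if "y \<in> D" for y using that by (force simp: restr_def)
    then show "\<exists>D g. Q D g \<and> x \<in> D \<and> D \<subseteq> \<Union>\<U> \<and> (\<forall>y\<in>D. f y = g y)"
      using d V by blast
  qed (use * in auto)
qed

text \<open>Locally the function is basic, and \<open>basic_nonzero\<close> makes its nonvanishing
  locus basic. Separatedness rests on this.\<close>

lemma nonzero_open:
  assumes "openin (ztop X) U" "f \<in> reg X U"
  shows "openin (ztop X) {x\<in>U. f x \<noteq> 0}"
  unfolding openin_iff
proof clarify
  fix x assume x: "x \<in> U" "f x \<noteq> 0"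
  then obtain D d where d: "Q D d" "x \<in> D" "D \<subseteq> U" "\<forall>y\<in>D. f y = d y"
    using regE[OF assms] by blast
  then obtain h where "Q {y\<in>D. d y \<noteq> 0} h" using basic_nonzero by blast
  then show "\<exists>D g. Q D g \<and> x \<in> D \<and> D \<subseteq> {x\<in>U. f x \<noteq> 0}"
    using d x by (intro exI[of _ "{y\<in>D. d y \<noteq> 0}"] exI[of _ h]) auto
qed

end


subsection \<open>Induced spaces\<close>

text \<open>Only the values of \<open>g\<close> on \<open>D\<close> are prescribed; unlike elements
  of \<open>reg\<close>, basic functions need not vanish off their domain.\<close>

definition pullback_basic ::
  "'x set \<Rightarrow> ('x \<Rightarrow> 'y) \<Rightarrow> ('y set \<Rightarrow> ('y \<Rightarrow> 'k) \<Rightarrow> bool) \<Rightarrow> 'x set \<Rightarrow> ('x \<Rightarrow> 'k) \<Rightarrow> bool" where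
  "pullback_basic A f Q D g \<longleftrightarrow> (\<exists>E h. Q E h \<and> D = f -` E \<inter> A \<and> (\<forall>x\<in>D. g x = h (f x)))"

text \<open>Being presented passes to induced spaces, so one verification for projective space and
  one for affine space serve the grassmannians, their filtration steps and all charts.\<close>

lemma (in presented) presented_induced:
  assumes A: "f ` A \<subseteq> P"
  shows "presented (induced_space A f X) A (pullback_basic A f Q)"
proof
  let ?Y = "induced_space A f X" and ?Q = "pullback_basic A f Q"
  have top: "openin (ztop ?Y) U \<longleftrightarrow> (\<exists>V. openin (ztop X) V \<and> U = f -` V \<inter> A)" for U
    by (simp add: induced_space_def openin_pullback_topology)
  show op: "openin (ztop ?Y) U \<longleftrightarrow> (\<forall>x\<in>U. \<exists>D g. ?Q D g \<and> x \<in> D \<and> D \<subseteq> U)" for U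
  proof
    assume "openin (ztop ?Y) U"
    then obtain V where V: "openin (ztop X) V" "U = f -` V \<inter> A" using top by blast
    show "\<forall>x\<in>U. \<exists>D g. ?Q D g \<and> x \<in> D \<and> D \<subseteq> U"
    proof
      fix x assume x: "x \<in> U"
      then have "f x \<in> V" using V by blast
      then obtain E h where "Q E h" "f x \<in> E" "E \<subseteq> V" using openE[OF V(1)] by blast
      then show "\<exists>D g. ?Q D g \<and> x \<in> D \<and> D \<subseteq> U"
        using x V(2) unfolding pullback_basic_def
        by (intro exI[of _ "f -` E \<inter> A"] exI[of _ "h \<circ> f"]) auto
    qed
  next
    assume *: "\<forall>x\<in>U. \<exists>D g. ?Q D g \<and> x \<in> D \<and> D \<subseteq> U"
    \<comment> \<open>The union of all basic sets whose preimage lies in \<open>U\<close>. Its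
      preimage is all of \<open>U\<close>, because \<open>U\<close> is covered by preimages of basic
      sets.\<close>
    let ?V = "\<Union>{E. (\<exists>h. Q E h) \<and> f -` E \<inter> A \<subseteq> U}"
    have "openin (ztop X) ?V" using basic_open by blast
    moreover have "U = f -` ?V \<inter> A" using * unfolding pullback_basic_def by blast
    ultimately show "openin (ztop ?Y) U" using top by blast
  qed
  show "?Q D g \<Longrightarrow> D \<subseteq> A" for D g by (auto simp: pullback_basic_def)
  show "?Q A (\<lambda>_. c)" for c
    unfolding pullback_basic_def using basic_const[of c] A by blast
  show "?Q (D \<inter> E) (\<lambda>x. g x + h x)" if DE: "?Q D g" "?Q E h" for D E g h
  proof -
    obtain D' g' E' h' where "Q D' g'" "D = f -` D' \<inter> A" "\<forall>x\<in>D. g x = g' (f x)"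
      "Q E' h'" "E = f -` E' \<inter> A" "\<forall>x\<in>E. h x = h' (f x)"
      using DE unfolding pullback_basic_def by blast
    then show ?thesis using basic_add[of D' g' E' h'] unfolding pullback_basic_def
      by (intro exI[of _ "D' \<inter> E'"] exI[of _ "\<lambda>x. g' x + h' x"]) auto
  qed
  show "?Q (D \<inter> E) (\<lambda>x. g x * h x)" if DE: "?Q D g" "?Q E h" for D E g h
  proof -
    obtain D' g' E' h' where "Q D' g'" "D = f -` D' \<inter> A" "\<forall>x\<in>D. g x = g' (f x)"
      "Q E' h'" "E = f -` E' \<inter> A" "\<forall>x\<in>E. h x = h' (f x)"
      using DE unfolding pullback_basic_def by blast
    then show ?thesis using basic_mult[of D' g' E' h'] unfolding pullback_basic_def
      by (intro exI[of _ "D' \<inter> E'"] exI[of _ "\<lambda>x. g' x * h' x"]) auto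
  qed
  show "\<exists>h. ?Q {x\<in>D. g x \<noteq> 0} h" if D: "?Q D g" for D g
  proof -
    obtain E h where E: "Q E h" "D = f -` E \<inter> A" "\<forall>x\<in>D. g x = h (f x)"
      using D unfolding pullback_basic_def by blast
    then obtain h' where "Q {y\<in>E. h y \<noteq> 0} h'" using basic_nonzero by blast
    then show ?thesis using E unfolding pullback_basic_def
      by (intro exI[of _ "h' \<circ> f"] exI[of _ "{y\<in>E. h y \<noteq> 0}"] exI[of _ h']) auto
  qed
  show "g \<in> reg ?Y U \<longleftrightarrow> restr U g = g \<and>
      (\<forall>x\<in>U. \<exists>D d. ?Q D d \<and> x \<in> D \<and> D \<subseteq> U \<and> (\<forall>y\<in>D. g y = d y))"
    if U: "openin (ztop ?Y) U" for U g
  proof -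
    have "(\<exists>V h. openin (ztop X) V \<and> h \<in> reg X V \<and> f x \<in> V \<and> f -` V \<inter> A \<subseteq> U \<and>
            (\<forall>z \<in> f -` V \<inter> A. g z = h (f z))) \<longleftrightarrow>
        (\<exists>D d. ?Q D d \<and> x \<in> D \<and> D \<subseteq> U \<and> (\<forall>y\<in>D. g y = d y))" (is "?l \<longleftrightarrow> ?r") if x: "x \<in> U" for x
    proof
      assume ?l
      then obtain V h where V: "openin (ztop X) V" "h \<in> reg X V" "f x \<in> V" "f -` V \<inter> A \<subseteq> U"
        "\<forall>z \<in> f -` V \<inter> A. g z = h (f z)" by blast
      then obtain E e where E: "Q E e" "f x \<in> E" "E \<subseteq> V" "\<forall>y\<in>E. h y = e y"
        using regE[OF V(1-3)] by blast
      have "x \<in> A" using U top x by auto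
      then show ?r
        using E V(4,5) unfolding pullback_basic_def
        by (intro exI[of _ "f -` E \<inter> A"] exI[of _ "e \<circ> f"] conjI exI[of _ E] exI[of _ e]) auto
    next
      assume ?r
      then obtain E h where E: "Q E h" "x \<in> f -` E \<inter> A" "f -` E \<inter> A \<subseteq> U" "\<forall>y\<in>f -` E \<inter> A. g y = h (f y)"
        unfolding pullback_basic_def by auto
      then show ?l
        using basic_open[OF E(1)] basic_reg[OF E(1)]
        by (intro exI[of _ E] exI[of _ "restr E h"]) (auto simp: restr_def)
    qed
    then show ?thesis by (simp add: induced_space_def cong: ball_cong)
  qed
qed


subsection \<open>Isomorphisms\<close>

lemma presented_change:
  assumes "presented X P Q" "\<And>D g. Q D g = Q' D g"
  shows "presented X P Q'"
proof -
  have "Q = Q'" using assms(2) by blast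
  then show ?thesis using assms(1) by simp
qed

text \<open>Continuity and regularity are tested only on basic functions and only near a point:
  \<open>pull\<close> asks that their pullback agrees with a basic function on some smaller basic
  set.\<close>

lemma presented_morphism:
  assumes "presented X A Q" "presented Y B R" and f: "f ` A \<subseteq> B"
    and pull: "\<And>E h x. R E h \<Longrightarrow> x \<in> A \<Longrightarrow> f x \<in> E \<Longrightarrow>
      \<exists>D g. Q D g \<and> x \<in> D \<and> f ` D \<subseteq> E \<and> (\<forall>y\<in>D. h (f y) = g y)"
  shows "morphism f X Y"
proof -
  interpret X: presented X A Q by fact
  interpret Y: presented Y B R by fact
  have op: "openin (ztop X) (f -` V \<inter> A)" if V: "openin (ztop Y) V" for V
    unfolding X.openin_iff
  proof
    fix x assume x: "x \<in> f -` V \<inter> A"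
    then have "f x \<in> V" by blast
    then obtain E h where "R E h" "f x \<in> E" "E \<subseteq> V" using Y.openE[OF V] by blast
    then obtain D g where "Q D g" "x \<in> D" "f ` D \<subseteq> E" using pull x by blast
    then show "\<exists>D g. Q D g \<and> x \<in> D \<and> D \<subseteq> f -` V \<inter> A"
      using X.basic_subset \<open>E \<subseteq> V\<close> by blast
  qed
  show ?thesis
    unfolding morphism_def
  proof (intro conjI allI impI)
    have "f -` V \<inter> A = {x\<in>A. f x \<in> V}" for V by auto
    then show "continuous_map (ztop X) (ztop Y) f"
      using op f by (auto simp: continuous_map_def X.pts_eq Y.pts_eq)
    fix V h assume Vh: "openin (ztop Y) V \<and> h \<in> reg Y V"
    have o: "openin (ztop X) (f -` V \<inter> A)" using op Vh by blast
    have "\<exists>D g. Q D g \<and> x \<in> D \<and> D \<subseteq> f -` V \<inter> A \<and> (\<forall>y\<in>D. restr (f -` V \<inter> A) (h \<circ> f) y = g y)"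
      if x: "x \<in> f -` V \<inter> A" for x
    proof -
      have V: "openin (ztop Y) V" "h \<in> reg Y V" "f x \<in> V" using x Vh by auto
      obtain E e where E: "R E e" "f x \<in> E" "E \<subseteq> V" "\<forall>y\<in>E. h y = e y"
        using Y.regE[OF V] by blast
      then obtain D g where D: "Q D g" "x \<in> D" "f ` D \<subseteq> E" "\<forall>y\<in>D. e (f y) = g y" using pull x by blast
      moreover have "D \<subseteq> f -` V \<inter> A" using D E X.basic_subset by blast
      ultimately show ?thesis
        using E by (intro exI[of _ D] exI[of _ g]) (auto simp: restr_def)
    qed
    then show "restr (f -` V \<inter> pts X) (h \<circ> f) \<in> reg X (f -` V \<inter> pts X)"
      unfolding X.pts_eq X.reg_iff[OF o] by (auto simp: restr_def)
  qed
qed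

text \<open>\<open>pull\<close> makes \<open>f\<close> a morphism. \<open>push\<close> makes the
  inverse one without mentioning it: near \<open>f x\<close>, a basic function on \<open>X\<close>
  is a basic function on \<open>Y\<close> composed with \<open>f\<close>.\<close>

lemma presented_isomorphism:
  assumes X: "presented X A Q" and Y: "presented Y B R" and f: "bij_betw f A B"
    and pull: "\<And>E h x. R E h \<Longrightarrow> x \<in> A \<Longrightarrow> f x \<in> E \<Longrightarrow>
      \<exists>D g. Q D g \<and> x \<in> D \<and> f ` D \<subseteq> E \<and> (\<forall>y\<in>D. h (f y) = g y)"
    and push: "\<And>D g x. Q D g \<Longrightarrow> x \<in> D \<Longrightarrow>
      \<exists>E h. R E h \<and> f x \<in> E \<and> (\<forall>y\<in>A. f y \<in> E \<longrightarrow> y \<in> D \<and> g y = h (f y))"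
  shows "isomorphism f X Y"
proof -
  interpret X: presented X A Q by fact
  interpret Y: presented Y B R by fact
  let ?i = "inv_into A f"
  have i: "?i ` B = A" "\<And>x. x \<in> A \<Longrightarrow> ?i (f x) = x" "\<And>y. y \<in> B \<Longrightarrow> f (?i y) = y"
    using bij_betw_imp_surj_on[OF bij_betw_inv_into[OF f]] bij_betw_inv_into_left[OF f]
      bij_betw_inv_into_right[OF f] by auto
  have "morphism f X Y"
    by (rule presented_morphism[OF X Y]) (use f pull in \<open>auto simp: bij_betw_def\<close>)
  moreover have "morphism ?i Y X"
  proof (rule presented_morphism[OF Y X])
    fix D g y assume D: "Q D g" "y \<in> B" "?i y \<in> D"
    then obtain E h where E: "R E h" "f (?i y) \<in> E" "\<forall>z\<in>A. f z \<in> E \<longrightarrow> z \<in> D \<and> g z = h (f z)"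
      using push by blast
    moreover have "?i z \<in> D \<and> g (?i z) = h z" if "z \<in> E" for z
    proof -
      have "z \<in> B" using that E Y.basic_subset by blast
      then show ?thesis using E(3) i that by (metis image_eqI)
    qed
    ultimately show "\<exists>E h. R E h \<and> y \<in> E \<and> ?i ` E \<subseteq> D \<and> (\<forall>z\<in>E. g (?i z) = h z)"
      using i(3)[OF D(2)] by auto
  qed (use i in auto)
  ultimately show ?thesis
    using f by (simp add: isomorphism_def X.pts_eq Y.pts_eq)
qed

lemma presented_isomorphism_pullback:
  assumes X: "presented X A Q" and Y: "presented Y B R" and f: "bij_betw f A B"
    and eq: "\<And>D g. Q D g \<longleftrightarrow> pullback_basic A f R D g"
  shows "isomorphism f X Y"
proof (rule presented_isomorphism[OF X Y f])
  interpret Y: presented Y B R by fact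
  fix E h x assume "R E h" "x \<in> A" "f x \<in> E"
  then show "\<exists>D g. Q D g \<and> x \<in> D \<and> f ` D \<subseteq> E \<and> (\<forall>y\<in>D. h (f y) = g y)"
    unfolding eq pullback_basic_def
    by (intro exI[of _ "f -` E \<inter> A"] exI[of _ "h \<circ> f"]) auto
next
  fix D g x assume D: "Q D g" "x \<in> D"
  then obtain E h where "R E h" "D = f -` E \<inter> A" "\<forall>x\<in>D. g x = h (f x)"
    unfolding eq pullback_basic_def by blast
  then show "\<exists>E h. R E h \<and> f x \<in> E \<and> (\<forall>y\<in>A. f y \<in> E \<longrightarrow> y \<in> D \<and> g y = h (f y))"
    using D by blast
qed

text \<open>When the basic functions of \<open>X\<close> are exactly the pullbacks from
  \<open>Y\<close>, the structure induced on the image is that of \<open>X\<close>, so only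
  injectivity and closedness of the image are left.\<close>

lemma presented_closed_immersion:
  assumes X: "presented X A Q" and Y: "presented Y B R" and f: "inj_on f A" "f ` A \<subseteq> B"
    and closed: "closedin (ztop Y) (f ` A)"
    and eq: "\<And>D g. Q D g \<longleftrightarrow> pullback_basic A f R D g"
  shows "closed_immersion f X Y"
proof -
  interpret X: presented X A Q by fact
  interpret Y: presented Y B R by fact
  have "isomorphism f X (subspace_of Y (f ` A))"
  proof (rule presented_isomorphism_pullback[OF X Y.presented_induced])
    fix D g
    show "Q D g \<longleftrightarrow> pullback_basic A f (pullback_basic (f ` A) (\<lambda>y. y) R) D g"
      unfolding eq
    proof
      assume "pullback_basic A f R D g"
      then obtain E h where "R E h" "D = f -` E \<inter> A" "\<forall>x\<in>D. g x = h (f x)"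
        unfolding pullback_basic_def by blast
      then show "pullback_basic A f (pullback_basic (f ` A) (\<lambda>y. y) R) D g"
        unfolding pullback_basic_def[of A] unfolding pullback_basic_def
        by (intro exI[of _ "E \<inter> f ` A"] exI[of _ h]) auto
    next
      assume "pullback_basic A f (pullback_basic (f ` A) (\<lambda>y. y) R) D g"
      then obtain E h where E: "pullback_basic (f ` A) (\<lambda>y. y) R E h" "D = f -` E \<inter> A"
        "\<forall>x\<in>D. g x = h (f x)"
        unfolding pullback_basic_def[of A] by blast
      then obtain E' h' where "R E' h'" "E = E' \<inter> f ` A" "\<forall>x\<in>E. h x = h' x"
        unfolding pullback_basic_def by auto
      then show "pullback_basic A f R D g"
        using E unfolding pullback_basic_def
        by (intro exI[of _ E'] exI[of _ h']) auto
    qed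
  qed (use f in \<open>auto simp: bij_betw_def\<close>)
  then show ?thesis
    using closed by (simp add: closed_immersion_def X.pts_eq)
qed


subsection \<open>Fractions of polynomials\<close>

text \<open>\<open>r x\<close> is a vector of (homogeneous or affine) coordinates of the point \<open>x\<close>.\<close>

definition fractions ::
  "(nat \<Rightarrow> ('v, 'k::field) mpoly \<Rightarrow> bool) \<Rightarrow> 'x set \<Rightarrow> ('x \<Rightarrow> 'v \<Rightarrow> 'k) \<Rightarrow> 'x set \<Rightarrow> ('x \<Rightarrow> 'k) \<Rightarrow> bool" where
  "fractions H P r D g \<longleftrightarrow> (\<exists>d p q. H d p \<and> H d q \<and> D = {x\<in>P. mp_eval (r x) q \<noteq> 0} \<and>
     (\<forall>x\<in>D. g x = mp_eval (r x) p / mp_eval (r x) q))"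

text \<open>Homogeneous polynomials and arbitrary polynomials with a dummy degree both satisfy this,
  so projective and affine space share one treatment.\<close>

definition grading :: "(nat \<Rightarrow> ('v, 'k::field) mpoly \<Rightarrow> bool) \<Rightarrow> bool" where
  "grading H \<longleftrightarrow> (\<forall>c. H 0 (mp_const c)) \<and> (\<forall>d p q. H d p \<longrightarrow> H d q \<longrightarrow> H d (p + q)) \<and>
     (\<forall>d e p q. H d p \<longrightarrow> H e q \<longrightarrow> H (d + e) (p * q))"

lemma grading_homogeneous: "grading homogeneous"
  by (auto simp: grading_def intro: homogeneous_add homogeneous_mult)

lemma grading_trivial: "grading (\<lambda>_ _. True)"
  by (simp add: grading_def)

lemma fractionsI:
  assumes "H d p" "H d q" "D = {x\<in>P. mp_eval (r x) q \<noteq> 0}"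
    "\<And>x. x \<in> D \<Longrightarrow> g x = mp_eval (r x) p / mp_eval (r x) q"
  shows "fractions H P r D g"
  using assms unfolding fractions_def by blast

text \<open>A fraction carries its own domain, the nonvanishing locus of its denominator; sums and
  products over a common denominator live on the intersection of the domains.\<close>

lemma presented_fractions:
  assumes H: "grading H"
    and op: "\<And>U. openin (ztop X) U \<longleftrightarrow>
      (\<forall>x\<in>U. \<exists>d q. H d q \<and> x \<in> P \<and> mp_eval (r x) q \<noteq> 0 \<and> {y\<in>P. mp_eval (r y) q \<noteq> 0} \<subseteq> U)"
    and reg: "\<And>U f. openin (ztop X) U \<Longrightarrow> f \<in> reg X U \<longleftrightarrow> restr U f = f \<and>
      (\<forall>x\<in>U. \<exists>V d p q. openin (ztop X) V \<and> x \<in> V \<and> V \<subseteq> U \<and> H d p \<and> H d q \<and>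
         (\<forall>y\<in>V. mp_eval (r y) q \<noteq> 0 \<and> f y = mp_eval (r y) p / mp_eval (r y) q))"
  shows "presented X P (fractions H P r)"
proof
  let ?Q = "fractions H P r"
  have c: "H 0 (mp_const c)" and add: "H d p \<Longrightarrow> H d q \<Longrightarrow> H d (p + q)"
    and mult: "H d p \<Longrightarrow> H e q \<Longrightarrow> H (d + e) (p * q)" for c d e p q
    using H by (auto simp: grading_def)
  have basic: "?Q {x\<in>P. mp_eval (r x) q \<noteq> 0} (\<lambda>x. mp_eval (r x) q / mp_eval (r x) q)" if "H d q" for d q
    using that by (intro fractionsI[of H d q q]) auto
  show openin: "openin (ztop X) U \<longleftrightarrow> (\<forall>x\<in>U. \<exists>D g. ?Q D g \<and> x \<in> D \<and> D \<subseteq> U)" for U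
    unfolding op
  proof (intro ball_cong refl iffI)
    fix x assume "\<exists>d q. H d q \<and> x \<in> P \<and> mp_eval (r x) q \<noteq> 0 \<and> {y \<in> P. mp_eval (r y) q \<noteq> 0} \<subseteq> U"
    then show "\<exists>D g. ?Q D g \<and> x \<in> D \<and> D \<subseteq> U" using basic by blast
  next
    fix x assume "\<exists>D g. ?Q D g \<and> x \<in> D \<and> D \<subseteq> U"
    then show "\<exists>d q. H d q \<and> x \<in> P \<and> mp_eval (r x) q \<noteq> 0 \<and> {y \<in> P. mp_eval (r y) q \<noteq> 0} \<subseteq> U"
      unfolding fractions_def by blast
  qed
  show "?Q D g \<Longrightarrow> D \<subseteq> P" for D g by (auto simp: fractions_def)
  show "?Q P (\<lambda>_. a)" for a
    using c[of a] c[of 1] by (intro fractionsI[of H 0 "mp_const a" "mp_const 1"]) auto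
  show "?Q (D \<inter> E) (\<lambda>x. g x + h x)" if DE: "?Q D g" "?Q E h" for D E g h
  proof -
    obtain d p q where 1: "H d p" "H d q" "D = {x\<in>P. mp_eval (r x) q \<noteq> 0}"
      "\<forall>x\<in>D. g x = mp_eval (r x) p / mp_eval (r x) q" using DE(1) unfolding fractions_def by blast
    obtain e s t where 2: "H e s" "H e t" "E = {x\<in>P. mp_eval (r x) t \<noteq> 0}"
      "\<forall>x\<in>E. h x = mp_eval (r x) s / mp_eval (r x) t" using DE(2) unfolding fractions_def by blast
    show ?thesis
      using 1 2 mult[OF 1(1) 2(2)] mult[OF 1(2) 2(1)] mult[OF 1(2) 2(2)]
      by (intro fractionsI[of H "d + e" "p * t + q * s" "q * t"])
        (auto simp: mp_eval.hom_add mp_eval.hom_mult field_simps intro: add)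
  qed
  show "?Q (D \<inter> E) (\<lambda>x. g x * h x)" if DE: "?Q D g" "?Q E h" for D E g h
  proof -
    obtain d p q where 1: "H d p" "H d q" "D = {x\<in>P. mp_eval (r x) q \<noteq> 0}"
      "\<forall>x\<in>D. g x = mp_eval (r x) p / mp_eval (r x) q" using DE(1) unfolding fractions_def by blast
    obtain e s t where 2: "H e s" "H e t" "E = {x\<in>P. mp_eval (r x) t \<noteq> 0}"
      "\<forall>x\<in>E. h x = mp_eval (r x) s / mp_eval (r x) t" using DE(2) unfolding fractions_def by blast
    show ?thesis
      using 1 2 mult[OF 1(1) 2(1)] mult[OF 1(2) 2(2)]
      by (intro fractionsI[of H "d + e" "p * s" "q * t"])
        (auto simp: mp_eval.hom_mult)
  qed
  show "\<exists>h. ?Q {x\<in>D. g x \<noteq> 0} h" if D: "?Q D g" for D g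
  proof -
    obtain d p q where 1: "H d p" "H d q" "D = {x\<in>P. mp_eval (r x) q \<noteq> 0}"
      "\<forall>x\<in>D. g x = mp_eval (r x) p / mp_eval (r x) q" using D unfolding fractions_def by blast
    then have "{x\<in>D. g x \<noteq> 0} = {x\<in>P. mp_eval (r x) (p * q) \<noteq> 0}"
      by (auto simp: mp_eval.hom_mult)
    then show ?thesis using basic[OF mult[OF 1(1,2)]] by auto
  qed
  show "f \<in> reg X U \<longleftrightarrow> restr U f = f \<and> (\<forall>x\<in>U. \<exists>D g. ?Q D g \<and> x \<in> D \<and> D \<subseteq> U \<and> (\<forall>y\<in>D. f y = g y))"
    if U: "openin (ztop X) U" for U f
    unfolding reg[OF U]
  proof (intro conj_cong refl ball_cong iffI)
    fix x assume x: "x \<in> U" and "\<exists>V d p q. openin (ztop X) V \<and> x \<in> V \<and> V \<subseteq> U \<and> H d p \<and> H d q \<and>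
         (\<forall>y\<in>V. mp_eval (r y) q \<noteq> 0 \<and> f y = mp_eval (r y) p / mp_eval (r y) q)"
    then obtain V d p q where V: "openin (ztop X) V" "x \<in> V" "V \<subseteq> U" "H d p" "H d q"
      "\<forall>y\<in>V. mp_eval (r y) q \<noteq> 0 \<and> f y = mp_eval (r y) p / mp_eval (r y) q" by blast
    then obtain e t where t: "H e t" "x \<in> P" "mp_eval (r x) t \<noteq> 0" "{y\<in>P. mp_eval (r y) t \<noteq> 0} \<subseteq> V"
      using op[of V] by blast
    \<comment> \<open>The given neighbourhood \<open>V\<close> need not be the locus of
      \<open>q\<close>. It is shrunk to the locus of some \<open>t\<close>, and numerator and
      denominator are multiplied by \<open>t\<close>, which makes the domain the locus of
      \<open>q * t\<close>.\<close>
    show "\<exists>D g. ?Q D g \<and> x \<in> D \<and> D \<subseteq> U \<and> (\<forall>y\<in>D. f y = g y)"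
    proof (intro exI conjI)
      show "?Q {y\<in>P. mp_eval (r y) (q * t) \<noteq> 0} f"
        by (rule fractionsI[of H "d + e" "p * t" "q * t"])
          (use V t mult in \<open>auto simp: mp_eval.hom_mult\<close>)
    qed (use V t in \<open>auto simp: mp_eval.hom_mult\<close>)
  next
    fix x assume x: "x \<in> U" and "\<exists>D g. ?Q D g \<and> x \<in> D \<and> D \<subseteq> U \<and> (\<forall>y\<in>D. f y = g y)"
    then obtain D g where D: "?Q D g" "x \<in> D" "D \<subseteq> U" "\<forall>y\<in>D. f y = g y" by blast
    then obtain d p q where 1: "H d p" "H d q" "D = {x\<in>P. mp_eval (r x) q \<noteq> 0}"
      "\<forall>x\<in>D. g x = mp_eval (r x) p / mp_eval (r x) q" unfolding fractions_def by blast
    moreover have "openin (ztop X) D" unfolding openin using D(1) by blast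
    ultimately show "\<exists>V d p q. openin (ztop X) V \<and> x \<in> V \<and> V \<subseteq> U \<and> H d p \<and> H d q \<and>
         (\<forall>y\<in>V. mp_eval (r y) q \<noteq> 0 \<and> f y = mp_eval (r y) p / mp_eval (r y) q)"
      using D by (intro exI[of _ D] exI[of _ d] exI[of _ p] exI[of _ q]) auto
  qed
qed

text \<open>A fraction pulls back to the same fraction of polynomials, so a map changes nothing but
  the coordinate vector.\<close>

lemma pullback_fractions:
  assumes "f ` A \<subseteq> P"
  shows "pullback_basic A f (fractions H P r) = fractions H A (\<lambda>x. r (f x))"
proof (intro ext iffI)
  fix D g assume "pullback_basic A f (fractions H P r) D g"
  then obtain E h where E: "fractions H P r E h" "D = f -` E \<inter> A" "\<forall>x\<in>D. g x = h (f x)"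
    unfolding pullback_basic_def by blast
  then obtain d p q where "H d p" "H d q" "E = {x\<in>P. mp_eval (r x) q \<noteq> 0}"
    "\<forall>x\<in>E. h x = mp_eval (r x) p / mp_eval (r x) q" unfolding fractions_def by blast
  then show "fractions H A (\<lambda>x. r (f x)) D g"
    using E assms by (intro fractionsI[of H d p q]) auto
next
  fix D g assume "fractions H A (\<lambda>x. r (f x)) D g"
  then obtain d p q where "H d p" "H d q" "D = {x\<in>A. mp_eval (r (f x)) q \<noteq> 0}"
    "\<forall>x\<in>D. g x = mp_eval (r (f x)) p / mp_eval (r (f x)) q" unfolding fractions_def by blast
  then show "pullback_basic A f (fractions H P r) D g"
    unfolding pullback_basic_def using assms
    by (intro exI[of _ "{x\<in>P. mp_eval (r x) q \<noteq> 0}"] exI[of _ "\<lambda>x. mp_eval (r x) p / mp_eval (r x) q"])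
      (auto intro!: fractionsI[of H d p q])
qed

text \<open>\<open>topology\<close> inverts \<open>openin\<close> only on predicates that are
  topologies; intersections are handled by products of polynomials.\<close>

lemma openin_topology_basic:
  assumes pred: "\<And>U. pred U \<longleftrightarrow> (\<forall>x\<in>U. \<exists>d q. H d q \<and> x \<in> P \<and> mp_eval (r x) q \<noteq> 0 \<and>
      {y\<in>P. mp_eval (r y) q \<noteq> 0} \<subseteq> U)" and H: "grading H"
  shows "openin (topology pred) = pred"
proof -
  have "istopology pred"
    unfolding istopology_def
  proof (intro conjI allI impI)
    fix S T assume S: "pred S" and T: "pred T"
    show "pred (S \<inter> T)"
      unfolding pred
    proof
      fix x assume x: "x \<in> S \<inter> T"
      then obtain d p where p: "H d p" "x \<in> P" "mp_eval (r x) p \<noteq> 0" "{y\<in>P. mp_eval (r y) p \<noteq> 0} \<subseteq> S"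
        using S pred by blast
      obtain e q where q: "H e q" "mp_eval (r x) q \<noteq> 0" "{y\<in>P. mp_eval (r y) q \<noteq> 0} \<subseteq> T"
        using T pred x by blast
      have "H (d + e) (p * q)" using p q H by (simp add: grading_def)
      then show "\<exists>d q. H d q \<and> x \<in> P \<and> mp_eval (r x) q \<noteq> 0 \<and> {y \<in> P. mp_eval (r y) q \<noteq> 0} \<subseteq> S \<inter> T"
        using p q by (intro exI[of _ "d + e"] exI[of _ "p * q"]) (auto simp: mp_eval.hom_mult)
    qed
  next
    fix \<K> assume K: "\<forall>K\<in>\<K>. pred K"
    show "pred (\<Union>\<K>)"
      unfolding pred
    proof
      fix x assume "x \<in> \<Union>\<K>"
      then obtain K where "K \<in> \<K>" "x \<in> K" by blast
      then show "\<exists>d q. H d q \<and> x \<in> P \<and> mp_eval (r x) q \<noteq> 0 \<and> {y \<in> P. mp_eval (r y) q \<noteq> 0} \<subseteq> \<Union>\<K>"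
        using K pred[of K] by blast
    qed
  qed
  then show ?thesis by (rule topology_inverse')
qed

text \<open>\<open>Z\<close> is the notion of zero of the definition, which for lines quantifies
  over all their nonzero vectors, while \<open>r\<close> picks one vector. From right to left,
  \<open>F\<close> is the set of all admissible polynomials that vanish on the complement.\<close>

lemma complement_zeros_iff:
  assumes zero: "\<And>x p. x \<in> P \<Longrightarrow> (\<exists>d. H d p) \<Longrightarrow> Z p x \<longleftrightarrow> mp_eval (r x) p = 0"
  shows "U \<subseteq> P \<and> (\<exists>F. (\<forall>p\<in>F. \<exists>d. H d p) \<and> P - U = {x\<in>P. \<forall>p\<in>F. Z p x}) \<longleftrightarrow>
    (\<forall>x\<in>U. \<exists>d q. H d q \<and> x \<in> P \<and> mp_eval (r x) q \<noteq> 0 \<and> {y\<in>P. mp_eval (r y) q \<noteq> 0} \<subseteq> U)"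
    (is "?l \<longleftrightarrow> ?r")
proof
  assume ?l
  then obtain F where F: "U \<subseteq> P" "\<forall>p\<in>F. \<exists>d. H d p" "P - U = {x\<in>P. \<forall>p\<in>F. Z p x}" by blast
  show ?r
  proof
    fix x assume x: "x \<in> U"
    then obtain p where p: "p \<in> F" "\<not> Z p x" using F by blast
    then obtain d where d: "H d p" using F by blast
    have "y \<in> U" if "y \<in> P" "mp_eval (r y) p \<noteq> 0" for y
    proof (rule ccontr)
      assume "y \<notin> U"
      then have "Z p y" using F(3) p(1) that by blast
      then show False using zero that d by blast
    qed
    then show "\<exists>d q. H d q \<and> x \<in> P \<and> mp_eval (r x) q \<noteq> 0 \<and> {y\<in>P. mp_eval (r y) q \<noteq> 0} \<subseteq> U"
      using d p x F(1) zero[of x p] by (intro exI[of _ d] exI[of _ p] conjI) blast+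
  qed
next
  assume r: ?r
  let ?F = "{p. (\<exists>d. H d p) \<and> (\<forall>y\<in>P - U. mp_eval (r y) p = 0)}"
  have "P - U = {x\<in>P. \<forall>p\<in>?F. Z p x}"
  proof (intro equalityI subsetI)
    fix x assume "x \<in> {x\<in>P. \<forall>p\<in>?F. Z p x}"
    then have x: "x \<in> P" "\<forall>p\<in>?F. mp_eval (r x) p = 0" using zero by auto
    show "x \<in> P - U"
    proof (rule ccontr)
      assume "x \<notin> P - U"
      then obtain d q where "H d q" "mp_eval (r x) q \<noteq> 0" "{y\<in>P. mp_eval (r y) q \<noteq> 0} \<subseteq> U"
        using r x by blast
      moreover from this have "q \<in> ?F" by blast
      ultimately show False using x by blast
    qed
  qed (use zero in auto)
  moreover have "U \<subseteq> P" "\<forall>p\<in>?F. \<exists>d. H d p" using r by auto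
  ultimately show ?l by (intro conjI exI[of _ ?F])
qed

section \<open>Affine and projective space\<close>

lemma presented_affine:
  "presented (affine_space d :: (nat \<Rightarrow> 'k::field, 'k) kspace) (coord_space {..<d}) (fractions (\<lambda>_ _. True) (coord_space {..<d}) (\<lambda>x. x))"
proof -
  let ?E = "coord_space {..<d} :: (nat \<Rightarrow> 'k) set"
  let ?pred = "\<lambda>U. U \<subseteq> ?E \<and> (\<exists>F. ?E - U = {x\<in>?E. \<forall>p\<in>F. mp_eval x p = 0})"
  note eq = complement_zeros_iff[where H = "\<lambda>_ _. True" and r = "\<lambda>x. x" and Z = "\<lambda>p x. mp_eval x p = 0" and P = ?E]
  have top: "openin (topology ?pred) = ?pred"
    by (rule openin_topology_basic[OF _ grading_trivial, of _ ?E "\<lambda>x. x"]) (use eq in simp)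
  have ztop: "ztop (affine_space d) = topology ?pred" by (simp add: affine_space_def Let_def)
  show ?thesis
  proof (rule presented_fractions[OF grading_trivial])
    show "openin (ztop (affine_space d)) U \<longleftrightarrow> (\<forall>x\<in>U. \<exists>(e::nat) q. True \<and> x \<in> ?E \<and>
        mp_eval x q \<noteq> 0 \<and> {y\<in>?E. mp_eval y q \<noteq> 0} \<subseteq> U)" for U
      unfolding ztop top using eq[of U] by simp
    fix U :: "(nat \<Rightarrow> 'k) set" and f assume "openin (ztop (affine_space d)) U"
    show "f \<in> reg (affine_space d) U \<longleftrightarrow> restr U f = f \<and>
      (\<forall>x\<in>U. \<exists>V (e::nat) p q. openin (ztop (affine_space d)) V \<and> x \<in> V \<and> V \<subseteq> U \<and> True \<and> True \<and>
         (\<forall>y\<in>V. mp_eval y q \<noteq> 0 \<and> f y = mp_eval y p / mp_eval y q))"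
      unfolding ztop by (simp add: affine_space_def Let_def)
  qed
qed

text \<open>A coordinate vector of the line, by choice. Every other nonzero vector of the line is a
  nonzero multiple, so homogeneous statements do not depend on it.\<close>

definition rep :: "('v \<Rightarrow> 'k::field) set \<Rightarrow> 'v \<Rightarrow> 'k" where
  "rep l = (SOME v. v \<in> l - {0})"

lemma vline_rep:
  assumes "l \<in> vline ` (E - {0})"
  shows "rep l \<in> l - {0}" "l = vline (rep l)" "v \<in> l - {0} \<Longrightarrow> \<exists>c. c \<noteq> 0 \<and> v = fscale c (rep l)"
proof -
  obtain w where w: "l = vline w" "w \<noteq> 0" using assms by blast
  have "w = fscale 1 w" by simp
  then have "w \<in> l - {0}" using w unfolding vline_def by blast
  then show 1: "rep l \<in> l - {0}" unfolding rep_def by (rule someI[where P = "\<lambda>v. v \<in> l - {0}"])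
  then obtain c where c: "rep l = fscale c w" using w by (auto simp: vline_def)
  then have c0: "c \<noteq> 0" using 1 by auto
  have "fscale a w = fscale (a / c) (rep l)" for a using c c0 by simp
  then have "\<exists>b. fscale a w = fscale b (rep l)" for a by blast
  moreover have "\<exists>b. fscale a (rep l) = fscale b w" for a using c by auto
  ultimately have "vline w = vline (rep l)" unfolding vline_def by blast
  then show 2: "l = vline (rep l)" using w by simp
  assume v: "v \<in> l - {0}"
  then have "v \<in> vline (rep l)" using 2 by simp
  then obtain b where "v = fscale b (rep l)" by (auto simp: vline_def)
  then show "\<exists>c. c \<noteq> 0 \<and> v = fscale c (rep l)" using v by auto
qed

lemma presented_proj:
  fixes E :: "('v \<Rightarrow> 'k::field) set"
  shows "presented (proj_space E) (vline ` (E - {0})) (fractions homogeneous (vline ` (E - {0})) rep)"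
proof -
  let ?P = "vline ` (E - {0})"
  let ?pred = "\<lambda>U. U \<subseteq> ?P \<and> (\<exists>F. (\<forall>p\<in>F. \<exists>d. homogeneous d p) \<and>
                ?P - U = {l\<in>?P. \<forall>p\<in>F. \<forall>v \<in> l - {0}. mp_eval v p = 0})"
  have zero: "(\<forall>v \<in> l - {0}. mp_eval v p = 0) \<longleftrightarrow> mp_eval (rep l) p = 0"
    if l: "l \<in> ?P" and p: "\<exists>d. homogeneous d p" for l p
  proof
    assume *: "mp_eval (rep l) p = 0"
    obtain d where d: "homogeneous d p" using p by blast
    show "\<forall>v \<in> l - {0}. mp_eval v p = 0"
    proof
      fix v assume "v \<in> l - {0}"
      then obtain a where "v = fscale a (rep l)" using vline_rep(3)[OF l] by blast
      then show "mp_eval v p = 0" using * d by (simp add: mp_eval_fscale)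
    qed
  qed (use vline_rep(1)[OF l] in blast)
  \<comment> \<open>Another vector of the line multiplies numerator and denominator by the same
    \<open>a ^ d\<close>.\<close>
  have nonzero: "(\<forall>v \<in> l - {0}. mp_eval v q \<noteq> 0 \<and> c = mp_eval v p / mp_eval v q) \<longleftrightarrow>
     mp_eval (rep l) q \<noteq> 0 \<and> c = mp_eval (rep l) p / mp_eval (rep l) q"
    if l: "l \<in> ?P" and pq: "homogeneous d p" "homogeneous d q" for l p q c d
  proof
    assume *: "mp_eval (rep l) q \<noteq> 0 \<and> c = mp_eval (rep l) p / mp_eval (rep l) q"
    show "\<forall>v \<in> l - {0}. mp_eval v q \<noteq> 0 \<and> c = mp_eval v p / mp_eval v q"
    proof
      fix v assume "v \<in> l - {0}"
      then obtain a where "a \<noteq> 0" "v = fscale a (rep l)" using vline_rep(3)[OF l] by blast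
      then show "mp_eval v q \<noteq> 0 \<and> c = mp_eval v p / mp_eval v q"
        using * pq by (simp add: mp_eval_fscale[of d])
    qed
  qed (use vline_rep(1)[OF l] in blast)
  note eq = complement_zeros_iff[where H = homogeneous and r = rep
      and Z = "\<lambda>p l. \<forall>v \<in> l - {0}. mp_eval v p = 0" and P = ?P, OF zero]
  have top: "openin (topology ?pred) = ?pred"
    by (rule openin_topology_basic[OF eq grading_homogeneous])
  have ztop: "ztop (proj_space E) = topology ?pred" by (simp add: proj_space_def Let_def)
  show ?thesis
  proof (rule presented_fractions[OF grading_homogeneous])
    show "openin (ztop (proj_space E)) U \<longleftrightarrow> (\<forall>x\<in>U. \<exists>d q. homogeneous d q \<and> x \<in> ?P \<and>
        mp_eval (rep x) q \<noteq> 0 \<and> {y\<in>?P. mp_eval (rep y) q \<noteq> 0} \<subseteq> U)" for U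
      unfolding ztop top by (rule eq)
    fix U and f :: "('v \<Rightarrow> 'k) set \<Rightarrow> 'k" assume "openin (ztop (proj_space E)) U"
    have key: "(\<forall>l'\<in>V. \<forall>v \<in> l' - {0}. mp_eval v q \<noteq> 0 \<and> f l' = mp_eval v p / mp_eval v q) \<longleftrightarrow>
        (\<forall>y\<in>V. mp_eval (rep y) q \<noteq> 0 \<and> f y = mp_eval (rep y) p / mp_eval (rep y) q)"
      if V: "openin (topology ?pred) V" and pq: "homogeneous d p" "homogeneous d q" for V d p q
    proof (rule ball_cong[OF refl])
      fix l assume "l \<in> V"
      then have "l \<in> ?P" using V unfolding top by blast
      then show "(\<forall>v \<in> l - {0}. mp_eval v q \<noteq> 0 \<and> f l = mp_eval v p / mp_eval v q) \<longleftrightarrow>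
          mp_eval (rep l) q \<noteq> 0 \<and> f l = mp_eval (rep l) p / mp_eval (rep l) q"
        by (rule nonzero[OF _ pq])
    qed
    have "(\<exists>V d p q. openin (topology ?pred) V \<and> l \<in> V \<and> V \<subseteq> U \<and> homogeneous d p \<and> homogeneous d q \<and>
          (\<forall>l'\<in>V. \<forall>v \<in> l' - {0}. mp_eval v q \<noteq> 0 \<and> f l' = mp_eval v p / mp_eval v q)) \<longleftrightarrow>
        (\<exists>V d p q. openin (topology ?pred) V \<and> l \<in> V \<and> V \<subseteq> U \<and> homogeneous d p \<and> homogeneous d q \<and>
          (\<forall>y\<in>V. mp_eval (rep y) q \<noteq> 0 \<and> f y = mp_eval (rep y) p / mp_eval (rep y) q))" for l
      by (intro ex_cong1 conj_cong refl key)
    then show "f \<in> reg (proj_space E) U \<longleftrightarrow> restr U f = f \<and>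
      (\<forall>x\<in>U. \<exists>V d p q. openin (ztop (proj_space E)) V \<and> x \<in> V \<and> V \<subseteq> U \<and> homogeneous d p \<and> homogeneous d q \<and>
         (\<forall>y\<in>V. mp_eval (rep y) q \<noteq> 0 \<and> f y = mp_eval (rep y) p / mp_eval (rep y) q))"
      unfolding ztop by (simp add: proj_space_def Let_def)
  qed
qed


section \<open>Alternating forms and minors\<close>

text \<open>The forms are defined on infinite sequences of vectors and look only at the first
  \<open>m\<close>; changing a column is then a plain function update.\<close>

definition alt_form :: "nat \<Rightarrow> ((nat \<Rightarrow> 'a \<Rightarrow> 'k::field) \<Rightarrow> 'k) \<Rightarrow> bool" where
  "alt_form m F \<longleftrightarrow> (\<forall>w w'. (\<forall>c<m. w c = w' c) \<longrightarrow> F w = F w') \<and>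
     (\<forall>w c u v. c < m \<longrightarrow> F (w(c := u + v)) = F (w(c := u)) + F (w(c := v))) \<and>
     (\<forall>w c a u. c < m \<longrightarrow> F (w(c := fscale a u)) = a * F (w(c := u))) \<and>
     (\<forall>w c d. c < m \<longrightarrow> d < m \<longrightarrow> c \<noteq> d \<longrightarrow> w c = w d \<longrightarrow> F w = 0)"

lemma
  assumes "alt_form m F"
  shows alt_form_cong: "(\<And>c. c < m \<Longrightarrow> w c = w' c) \<Longrightarrow> F w = F w'"
    and alt_form_add: "c < m \<Longrightarrow> F (w(c := u + v)) = F (w(c := u)) + F (w(c := v))"
    and alt_form_scale: "c < m \<Longrightarrow> F (w(c := fscale a u)) = a * F (w(c := u))"
    and alt_form_eq: "c < m \<Longrightarrow> d < m \<Longrightarrow> c \<noteq> d \<Longrightarrow> w c = w d \<Longrightarrow> F w = 0"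
  using assms unfolding alt_form_def by blast+

lemma alt_formI:
  assumes "\<And>w w'. (\<And>c. c < m \<Longrightarrow> w c = w' c) \<Longrightarrow> F w = F w'"
    "\<And>w c u v. c < m \<Longrightarrow> F (w(c := u + v)) = F (w(c := u)) + F (w(c := v))"
    "\<And>w c a u. c < m \<Longrightarrow> F (w(c := fscale a u)) = a * F (w(c := u))"
    "\<And>w c d. c < m \<Longrightarrow> d < m \<Longrightarrow> c \<noteq> d \<Longrightarrow> w c = w d \<Longrightarrow> F w = 0"
  shows "alt_form m F"
  unfolding alt_form_def using assms by blast

lemma alt_form_plus:
  assumes F: "alt_form m F" and G: "alt_form m G"
  shows "alt_form m (\<lambda>w. F w + G w)"
proof (rule alt_formI)
  fix w w' :: "nat \<Rightarrow> 'a \<Rightarrow> 'b" assume "\<And>c. c < m \<Longrightarrow> w c = w' c"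
  then show "F w + G w = F w' + G w'" using alt_form_cong[OF F, of w w'] alt_form_cong[OF G, of w w'] by simp
next
  fix w :: "nat \<Rightarrow> 'a \<Rightarrow> 'b" and c d assume "c < m" "d < m" "c \<noteq> d" "w c = w d"
  then show "F w + G w = 0" using alt_form_eq[OF F, of c d w] alt_form_eq[OF G, of c d w] by simp
qed (simp_all only: alt_form_add[OF F] alt_form_add[OF G] alt_form_scale[OF F] alt_form_scale[OF G] distrib_left ac_simps)

lemma alt_form_cmult:
  assumes F: "alt_form m F"
  shows "alt_form m (\<lambda>w. a * F w)"
proof (rule alt_formI)
  fix w w' :: "nat \<Rightarrow> 'a \<Rightarrow> 'b" assume "\<And>c. c < m \<Longrightarrow> w c = w' c"
  then show "a * F w = a * F w'" using alt_form_cong[OF F, of w w'] by simp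
next
  fix w :: "nat \<Rightarrow> 'a \<Rightarrow> 'b" and c d assume "c < m" "d < m" "c \<noteq> d" "w c = w d"
  then show "a * F w = 0" using alt_form_eq[OF F, of c d w] by simp
qed (simp_all only: alt_form_add[OF F] alt_form_scale[OF F] distrib_left mult.left_commute)

lemma alt_form_diff: "alt_form m F \<Longrightarrow> alt_form m G \<Longrightarrow> alt_form m (\<lambda>w. F w - G w)"
  using alt_form_plus[OF _ alt_form_cmult[of m G "- 1"], of F] by simp

lemma alt_form_0: "alt_form m (\<lambda>_. 0)"
  unfolding alt_form_def by simp

lemma alt_form_sum: "(\<And>i. i \<in> A \<Longrightarrow> alt_form m (F i)) \<Longrightarrow> alt_form m (\<lambda>w. \<Sum>i\<in>A. F i w)"
  by (induction A rule: infinite_finite_induct) (auto intro: alt_form_0 alt_form_plus)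

lemma alt_form_zero:
  assumes "alt_form m F" "c < m" "w c = 0"
  shows "F w = 0"
  using alt_form_scale[OF assms(1,2), of w 0 0] assms(3) by (metis fun_upd_triv fun_vs.scale_zero_left mult_zero_left)

text \<open>The form with \<open>w c + w d\<close> in both places is 0; expanding it leaves the two
  swapped values.\<close>

lemma alt_form_swap:
  assumes F: "alt_form m F" and cd: "c < m" "d < m" "c \<noteq> d"
  shows "F (w \<circ> Transposition.transpose c d) = - F w"
proof -
  let ?G = "\<lambda>u v. F (w(c := u, d := v))"
  have add1: "?G (u + u') v = ?G u v + ?G u' v" for u u' v
    using alt_form_add[OF F cd(1), of "w(d := v)" u u'] cd(3) by (simp add: fun_upd_twist)
  have add2: "?G u (v + v') = ?G u v + ?G u v'" for u v v'
    using alt_form_add[OF F cd(2), of "w(c := u)" v v'] by simp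
  have eq: "?G u u = 0" for u
    using alt_form_eq[OF F cd, of "w(c := u, d := u)"] cd by simp
  have "?G (w c + w d) (w c + w d) = ?G (w c) (w d) + ?G (w d) (w c)"
    unfolding add1 add2 using eq[of "w c"] eq[of "w d"] by simp
  then have "?G (w d) (w c) = - ?G (w c) (w d)" using eq by (metis add.commute add_eq_0_iff)
  moreover have "w(c := w d, d := w c) = w \<circ> Transposition.transpose c d"
    using cd by (auto simp: fun_eq_iff Transposition.transpose_def)
  ultimately show ?thesis by simp
qed

definition msubsets :: "nat \<Rightarrow> 'a set \<Rightarrow> 'a set set" where
  "msubsets m I = {J. J \<subseteq> I \<and> card J = m}"

lemma finite_msubsets: "finite I \<Longrightarrow> finite (msubsets m I)"
  unfolding msubsets_def by (rule finite_subset[of _ "Pow I"]) auto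

lemma minor_sets_msubsets: "minor_sets m n = msubsets m {- int m..<int n}"
  by (simp add: minor_sets_def msubsets_def)

lemma row_at_bij:
  assumes "finite J" "card J = m"
  shows "bij_betw (row_at J) {..<m} J"
proof -
  have "bij_betw ((!) (sorted_list_of_set J)) {..<length (sorted_list_of_set J)} (set (sorted_list_of_set J))"
    by (rule bij_betw_nth) auto
  then show ?thesis using assms by (simp add: row_at_def[abs_def])
qed

lemma row_at_in: "finite J \<Longrightarrow> card J = m \<Longrightarrow> r < m \<Longrightarrow> row_at J r \<in> J"
  using bij_betwE[OF row_at_bij] by blast

lemma row_at_eq_iff:
  "finite J \<Longrightarrow> card J = m \<Longrightarrow> r < m \<Longrightarrow> s < m \<Longrightarrow> row_at J r = row_at J s \<longleftrightarrow> r = s"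
  using row_at_bij[of J m] by (auto simp: bij_betw_def inj_on_def)

lemma sum_fun_apply: "sum f A x = (\<Sum>i\<in>A. f i x)"
  by (induction A rule: infinite_finite_induct) auto

lemma coord_space_span: "finite I \<Longrightarrow> coord_space I = fun_vs.span (std_vec ` I)"
proof (intro equalityI subsetI)
  fix v :: "int \<Rightarrow> 'a" assume I: "finite I" and v: "v \<in> coord_space I"
  have "(\<Sum>i\<in>I. fscale (v i) (std_vec i)) j = v j" for j
  proof -
    have "(\<Sum>i\<in>I. fscale (v i) (std_vec i)) j = (\<Sum>i\<in>I. if i = j then v j else 0)"
      unfolding sum_fun_apply by (intro sum.cong) (auto simp: fscale_def std_vec_def)
    also have "\<dots> = v j" using I v by (auto simp: coord_space_def)
    finally show ?thesis .
  qed
  then have "v = (\<Sum>i\<in>I. fscale (v i) (std_vec i))" by auto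
  also have "\<dots> \<in> fun_vs.span (std_vec ` I)"
    by (intro fun_vs.span_sum fun_vs.span_scale fun_vs.span_base) auto
  finally show "v \<in> fun_vs.span (std_vec ` I)" .
qed (use span_std_vec_zero in \<open>fastforce simp: coord_space_def\<close>)

text \<open>Multilinearity reduces to tuples of standard vectors, and a permutation sorts their
  indices at the cost of a sign.\<close>

lemma alt_form_vanish:
  assumes F: "alt_form m F" and I: "finite I"
    and J: "\<And>J. J \<in> msubsets m I \<Longrightarrow> F (\<lambda>c. std_vec (row_at J c)) = 0"
    and w: "\<And>c. c < m \<Longrightarrow> w c \<in> coord_space I"
  shows "F w = 0"
proof -
  have basis: "F (\<lambda>c. std_vec (g c)) = 0" if g: "\<And>c. c < m \<Longrightarrow> g c \<in> I" for g
  proof (cases "inj_on g {..<m}")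
    case False
    then obtain c d where "c < m" "d < m" "c \<noteq> d" "g c = g d" by (auto simp: inj_on_def)
    then show ?thesis by (intro alt_form_eq[OF F, of c d]) auto
  next
    case inj: True
    let ?J = "g ` {..<m}"
    have J': "?J \<in> msubsets m I" "finite ?J" "card ?J = m"
      using g inj by (auto simp: msubsets_def card_image)
    have bij: "bij_betw (row_at ?J) {..<m} ?J" using row_at_bij J' by blast
    have gbij: "bij_betw g {..<m} ?J" using inj by (simp add: bij_betw_def)
    \<comment> \<open>The permutation that sorts \<open>g\<close>, extended by the identity outside
      \<open>{..<m}\<close> as \<open>permutes\<close> demands.\<close>
    define \<pi> where "\<pi> c = (if c \<in> {..<m} then inv_into {..<m} (row_at ?J) (g c) else c)" for c
    have "bij_betw (\<lambda>c. inv_into {..<m} (row_at ?J) (g c)) {..<m} {..<m}"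
      using bij_betw_trans[OF gbij bij_betw_inv_into[OF bij]] by (simp add: o_def)
    then have "bij_betw \<pi> {..<m} {..<m}" by (rule bij_betw_cong[THEN iffD1, rotated]) (simp add: \<pi>_def)
    then have perm: "\<pi> permutes {..<m}" by (rule bij_imp_permutes) (simp add: \<pi>_def)
    have g_eq: "g c = row_at ?J (\<pi> c)" if "c < m" for c
      using that bij_betw_inv_into_right[OF bij] by (simp add: \<pi>_def)
    \<comment> \<open>The induction multiplies \<open>p\<close> on the left by transpositions; the
      inverse turns this into composition on the right, which is the form of
      \<open>alt_form_swap\<close>.\<close>
    let ?F = "\<lambda>p. F (\<lambda>c. std_vec (row_at ?J (Hilbert_Choice.inv p c)))"
    have "?F q = 0" if "q permutes {..<m}" for q
      using that finite_lessThan[of m]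
    proof (induction q rule: permutes_induct)
      case (swap a b p)
      have "Hilbert_Choice.inv (Transposition.transpose a b \<circ> p) = Hilbert_Choice.inv p \<circ> Transposition.transpose a b"
        using permutes_bij[OF \<open>p permutes {..<m}\<close>] by (subst o_inv_distrib) auto
      then have "?F (Transposition.transpose a b \<circ> p) =
          F ((\<lambda>c. std_vec (row_at ?J (Hilbert_Choice.inv p c))) \<circ> Transposition.transpose a b)"
        by (simp add: o_def)
      also have "\<dots> = 0" using alt_form_swap[OF F, of a b] swap by simp
      finally show ?case .
    qed (use J[OF J'(1)] in auto)
    from this[OF permutes_inv[OF perm]] have "F (\<lambda>c. std_vec (row_at ?J (\<pi> c))) = 0"
      using permutes_inv_inv[OF perm] by simp
    then show ?thesis using alt_form_cong[OF F, of "\<lambda>c. std_vec (g c)"] g_eq by metis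
  qed
  \<comment> \<open>The columns from \<open>k\<close> on are standard vectors; they are freed one at
    a time by linearity over the span.\<close>
  have "F w = 0"
    if "k \<le> m" "\<And>c. c < k \<Longrightarrow> w c \<in> coord_space I" "\<And>c. k \<le> c \<Longrightarrow> c < m \<Longrightarrow> w c \<in> std_vec ` I" for k w
    using that
  proof (induction k arbitrary: w)
    case 0
    then have "\<forall>c. \<exists>i. c < m \<longrightarrow> i \<in> I \<and> w c = std_vec i" by blast
    then obtain g where g: "\<forall>c. c < m \<longrightarrow> g c \<in> I \<and> w c = std_vec (g c)" by metis
    then have "F w = F (\<lambda>c. std_vec (g c))" by (intro alt_form_cong[OF F]) auto
    then show ?case using basis[of g] g by simp
  next
    case (Suc k)
    then have k: "k < m" by simp
    have "w k \<in> fun_vs.span (std_vec ` I)" unfolding coord_space_span[OF I, symmetric] using Suc.prems(2)[of k] by simp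
    moreover have "fun_vs.subspace {v. F (w(k := v)) = 0}"
      unfolding fun_vs.subspace_def
      using alt_form_add[OF F k, of w] alt_form_scale[OF F k, of w] alt_form_zero[OF F k, of "w(k := 0)"] by auto
    moreover have "F (w(k := v)) = 0" if "v \<in> std_vec ` I" for v
    proof (rule Suc.IH)
      fix c assume "k \<le> c" "c < m"
      then show "(w(k := v)) c \<in> std_vec ` I" using that Suc.prems(3)[of c] by (cases "c = k") auto
    qed (use Suc.prems in auto)
    ultimately have "F (w(k := w k)) = 0" by (rule fun_vs.span_induct)
    then show ?case by simp
  qed
  from this[of m] show ?thesis using w by simp
qed

text \<open>Arbitrary functionals \<open>\<Lambda> r\<close> take the place of the rows: coordinate
  functionals give minors, one exchanged coordinate gives Cramer's rule, and a dual basis detects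
  independence.\<close>

definition dform :: "nat \<Rightarrow> (nat \<Rightarrow> 'a \<Rightarrow> 'r::comm_ring_1) \<Rightarrow> (nat \<Rightarrow> 'a) \<Rightarrow> 'r" where
  "dform m \<Lambda> w = det (mat m m (\<lambda>(r, c). \<Lambda> r (w c)))"

abbreviation tminor :: "nat \<Rightarrow> (nat \<Rightarrow> 'a \<Rightarrow> 'r::comm_ring_1) \<Rightarrow> (nat \<Rightarrow> 'a) \<Rightarrow> 'r" where
  "tminor m w \<rho> \<equiv> dform m (\<lambda>r v. v (\<rho> r)) w"

abbreviation minor :: "nat \<Rightarrow> (nat \<Rightarrow> int \<Rightarrow> 'r::comm_ring_1) \<Rightarrow> int set \<Rightarrow> 'r" where
  "minor m w J \<equiv> tminor m w (row_at J)"

lemma dform_cong: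
  assumes "\<And>r c. r < m \<Longrightarrow> c < m \<Longrightarrow> \<Lambda> r (w c) = \<Lambda>' r (w' c)"
  shows "dform m \<Lambda> w = dform m \<Lambda>' w'"
  unfolding dform_def using assms by (intro arg_cong[where f = det] eq_matI) auto

text \<open>Laplace expansion: the coefficients are cofactors, which do not see column
  \<open>c\<close> and can therefore be taken with the filler \<open>undefined\<close>
  there.\<close>

lemma dform_expand_col:
  assumes "c < m"
  shows "\<exists>a. \<forall>v. dform m \<Lambda> (w(c := v)) = (\<Sum>r<m. \<Lambda> r v * a r)"
proof (intro exI allI)
  let ?A = "\<lambda>v. mat m m (\<lambda>(r, d). \<Lambda> r ((w(c := v)) d))"
  fix v
  have "dform m \<Lambda> (w(c := v)) = (\<Sum>r<m. ?A v $$ (r, c) * cofactor (?A v) r c)"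
    unfolding dform_def by (rule laplace_expansion_column[OF _ assms]) simp
  also have "\<dots> = (\<Sum>r<m. \<Lambda> r v * cofactor (?A undefined) r c)"
  proof (rule sum.cong[OF refl])
    fix r assume "r \<in> {..<m}"
    moreover have "mat_delete (?A v) r c = mat_delete (?A undefined) r c"
      using assms by (intro eq_matI) (auto simp: mat_delete_def)
    ultimately show "?A v $$ (r, c) * cofactor (?A v) r c = \<Lambda> r v * cofactor (?A undefined) r c"
      using assms by (simp add: cofactor_def)
  qed
  finally show "dform m \<Lambda> (w(c := v)) = (\<Sum>r<m. \<Lambda> r v * cofactor (?A undefined) r c)" .
qed

lemma dform_expand_row:
  assumes "r < m"
  shows "\<exists>a. \<forall>l. dform m (\<Lambda>(r := l)) w = (\<Sum>c<m. l (w c) * a c)"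
proof (intro exI allI)
  let ?A = "\<lambda>v. mat m m (\<lambda>(s, d). (\<Lambda>(r := v)) s (w d))"
  fix v
  have "dform m (\<Lambda>(r := v)) w = (\<Sum>c<m. ?A v $$ (r, c) * cofactor (?A v) r c)"
    unfolding dform_def by (rule laplace_expansion_row[OF _ assms]) simp
  also have "\<dots> = (\<Sum>c<m. v (w c) * cofactor (?A undefined) r c)"
  proof (rule sum.cong[OF refl])
    fix c assume "c \<in> {..<m}"
    moreover have "mat_delete (?A v) r c = mat_delete (?A undefined) r c"
      using assms by (intro eq_matI) (auto simp: mat_delete_def)
    ultimately show "?A v $$ (r, c) * cofactor (?A v) r c = v (w c) * cofactor (?A undefined) r c"
      using assms by (simp add: cofactor_def)
  qed
  finally show "dform m (\<Lambda>(r := v)) w = (\<Sum>c<m. v (w c) * cofactor (?A undefined) r c)" .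
qed

lemma dform_eq_cols:
  assumes "c < m" "d < m" "c \<noteq> d" "w c = w d"
  shows "dform m \<Lambda> w = 0"
  unfolding dform_def
  using assms by (intro det_identical_columns[of _ m c d]) (auto intro: eq_vecI)

lemma dform_eq_rows:
  assumes "r < m" "s < m" "r \<noteq> s" "\<Lambda> r = \<Lambda> s"
  shows "dform m \<Lambda> w = 0"
  unfolding dform_def
  using assms by (intro det_identical_rows[of _ m r s]) (auto intro: eq_vecI)

lemma dform_zero_col:
  assumes "c < m" "\<And>r. r < m \<Longrightarrow> \<Lambda> r (w c) = 0"
  shows "dform m \<Lambda> w = 0"
proof -
  obtain a where "\<And>v. dform m \<Lambda> (w(c := v)) = (\<Sum>r<m. \<Lambda> r v * a r)" using dform_expand_col[OF assms(1), of \<Lambda> w] by blast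
  from this[of "w c"] show ?thesis using assms(2) by simp
qed

lemma dform_zero_row:
  assumes "r < m" "\<And>c. c < m \<Longrightarrow> \<Lambda> r (w c) = 0"
  shows "dform m \<Lambda> w = 0"
proof -
  obtain a where "\<And>l. dform m (\<Lambda>(r := l)) w = (\<Sum>c<m. l (w c) * a c)" using dform_expand_row[OF assms(1), of \<Lambda> w] by blast
  from this[of "\<Lambda> r"] show ?thesis using assms(2) by simp
qed

lemma dform_diag:
  assumes "\<And>r c. r < m \<Longrightarrow> c < m \<Longrightarrow> \<Lambda> r (w c) = (if r = c then x else 0)"
  shows "dform m \<Lambda> w = x ^ m"
proof -
  have "mat m m (\<lambda>(r, c). \<Lambda> r (w c)) = x \<cdot>\<^sub>m 1\<^sub>m m"
    using assms by (intro eq_matI) auto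
  then show ?thesis by (simp add: dform_def)
qed

lemma alt_form_dform:
  assumes "\<And>r u v. r < m \<Longrightarrow> \<Lambda> r (u + v) = \<Lambda> r u + \<Lambda> r v" "\<And>r a u. r < m \<Longrightarrow> \<Lambda> r (fscale a u) = a * \<Lambda> r u"
  shows "alt_form m (dform m \<Lambda>)"
  unfolding alt_form_def
proof (intro conjI allI impI)
  fix w w' :: "nat \<Rightarrow> 'a \<Rightarrow> 'b" assume "\<forall>c<m. w c = w' c"
  then show "dform m \<Lambda> w = dform m \<Lambda> w'" by (intro dform_cong) auto
next
  fix w :: "nat \<Rightarrow> 'a \<Rightarrow> 'b" and c u v assume c: "c < m"
  obtain a where a: "\<And>v. dform m \<Lambda> (w(c := v)) = (\<Sum>r<m. \<Lambda> r v * a r)" using dform_expand_col[OF c, of \<Lambda> w] by blast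
  show "dform m \<Lambda> (w(c := u + v)) = dform m \<Lambda> (w(c := u)) + dform m \<Lambda> (w(c := v))"
    unfolding a using assms by (simp add: sum.distrib algebra_simps)
next
  fix w :: "nat \<Rightarrow> 'a \<Rightarrow> 'b" and c b u assume c: "c < m"
  obtain a where a: "\<And>v. dform m \<Lambda> (w(c := v)) = (\<Sum>r<m. \<Lambda> r v * a r)" using dform_expand_col[OF c, of \<Lambda> w] by blast
  show "dform m \<Lambda> (w(c := fscale b u)) = b * dform m \<Lambda> (w(c := u))"
    unfolding a using assms by (simp add: sum_distrib_left algebra_simps)
qed (rule dform_eq_cols)

lemma alt_form_tminor: "alt_form m (\<lambda>w. tminor m w \<rho>)"
  by (rule alt_form_dform) (auto simp: fscale_def)

lemma tminor_product:
  assumes "\<And>c i. c < m \<Longrightarrow> w' c i = (\<Sum>d<m. g d c * w d i)"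
  shows "tminor m w' \<rho> = tminor m w \<rho> * det (mat m m (\<lambda>(d, c). g d c))"
proof -
  have "mat m m (\<lambda>(r, c). w' c (\<rho> r)) = mat m m (\<lambda>(r, c). w c (\<rho> r)) * mat m m (\<lambda>(d, c). g d c)"
    using assms by (intro eq_matI) (auto simp: scalar_prod_def atLeast0LessThan mult.commute intro!: sum.cong)
  then show ?thesis unfolding dform_def by (simp add: det_mult[of _ m])
qed

lemma minor_std_vec:
  assumes "J \<in> msubsets m I" "K \<in> msubsets m I" "finite I"
  shows "minor m (\<lambda>c. std_vec (row_at K c)) J = (if J = K then 1 else 0 :: 'k::field)"
proof -
  have fin: "finite J" "card J = m" "finite K" "card K = m"
    using assms finite_subset by (auto simp: msubsets_def)
  show ?thesis
  proof (cases "J = K")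
    case True
    have "minor m (\<lambda>c. std_vec (row_at K c)) J = (1 :: 'k) ^ m"
      using fin True by (intro dform_diag) (auto simp: std_vec_def row_at_eq_iff)
    then show ?thesis using True by simp
  next
    case False
    then have "\<not> K \<subseteq> J" using fin by (metis card_subset_eq)
    then obtain k where "k \<in> K" "k \<notin> J" by blast
    then obtain c where "c < m" "row_at K c \<notin> J"
      using bij_betw_imp_surj_on[OF row_at_bij[OF fin(3,4)]] by (metis imageE lessThan_iff)
    moreover from this have "row_at J r \<noteq> row_at K c" if "r < m" for r
      using row_at_in[OF fin(1,2) that] by metis
    ultimately have "minor m (\<lambda>c. std_vec (row_at K c)) J = (0 :: 'k)"
      by (intro dform_zero_col[of c]) (auto simp: std_vec_def)
    then show ?thesis using False by simp
  qed
qed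

text \<open>The minors are dual to the increasing tuples of standard vectors: the difference of both
  sides is an alternating form that vanishes on these tuples.\<close>

lemma alt_form_expand:
  assumes F: "alt_form m F" and I: "finite I" and w: "\<And>c. c < m \<Longrightarrow> w c \<in> coord_space I"
  shows "F w = (\<Sum>K\<in>msubsets m I. F (\<lambda>c. std_vec (row_at K c)) * minor m w K)"
proof -
  let ?D = "\<lambda>w. F w - (\<Sum>K\<in>msubsets m I. F (\<lambda>c. std_vec (row_at K c)) * minor m w K)"
  have "?D w = 0"
  proof (rule alt_form_vanish[OF _ I _ w])
    show "alt_form m ?D"
      by (intro alt_form_diff F alt_form_sum alt_form_cmult alt_form_tminor)
    fix J assume J: "J \<in> msubsets m I"
    have "(\<Sum>K\<in>msubsets m I. F (\<lambda>c. std_vec (row_at K c)) * minor m (\<lambda>c. std_vec (row_at J c)) K) =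
      (\<Sum>K\<in>msubsets m I. if K = J then F (\<lambda>c. std_vec (row_at J c)) else 0)"
      by (intro sum.cong refl) (simp add: minor_std_vec[OF _ J I])
    then show "?D (\<lambda>c. std_vec (row_at J c)) = 0"
      using J finite_msubsets[OF I, of m] by simp
  qed
  then show ?thesis by simp
qed


subsection \<open>Frames\<close>

definition lin_indep :: "nat \<Rightarrow> (nat \<Rightarrow> 'a \<Rightarrow> 'k::field) \<Rightarrow> bool" where
  "lin_indep m w \<longleftrightarrow> inj_on w {..<m} \<and> \<not> fun_vs.dependent (w ` {..<m})"

text \<open>A dependent column lies in the span of the others, and the form vanishes when that
  column is replaced by any one of them.\<close>

lemma alt_form_dependent:
  assumes F: "alt_form m F" and "\<not> lin_indep m w"
  shows "F w = 0"
proof (cases "inj_on w {..<m}")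
  case False
  then show ?thesis using alt_form_eq[OF F] by (auto simp: inj_on_def)
next
  case inj: True
  then have "fun_vs.dependent (w ` {..<m})" using assms by (simp add: lin_indep_def)
  then obtain v where v: "v \<in> w ` {..<m}" "v \<in> fun_vs.span (w ` {..<m} - {v})"
    by (auto simp: fun_vs.dependent_def)
  then obtain k where k: "k < m" "w k \<in> fun_vs.span (w ` {..<m} - {w k})" by auto
  have "fun_vs.subspace {v. F (w(k := v)) = 0}"
    unfolding fun_vs.subspace_def
    using alt_form_add[OF F k(1), of w] alt_form_scale[OF F k(1), of w] alt_form_zero[OF F k(1), of "w(k := 0)"] by auto
  moreover have "F (w(k := v)) = 0" if v: "v \<in> w ` {..<m} - {w k}" for v
  proof -
    obtain d where "d < m" "v = w d" using v by auto
    moreover from this v have "d \<noteq> k" by auto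
    ultimately show ?thesis using alt_form_eq[OF F k(1), of d "w(k := v)"] by simp
  qed
  ultimately have "F (w(k := w k)) = 0" by (rule fun_vs.span_induct[OF k(2)])
  then show ?thesis by simp
qed

text \<open>Functionals dual to the columns give an alternating form with value 1 at
  \<open>w\<close>; were all minors zero, its expansion in minors would be 0.\<close>

lemma lin_indep_minor:
  assumes w: "lin_indep m w" "\<And>c. c < m \<Longrightarrow> w c \<in> coord_space I" and I: "finite I"
  shows "\<exists>J\<in>msubsets m I. minor m w J \<noteq> (0 :: 'k::field)"
proof (rule ccontr)
  interpret P: vector_space_pair "fscale :: 'k \<Rightarrow> (int \<Rightarrow> 'k) \<Rightarrow> int \<Rightarrow> 'k" "(*) :: 'k \<Rightarrow> 'k \<Rightarrow> 'k"
    by unfold_locales (simp_all only: distrib_left distrib_right mult.assoc mult_1_left)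
  assume *: "\<not> ?thesis"
  have "\<exists>g. Vector_Spaces.linear fscale (*) g \<and> (\<forall>x\<in>w ` {..<m}. g x = (if x = w c then 1 else 0))" for c
    using w(1) by (intro P.linear_independent_extend) (simp add: lin_indep_def)
  then obtain \<Lambda> where lin: "\<And>c. Vector_Spaces.linear fscale (*) (\<Lambda> c)"
    and \<Lambda>: "\<And>c x. x \<in> w ` {..<m} \<Longrightarrow> \<Lambda> c x = (if x = w c then 1 else 0)" by metis
  have F: "alt_form m (dform m \<Lambda>)"
    using P.linear_add[OF lin] P.linear_scale[OF lin] by (intro alt_form_dform) auto
  have "dform m \<Lambda> w = 1 ^ m"
    using w(1) by (intro dform_diag) (auto simp: \<Lambda> lin_indep_def inj_on_def)
  moreover have "dform m \<Lambda> w = 0"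
    using alt_form_expand[OF F I w(2)] * by simp
  ultimately show False by simp
qed

lemma lin_indep_iff_minor:
  assumes "\<And>c. c < m \<Longrightarrow> w c \<in> coord_space I" "finite I"
  shows "lin_indep m w \<longleftrightarrow> (\<exists>J\<in>msubsets m I. minor m w J \<noteq> (0 :: 'k::field))"
proof
  assume "lin_indep m w"
  then show "\<exists>J\<in>msubsets m I. minor m w J \<noteq> 0" by (rule lin_indep_minor[OF _ assms])
next
  assume "\<exists>J\<in>msubsets m I. minor m w J \<noteq> 0"
  then obtain J where "minor m w J \<noteq> 0" by blast
  then show "lin_indep m w" using alt_form_dependent[OF alt_form_tminor, of m w "row_at J"] by metis
qed

lemma span_image_lessThan:
  "v \<in> fun_vs.span (w ` {..<m::nat}) \<longleftrightarrow> (\<exists>a. v = (\<Sum>c<m. fscale (a c) (w c)))"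
proof
  assume "v \<in> fun_vs.span (w ` {..<m})"
  then show "\<exists>a. v = (\<Sum>c<m. fscale (a c) (w c))"
  proof (induction rule: fun_vs.span_induct_alt)
    case base
    show ?case by (intro exI[of _ "\<lambda>_. 0"]) simp
  next
    case (step b x y)
    then obtain d a where d: "d < m" "x = w d" and a: "y = (\<Sum>c<m. fscale (a c) (w c))" by auto
    have "fscale b x + y = (\<Sum>c<m. fscale ((a(d := a d + b)) c) (w c))"
    proof -
      have "(\<Sum>c<m. fscale ((a(d := a d + b)) c) (w c)) = (\<Sum>c<m. fscale (a c) (w c) + (if c = d then fscale b (w d) else 0))"
        by (intro sum.cong) (auto simp: fun_vs.scale_left_distrib)
      also have "\<dots> = y + fscale b x" using d by (simp add: sum.distrib a)
      finally show ?thesis by (simp add: add.commute)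
    qed
    then show ?case by blast
  qed
next
  assume "\<exists>a. v = (\<Sum>c<m. fscale (a c) (w c))"
  then obtain a where v: "v = (\<Sum>c<m. fscale (a c) (w c))" by blast
  show "v \<in> fun_vs.span (w ` {..<m})"
    unfolding v by (intro fun_vs.span_sum fun_vs.span_scale fun_vs.span_base) simp
qed

text \<open>The factor is the determinant of the coefficient matrix and is the same for all row
  selections \<open>\<rho>\<close>.\<close>

lemma minor_change_basis:
  assumes "\<And>c. c < m \<Longrightarrow> w' c \<in> fun_vs.span (w ` {..<m})"
  shows "\<exists>a. \<forall>\<rho>. tminor m w' \<rho> = a * tminor m w (\<rho> :: nat \<Rightarrow> 'a)"
proof -
  have "\<forall>c. \<exists>g. c < m \<longrightarrow> w' c = (\<Sum>d<m. fscale (g d) (w d))"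
    using assms span_image_lessThan[of _ w m] by blast
  then obtain g where g: "\<And>c. c < m \<Longrightarrow> w' c = (\<Sum>d<m. fscale (g c d) (w d))" by metis
  have "w' c i = (\<Sum>d<m. g c d * w d i)" if "c < m" for c i
    using g[OF that] by (simp add: sum_fun_apply fscale_def)
  then have "tminor m w' \<rho> = det (mat m m (\<lambda>(d, c). g c d)) * tminor m w \<rho>" for \<rho> :: "nat \<Rightarrow> 'a"
    using tminor_product[of m w' "\<lambda>d c. g c d" w \<rho>] by (simp only: mult.commute)
  then show ?thesis by blast
qed


subsection \<open>Reconstruction of a subspace from its Pluecker coordinates\<close>

text \<open>Replacing one row of a fixed minor of \<open>w\<close> by the row \<open>i\<close> is linear in the vector of all maximal
  minors of \<open>w\<close>. By Cramer's rule, these values form a new frame of the span of \<open>w\<close>.\<close>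

definition exchange :: "nat \<Rightarrow> int set \<Rightarrow> int set \<Rightarrow> (int set \<Rightarrow> 'k::field) \<Rightarrow> nat \<Rightarrow> int \<Rightarrow> 'k" where
  "exchange m I J p c i =
     (\<Sum>K\<in>msubsets m I. tminor m (\<lambda>d. std_vec (row_at K d)) ((row_at J)(c := i)) * p K)"

text \<open>The right side is an alternating form in \<open>w\<close>; \<open>exchange\<close> is
  its expansion in maximal minors, whose coefficients do not depend on \<open>w\<close>.\<close>

lemma exchange_minor:
  assumes "finite I" "\<And>c. c < m \<Longrightarrow> w c \<in> coord_space I" "\<And>K. K \<in> msubsets m I \<Longrightarrow> p K = minor m w K"
  shows "exchange m I J p c i = tminor m w ((row_at J)(c := i))"
  unfolding exchange_def
  by (subst alt_form_expand[OF alt_form_tminor assms(1,2)]) (simp_all add: assms(3) del: fun_upd_apply)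

lemma exchange_coord_space:
  assumes "finite I" "c < m"
  shows "exchange m I J p c \<in> coord_space I"
  unfolding coord_space_def
proof clarify
  fix i assume i: "i \<notin> I"
  have "tminor m (\<lambda>d. std_vec (row_at K d)) ((row_at J)(c := i)) = (0 :: 'a)" if "K \<in> msubsets m I" for K
  proof (rule dform_zero_row[OF assms(2)])
    fix d assume "d < m"
    then have "row_at K d \<in> I" using that row_at_in[of K m d] finite_subset[of K I] assms by (auto simp: msubsets_def)
    then show "(std_vec (row_at K d) :: int \<Rightarrow> 'a) (((row_at J)(c := i)) c) = 0" using i by (auto simp: std_vec_def)
  qed
  then show "exchange m I J p c i = 0" by (simp add: exchange_def)
qed

text \<open>Expansion along the exchanged row: the entries in row \<open>i\<close> are combined with
  cofactors that do not depend on \<open>i\<close>.\<close>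

lemma exchange_span:
  assumes "finite I" "\<And>c. c < m \<Longrightarrow> w c \<in> coord_space I" "\<And>K. K \<in> msubsets m I \<Longrightarrow> p K = minor m w K" "c < m"
  shows "exchange m I J p c \<in> fun_vs.span (w ` {..<m})"
proof -
  obtain a where a: "\<And>l. dform m ((\<lambda>r v. v (row_at J r))(c := l)) w = (\<Sum>d<m. l (w d) * a d)"
    using dform_expand_row[OF assms(4), of "\<lambda>r v. v (row_at J r)" w] by blast
  have "exchange m I J p c i = (\<Sum>d<m. fscale (a d) (w d)) i" for i
  proof -
    have "exchange m I J p c i = dform m ((\<lambda>r v. v (row_at J r))(c := \<lambda>v. v i)) w"
    proof -
      have "exchange m I J p c i = tminor m w ((row_at J)(c := i))"
        by (rule exchange_minor[OF assms(1-3)])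
      also have "\<dots> = dform m ((\<lambda>r v. v (row_at J r))(c := \<lambda>v. v i)) w"
        by (rule dform_cong) auto
      finally show ?thesis .
    qed
    then show ?thesis using a[of "\<lambda>v. v i"] by (simp add: sum_fun_apply fscale_def mult.commute)
  qed
  then have "exchange m I J p c = (\<Sum>d<m. fscale (a d) (w d))" by auto
  then show ?thesis unfolding span_image_lessThan by blast
qed

text \<open>For \<open>r \<noteq> c\<close> two rows of the exchanged minor coincide, and for
  \<open>r = c\<close> nothing has been exchanged.\<close>

lemma exchange_row:
  assumes I: "finite I" and w: "\<And>c. c < m \<Longrightarrow> w c \<in> coord_space I"
    and p: "\<And>K. K \<in> msubsets m I \<Longrightarrow> p K = minor m w K"
    and J: "J \<in> msubsets m I" and rc: "r < m" "c < m"
  shows "exchange m I J p c (row_at J r) = (if r = c then p J else 0)"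
proof -
  have "exchange m I J p c (row_at J r) = tminor m w ((row_at J)(c := row_at J r))"
    by (rule exchange_minor[OF I w p])
  also have "\<dots> = (if r = c then p J else 0)"
  proof (cases "r = c")
    case False
    then show ?thesis using rc by (simp add: dform_eq_rows[of r m c])
  qed (simp add: p[OF J])
  finally show ?thesis .
qed

text \<open>The exchanged frame has \<open>p J\<close> times the identity in the rows
  \<open>J\<close>, so its \<open>J\<close>-minor is \<open>p J ^ m\<close>, and all its minors are
  proportional to those of \<open>w\<close>. Without division this is a polynomial identity between
  Pluecker coordinates, valid also where \<open>p J = 0\<close>.\<close>

lemma minor_exchange:
  assumes I: "finite I" and w: "\<And>c. c < m \<Longrightarrow> w c \<in> coord_space I"
    and p: "\<And>K. K \<in> msubsets m I \<Longrightarrow> p K = minor m w K"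
    and J: "J \<in> msubsets m I" and K: "K \<in> msubsets m I"
  shows "p J * minor m (exchange m I J p) K = p J ^ m * p K"
proof -
  have finJ: "finite J" "card J = m" using J I finite_subset by (auto simp: msubsets_def)
  obtain a where a: "\<And>\<rho>. tminor m (exchange m I J p) \<rho> = a * tminor m w \<rho>"
    using minor_change_basis[of m "exchange m I J p" w, OF exchange_span[OF I w p]] by blast
  have "minor m (exchange m I J p) J = p J ^ m"
    by (rule dform_diag) (rule exchange_row[OF I w p J])
  then have "a * p J = p J ^ m" using a[of "row_at J"] p[OF J] by simp
  then show ?thesis using a[of "row_at K"] p[OF K] by (metis mult.assoc mult.commute)
qed

text \<open>The nonzero minor makes the new columns independent, and \<open>m\<close> independent
  vectors in a space spanned by \<open>m\<close> vectors span it.\<close>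

lemma span_eq_of_minor:
  assumes I: "finite I" and w: "\<And>c. c < m \<Longrightarrow> w c \<in> coord_space I"
    and w': "\<And>c. c < m \<Longrightarrow> w' c \<in> fun_vs.span (w ` {..<m})" and J: "minor m w' J \<noteq> 0"
  shows "fun_vs.span (w' ` {..<m}) = fun_vs.span (w ` {..<m})"
proof -
  have ind: "lin_indep m w'" using alt_form_dependent[OF alt_form_tminor, of m w' "row_at J"] J by metis
  then have card: "card (w' ` {..<m}) = m" by (simp add: lin_indep_def card_image)
  have sub: "w' ` {..<m} \<subseteq> fun_vs.span (w ` {..<m})" using w' by auto
  have "card (w ` {..<m}) \<le> m" using card_image_le[of "{..<m}" w] by simp
  then have "fun_vs.dim (fun_vs.span (w ` {..<m})) \<le> m"
    using fun_vs.dim_le_card'[of "w ` {..<m}"] by (simp add: fun_vs.dim_span)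
  show ?thesis
  proof
    show "fun_vs.span (w' ` {..<m}) \<subseteq> fun_vs.span (w ` {..<m})"
      using sub by (rule fun_vs.span_minimal) (rule fun_vs.subspace_span)
    have "fun_vs.span (w ` {..<m}) \<subseteq> fun_vs.span (w' ` {..<m})"
    proof (rule ccontr)
      assume "\<not> ?thesis"
      then obtain c where c: "c < m" "w c \<notin> fun_vs.span (w' ` {..<m})"
        using fun_vs.span_minimal[OF _ fun_vs.subspace_span, of "w ` {..<m}" "w' ` {..<m}"] by blast
      let ?B = "insert (w c) (w' ` {..<m})"
      have "\<not> fun_vs.dependent ?B"
        using ind c by (intro fun_vs.independent_insertI) (auto simp: lin_indep_def)
      moreover have "?B \<subseteq> fun_vs.span (w ` {..<m})" using sub c(1) fun_vs.span_base[of "w c" "w ` {..<m}"] by simp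
      ultimately have "card ?B \<le> card (w ` {..<m})"
        using fun_vs.independent_span_bound[of "w ` {..<m}" ?B] by simp
      moreover have "card ?B = Suc m"
        using card c fun_vs.span_base[of "w c" "w' ` {..<m}"] by (subst card_insert_disjoint) auto
      ultimately show False using \<open>card (w ` {..<m}) \<le> m\<close> by simp
    qed
    then show "fun_vs.span (w ` {..<m}) \<subseteq> fun_vs.span (w' ` {..<m})" .
  qed
qed


section \<open>Pluecker coordinates on the infinite grassmannian\<close>

lemma homogeneous_var_Suc [simp]: "homogeneous (Suc 0) (mp_var v)"
  using homogeneous_var[of v] by simp

text \<open>The scalars \<open>c\<close> disappear in a quotient of forms of equal degree.
  Homogeneous coordinates are changed below by applying this in both directions.\<close>

lemma fractions_subst:
  assumes L: "\<And>v. homogeneous 1 (L v)"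
    and r: "\<And>x. x \<in> A \<Longrightarrow> \<exists>c. c \<noteq> 0 \<and> r x = (\<lambda>v. c * mp_eval (r' x) (L v))"
    and D: "fractions homogeneous A r D g"
  shows "fractions homogeneous A r' D g"
proof -
  obtain d p q where pq: "homogeneous d p" "homogeneous d q" "D = {x\<in>A. mp_eval (r x) q \<noteq> 0}"
    "\<forall>x\<in>D. g x = mp_eval (r x) p / mp_eval (r x) q" using D unfolding fractions_def by blast
  have ev: "\<exists>a. a \<noteq> 0 \<and> mp_eval (r x) p = a * mp_eval (r' x) (mp_subst L p) \<and>
      mp_eval (r x) q = a * mp_eval (r' x) (mp_subst L q)" if x: "x \<in> A" for x
  proof -
    obtain c where c: "c \<noteq> 0" "r x = (\<lambda>v. c * mp_eval (r' x) (L v))" using r[OF x] by blast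
    then show ?thesis
      by (intro exI[of _ "c ^ d"])
        (simp add: mp_eval_homogeneous_scale[OF pq(1)] mp_eval_homogeneous_scale[OF pq(2)] mp_eval_subst)
  qed
  show ?thesis
  proof (rule fractionsI)
    show "homogeneous d (mp_subst L p)" "homogeneous d (mp_subst L q)"
      using homogeneous_subst[OF pq(1) L] homogeneous_subst[OF pq(2) L] by simp_all
    have "mp_eval (r x) q \<noteq> 0 \<longleftrightarrow> mp_eval (r' x) (mp_subst L q) \<noteq> 0" if "x \<in> A" for x
      using ev[OF that] by auto
    then show "D = {x\<in>A. mp_eval (r' x) (mp_subst L q) \<noteq> 0}" unfolding pq(3) by blast
    fix x assume x: "x \<in> D"
    then have "x \<in> A" using pq(3) by blast
    then obtain a where "a \<noteq> 0" "mp_eval (r x) p = a * mp_eval (r' x) (mp_subst L p)"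
      "mp_eval (r x) q = a * mp_eval (r' x) (mp_subst L q)" using ev by blast
    then show "g x = mp_eval (r' x) (mp_subst L p) / mp_eval (r' x) (mp_subst L q)"
      using pq(4) x by simp
  qed
qed

section \<open>Points of the finite grassmannians as spans of frames\<close>

definition frame :: "nat \<Rightarrow> nat \<Rightarrow> (nat \<Rightarrow> int \<Rightarrow> 'k::field) \<Rightarrow> bool" where
  "frame m n w \<longleftrightarrow> (\<forall>c<m. w c \<in> coord_space {- int m..<int n}) \<and> lin_indep m w"

abbreviation colspan :: "nat \<Rightarrow> (nat \<Rightarrow> 'a \<Rightarrow> 'k::field) \<Rightarrow> ('a \<Rightarrow> 'k) set" where
  "colspan m w \<equiv> fun_vs.span (w ` {..<m})"

lemma frame_iff_minor:
  "frame m n w \<longleftrightarrow> (\<forall>c<m. w c \<in> coord_space {- int m..<int n}) \<and> (\<exists>J\<in>minor_sets m n. minor m w J \<noteq> 0)"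
  unfolding frame_def minor_sets_msubsets using lin_indep_iff_minor[of m w "{- int m..<int n}"] by auto

lemma grassmannian_frame: "grassmannian m n = {colspan m w | w. frame m n w}"
proof (intro equalityI subsetI)
  fix W :: "(int \<Rightarrow> 'k::field) set" assume "W \<in> grassmannian m n"
  then have W: "fun_vs.subspace W" "W \<subseteq> fun_vs.span (std_vec ` {- int m..<int n})" "fun_vs.dim W = m"
    by (auto simp: grassmannian_def)
  obtain B where B: "B \<subseteq> W" "\<not> fun_vs.dependent B" "W \<subseteq> fun_vs.span B" "card B = fun_vs.dim W"
    by (rule fun_vs.basis_exists)
  have fin: "finite B"
    using fun_vs.independent_span_bound[of "std_vec ` {- int m..<int n}" B] B W(2) by auto
  then obtain w where w: "bij_betw w {..<m} B"
    using ex_bij_betw_nat_finite[OF fin] B W(3) by (auto simp: atLeast0LessThan)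
  have wB: "w ` {..<m} = B" "inj_on w {..<m}" using w by (auto simp: bij_betw_def)
  have "fun_vs.span B = W" using B(3) fun_vs.span_minimal[OF B(1) W(1)] by blast
  moreover have "frame m n w"
    unfolding frame_def lin_indep_def wB coord_space_span[OF finite_atLeastLessThan_int]
    using wB B W(2) by auto
  ultimately show "W \<in> {colspan m w | w. frame m n w}" using wB by blast
next
  fix W :: "(int \<Rightarrow> 'k::field) set" assume "W \<in> {colspan m w | w. frame m n w}"
  then obtain w where w: "W = colspan m w" "frame m n w" by blast
  have "w ` {..<m} \<subseteq> fun_vs.span (std_vec ` {- int m..<int n})"
    using w(2) unfolding frame_def coord_space_span[OF finite_atLeastLessThan_int] by auto
  then have "W \<subseteq> fun_vs.span (std_vec ` {- int m..<int n})"
    unfolding w(1) by (rule fun_vs.span_minimal) (rule fun_vs.subspace_span)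
  moreover have "fun_vs.dim W = m"
    unfolding w(1) using w(2) by (simp add: frame_def lin_indep_def fun_vs.dim_span fun_vs.dim_eq_card_independent card_image)
  ultimately show "W \<in> grassmannian m n"
    using fun_vs.subspace_span[of "w ` {..<m}"] w(1) by (simp add: grassmannian_def)
qed

lemma frame_grassmannian: "frame m n w \<Longrightarrow> colspan m w \<in> grassmannian m n"
  unfolding grassmannian_frame by blast

text \<open>Every basis listed in \<open>pluecker\<close> scales all minors by one factor, and the
  scalar \<open>a\<close> of that definition fills the line already from the single basis
  \<open>w\<close>.\<close>

lemma pluecker_frame:
  assumes w: "frame m n w"
  shows "pluecker m n (colspan m w) = vline (restr (minor_sets m n) (minor m w))"
proof (intro equalityI subsetI)
  fix p assume "p \<in> pluecker m n (colspan m w)"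
  then obtain a ws where ws: "p = restr (minor_sets m n) (\<lambda>J. a * det (mat m m (\<lambda>(r, c). (ws ! c) (row_at J r))))"
    "length ws = m" "fun_vs.span (set ws) = colspan m w"
    unfolding pluecker_def by blast
  have "ws ! c \<in> colspan m w" if "c < m" for c
    using fun_vs.span_base[of "ws ! c" "set ws"] ws(2,3) that by auto
  then obtain b where b: "\<And>\<rho>. tminor m (\<lambda>c. ws ! c) \<rho> = b * tminor m w \<rho>"
    using minor_change_basis[of m "\<lambda>c. ws ! c" w] by blast
  have "p = fscale (a * b) (restr (minor_sets m n) (minor m w))"
    using b unfolding ws(1) by (auto simp: restr_def fscale_def fun_eq_iff dform_def)
  then show "p \<in> vline (restr (minor_sets m n) (minor m w))" by (auto simp: vline_def)
next
  fix p assume "p \<in> vline (restr (minor_sets m n) (minor m w))"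
  then obtain a where p: "p = fscale a (restr (minor_sets m n) (minor m w))" by (auto simp: vline_def)
  let ?ws = "map w [0..<m]"
  have "mat m m (\<lambda>(r, c). (?ws ! c) (row_at J r)) = mat m m (\<lambda>(r, c). w c (row_at J r))" for J
    by (intro eq_matI) auto
  then have "p = restr (minor_sets m n) (\<lambda>J. a * det (mat m m (\<lambda>(r, c). (?ws ! c) (row_at J r))))"
    unfolding p by (auto simp: restr_def fscale_def dform_def)
  moreover have "length ?ws = m" "distinct ?ws" "set ?ws = w ` {..<m}" "\<not> fun_vs.dependent (w ` {..<m})"
    using w by (auto simp: frame_def lin_indep_def distinct_map atLeast0LessThan)
  ultimately show "p \<in> pluecker m n (colspan m w)"
    unfolding pluecker_def by (intro CollectI exI[of _ a] exI[of _ ?ws]) simp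
qed


subsection \<open>Enlarging a frame\<close>

lemma row_at_Min:
  assumes "finite J" "x \<in> J" "\<And>y. y \<in> J \<Longrightarrow> x \<le> y"
  shows "row_at J 0 = x" "row_at J (Suc r) = row_at (J - {x}) r"
proof -
  have "Min J = x" using assms by (intro Min_eqI) auto
  then have "sorted_list_of_set J = x # sorted_list_of_set (J - {x})"
    using sorted_list_of_set_nonempty[of J] assms by auto
  then show "row_at J 0 = x" "row_at J (Suc r) = row_at (J - {x}) r" by (simp_all add: row_at_def)
qed

text \<open>Laplace expansion along the first column, whose only nonzero entry within
  \<open>J\<close> is in row \<open>x\<close>. Being minimal in \<open>J\<close>, this row comes
  first, and no sign appears.\<close>

lemma minor_Suc:
  fixes w :: "nat \<Rightarrow> int \<Rightarrow> 'r::comm_ring_1"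
  assumes J: "finite J" "card J = Suc m" "\<And>y. y \<in> J \<Longrightarrow> x \<le> y"
    and w: "\<And>i. i \<in> J \<Longrightarrow> w 0 i = (if i = x then 1 else 0)"
  shows "minor (Suc m) w J = (if x \<in> J then minor m (\<lambda>c. w (Suc c)) (J - {x}) else 0)"
proof (cases "x \<in> J")
  case False
  have "w 0 (row_at J r) = 0" if "r < Suc m" for r
    using w[OF row_at_in[OF J(1,2) that]] row_at_in[OF J(1,2) that] False by auto
  then have "minor (Suc m) w J = 0" by (intro dform_zero_col[of 0]) auto
  then show ?thesis using False by simp
next
  case True
  note row = row_at_Min[OF J(1) True J(3)]
  let ?A = "mat (Suc m) (Suc m) (\<lambda>(r, c). w c (row_at J r))"
  have entry: "w 0 (row_at J r) = (if r = 0 then 1 else 0)" if "r < Suc m" for r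
    using w[OF row_at_in[OF J(1,2) that]] row(1) row_at_eq_iff[OF J(1,2) that, of 0] by auto
  have "minor (Suc m) w J = (\<Sum>r<Suc m. ?A $$ (r, 0) * cofactor ?A r 0)"
    unfolding dform_def by (rule laplace_expansion_column) auto
  also have "\<dots> = (\<Sum>r<Suc m. if r = 0 then cofactor ?A 0 0 else 0)"
    using entry by (intro sum.cong refl) auto
  also have "\<dots> = cofactor ?A 0 0" by (subst sum.delta) auto
  also have "\<dots> = det (mat_delete ?A 0 0)" by (simp add: cofactor_def)
  also have "mat_delete ?A 0 0 = mat m m (\<lambda>(r, c). w (Suc c) (row_at (J - {x}) r))"
    by (intro eq_matI) (auto simp: mat_delete_def row(2))
  finally show ?thesis using True by (simp add: dform_def)
qed

text \<open>The new standard vector is put first, in accordance with the order of the rows, so that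
  minors are preserved without signs.\<close>

definition lift_frame :: "nat \<Rightarrow> (nat \<Rightarrow> int \<Rightarrow> 'k::field) \<Rightarrow> nat \<Rightarrow> int \<Rightarrow> 'k" where
  "lift_frame m w c = (case c of 0 \<Rightarrow> std_vec (- int (Suc m)) | Suc d \<Rightarrow> w d)"

lemma coord_space_mono: "I \<subseteq> J \<Longrightarrow> coord_space I \<subseteq> coord_space J"
  by (auto simp: coord_space_def)

lemma finite_minor_set: "J \<in> minor_sets m n \<Longrightarrow> finite J \<and> card J = m"
  unfolding minor_sets_def by (auto intro: finite_subset)

lemma minor_lift_frame:
  assumes J: "J \<in> minor_sets (Suc m) n"
  shows "minor (Suc m) (lift_frame m w) J =
    (if - int (Suc m) \<in> J then minor m w (J - {- int (Suc m)}) else 0)"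
proof -
  have "minor (Suc m) (lift_frame m w) J =
      (if - int (Suc m) \<in> J then minor m (\<lambda>c. lift_frame m w (Suc c)) (J - {- int (Suc m)}) else 0)"
    by (rule minor_Suc)
      (use J finite_minor_set[OF J] in \<open>auto simp: minor_sets_def lift_frame_def std_vec_def\<close>)
  then show ?thesis by (simp add: lift_frame_def)
qed

lemma minor_sets_insert:
  assumes "J \<in> minor_sets m n"
  shows "insert (- int (Suc m)) J \<in> minor_sets (Suc m) n" "- int (Suc m) \<notin> J"
proof -
  show n: "- int (Suc m) \<notin> J" using assms by (auto simp: minor_sets_def)
  then show "insert (- int (Suc m)) J \<in> minor_sets (Suc m) n"
    using assms finite_minor_set[OF assms] by (auto simp: minor_sets_def)
qed

lemma frame_lift:
  assumes w: "frame m n w"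
  shows "frame (Suc m) n (lift_frame m w)"
proof -
  obtain J where J: "J \<in> minor_sets m n" "minor m w J \<noteq> 0" using w frame_iff_minor by blast
  let ?J = "insert (- int (Suc m)) J"
  have "minor (Suc m) (lift_frame m w) ?J = minor m w J"
    using minor_lift_frame[OF minor_sets_insert(1)[OF J(1)], of w] minor_sets_insert(2)[OF J(1)] by simp
  moreover have "lift_frame m w c \<in> coord_space {- int (Suc m)..<int n}" if "c < Suc m" for c
    using that w coord_space_mono[of "{- int m..<int n}" "{- int (Suc m)..<int n}"]
    by (cases c) (auto simp: lift_frame_def frame_def coord_space_def std_vec_def)
  ultimately show ?thesis
    unfolding frame_iff_minor using J(2) minor_sets_insert(1)[OF J(1)]
    by (intro conjI allI impI bexI[of _ ?J]) auto
qed

lemma frame_mono: "frame m n w \<Longrightarrow> n \<le> n' \<Longrightarrow> frame m n' w"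
  using coord_space_mono[of "{- int m..<int n}" "{- int m..<int n'}"] by (auto simp: frame_def)

lemma grass_incl_lift:
  "grass_incl (Suc m) (colspan (Suc m) (lift_frame m w)) = grass_incl m (colspan m w)"
proof -
  have "lift_frame m w ` {..<Suc m} = std_vec ` {- int (Suc m)..<- int m} \<union> w ` {..<m}"
  proof -
    have "{..<Suc m} = insert 0 (Suc ` {..<m})" by (rule lessThan_Suc_eq_insert_0)
    moreover have "{- int (Suc m)..<- int m} = {- int (Suc m)}" by auto
    ultimately show ?thesis by (simp add: lift_frame_def image_image)
  qed
  then have "colspan (Suc m) (lift_frame m w) = grass_emb m (Suc m) (colspan m w)"
    by (simp add: fun_vs.span_Un grass_emb_def subspace_sum_def) 
  then show ?thesis using grass_incl_emb[of m "Suc m" "colspan m w"] by simp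
qed


subsection \<open>Semi-infinite index sets\<close>

text \<open>The Pluecker coordinates of level \<open>n\<close> are indexed by the sets \<open>semi n J\<close>, so that the coordinates
  of the different levels match.\<close>

definition semi :: "nat \<Rightarrow> int set \<Rightarrow> int set" where
  "semi n J = {..<- int n} \<union> J"

definition maya :: "nat \<Rightarrow> int set set" where
  "maya n = semi n ` minor_sets n n"

definition pext :: "nat \<Rightarrow> (nat \<Rightarrow> int \<Rightarrow> 'r::comm_ring_1) \<Rightarrow> int set \<Rightarrow> 'r" where
  "pext n w S = (if S \<in> maya n then minor n w (S \<inter> {- int n..}) else 0)"

lemma semi_Int: "J \<in> minor_sets n n \<Longrightarrow> semi n J \<inter> {- int n..} = J"
  by (auto simp: semi_def minor_sets_def)

lemma pext_semi: "J \<in> minor_sets n n \<Longrightarrow> pext n w (semi n J) = minor n w J"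
  by (simp add: pext_def maya_def semi_Int)

lemma inj_on_semi: "inj_on (semi n) (minor_sets n n)"
  using semi_Int by (metis inj_onI)

lemma finite_minor_sets: "finite (minor_sets m n)"
  unfolding minor_sets_msubsets by (intro finite_msubsets) simp

lemma finite_maya: "finite (maya n)"
  unfolding maya_def using finite_minor_sets by blast

lemma minor_row_outside:
  assumes "\<And>c. c < m \<Longrightarrow> w c \<in> coord_space I" "finite J" "card J = m" "j \<in> J" "j \<notin> I"
  shows "minor m w J = 0"
proof -
  have "j \<in> row_at J ` {..<m}" using bij_betw_imp_surj_on[OF row_at_bij[OF assms(2,3)]] assms(4) by simp
  then obtain r where r: "r < m" "row_at J r = j" by auto
  show ?thesis
    by (rule dform_zero_row[OF r(1)]) (use assms(1,5) r(2) in \<open>auto simp: coord_space_def\<close>)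
qed

lemma maya_Suc: "maya n \<subseteq> maya (Suc n)"
proof
  fix S assume "S \<in> maya n"
  then obtain J where J: "J \<in> minor_sets n n" "S = semi n J" by (auto simp: maya_def)
  have "insert (- int (Suc n)) J \<in> minor_sets (Suc n) (Suc n)"
    using minor_sets_insert(1)[OF J(1)] by (auto simp: minor_sets_def)
  moreover have "S = semi (Suc n) (insert (- int (Suc n)) J)"
    unfolding J(2) semi_def by auto
  ultimately show "S \<in> maya (Suc n)" by (auto simp: maya_def)
qed

lemma maya_mono: "n \<le> N \<Longrightarrow> maya n \<subseteq> maya N"
  by (induction rule: dec_induct) (use maya_Suc in auto)

lemma pext_lift:
  assumes w: "\<And>c. c < n \<Longrightarrow> w c \<in> coord_space {- int n..<int n}"
  shows "pext (Suc n) (lift_frame n w) = pext n w"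
proof
  fix S
  show "pext (Suc n) (lift_frame n w) S = pext n w S"
  proof (cases "S \<in> maya (Suc n)")
    case False
    then show ?thesis using maya_Suc by (auto simp: pext_def)
  next
    case True
    then obtain J where J: "J \<in> minor_sets (Suc n) (Suc n)" "S = semi (Suc n) J" by (auto simp: maya_def)
    let ?x = "- int (Suc n)" and ?K = "J - {- int (Suc n)}"
    have p: "pext (Suc n) (lift_frame n w) S = (if ?x \<in> J then minor n w ?K else 0)"
      unfolding J(2) pext_semi[OF J(1)] by (rule minor_lift_frame[OF J(1)])
    have fin: "finite J" "card J = Suc n" using finite_minor_set[OF J(1)] by auto
    show ?thesis
    \<comment> \<open>\<open>S\<close> belongs to level \<open>n\<close> exactly when
      \<open>J\<close> contains the new lowest index and avoids the new highest one.\<close>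
    proof (cases "?x \<in> J \<and> int n \<notin> J")
      case True
      have "?K \<subseteq> {- int n..<int n}"
      proof
        fix k assume k: "k \<in> ?K"
        then have "k \<in> {- int (Suc n)..<int (Suc n)}" using J(1) by (auto simp: minor_sets_def)
        moreover have "k \<noteq> - int (Suc n)" "k \<noteq> int n" using k True by auto
        ultimately show "k \<in> {- int n..<int n}" by auto
      qed
      then have "?K \<in> minor_sets n n"
        using fin True by (simp add: minor_sets_def)
      moreover have "S = semi n ?K"
        unfolding J(2)
      proof (rule Set.set_eqI)
        fix x show "x \<in> semi (Suc n) J \<longleftrightarrow> x \<in> semi n ?K"
          using True by (cases "x = - int (Suc n)") (auto simp: semi_def)
      qed
      ultimately have "pext n w S = minor n w ?K" by (simp add: pext_semi)
      then show ?thesis using p True by simp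
    next
      case False
      have "S \<notin> maya n"
      proof
        assume "S \<in> maya n"
        then obtain K where K: "K \<in> minor_sets n n" "S = semi n K" by (auto simp: maya_def)
        have "?x \<in> S" "int n \<notin> S" using K by (auto simp: semi_def minor_sets_def)
        then show False using False unfolding J(2) semi_def by auto
      qed
      \<comment> \<open>If \<open>int n\<close> is a row of the minor, that row of \<open>w\<close>
        is zero, because \<open>w\<close> lives in the box of level \<open>n\<close>.\<close>
      moreover have "(if ?x \<in> J then minor n w ?K else 0) = 0"
        using False fin by (auto intro!: minor_row_outside[OF w, where j = "int n"])
      ultimately show ?thesis using p by (simp add: pext_def)
    qed
  qed
qed

text \<open>The columns added by lifting are standard vectors that \<open>grass_incl\<close>
  contributes anyway, so neither the point nor its semi-infinite coordinates change.\<close>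

lemma frame_raise:
  assumes "frame n n w" "n \<le> N"
  shows "\<exists>w'. frame N N w' \<and> grass_incl N (colspan N w') = grass_incl n (colspan n w) \<and> pext N w' = pext n w"
  using assms(2)
proof (induction rule: dec_induct)
  case base
  show ?case using assms(1) by blast
next
  case (step N)
  then obtain w' where w': "frame N N w'" "grass_incl N (colspan N w') = grass_incl n (colspan n w)"
    "pext N w' = pext n w" by blast
  have "frame (Suc N) (Suc N) (lift_frame N w')" using frame_mono[OF frame_lift[OF w'(1)], of "Suc N"] by simp
  moreover have "pext (Suc N) (lift_frame N w') = pext N w'"
    using w'(1) by (intro pext_lift) (simp add: frame_def)
  ultimately show ?case using w' grass_incl_lift[of N w'] by metis
qed

lemma frame_raise2:
  assumes "frame m n w" "m \<le> N" "n \<le> N"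
  shows "\<exists>w'. frame N N w' \<and> grass_incl N (colspan N w') = grass_incl m (colspan m w)"
proof -
  have "\<exists>w'. frame N n w' \<and> grass_incl N (colspan N w') = grass_incl m (colspan m w)"
    using assms(2)
  proof (induction rule: dec_induct)
    case base
    show ?case using assms(1) by blast
  next
    case (step N)
    then show ?case using frame_lift grass_incl_lift by metis
  qed
  then show ?thesis using frame_mono assms(3) by blast
qed

text \<open>Two levels are compared at their maximum, where \<open>grass_incl\<close> is injective:
  there both frames span the same subspace, and their Pluecker vectors have not changed on the way
  up.\<close>

lemma pext_proportional:
  assumes w: "frame n n w" and w': "frame n' n' w'"
    and eq: "grass_incl n (colspan n w) = grass_incl n' (colspan n' w')"
  shows "\<exists>a. a \<noteq> 0 \<and> pext n' w' = fscale a (pext n w)"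
proof -
  let ?N = "max n n'"
  obtain v where v: "frame ?N ?N v" "grass_incl ?N (colspan ?N v) = grass_incl n (colspan n w)" "pext ?N v = pext n w"
    using frame_raise[OF w, of ?N] by auto
  obtain v' where v': "frame ?N ?N v'" "grass_incl ?N (colspan ?N v') = grass_incl n' (colspan n' w')" "pext ?N v' = pext n' w'"
    using frame_raise[OF w', of ?N] by auto
  have span: "colspan ?N v = colspan ?N v'"
    using inj_onD[OF grass_incl_inj _ frame_grassmannian[OF v(1)] frame_grassmannian[OF v'(1)]] v(2) v'(2) eq by simp
  have "v' c \<in> colspan ?N v" if "c < ?N" for c
    unfolding span using that by (intro fun_vs.span_base) auto
  then obtain a where a: "\<And>\<rho>. tminor ?N v' \<rho> = a * tminor ?N v \<rho>" using minor_change_basis[of ?N v' v] by blast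
  then have "pext ?N v' = fscale a (pext ?N v)" by (auto simp: pext_def fscale_def)
  moreover have "a \<noteq> 0"
    using v'(1) a unfolding frame_iff_minor by auto
  ultimately show ?thesis using v(3) v'(3) by auto
qed

definition grass_step :: "nat \<Rightarrow> (int \<Rightarrow> 'k::field) set set" where
  "grass_step n = grass_incl n ` grassmannian n n"

text \<open>A Pluecker vector chosen once for each point of the union, over all levels at the same
  time. The coordinates of one point at different levels thus agree without a scalar.\<close>

definition pv :: "(int \<Rightarrow> 'k::field) set \<Rightarrow> int set \<Rightarrow> 'k" where
  "pv W = (SOME p. \<exists>n w. frame n n w \<and> W = grass_incl n (colspan n w) \<and> p = pext n w)"

lemma grass_step_frame:
  "W \<in> grass_step n \<longleftrightarrow> (\<exists>w. frame n n w \<and> W = grass_incl n (colspan n w))"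
  unfolding grass_step_def grassmannian_frame by auto

lemma pv_frame:
  assumes "frame n n w"
  shows "\<exists>a. a \<noteq> 0 \<and> pext n w = fscale a (pv (grass_incl n (colspan n w)))"
proof -
  let ?W = "grass_incl n (colspan n w)"
  have "\<exists>p n' w'. frame n' n' w' \<and> ?W = grass_incl n' (colspan n' w') \<and> p = pext n' w'" using assms by blast
  then have "\<exists>n' w'. frame n' n' w' \<and> ?W = grass_incl n' (colspan n' w') \<and> pv ?W = pext n' w'"
    unfolding pv_def by (rule someI_ex)
  then show ?thesis using pext_proportional[OF _ assms] by metis
qed

text \<open>The chosen vector may stem from another level, but it is proportional to one of level
  \<open>n\<close>.\<close>

lemma pv_outside: "W \<in> grass_step n \<Longrightarrow> S \<notin> maya n \<Longrightarrow> pv W S = 0"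
proof -
  assume W: "W \<in> grass_step n" and S: "S \<notin> maya n"
  obtain w where w: "frame n n w" "W = grass_incl n (colspan n w)" using W unfolding grass_step_frame by blast
  obtain a where a: "a \<noteq> 0" "pext n w = fscale a (pv W)" using pv_frame[OF w(1)] w(2) by blast
  have "pext n w S = a * pv W S" unfolding a(2) by (simp add: fscale_def)
  then show "pv W S = 0" using a(1) S by (simp add: pext_def)
qed

lemma grass_step_mono: "n \<le> N \<Longrightarrow> grass_step n \<subseteq> grass_step N"
  using frame_raise unfolding subset_iff grass_step_frame by metis

lemma grass_inf_steps: "grass_inf = (\<Union>i. grass_step (Suc i))"
proof
  show "grass_inf \<subseteq> (\<Union>i. grass_step (Suc i))"
  proof
    fix W :: "(int \<Rightarrow> 'k::field) set" assume "W \<in> grass_inf"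
    then obtain m n w where w: "frame m n w" "W = grass_incl m (colspan m w)"
      unfolding grass_inf_def grassmannian_frame by auto
    have "W \<in> grass_step (Suc (max m n))"
      using frame_raise2[OF w(1), of "Suc (max m n)"] w(2) unfolding grass_step_frame by force
    then show "W \<in> (\<Union>i. grass_step (Suc i))" by blast
  qed
qed (auto simp: grass_inf_def grass_step_def)

lemma pv_nonzero: "W \<in> grass_step n \<Longrightarrow> \<exists>S\<in>maya n. pv W S \<noteq> 0"
proof -
  assume "W \<in> grass_step n"
  then obtain w where w: "frame n n w" "W = grass_incl n (colspan n w)" unfolding grass_step_frame by blast
  obtain a where a: "pext n w = fscale a (pv W)" using pv_frame[OF w(1)] w(2) by blast
  obtain J where J: "J \<in> minor_sets n n" "minor n w J \<noteq> 0" using w(1) frame_iff_minor by blast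
  then have "pext n w (semi n J) \<noteq> 0" by (simp add: pext_semi)
  then show ?thesis using a J by (auto simp: fscale_def maya_def)
qed

lemma pluecker_pv:
  assumes w: "frame n n w"
  shows "pluecker n n (colspan n w) =
    vline (restr (minor_sets n n) (\<lambda>J. pv (grass_incl n (colspan n w)) (semi n J)))"
proof -
  obtain a where a: "a \<noteq> 0" "pext n w = fscale a (pv (grass_incl n (colspan n w)))" using pv_frame[OF w] by blast
  have "pext n w (semi n J) = a * pv (grass_incl n (colspan n w)) (semi n J)" for J
    unfolding a(2) by (simp add: fscale_def)
  then have "restr (minor_sets n n) (minor n w) = fscale a (restr (minor_sets n n) (\<lambda>J. pv (grass_incl n (colspan n w)) (semi n J)))"
    using pext_semi[of _ n w] by (fastforce simp: restr_def fscale_def)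
  moreover have "vline (fscale a v) = vline v" for v :: "int set \<Rightarrow> 'a"
  proof -
    have "fscale c v = fscale (c / a) (fscale a v)" for c using a(1) by simp
    then have "\<exists>b. fscale c v = fscale b (fscale a v)" for c by blast
    moreover have "\<exists>b. fscale c (fscale a v) = fscale b v" for c by auto
    ultimately show ?thesis unfolding vline_def by blast
  qed
  ultimately show ?thesis unfolding pluecker_frame[OF w] by simp
qed

text \<open>The definition reaches the coordinates through \<open>inv_into\<close>,
  \<open>pluecker\<close> and a vector of the line. They are replaced by \<open>pv\<close>, from
  which they differ by a nonzero scalar and a relabelling of the indices.\<close>

lemma presented_grass_filt:
  "presented (grass_filt i :: ((int \<Rightarrow> 'k::field) set, 'k) kspace) (grass_step (Suc i)) (fractions homogeneous (grass_step (Suc i)) pv)"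
proof -
  define n where "n = Suc i"
  let ?Gr = "grassmannian n n :: (int \<Rightarrow> 'k) set set" and ?A = "grass_step n :: (int \<Rightarrow> 'k) set set"
  let ?E = "coord_space (minor_sets n n) :: (int set \<Rightarrow> 'k) set"
  let ?inv = "inv_into ?Gr (grass_incl n)"
  have fr: "\<exists>w. frame n n w \<and> U = colspan n w \<and> pluecker n n U = vline (restr (minor_sets n n) (\<lambda>J. pv (grass_incl n U) (semi n J)))
      \<and> restr (minor_sets n n) (\<lambda>J. pv (grass_incl n U) (semi n J)) \<in> ?E - {0}" if U: "U \<in> ?Gr" for U
  proof -
    obtain w where w: "frame n n w" "U = colspan n w" using U unfolding grassmannian_frame by blast
    have "grass_incl n U \<in> grass_step n" using U by (auto simp: grass_step_def)
    then obtain J where "J \<in> minor_sets n n" "pv (grass_incl n U) (semi n J) \<noteq> 0"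
      using pv_nonzero[of "grass_incl n U" n] by (auto simp: maya_def)
    then have "restr (minor_sets n n) (\<lambda>J. pv (grass_incl n U) (semi n J)) \<noteq> 0"
      by (auto simp: restr_def fun_eq_iff)
    then show ?thesis using w pluecker_pv[OF w(1)] by (auto simp: coord_space_def restr_def)
  qed
  have pl: "pluecker n n ` ?Gr \<subseteq> vline ` (?E - {0})" using fr by blast
  have inv: "?inv ` ?A \<subseteq> ?Gr" unfolding grass_step_def by (auto intro: inv_into_into)
  have incl_inv: "grass_incl n (?inv W) = W" if "W \<in> ?A" for W
    using that unfolding grass_step_def by (rule f_inv_into_f)
  interpret Y: presented "proj_space ?E" "vline ` (?E - {0})" "fractions homogeneous (vline ` (?E - {0})) rep"
    by (rule presented_proj)
  interpret G: presented "grassmann_space n n" ?Gr "pullback_basic ?Gr (pluecker n n) (fractions homogeneous (vline ` (?E - {0})) rep)"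
    unfolding grassmann_space_def by (rule Y.presented_induced[OF pl])
  have gf: "grass_filt i = induced_space ?A ?inv (grassmann_space n n)"
    by (simp add: grass_filt_def n_def grass_step_def Let_def)
  define r where "r W = rep (pluecker n n (?inv W))" for W
  have Q: "pullback_basic ?A ?inv (pullback_basic ?Gr (pluecker n n) (fractions homogeneous (vline ` (?E - {0})) rep)) =
      fractions homogeneous ?A r"
    unfolding pullback_fractions[OF pl] pullback_fractions[OF inv] r_def ..
  have P: "presented (grass_filt i) ?A (fractions homogeneous ?A r)"
    unfolding gf Q[symmetric] by (rule G.presented_induced[OF inv])
  have r: "\<exists>c. c \<noteq> 0 \<and> r W = fscale c (restr (minor_sets n n) (\<lambda>J. pv W (semi n J)))" if W: "W \<in> ?A" for W
  proof -
    let ?v = "restr (minor_sets n n) (\<lambda>J. pv W (semi n J))"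
    have "?inv W \<in> ?Gr" using inv W by blast
    then have v: "pluecker n n (?inv W) = vline ?v" "?v \<in> ?E - {0}"
      using fr[of "?inv W"] incl_inv[OF W] by auto
    then have l: "vline ?v \<in> vline ` (?E - {0})" by blast
    have "?v = fscale 1 ?v" by simp
    then have "?v \<in> vline ?v - {0}" using v(2) unfolding vline_def by blast
    then obtain a where a: "a \<noteq> 0" "?v = fscale a (rep (vline ?v))" using vline_rep(3)[OF l] by blast
    have "fscale (1 / a) ?v = fscale (1 / a) (fscale a (rep (vline ?v)))" using a(2) by (rule arg_cong)
    then have "rep (vline ?v) = fscale (1 / a) ?v" using a(1) by simp
    then show ?thesis using a(1) unfolding r_def v(1) by (intro exI[of _ "1 / a"]) simp
  qed
  have "presented (grass_filt i) ?A (fractions homogeneous ?A pv)"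
  proof (rule presented_change[OF P], rule iffI)
    fix D g assume "fractions homogeneous ?A r D g"
    then show "fractions homogeneous ?A pv D g"
    proof (rule fractions_subst[rotated 2])
      let ?L = "\<lambda>J. if J \<in> minor_sets n n then mp_var (semi n J) else 0"
      show "homogeneous 1 (?L J)" for J by simp
      fix W assume "W \<in> ?A"
      then obtain c where "c \<noteq> 0" "r W = fscale c (restr (minor_sets n n) (\<lambda>J. pv W (semi n J)))" using r by blast
      then show "\<exists>c. c \<noteq> 0 \<and> r W = (\<lambda>J. c * mp_eval (pv W) (?L J))"
        by (intro exI[of _ c]) (auto simp: fscale_def restr_def)
    qed
  next
    fix D g assume "fractions homogeneous ?A pv D g"
    then show "fractions homogeneous ?A r D g"
    proof (rule fractions_subst[rotated 2])
      \<comment> \<open>Coordinates outside level \<open>n\<close> vanish on the whole space, so the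
        zero form represents them.\<close>
      let ?L = "\<lambda>S. if S \<in> maya n then mp_var (S \<inter> {- int n..}) else 0"
      show "homogeneous 1 (?L S)" for S by simp
      fix W assume W: "W \<in> ?A"
      then obtain c where c: "c \<noteq> 0" "r W = fscale c (restr (minor_sets n n) (\<lambda>J. pv W (semi n J)))" using r by blast
      have "pv W S = 1 / c * mp_eval (r W) (?L S)" for S
      proof (cases "S \<in> maya n")
        case True
        then obtain J where J: "J \<in> minor_sets n n" "S = semi n J" by (auto simp: maya_def)
        then show ?thesis using c True by (simp add: semi_Int fscale_def restr_def)
      qed (use pv_outside[OF W] in auto)
      then show "\<exists>c. c \<noteq> 0 \<and> pv W = (\<lambda>S. c * mp_eval (r W) (?L S))"
        using c(1) by (intro exI[of _ "1 / c"]) (auto simp: fun_eq_iff)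
    qed
  qed
  then show ?thesis unfolding n_def .
qed


section \<open>The affine charts\<close>

lemma (in comm_ring_hom) hom_tminor: "hom (tminor m w \<rho>) = tminor m (\<lambda>c i. hom (w c i)) \<rho>"
proof -
  have "map_mat hom (mat m m (\<lambda>(r, c). w c (\<rho> r))) = mat m m (\<lambda>(r, c). hom (w c (\<rho> r)))"
    by (intro eq_matI) auto
  then show ?thesis using hom_det[of "mat m m (\<lambda>(r, c). w c (\<rho> r))"] by (simp add: dform_def)
qed

lemma (in comm_ring_hom) hom_pext: "hom (pext n w S) = pext n (\<lambda>c i. hom (w c i)) S"
  by (simp add: pext_def hom_tminor)

text \<open>The reduced form of a frame in the chart of \<open>J\<close>, with an identity block in
  the rows \<open>J\<close>; each point of the chart has exactly one, as far as the first
  \<open>n\<close> columns are concerned.\<close>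

definition normal_frame :: "nat \<Rightarrow> int set \<Rightarrow> (nat \<Rightarrow> int \<Rightarrow> 'k::field) \<Rightarrow> bool" where
  "normal_frame n J w \<longleftrightarrow> (\<forall>c<n. w c \<in> coord_space {- int n..<int n}) \<and>
     (\<forall>r<n. \<forall>c<n. w c (row_at J r) = (if r = c then 1 else 0))"

abbreviation nexchange :: "nat \<Rightarrow> int set \<Rightarrow> (int set \<Rightarrow> 'k::field) \<Rightarrow> nat \<Rightarrow> int \<Rightarrow> 'k" where
  "nexchange n \<equiv> exchange n {- int n..<int n}"

lemma normal_frame_minor: "normal_frame n J w \<Longrightarrow> minor n w J = 1"
  using dform_diag[of n "\<lambda>r v. v (row_at J r)" w 1] by (simp add: normal_frame_def)

lemma normal_frame_frame: "normal_frame n J w \<Longrightarrow> J \<in> minor_sets n n \<Longrightarrow> frame n n w"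
  using normal_frame_minor[of n J w] unfolding frame_iff_minor normal_frame_def by force

text \<open>The exchanged vector lies in the span of \<open>w\<close>, and its rows in
  \<open>J\<close> determine the coefficients, since \<open>w\<close> has the identity
  there.\<close>

lemma exchange_normal:
  assumes w: "normal_frame n J w" and J: "J \<in> minor_sets n n"
    and p: "\<And>K. K \<in> minor_sets n n \<Longrightarrow> p K = minor n w K" and c: "c < n"
  shows "nexchange n J p c = w c"
proof -
  note hyps = finite_atLeastLessThan_int _ p[unfolded minor_sets_msubsets]
  have wc: "\<And>c. c < n \<Longrightarrow> w c \<in> coord_space {- int n..<int n}" using w by (simp add: normal_frame_def)
  have "nexchange n J p c \<in> colspan n w" by (rule exchange_span[OF hyps c]) (rule wc)
  then obtain a where a: "nexchange n J p c = (\<Sum>d<n. fscale (a d) (w d))" unfolding span_image_lessThan by blast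
  have "a r = (if r = c then 1 else 0)" if r: "r < n" for r
  proof -
    have "nexchange n J p c (row_at J r) = (if r = c then p J else 0)"
      by (rule exchange_row[OF hyps]) (use wc J r c in \<open>auto simp: minor_sets_msubsets\<close>)
    moreover have "nexchange n J p c (row_at J r) = (\<Sum>d<n. if d = r then a r else 0)"
      unfolding a sum_fun_apply using w r by (intro sum.cong) (auto simp: fscale_def normal_frame_def)
    ultimately show ?thesis using r p[OF J] normal_frame_minor[OF w] by simp
  qed
  then have "nexchange n J p c = (\<Sum>d<n. if d = c then w c else 0)"
    unfolding a by (intro sum.cong) auto
  then show ?thesis using c by simp
qed

text \<open>The exchange frame has \<open>minor n w J\<close> times the identity in the rows
  \<open>J\<close>; dividing by this minor normalizes it.\<close>

lemma normal_frame_exists: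
  assumes w: "frame n n w" and J: "J \<in> minor_sets n n" "minor n w J \<noteq> 0"
  shows "\<exists>w'. normal_frame n J w' \<and> colspan n w' = colspan n w"
proof -
  let ?e = "nexchange n J (minor n w)"
  have wc: "\<And>c. c < n \<Longrightarrow> w c \<in> coord_space {- int n..<int n}" using w by (simp add: frame_def)
  have e: "?e c (row_at J r) = (if r = c then minor n w J else 0)" if "r < n" "c < n" for r c
    by (rule exchange_row[OF _ wc]) (use that J in \<open>auto simp: minor_sets_msubsets\<close>)
  define w' where "w' c = fscale (1 / minor n w J) (?e c)" for c
  have w': "normal_frame n J w'"
    unfolding normal_frame_def
  proof (intro conjI allI impI)
    fix c assume "c < n"
    then show "w' c \<in> coord_space {- int n..<int n}"
      using exchange_coord_space[of "{- int n..<int n}" c n J "minor n w"]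
      by (auto simp: w'_def coord_space_def fscale_def)
  qed (use e J(2) in \<open>auto simp: w'_def fscale_def\<close>)
  have "w' c \<in> colspan n w" if "c < n" for c
    unfolding w'_def by (intro fun_vs.span_scale exchange_span[OF _ wc]) (use that in auto)
  then have "colspan n w' = colspan n w"
    using normal_frame_minor[OF w'] wc
    by (intro span_eq_of_minor[where I = "{- int n..<int n}" and J = J]) auto
  then show ?thesis using w' by blast
qed

text \<open>The minor of a normal frame at \<open>J\<close> is 1, so its minors are the coordinates
  divided by the one at \<open>J\<close>.\<close>

lemma pv_normal:
  assumes w: "normal_frame n J w" and J: "J \<in> minor_sets n n" and W: "W = grass_incl n (colspan n w)"
  shows "W \<in> grass_step n" "pv W (semi n J) \<noteq> 0" "pv W S = pv W (semi n J) * pext n w S"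
proof -
  note f = normal_frame_frame[OF w J]
  then show "W \<in> grass_step n" unfolding grass_step_frame W by blast
  obtain a where a: "a \<noteq> 0" "pext n w = fscale a (pv W)" using pv_frame[OF f] W by blast
  have *: "pext n w T = a * pv W T" for T unfolding a(2) by (simp add: fscale_def)
  have "a * pv W (semi n J) = 1"
    using *[of "semi n J"] pext_semi[OF J, of w] normal_frame_minor[OF w] by simp
  then show "pv W (semi n J) \<noteq> 0" "pv W S = pv W (semi n J) * pext n w S"
    unfolding * by (auto simp: algebra_simps)
qed

lemma pv_chart:
  assumes "W \<in> grass_step n" "J \<in> minor_sets n n" "pv W (semi n J) \<noteq> 0"
  shows "\<exists>w. normal_frame n J w \<and> W = grass_incl n (colspan n w)"
proof -
  obtain w where w: "frame n n w" "W = grass_incl n (colspan n w)" using assms(1) unfolding grass_step_frame by blast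
  obtain a where a: "a \<noteq> 0" "pext n w = fscale a (pv W)" using pv_frame[OF w(1)] w(2) by blast
  have "pext n w (semi n J) = a * pv W (semi n J)" unfolding a(2) by (simp add: fscale_def)
  then have "minor n w J \<noteq> 0" using a(1) assms(2,3) by (simp add: pext_semi)
  then show ?thesis using normal_frame_exists[OF w(1) assms(2)] w(2) by metis
qed

lemma colspan_cong: "(\<And>c. c < n \<Longrightarrow> w c = w' c) \<Longrightarrow> colspan n w = colspan n w'"
  by (metis (no_types, lifting) image_cong lessThan_iff)

text \<open>Proportional vectors are nonzero at a common index, so both points lie in one chart;
  there the minors of their normal frames agree, and these determine the frames.\<close>

lemma pv_inj:
  assumes W: "W \<in> grass_step n" and W': "W' \<in> grass_step n"
    and eq: "\<And>S T. S \<in> maya n \<Longrightarrow> T \<in> maya n \<Longrightarrow> pv W S * pv W' T = pv W T * pv W' S"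
  shows "W = W'"
proof -
  obtain J where J: "J \<in> minor_sets n n" "pv W (semi n J) \<noteq> 0"
    using pv_nonzero[OF W] by (auto simp: maya_def)
  have J': "pv W' (semi n J) \<noteq> 0"
  proof
    assume 0: "pv W' (semi n J) = 0"
    have "pv W' T = 0" if "T \<in> maya n" for T
      using eq[of "semi n J" T] that J 0 by (simp add: maya_def)
    then show False using pv_nonzero[OF W'] by blast
  qed
  obtain w where w: "normal_frame n J w" "W = grass_incl n (colspan n w)" using pv_chart[OF W J] by blast
  obtain w' where w': "normal_frame n J w'" "W' = grass_incl n (colspan n w')" using pv_chart[OF W' J(1) J'] by blast
  have m: "minor n w K = minor n w' K" if K: "K \<in> minor_sets n n" for K
  proof -
    have "pv W (semi n J) * pv W' (semi n K) = pv W (semi n K) * pv W' (semi n J)"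
      using eq J K by (simp add: maya_def)
    then show ?thesis
      unfolding pv_normal(3)[OF w(1) J(1) w(2), of "semi n K"] pv_normal(3)[OF w'(1) J(1) w'(2), of "semi n K"]
      using J(2) J' K by (simp add: pext_semi)
  qed
  have "w c = w' c" if "c < n" for c
    using exchange_normal[OF w(1) J(1) refl that] exchange_normal[OF w'(1) J(1) m that] by simp
  then show ?thesis using w(2) w'(2) colspan_cong by metis
qed

section \<open>Chart coordinates in affine space\<close>

definition vec_of :: "nat \<Rightarrow> (nat \<Rightarrow> int \<Rightarrow> 'k::field) \<Rightarrow> nat \<Rightarrow> 'k" where
  "vec_of n w k = (if k < n * (2 * n) then w (k div (2 * n)) (int (k mod (2 * n)) - int n) else 0)"

text \<open>Columns have length \<open>2 * n\<close>: column \<open>c\<close> starts at position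
  \<open>c * (2 * n)\<close>, and the row index is shifted by \<open>n\<close> to be nonnegative.
  Over a general ring this also gives the matrix of variables
  \<open>mat_of n mp_var\<close>.\<close>

definition mat_of :: "nat \<Rightarrow> (nat \<Rightarrow> 'r::comm_ring_1) \<Rightarrow> nat \<Rightarrow> int \<Rightarrow> 'r" where
  "mat_of n x c i = (if i \<in> {- int n..<int n} then x (c * (2 * n) + nat (i + int n)) else 0)"

lemma mat_of_vec_of:
  assumes "w c \<in> coord_space {- int n..<int n}" "c < n"
  shows "mat_of n (vec_of n w) c = w c"
proof
  fix i
  show "mat_of n (vec_of n w) c i = w c i"
  proof (cases "i \<in> {- int n..<int n}")
    case True
    let ?j = "nat (i + int n)"
    have j: "?j < 2 * n" "int ?j - int n = i" using True by auto
    have "c * (2 * n) + ?j < Suc c * (2 * n)" using j by simp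
    also have "\<dots> \<le> n * (2 * n)" using assms(2) by (intro mult_right_mono) auto
    finally have "c * (2 * n) + ?j < n * (2 * n)" .
    moreover have "(c * (2 * n) + ?j) div (2 * n) = c" "(c * (2 * n) + ?j) mod (2 * n) = ?j"
      using j(1) by (auto simp: div_mult_self3 mod_mult_self3)
    ultimately have "vec_of n w (c * (2 * n) + ?j) = w c i" by (simp only: vec_of_def if_True j(2))
    then show ?thesis using True by (simp add: mat_of_def)
  qed (use assms(1) in \<open>auto simp: mat_of_def coord_space_def\<close>)
qed

lemma vec_of_mat_of:
  assumes "x \<in> coord_space {..<n * (2 * n)}"
  shows "vec_of n (mat_of n x) = x"
proof
  fix k
  show "vec_of n (mat_of n x) k = x k"
  proof (cases "k < n * (2 * n)")
    case True
    then have "n > 0" by (cases n) auto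
    then have "k mod (2 * n) < 2 * n" by simp
    then show ?thesis using True div_mult_mod_eq[of k "2 * n"] by (simp add: vec_of_def mat_of_def)
  qed (use assms in \<open>auto simp: vec_of_def coord_space_def\<close>)
qed

lemma vec_of_coord_space: "vec_of n w \<in> coord_space {..<n * (2 * n)}"
  by (auto simp: vec_of_def coord_space_def)

lemma mat_of_coord_space: "mat_of n x c \<in> coord_space {- int n..<int n}"
  by (auto simp: mat_of_def coord_space_def)

lemma vec_of_cong: "(\<And>c. c < n \<Longrightarrow> w c = w' c) \<Longrightarrow> vec_of n w = vec_of n w'"
  by (auto simp: vec_of_def fun_eq_iff less_mult_imp_div_less)

lemma homogenize:
  assumes L: "\<And>v. homogeneous 1 (L v)" and T: "homogeneous 1 T"
  shows "\<exists>N0. \<forall>N\<ge>N0. \<exists>p'. homogeneous N p' \<and>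
    (\<forall>y. mp_eval y T \<noteq> 0 \<longrightarrow> mp_eval y p' = mp_eval y T ^ N * mp_eval (\<lambda>v. mp_eval y (L v) / mp_eval y T) p)"
proof (induction p rule: mpoly_induct)
  case (single \<mu> a)
  have "homogeneous (mdeg \<mu>) (mp_mon L \<mu>)"
    unfolding mp_mon_def mdeg_def using homogeneous_power[OF L] by (intro homogeneous_prod) simp
  then have h: "homogeneous N (mp_const a * (mp_mon L \<mu> * T ^ (N - mdeg \<mu>)))" if "N \<ge> mdeg \<mu>" for N
    using homogeneous_mult[OF _ homogeneous_power[OF T], of "mdeg \<mu>" "mp_mon L \<mu>" "N - mdeg \<mu>"] that
    by (intro homogeneous_cmult) simp
  have "mp_eval y (mp_const a * (mp_mon L \<mu> * T ^ (N - mdeg \<mu>))) =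
      mp_eval y T ^ N * mp_eval (\<lambda>v. mp_eval y (L v) / mp_eval y T) (Poly_Mapping.single \<mu> a)"
    if N: "N \<ge> mdeg \<mu>" and y: "mp_eval y T \<noteq> 0" for N y
  proof -
    have "mp_mon (\<lambda>v. mp_eval y (L v) / mp_eval y T) \<mu> * mp_eval y T ^ mdeg \<mu> = mp_mon (\<lambda>v. mp_eval y (L v)) \<mu>"
      using y by (simp add: mp_mon_def mdeg_def power_sum prod.distrib[symmetric] power_divide)
    moreover have "mp_eval y T ^ N = mp_eval y T ^ mdeg \<mu> * mp_eval y T ^ (N - mdeg \<mu>)"
      using N by (simp add: power_add[symmetric])
    moreover have "mp_eval (\<lambda>v. mp_eval y (L v) / mp_eval y T) (Poly_Mapping.single \<mu> a) =
        a * mp_mon (\<lambda>v. mp_eval y (L v) / mp_eval y T) \<mu>"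
      unfolding mp_eval_hom by (rule comm_ring_hom.mp_hom_single[OF comm_ring_hom_id])
    moreover have "mp_eval y (mp_mon L \<mu>) = mp_mon (\<lambda>v. mp_eval y (L v)) \<mu>"
      by (simp add: mp_mon_def mp_eval.hom_prod mp_eval.hom_power)
    ultimately show ?thesis
      by (simp add: mp_eval.hom_mult mp_eval.hom_power algebra_simps)
  qed
  then show ?case using h by blast
next
  case (add p q)
  from add.IH obtain M N where M: "\<forall>k\<ge>M. \<exists>p'. homogeneous k p' \<and>
      (\<forall>y. mp_eval y T \<noteq> 0 \<longrightarrow> mp_eval y p' = mp_eval y T ^ k * mp_eval (\<lambda>v. mp_eval y (L v) / mp_eval y T) p)"
    and N: "\<forall>k\<ge>N. \<exists>p'. homogeneous k p' \<and>
      (\<forall>y. mp_eval y T \<noteq> 0 \<longrightarrow> mp_eval y p' = mp_eval y T ^ k * mp_eval (\<lambda>v. mp_eval y (L v) / mp_eval y T) q)"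
    by blast
  show ?case
  proof (intro exI[of _ "max M N"] allI impI)
    fix k assume k: "k \<ge> max M N"
    obtain p' where p': "homogeneous k p'" "\<And>y. mp_eval y T \<noteq> 0 \<Longrightarrow>
        mp_eval y p' = mp_eval y T ^ k * mp_eval (\<lambda>v. mp_eval y (L v) / mp_eval y T) p" using M k by auto
    obtain q' where q': "homogeneous k q'" "\<And>y. mp_eval y T \<noteq> 0 \<Longrightarrow>
        mp_eval y q' = mp_eval y T ^ k * mp_eval (\<lambda>v. mp_eval y (L v) / mp_eval y T) q" using N k by auto
    show "\<exists>p'. homogeneous k p' \<and> (\<forall>y. mp_eval y T \<noteq> 0 \<longrightarrow>
        mp_eval y p' = mp_eval y T ^ k * mp_eval (\<lambda>v. mp_eval y (L v) / mp_eval y T) (p + q))"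
      using p' q' by (intro exI[of _ "p' + q'"]) (simp add: homogeneous_add mp_eval.hom_add distrib_left)
  qed
qed

definition grass_chart :: "nat \<Rightarrow> int set \<Rightarrow> (int \<Rightarrow> 'k::field) set set" where
  "grass_chart n J = {W\<in>grass_step n. pv W (semi n J) \<noteq> 0}"

definition chart_coords :: "nat \<Rightarrow> int set \<Rightarrow> (int \<Rightarrow> 'k::field) set \<Rightarrow> nat \<Rightarrow> 'k" where
  "chart_coords n J W = vec_of n (nexchange n J (\<lambda>K. pv W (semi n K) / pv W (semi n J)))"

text \<open>Every matrix with the identity in the rows \<open>J\<close> is a normal frame, so the
  chart is an affine subspace cut out by these linear equations alone.\<close>

definition chart_image :: "nat \<Rightarrow> int set \<Rightarrow> (nat \<Rightarrow> 'k::field) set" where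
  "chart_image n J = {x\<in>coord_space {..<n * (2 * n)}. \<forall>r<n. \<forall>c<n. mat_of n x c (row_at J r) = (if r = c then 1 else 0)}"

lemma chart_coords_normal:
  assumes w: "normal_frame n J w" and J: "J \<in> minor_sets n n" and W: "W = grass_incl n (colspan n w)"
  shows "chart_coords n J W = vec_of n w"
  unfolding chart_coords_def
proof (rule vec_of_cong, rule exchange_normal[OF w J])
  fix K assume "K \<in> minor_sets n n"
  then show "pv W (semi n K) / pv W (semi n J) = minor n w K"
    using pv_normal(2)[OF w J W] pv_normal(3)[OF w J W, of "semi n K"] by (simp add: pext_semi)
qed

lemma chart_image_normal: "x \<in> chart_image n J \<Longrightarrow> normal_frame n J (mat_of n x)"
  by (auto simp: chart_image_def normal_frame_def mat_of_coord_space)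

lemma vec_of_chart_image: "normal_frame n J w \<Longrightarrow> vec_of n w \<in> chart_image n J"
  by (auto simp: chart_image_def normal_frame_def mat_of_vec_of vec_of_coord_space)

lemma chart_coords_bij:
  assumes J: "J \<in> minor_sets n n"
  shows "bij_betw (chart_coords n J) (grass_chart n J) (chart_image n J :: (nat \<Rightarrow> 'k::field) set)"
proof (rule bij_betw_byWitness[where f' = "\<lambda>x. grass_incl n (colspan n (mat_of n x))"])
  have nf: "\<exists>w. normal_frame n J w \<and> W = grass_incl n (colspan n w)" if "W \<in> grass_chart n J" for W :: "(int \<Rightarrow> 'k) set"
    using that pv_chart[OF _ J] by (auto simp: grass_chart_def)
  show "\<forall>W\<in>grass_chart n J. grass_incl n (colspan n (mat_of n (chart_coords n J W))) = (W :: (int \<Rightarrow> 'k) set)"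
  proof
    fix W :: "(int \<Rightarrow> 'k) set" assume "W \<in> grass_chart n J"
    then obtain w where w: "normal_frame n J w" "W = grass_incl n (colspan n w)" using nf by blast
    have "mat_of n (vec_of n w) c = w c" if "c < n" for c
      using w(1) that by (intro mat_of_vec_of) (auto simp: normal_frame_def)
    then show "grass_incl n (colspan n (mat_of n (chart_coords n J W))) = W"
      using w colspan_cong unfolding chart_coords_normal[OF w(1) J w(2)] by metis
  qed
  show "\<forall>x\<in>chart_image n J. chart_coords n J (grass_incl n (colspan n (mat_of n x))) = (x :: nat \<Rightarrow> 'k)"
  proof
    fix x :: "nat \<Rightarrow> 'k" assume x: "x \<in> chart_image n J"
    then have "vec_of n (mat_of n x) = x" by (intro vec_of_mat_of) (simp add: chart_image_def)
    then show "chart_coords n J (grass_incl n (colspan n (mat_of n x))) = x"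
      using chart_coords_normal[OF chart_image_normal[OF x] J refl] by simp
  qed
  show "chart_coords n J ` grass_chart n J \<subseteq> (chart_image n J :: (nat \<Rightarrow> 'k) set)"
    using nf chart_coords_normal[OF _ J] vec_of_chart_image by fastforce
  show "(\<lambda>x. grass_incl n (colspan n (mat_of n x))) ` chart_image n J \<subseteq> (grass_chart n J :: (int \<Rightarrow> 'k) set set)"
    using pv_normal(1,2)[OF chart_image_normal J refl] by (auto simp: grass_chart_def)
qed

lemma chart_image_closed: "closedin (ztop (affine_space (n * (2 * n)))) (chart_image n J :: (nat \<Rightarrow> 'k::field) set)"
proof -
  let ?E = "coord_space {..<n * (2 * n)} :: (nat \<Rightarrow> 'k) set"
  interpret presented "affine_space (n * (2 * n))" ?E "fractions (\<lambda>_ _. True) ?E (\<lambda>x. x)" by (rule presented_affine)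
  have "openin (ztop (affine_space (n * (2 * n)))) (?E - chart_image n J)"
    unfolding openin_iff
  proof
    fix x assume x: "x \<in> ?E - chart_image n J"
    then obtain r c where rc: "r < n" "c < n" "mat_of n x c (row_at J r) \<noteq> (if r = c then 1 else 0)"
      by (auto simp: chart_image_def)
    let ?q = "mat_of n mp_var c (row_at J r) - mp_const (if r = c then 1 else 0) :: (nat, 'k) mpoly"
    have ev: "mp_eval y ?q = mat_of n y c (row_at J r) - (if r = c then 1 else 0)" for y
      by (simp add: mat_of_def mp_eval.hom_minus)
    have "fractions (\<lambda>_ _. True) ?E (\<lambda>x. x) {y\<in>?E. mp_eval y ?q \<noteq> 0} (\<lambda>y. mp_eval y ?q / mp_eval y ?q)"
      by (rule fractionsI[of _ 0 ?q ?q]) auto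
    moreover have "x \<in> {y\<in>?E. mp_eval y ?q \<noteq> 0}" using x rc unfolding ev by auto
    moreover have "{y\<in>?E. mp_eval y ?q \<noteq> 0} \<subseteq> ?E - chart_image n J"
      using rc(1,2) unfolding ev chart_image_def by auto
    ultimately show "\<exists>D g. fractions (\<lambda>_ _. True) ?E (\<lambda>x. x) D g \<and> x \<in> D \<and> D \<subseteq> ?E - chart_image n J" by blast
  qed
  moreover have "chart_image n J \<subseteq> ?E" by (auto simp: chart_image_def)
  ultimately show ?thesis by (simp add: closedin_def pts_eq)
qed

text \<open>The entries of the normal frame are linear forms divided by the coordinate at
  \<open>J\<close>, and the coordinates are minors of the normal frame times that coordinate.
  Substituting one into the other moves fractions in both directions.\<close>

lemma chart_isomorphism:
  assumes J: "J \<in> minor_sets (Suc i) (Suc i)" and n: "n = Suc i"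
  shows "isomorphism (chart_coords n J) (subspace_of (grass_filt i :: ((int \<Rightarrow> 'k::field) set, 'k) kspace) (grass_chart n J))
    (subspace_of (affine_space (n * (2 * n))) (chart_image n J))"
proof -
  let ?A = "grass_step n :: (int \<Rightarrow> 'k) set set" and ?U = "grass_chart n J :: (int \<Rightarrow> 'k) set set"
  let ?E = "coord_space {..<n * (2 * n)} :: (nat \<Rightarrow> 'k) set" and ?Z = "chart_image n J :: (nat \<Rightarrow> 'k) set"
  interpret X: presented "grass_filt i" ?A "fractions homogeneous ?A pv" unfolding n by (rule presented_grass_filt)
  interpret Y: presented "affine_space (n * (2 * n))" ?E "fractions (\<lambda>_ _. True) ?E (\<lambda>x. x)" by (rule presented_affine)
  have UA: "(\<lambda>y. y) ` ?U \<subseteq> ?A" by (auto simp: grass_chart_def)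
  have ZE: "(\<lambda>y. y) ` ?Z \<subseteq> ?E" by (auto simp: chart_image_def)
  note PX = X.presented_induced[OF UA, unfolded pullback_fractions[OF UA]]
  note PY = Y.presented_induced[OF ZE, unfolded pullback_fractions[OF ZE]]
  have J: "J \<in> minor_sets n n" using J n by simp
  let ?f = "chart_coords n J" and ?T = "mp_var (semi n J) :: (int set, 'k) mpoly"
  \<comment> \<open>The numerator of entry \<open>k\<close>: the linear form of
    \<open>exchange\<close>, with column and row decoded from \<open>k\<close> as in
    \<open>vec_of\<close>.\<close>
  let ?L = "\<lambda>k. if k < n * (2 * n) then (\<Sum>K\<in>msubsets n {- int n..<int n}. mp_const (tminor n (\<lambda>d. std_vec (row_at K d))
      ((row_at J)(k div (2 * n) := int (k mod (2 * n)) - int n))) * mp_var (semi n K)) else 0 :: (int set, 'k) mpoly"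
  have L: "homogeneous 1 (?L k)" for k
  proof (cases "k < n * (2 * n)")
    case True
    then show ?thesis
      unfolding if_P[OF True] by (intro homogeneous_sum homogeneous_cmult homogeneous_var)
  qed simp
  have Lf: "?f W = (\<lambda>k. mp_eval (pv W) (?L k) / mp_eval (pv W) ?T)" for W
  proof
    fix k show "?f W k = mp_eval (pv W) (?L k) / mp_eval (pv W) ?T"
      by (simp add: chart_coords_def vec_of_def exchange_def mp_eval.hom_sum mp_eval.hom_mult sum_divide_distrib)
  qed
  show ?thesis
  proof (rule presented_isomorphism[OF PX PY chart_coords_bij[OF J]])
    fix E h W assume "fractions (\<lambda>_ _. True) ?Z (\<lambda>x. x) E h" and W: "W \<in> ?U" and fW: "?f W \<in> E"
    then obtain p q where pq: "E = {x\<in>?Z. mp_eval x q \<noteq> 0}" "\<forall>x\<in>E. h x = mp_eval x p / mp_eval x q"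
      unfolding fractions_def by blast
    obtain N1 where N1: "\<forall>N\<ge>N1. \<exists>p'. homogeneous N p' \<and> (\<forall>y. mp_eval y ?T \<noteq> 0 \<longrightarrow>
        mp_eval y p' = mp_eval y ?T ^ N * mp_eval (\<lambda>v. mp_eval y (?L v) / mp_eval y ?T) p)"
      using homogenize[of ?L ?T p, OF L homogeneous_var] by blast
    obtain N2 where N2: "\<forall>N\<ge>N2. \<exists>p'. homogeneous N p' \<and> (\<forall>y. mp_eval y ?T \<noteq> 0 \<longrightarrow>
        mp_eval y p' = mp_eval y ?T ^ N * mp_eval (\<lambda>v. mp_eval y (?L v) / mp_eval y ?T) q)"
      using homogenize[of ?L ?T q, OF L homogeneous_var] by blast
    \<comment> \<open>A common degree for numerator and denominator, as a homogeneous fraction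
      requires.\<close>
    let ?N = "max N1 N2"
    obtain p' where p': "homogeneous ?N p'" "\<And>W. W \<in> ?U \<Longrightarrow> mp_eval (pv W) p' = pv W (semi n J) ^ ?N * mp_eval (?f W) p"
      using N1[rule_format, of ?N] unfolding Lf grass_chart_def by auto
    obtain q' where q': "homogeneous ?N q'" "\<And>W. W \<in> ?U \<Longrightarrow> mp_eval (pv W) q' = pv W (semi n J) ^ ?N * mp_eval (?f W) q"
      using N2[rule_format, of ?N] unfolding Lf grass_chart_def by auto
    have t: "pv W (semi n J) \<noteq> 0" if "W \<in> ?U" for W using that by (simp add: grass_chart_def)
    let ?D = "{W\<in>?U. mp_eval (pv W) q' \<noteq> 0}"
    have "fractions homogeneous ?U pv ?D (\<lambda>W. mp_eval (pv W) p' / mp_eval (pv W) q')"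
      by (rule fractionsI[of homogeneous, OF p'(1) q'(1)]) auto
    moreover have "W \<in> ?D" using W fW t[OF W] q'(2)[OF W] pq(1) by simp
    moreover have f: "?f V \<in> E" if "V \<in> ?D" for V
      using that q'(2)[of V] bij_betwE[OF chart_coords_bij[OF J]] pq(1) by auto
    moreover have "h (?f V) = mp_eval (pv V) p' / mp_eval (pv V) q'" if V: "V \<in> ?D" for V
    proof -
      have "h (?f V) = mp_eval (?f V) p / mp_eval (?f V) q" using pq(2) f[OF V] by blast
      then show ?thesis using V p'(2)[of V] q'(2)[of V] t[of V] by simp
    qed
    ultimately show "\<exists>D g. fractions homogeneous ?U pv D g \<and> W \<in> D \<and> ?f ` D \<subseteq> E \<and> (\<forall>y\<in>D. h (?f y) = g y)"
      by (intro exI[of _ ?D] exI[of _ "\<lambda>W. mp_eval (pv W) p' / mp_eval (pv W) q'"] conjI ballI) auto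
  next
    fix D g W assume "fractions homogeneous ?U pv D g" and W: "W \<in> D"
    then obtain d p q where pq: "homogeneous d p" "homogeneous d q" "D = {x\<in>?U. mp_eval (pv x) q \<noteq> 0}"
      "\<forall>x\<in>D. g x = mp_eval (pv x) p / mp_eval (pv x) q" unfolding fractions_def by blast
    \<comment> \<open>The minors of the matrix of variables; at a chart point they become the
      coordinates divided by the one at \<open>J\<close>.\<close>
    let ?M = "pext n (mat_of n (mp_var :: nat \<Rightarrow> (nat, 'k) mpoly))"
    have M: "mp_eval x (?M S) = pext n (mat_of n x) S" for x S
    proof -
      have "(\<lambda>c i. mp_eval x (mat_of n mp_var c i)) = mat_of n x" by (auto simp: mat_of_def fun_eq_iff)
      then show ?thesis by (simp add: mp_eval.hom_pext)
    qed
    have ev: "mp_eval (pv V) r = pv V (semi n J) ^ d * mp_eval (?f V) (mp_subst ?M r)"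
      if V: "V \<in> ?U" and r: "homogeneous d r" for V r
    proof -
      have fV: "?f V \<in> ?Z" using V bij_betwE[OF chart_coords_bij[OF J]] by blast
      have V': "V = grass_incl n (colspan n (mat_of n (?f V)))"
      proof -
        obtain w where w: "normal_frame n J w" "V = grass_incl n (colspan n w)"
          using V pv_chart[OF _ J] by (auto simp: grass_chart_def)
        have "mat_of n (?f V) c = w c" if "c < n" for c
          unfolding chart_coords_normal[OF w(1) J w(2)] using w(1) that by (intro mat_of_vec_of) (auto simp: normal_frame_def)
        then show ?thesis using w(2) colspan_cong by metis
      qed
      have "pv V S = pv V (semi n J) * mp_eval (?f V) (?M S)" for S
        unfolding M by (rule pv_normal(3)[OF chart_image_normal[OF fV] J V'])
      then have "pv V = fscale (pv V (semi n J)) (\<lambda>S. mp_eval (?f V) (?M S))"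
        unfolding fscale_def by (rule ext)
      then have "mp_eval (pv V) r = mp_eval (fscale (pv V (semi n J)) (\<lambda>S. mp_eval (?f V) (?M S))) r" by (rule arg_cong)
      then show ?thesis unfolding mp_eval_fscale[OF r] mp_eval_subst .
    qed
    have t: "pv W (semi n J) \<noteq> 0" if "W \<in> ?U" for W using that by (simp add: grass_chart_def)
    let ?p = "mp_subst ?M p" and ?q = "mp_subst ?M q"
    let ?E' = "{x\<in>?Z. mp_eval x ?q \<noteq> 0}"
    have "fractions (\<lambda>_ _. True) ?Z (\<lambda>x. x) ?E' (\<lambda>x. mp_eval x ?p / mp_eval x ?q)"
      by (rule fractionsI[of _ 0 ?p ?q]) auto
    moreover have iff: "?f V \<in> ?E' \<longleftrightarrow> V \<in> D" if "V \<in> ?U" for V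
      using that ev[OF that pq(2)] t[OF that] bij_betwE[OF chart_coords_bij[OF J]] unfolding pq(3) by auto
    moreover have "g V = mp_eval (?f V) ?p / mp_eval (?f V) ?q" if "V \<in> D" for V
    proof -
      have V: "V \<in> ?U" using that pq(3) by blast
      have "g V = mp_eval (pv V) p / mp_eval (pv V) q" using pq(4) that by blast
      then show ?thesis unfolding ev[OF V pq(1)] ev[OF V pq(2)] using t[OF V] by simp
    qed
    moreover have "W \<in> ?U" using W pq(3) by blast
    ultimately show "\<exists>E h. fractions (\<lambda>_ _. True) ?Z (\<lambda>x. x) E h \<and> ?f W \<in> E \<and>
        (\<forall>y\<in>?U. ?f y \<in> E \<longrightarrow> y \<in> D \<and> g y = h (?f y))"
      using W by (intro exI[of _ ?E'] exI[of _ "\<lambda>x. mp_eval x ?p / mp_eval x ?q"] conjI ballI impI) blast+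
  qed
qed


section \<open>The infinite grassmannian is an ind-variety\<close>

abbreviation coord_nonzero :: "(int \<Rightarrow> 'k::field) set set \<Rightarrow> int set \<Rightarrow> (int \<Rightarrow> 'k) set set" where
  "coord_nonzero A S \<equiv> {W\<in>A. pv W S \<noteq> 0}"

lemma fractions_coord:
  "fractions homogeneous A pv (coord_nonzero A S) (\<lambda>W. pv W R / pv W S)"
  by (rule fractionsI[of homogeneous 1 "mp_var R" "mp_var S"]) simp_all

lemma prevariety_grass_filt: "prevariety (grass_filt i :: ((int \<Rightarrow> 'k::field) set, 'k) kspace)"
proof -
  define n where "n = Suc i"
  let ?A = "grass_step n :: (int \<Rightarrow> 'k) set set"
  interpret X: presented "grass_filt i" ?A "fractions homogeneous ?A pv" unfolding n_def by (rule presented_grass_filt)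
  let ?U = "grass_chart n ` minor_sets n n :: (int \<Rightarrow> 'k) set set set"
  have "\<Union>?U = ?A"
    using pv_nonzero[of _ n] by (auto simp: grass_chart_def maya_def) 
  moreover have "openin (ztop (grass_filt i)) (grass_chart n J :: (int \<Rightarrow> 'k) set set)" for J
    unfolding grass_chart_def by (rule X.basic_open[OF fractions_coord])
  moreover have "\<exists>d Z f. closedin (ztop (affine_space d)) Z \<and>
      isomorphism f (subspace_of (grass_filt i) (grass_chart n J :: (int \<Rightarrow> 'k) set set)) (subspace_of (affine_space d) Z)"
    if "J \<in> minor_sets n n" for J
    using chart_image_closed[of n J] chart_isomorphism[of J i n] that unfolding n_def by blast
  ultimately show ?thesis
    unfolding prevariety_def using X.is_kspace finite_minor_sets[of n n]
    by (intro conjI exI[of _ ?U]) (auto simp: X.pts_eq)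
qed

lemma morphism_reg:
  assumes f: "morphism f Y X" and Y: "is_kspace Y"
    and V: "openin (ztop X) V" "h \<in> reg X V" and U: "openin (ztop Y) U" "U \<subseteq> f -` V"
  shows "restr U (h \<circ> f) \<in> reg Y U"
proof -
  let ?V = "f -` V \<inter> pts Y"
  have UV: "U \<subseteq> ?V" using U openin_subset by blast
  have r: "restr ?V (h \<circ> f) \<in> reg Y ?V" using f V by (simp add: morphism_def)
  have "?V = {y\<in>pts Y. f y \<in> V}" by auto
  then have o: "openin (ztop Y) ?V" using f V by (simp add: morphism_def continuous_map_def)
  have "restr U (restr ?V (h \<circ> f)) \<in> reg Y U"
    using Y o r U(1) UV unfolding is_kspace_def by blast
  moreover have "restr U (restr ?V (h \<circ> f)) = restr U (h \<circ> f)" using UV by (auto simp: restr_def fun_eq_iff)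
  ultimately show ?thesis by simp
qed

lemma kspace_reg:
  assumes "is_kspace Y" "openin (ztop Y) U"
  shows "restr U (\<lambda>_. c) \<in> reg Y U"
    and "f \<in> reg Y U \<Longrightarrow> g \<in> reg Y U \<Longrightarrow> (\<lambda>x. f x + g x) \<in> reg Y U"
    and "f \<in> reg Y U \<Longrightarrow> g \<in> reg Y U \<Longrightarrow> (\<lambda>x. f x * g x) \<in> reg Y U"
proof -
  note * = assms(1)[unfolded is_kspace_def, THEN conjunct1, THEN spec, THEN mp, OF assms(2)]
  show "restr U (\<lambda>_. c) \<in> reg Y U" using * by (elim conjE) (erule spec)
  show "(\<lambda>x. f x + g x) \<in> reg Y U" "(\<lambda>x. f x * g x) \<in> reg Y U"
    if "f \<in> reg Y U" "g \<in> reg Y U" using *[THEN conjunct2, THEN conjunct2] that by simp_all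
qed

text \<open>If \<open>f z\<close> and \<open>g z\<close> differ, some 2 by 2 determinant of their
  coordinate vectors is nonzero. Divided by coordinates that do not vanish near \<open>z\<close>, it
  is a regular function, and its nonvanishing keeps the two values apart in a neighbourhood.\<close>

lemma separated_grass_filt: "separated (grass_filt i :: ((int \<Rightarrow> 'k::field) set, 'k) kspace)"
  unfolding separated_def
proof (intro allI impI, elim conjE)
  fix d :: nat and Z :: "(nat \<Rightarrow> 'k) set" and f g :: "(nat \<Rightarrow> 'k) \<Rightarrow> (int \<Rightarrow> 'k) set"
  define n where "n = Suc i"
  let ?A = "grass_step n :: (int \<Rightarrow> 'k) set set" and ?X = "grass_filt i :: ((int \<Rightarrow> 'k) set, 'k) kspace"
  let ?T = "affine_space d :: (nat \<Rightarrow> 'k, 'k) kspace" and ?E = "coord_space {..<d} :: (nat \<Rightarrow> 'k) set"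
  let ?Y = "subspace_of ?T Z"
  assume Z: "closedin (ztop ?T) Z" and f: "morphism f ?Y ?X" and g: "morphism g ?Y ?X"
  interpret X: presented ?X ?A "fractions homogeneous ?A pv" unfolding n_def by (rule presented_grass_filt)
  interpret T: presented ?T ?E "fractions (\<lambda>_ _. True) ?E (\<lambda>x. x)" by (rule presented_affine)
  have ZE: "Z \<subseteq> ?E" using closedin_subset[OF Z] by (simp add: T.pts_eq)
  interpret Y: presented ?Y Z "pullback_basic Z (\<lambda>y. y) (fractions (\<lambda>_ _. True) ?E (\<lambda>x. x))"
    by (rule T.presented_induced) (use ZE in auto)
  have fg: "f z \<in> ?A" "g z \<in> ?A" if "z \<in> Z" for z
    using f g that by (auto simp: morphism_def continuous_map_def Pi_iff X.pts_eq Y.pts_eq)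
  have loc: "\<exists>M. openin (ztop ?Y) M \<and> z \<in> M \<and> M \<subseteq> {z\<in>Z. f z \<noteq> g z}" if z: "z \<in> Z" "f z \<noteq> g z" for z
  proof -
    obtain S where S: "pv (f z) S \<noteq> 0" using pv_nonzero[OF fg(1)[OF z(1)]] by blast
    obtain T where T: "pv (g z) T \<noteq> 0" using pv_nonzero[OF fg(2)[OF z(1)]] by blast
    obtain R R' where R: "pv (f z) R * pv (g z) R' \<noteq> pv (f z) R' * pv (g z) R"
      using pv_inj[OF fg(1)[OF z(1)] fg(2)[OF z(1)]] z(2) by blast
    let ?US = "coord_nonzero ?A S" and ?UT = "coord_nonzero ?A T"
    define M where "M = {y\<in>pts ?Y. f y \<in> ?US} \<inter> {y\<in>pts ?Y. g y \<in> ?UT}"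
    have US: "openin (ztop ?X) ?US" and UT: "openin (ztop ?X) ?UT" by (rule X.basic_open[OF fractions_coord])+
    have M: "openin (ztop ?Y) M"
      unfolding M_def using f g US UT
      by (intro openin_Int openin_continuous_map_preimage) (simp_all add: morphism_def)
    have OZ: "y \<in> M \<Longrightarrow> y \<in> Z \<and> pv (f y) S \<noteq> 0 \<and> pv (g y) T \<noteq> 0" for y by (simp add: M_def Y.pts_eq)
    have \<alpha>: "restr M (restr ?US (\<lambda>W. pv W P / pv W S) \<circ> f) \<in> reg ?Y M" for P
      by (rule morphism_reg[OF f Y.is_kspace US X.basic_reg[OF fractions_coord] M]) (auto simp: M_def)
    have \<beta>: "restr M (restr ?UT (\<lambda>W. pv W P / pv W T) \<circ> g) \<in> reg ?Y M" for P
      by (rule morphism_reg[OF g Y.is_kspace UT X.basic_reg[OF fractions_coord] M]) (auto simp: M_def)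
    let ?a = "\<lambda>P. restr M (restr ?US (\<lambda>W. pv W P / pv W S) \<circ> f)"
    let ?b = "\<lambda>P. restr M (restr ?UT (\<lambda>W. pv W P / pv W T) \<circ> g)"
    \<comment> \<open>The determinant over the coordinates \<open>S\<close> of \<open>f\<close> and
      \<open>T\<close> of \<open>g\<close>. The subtraction uses the constant function -1, because
      \<open>kspace_reg\<close> offers only constants, sums and products.\<close>
    let ?h = "\<lambda>y. ?a R y * ?b R' y + restr M (\<lambda>_. - 1) y * (?a R' y * ?b R y)"
    have h: "?h \<in> reg ?Y M"
      by (intro kspace_reg[OF Y.is_kspace M] \<alpha> \<beta>)
    have ev: "?h y = (pv (f y) R * pv (g y) R' - pv (f y) R' * pv (g y) R) / (pv (f y) S * pv (g y) T)" if "y \<in> M" for y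
      using that by (simp add: restr_def M_def Y.pts_eq diff_divide_distrib)
    have zO: "z \<in> M" using z fg S T by (simp add: M_def Y.pts_eq)
    show ?thesis
    proof (intro exI conjI)
      show "openin (ztop ?Y) {y\<in>M. ?h y \<noteq> 0}" by (rule Y.nonzero_open[OF M h])
      show "z \<in> {y\<in>M. ?h y \<noteq> 0}" using zO ev[OF zO] R S T by simp
      show "{y\<in>M. ?h y \<noteq> 0} \<subseteq> {z\<in>Z. f z \<noteq> g z}"
      proof clarify
        fix y assume y: "y \<in> M" "?h y \<noteq> 0"
        then have "f y \<noteq> g y" using ev[OF y(1)] by (auto simp: mult.commute)
        then show "y \<in> Z \<and> f y \<noteq> g y" using OZ[OF y(1)] by blast
      qed
    qed
  qed
  have "openin (ztop ?Y) {z\<in>Z. f z \<noteq> g z}"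
    unfolding openin_subopen[of _ "{z\<in>Z. f z \<noteq> g z}"] using loc by blast
  then obtain V where V: "openin (ztop ?T) V" "{z\<in>Z. f z \<noteq> g z} = V \<inter> Z"
    by (auto simp: induced_space_def openin_pullback_topology)
  have "?E - {z\<in>Z. f z = g z} = (?E - Z) \<union> V"
    using V openin_subset[OF V(1)] by (auto simp: T.pts_eq)
  then have "openin (ztop ?T) (?E - {z\<in>Z. f z = g z})"
    using V(1) Z by (auto simp: closedin_def T.pts_eq intro: openin_Un)
  then show "closedin (ztop ?T) {z\<in>Z. f z = g z}"
    using ZE by (auto simp: closedin_def T.pts_eq)
qed

lemma comm_ring_hom_poly: "comm_ring_hom (\<lambda>q. poly q t)"
  by unfold_locales auto

text \<open>Two points are joined by the line \<open>(1 - t) w\<^sub>1 + t w\<^sub>2\<close> of frames; on it, a nonempty open set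
  contains all but finitely many points.\<close>

lemma irreducible_grass_filt:
  "irreducible_top (ztop (grass_filt i :: ((int \<Rightarrow> 'k::field_char_0) set, 'k) kspace))"
  unfolding irreducible_top_def
proof (intro conjI allI impI)
  define n where "n = Suc i"
  let ?A = "grass_step n :: (int \<Rightarrow> 'k) set set" and ?X = "grass_filt i :: ((int \<Rightarrow> 'k) set, 'k) kspace"
  interpret X: presented ?X ?A "fractions homogeneous ?A pv" unfolding n_def by (rule presented_grass_filt)
  \<comment> \<open>The span of all standard vectors with negative index is a point, so the space is
    not empty.\<close>
  let ?J = "{- int n..<0}"
  have J: "?J \<in> minor_sets n n" by (auto simp: minor_sets_def)
  have "minor n (\<lambda>c. std_vec (row_at ?J c) :: int \<Rightarrow> 'k) ?J = 1"
    using minor_std_vec[of ?J n "{- int n..<int n}" ?J] J by (simp add: minor_sets_msubsets)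
  then have "frame n n (\<lambda>c. std_vec (row_at ?J c) :: int \<Rightarrow> 'k)"
    unfolding frame_iff_minor using J
  proof (intro conjI bexI[of _ ?J] allI impI)
    fix c assume "c < n"
    then have "row_at ?J c \<in> ?J" by (intro row_at_in[of _ n]) auto
    then have "row_at ?J c \<in> {- int n..<int n}" by simp
    then show "(std_vec (row_at ?J c) :: int \<Rightarrow> 'k) \<in> coord_space {- int n..<int n}"
      by (auto simp: coord_space_def std_vec_def)
  qed auto
  then show "pts ?X \<noteq> {}" unfolding X.pts_eq using grass_step_frame[of _ n] by blast
  fix U V assume "openin (ztop ?X) U \<and> openin (ztop ?X) V \<and> U \<noteq> {} \<and> V \<noteq> {}"
  then have U: "openin (ztop ?X) U" "U \<noteq> {}" and V: "openin (ztop ?X) V" "V \<noteq> {}" by blast+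
  have basic: "\<exists>w d q. frame n n w \<and> homogeneous d q \<and> mp_eval (pext n w) q \<noteq> 0 \<and> {W\<in>?A. mp_eval (pv W) q \<noteq> 0} \<subseteq> U"
    if U: "openin (ztop ?X) U" "U \<noteq> {}" for U
  proof -
    obtain W where "W \<in> U" using U by blast
    then obtain D g where "fractions homogeneous ?A pv D g" "W \<in> D" "D \<subseteq> U" using X.openE[OF U(1)] by blast
    then obtain d q where q: "homogeneous d q" "W \<in> ?A" "mp_eval (pv W) q \<noteq> 0" "{W\<in>?A. mp_eval (pv W) q \<noteq> 0} \<subseteq> U"
      unfolding fractions_def by blast
    then obtain w where w: "frame n n w" "W = grass_incl n (colspan n w)" unfolding grass_step_frame by blast
    then obtain a where "a \<noteq> 0" "pext n w = fscale a (pv W)" using pv_frame[OF w(1)] by blast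
    then have "mp_eval (pext n w) q \<noteq> 0" using q by (simp add: mp_eval_fscale)
    then show ?thesis using w(1) q by blast
  qed
  obtain w1 d1 q1 where 1: "frame n n w1" "homogeneous d1 q1" "mp_eval (pext n w1) q1 \<noteq> 0"
    "{W\<in>?A. mp_eval (pv W) q1 \<noteq> 0} \<subseteq> U" using basic[OF U] by blast
  obtain w2 d2 q2 where 2: "frame n n w2" "homogeneous d2 q2" "mp_eval (pext n w2) q2 \<noteq> 0"
    "{W\<in>?A. mp_eval (pv W) q2 \<noteq> 0} \<subseteq> V" using basic[OF V] by blast
  \<comment> \<open>The line of matrices from \<open>w1\<close> at \<open>t = 0\<close> to
    \<open>w2\<close> at \<open>t = 1\<close>, with univariate polynomials as entries.\<close>
  define Mp where "Mp = (\<lambda>c i. [:w1 c i, w2 c i - w1 c i:])"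
  define M where "M = (\<lambda>t c i. poly (Mp c i) t)"
  have M01: "M 0 = w1" "M 1 = w2" by (simp_all add: M_def Mp_def)
  have pM: "pext n (M t) S = poly (pext n Mp S) t" for t S
    using comm_ring_hom.hom_pext[OF comm_ring_hom_poly[of t], of n Mp S] unfolding M_def by (rule sym)
  have mM: "minor n (M t) J = poly (minor n Mp J) t" for t J
    using comm_ring_hom.hom_tminor[OF comm_ring_hom_poly[of t], of n "row_at J" Mp] unfolding M_def by (rule sym)
  have ev: "mp_eval (pext n (M t)) q = poly (mp_hom (\<lambda>c. [:c:]) (pext n Mp) q) t" for t q
  proof -
    have "pext n (M t) = (\<lambda>S. poly (pext n Mp S) t)" using pM by (rule ext)
    then show ?thesis by (simp only: mp_eval_poly)
  qed
  obtain J where J: "J \<in> minor_sets n n" "minor n w1 J \<noteq> 0" using 1(1) frame_iff_minor by blast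
  \<comment> \<open>The first factor is nonzero at \<open>t = 0\<close> and the second at
    \<open>t = 1\<close>. The third, nonzero at 0 as well, keeps the matrix a frame at the chosen
    \<open>t\<close>.\<close>
  let ?P = "mp_hom (\<lambda>c. [:c:]) (pext n Mp) q1 * mp_hom (\<lambda>c. [:c:]) (pext n Mp) q2 * minor n Mp J"
  have "mp_hom (\<lambda>c. [:c:]) (pext n Mp) q1 \<noteq> 0" using ev[of 0 q1] 1(3) M01 by auto
  moreover have "mp_hom (\<lambda>c. [:c:]) (pext n Mp) q2 \<noteq> 0" using ev[of 1 q2] 2(3) M01 by auto
  moreover have "minor n Mp J \<noteq> 0" using mM[where t = 0 and J = J] J(2) M01 by auto
  ultimately have "?P \<noteq> 0" by simp
  then obtain t where "poly ?P t \<noteq> 0" using poly_all_0_iff_0 by blast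
  then have t: "mp_eval (pext n (M t)) q1 \<noteq> 0" "mp_eval (pext n (M t)) q2 \<noteq> 0" "minor n (M t) J \<noteq> 0"
    unfolding ev mM by auto
  have "M t c \<in> coord_space {- int n..<int n}" if "c < n" for c
    using 1(1) 2(1) that by (auto simp: frame_def coord_space_def M_def Mp_def)
  then have fr: "frame n n (M t)" unfolding frame_iff_minor using t(3) J(1) by blast
  define W where "W = grass_incl n (colspan n (M t))"
  have W: "W \<in> ?A" unfolding W_def grass_step_frame using fr by blast
  obtain a where "pext n (M t) = fscale a (pv W)" using pv_frame[OF fr] W_def by blast
  then have "mp_eval (pv W) q1 \<noteq> 0" "mp_eval (pv W) q2 \<noteq> 0"
    using t(1,2) by (auto simp: mp_eval_fscale[OF 1(2)] mp_eval_fscale[OF 2(2)])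
  then show "U \<inter> V \<noteq> {}" using 1(4) 2(4) W by blast
qed

lemma variety_grass_filt: "variety (grass_filt i :: ((int \<Rightarrow> 'k::field_char_0) set, 'k) kspace)"
  unfolding variety_def using prevariety_grass_filt separated_grass_filt irreducible_grass_filt by blast

lemma semi_maya_iff:
  assumes "J \<in> minor_sets (Suc n) (Suc n)" "semi (Suc n) J \<in> maya n"
  shows "- int (Suc n) \<in> J" "int n \<notin> J" "J - {- int (Suc n)} \<in> minor_sets n n"
proof -
  obtain K where K: "K \<in> minor_sets n n" "semi (Suc n) J = semi n K" using assms(2) by (auto simp: maya_def)
  have "- int (Suc n) \<in> semi n K" "int n \<notin> semi n K" using K(1) by (auto simp: semi_def minor_sets_def)
  then have "- int (Suc n) \<in> semi (Suc n) J" "int n \<notin> semi (Suc n) J" by (simp_all only: K(2) not_False_eq_True)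
  then show 1: "- int (Suc n) \<in> J" "int n \<notin> J" by (auto simp: semi_def)
  have "J - {- int (Suc n)} \<subseteq> {- int n..<int n}"
  proof
    fix k assume k: "k \<in> J - {- int (Suc n)}"
    then have "k \<in> {- int (Suc n)..<int (Suc n)}" using assms(1) by (auto simp: minor_sets_def)
    moreover have "k \<noteq> - int (Suc n)" "k \<noteq> int n" using k 1 by auto
    ultimately show "k \<in> {- int n..<int n}" by auto
  qed
  then show "J - {- int (Suc n)} \<in> minor_sets n n"
    using 1 finite_minor_set[OF assms(1)] by (simp add: minor_sets_def)
qed

text \<open>In a normal frame of \<open>W\<close> at level \<open>n + 1\<close>, every nonzero minor
  contains the lowest row and avoids the highest one. Written by \<open>exchange\<close> as
  combinations of minors, the entries show that the first column is the lowest standard vector and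
  that the other columns lie in the smaller box. Removing the first column descends to level
  \<open>n\<close>.\<close>

lemma grass_step_if_zero:
  fixes W :: "(int \<Rightarrow> 'k::field) set"
  assumes W: "W \<in> grass_step (Suc n)" and zero: "\<And>S. S \<in> maya (Suc n) - maya n \<Longrightarrow> pv W S = 0"
  shows "W \<in> grass_step n"
proof -
  let ?N = "Suc n" and ?x = "- int (Suc n)" and ?I = "{- int (Suc n)..<int (Suc n)}"
  obtain J where J: "J \<in> minor_sets ?N ?N" "pv W (semi ?N J) \<noteq> 0"
    using pv_nonzero[OF W] by (auto simp: maya_def)
  have JM: "semi ?N J \<in> maya n" using zero[of "semi ?N J"] J by (auto simp: maya_def[of ?N])
  note J' = semi_maya_iff[OF J(1) JM]
  have finJ: "finite J" "card J = ?N" using finite_minor_set[OF J(1)] by auto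
  \<comment> \<open>The lowest index is the first row of \<open>J\<close>, hence the pivot of column
    0.\<close>
  have row0: "row_at J 0 = ?x"
    using J(1) by (intro row_at_Min(1)[OF finJ(1) J'(1)]) (auto simp: minor_sets_def)
  obtain w where w: "normal_frame ?N J w" "W = grass_incl ?N (colspan ?N w)" using pv_chart[OF W J] by blast
  have wI: "w c \<in> coord_space ?I" if "c < ?N" for c using w(1) that unfolding normal_frame_def by blast
  have wJ: "w c (row_at J r) = (if r = c then 1 else 0)" if "c < ?N" "r < ?N" for r c
    using w(1) that unfolding normal_frame_def by blast
  have K: "?x \<in> K" "int n \<notin> K" if "K \<in> minor_sets ?N ?N" "minor ?N w K \<noteq> 0" for K
  proof -
    have "pv W (semi ?N K) \<noteq> 0"
      using pv_normal(3)[OF w(1) J(1) w(2), of "semi ?N K"] that J(2) by (simp add: pext_semi)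
    then have "semi ?N K \<in> maya n" using zero[of "semi ?N K"] that(1) by (auto simp: maya_def[of ?N])
    then show "?x \<in> K" "int n \<notin> K" using semi_maya_iff[OF that(1)] by auto
  qed
  have expand: "w c i = (\<Sum>K\<in>minor_sets ?N ?N. tminor ?N (\<lambda>d. std_vec (row_at K d)) ((row_at J)(c := i)) * minor ?N w K)"
    if "c < ?N" for c i
  proof -
    have "nexchange ?N J (minor ?N w) c = w c" by (rule exchange_normal[OF w(1) J(1) refl that])
    from fun_cong[OF this, of i] show ?thesis by (simp only: exchange_def minor_sets_msubsets)
  qed
  have w0: "w 0 = std_vec ?x"
  proof
    fix i
    show "w 0 i = std_vec ?x i"
    proof (cases "i = ?x")
      case True
      then show ?thesis using wJ[of 0 0] row0 by (simp add: std_vec_def)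
    next
      case False
      \<comment> \<open>If the minor at \<open>K\<close> is nonzero, then \<open>K\<close> contains
        \<open>?x\<close>; the exchanged rows have lost \<open>?x\<close>, so the column
        \<open>std_vec ?x\<close> is zero on them.\<close>
      have "tminor ?N (\<lambda>d. std_vec (row_at K d)) ((row_at J)(0 := i)) * minor ?N w K = 0"
        if K': "K \<in> minor_sets ?N ?N" for K
      proof (cases "minor ?N w K = 0")
        case nz: False
        have "finite K" "card K = ?N" using finite_minor_set[OF K'] by auto
        then obtain d where d: "d < ?N" "row_at K d = ?x"
          using K(1)[OF K' nz] bij_betw_imp_surj_on[OF row_at_bij, of K ?N] by (metis imageE lessThan_iff)
        have "((row_at J)(0 := i)) r \<noteq> ?x" if "r < ?N" for r
          using that row0 row_at_eq_iff[OF finJ, of r 0] False by auto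
        then have "tminor ?N (\<lambda>d. std_vec (row_at K d) :: int \<Rightarrow> 'k) ((row_at J)(0 := i)) = 0"
          by (intro dform_zero_col[OF d(1)]) (simp add: d(2) std_vec_def)
        then show ?thesis by simp
      qed simp
      then have "w 0 i = 0" unfolding expand[OF zero_less_Suc] by (intro sum.neutral) blast
      then show ?thesis using False by (simp add: std_vec_def)
    qed
  qed
  have wc: "w c \<in> coord_space {- int n..<int n}" if c: "0 < c" "c < ?N" for c
    unfolding coord_space_def
  proof clarify
    fix i assume i: "i \<notin> {- int n..<int n}"
    consider "i = ?x" | "i = int n" | "i \<notin> ?I" using i by force
    then show "w c i = 0"
    proof cases
      case 1
      then show ?thesis using wJ[OF c(2), of 0] row0 c by simp
    next
      case 2
      \<comment> \<open>If the minor at \<open>K\<close> is nonzero, then \<open>K\<close> avoids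
        \<open>int n\<close>, so the exchanged row \<open>int n\<close> is zero on all standard
        vectors of \<open>K\<close>.\<close>
      have "tminor ?N (\<lambda>d. std_vec (row_at K d)) ((row_at J)(c := i)) * minor ?N w K = 0"
        if K': "K \<in> minor_sets ?N ?N" for K
      proof (cases "minor ?N w K = 0")
        case nz: False
        have "finite K" "card K = ?N" using finite_minor_set[OF K'] by auto
        then have rk: "int n \<noteq> row_at K d" if "d < ?N" for d
          using K(2)[OF K' nz] row_at_in[of K ?N d] that by metis
        have "tminor ?N (\<lambda>d. std_vec (row_at K d) :: int \<Rightarrow> 'k) ((row_at J)(c := i)) = 0"
          by (intro dform_zero_row[OF c(2)]) (simp add: 2 std_vec_def rk)
        then show ?thesis by simp
      qed simp
      then show ?thesis unfolding expand[OF c(2)] by (intro sum.neutral) blast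
    next
      case 3
      then show ?thesis using wI[OF c(2)] by (auto simp: coord_space_def)
    qed
  qed
  define v where "v c = w (Suc c)" for c
  have lift: "lift_frame n v c = w c" for c
    by (cases c) (simp_all add: lift_frame_def v_def w0)
  then have lift': "lift_frame n v = w" by blast
  have "minor n v (J - {?x}) = 1"
    using minor_lift_frame[of J n "Suc n" v] normal_frame_minor[OF w(1)] J(1) J'(1) by (simp add: lift')
  then have "frame n n v"
    unfolding frame_iff_minor using J'(3) wc by (force simp: v_def)
  moreover have "W = grass_incl n (colspan n v)"
    using w(2) grass_incl_lift[of n v] by (simp add: lift')
  ultimately show ?thesis unfolding grass_step_frame by blast
qed

text \<open>The complement of the smaller step is the union of the open sets where a coordinate new
  to the larger step is nonzero. Both steps use the same coordinates \<open>pv\<close>, so the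
  functions match.\<close>

lemma closed_immersion_grass_filt:
  "closed_immersion (\<lambda>x. x) (grass_filt i :: ((int \<Rightarrow> 'k::field) set, 'k) kspace) (grass_filt (Suc i))"
proof -
  let ?A = "grass_step (Suc i) :: (int \<Rightarrow> 'k) set set" and ?B = "grass_step (Suc (Suc i)) :: (int \<Rightarrow> 'k) set set"
  interpret Y: presented "grass_filt (Suc i)" ?B "fractions homogeneous ?B pv" by (rule presented_grass_filt)
  have AB: "?A \<subseteq> ?B" by (rule grass_step_mono) simp
  then have im: "(\<lambda>x. x) ` ?A \<subseteq> ?B" by auto
  have "?B - ?A = (\<Union>S\<in>maya (Suc (Suc i)) - maya (Suc i). coord_nonzero ?B S)"
    using grass_step_if_zero[of _ "Suc i"] pv_outside[of _ "Suc i"] by blast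
  moreover have "openin (ztop (grass_filt (Suc i))) (\<Union>S\<in>maya (Suc (Suc i)) - maya (Suc i). coord_nonzero ?B S)"
    using Y.basic_open[OF fractions_coord] by blast
  ultimately have closed: "closedin (ztop (grass_filt (Suc i))) ((\<lambda>x. x) ` ?A)"
    using AB by (simp add: closedin_def Y.pts_eq)
  show ?thesis
    by (rule presented_closed_immersion[OF presented_grass_filt presented_grass_filt _ im closed])
      (simp_all add: pullback_fractions[OF im])
qed

lemma pts_grass_filt [simp]: "pts (grass_filt i) = grass_step (Suc i)"
  by (rule presented.pts_eq[OF presented_grass_filt])

lemma ind_variety_grass:
  "ind_variety grass_inf (grass_filt :: nat \<Rightarrow> ((int \<Rightarrow> 'k::field_char_0) set, 'k) kspace)"
  unfolding ind_variety_def
proof (intro conjI allI)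
  show "pts (grass_filt n :: ((int \<Rightarrow> 'k) set, 'k) kspace) \<subseteq> pts (grass_filt (Suc n))" for n
    unfolding pts_grass_filt by (rule grass_step_mono) simp
qed (simp_all add: grass_inf_steps variety_grass_filt closed_immersion_grass_filt)


section \<open>The Pluecker line bundle\<close>

definition maya_inf :: "int set set" where
  "maya_inf = (\<Union>i. maya (Suc i))"

text \<open>The bundle of linear forms in the coordinates: in the chart \<open>S\<close> a section
  is the form divided by the coordinate \<open>S\<close>, hence the ratios as transition functions.
  They do not depend on the choice in \<open>pv\<close>.\<close>

definition pluecker_bundle :: "(int set, (int \<Rightarrow> 'k::field) set, 'k) lbundle" where
  "pluecker_bundle = \<lparr>idx = maya_inf, chart = coord_nonzero grass_inf, trans = (\<lambda>S T W. pv W T / pv W S)\<rparr>"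

lemma grass_step_inf: "grass_step (Suc i) \<subseteq> grass_inf"
  unfolding grass_inf_steps by blast

lemma coord_nonzero_Int: "coord_nonzero grass_inf S \<inter> grass_step (Suc i) = coord_nonzero (grass_step (Suc i)) S"
  using grass_step_inf[of i] by blast

lemma bundle_at_pluecker:
  "bundle_at grass_filt pluecker_bundle i =
    \<lparr>idx = maya_inf, chart = coord_nonzero (grass_step (Suc i)), trans = (\<lambda>S T W. pv W T / pv W S)\<rparr>"
  by (simp add: bundle_at_def bundle_restrict_def pluecker_bundle_def coord_nonzero_Int)

lemma coord_nonzero_cover:
  "(\<Union>S\<in>maya_inf. coord_nonzero (grass_step (Suc i)) S) = (grass_step (Suc i) :: (int \<Rightarrow> 'k::field) set set)"
proof
  show "grass_step (Suc i) \<subseteq> (\<Union>S\<in>maya_inf. coord_nonzero (grass_step (Suc i)) S :: (int \<Rightarrow> 'k) set set)"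
  proof
    fix W :: "(int \<Rightarrow> 'k) set" assume W: "W \<in> grass_step (Suc i)"
    then obtain S where "S \<in> maya (Suc i)" "pv W S \<noteq> 0" using pv_nonzero by blast
    then show "W \<in> (\<Union>S\<in>maya_inf. coord_nonzero (grass_step (Suc i)) S)" using W by (auto simp: maya_inf_def)
  qed
qed auto

lemma open_coord_nonzero: "openin (ztop (grass_filt i)) (coord_nonzero (grass_step (Suc i)) S)"
proof -
  interpret presented "grass_filt i" "grass_step (Suc i)" "fractions homogeneous (grass_step (Suc i)) pv"
    by (rule presented_grass_filt)
  show ?thesis by (rule basic_open[OF fractions_coord])
qed

lemma reg_ratio:
  fixes i
  defines "A \<equiv> grass_step (Suc i)"
  shows "restr (coord_nonzero A S \<inter> coord_nonzero A T) (\<lambda>W. pv W T / pv W S)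
    \<in> reg (grass_filt i) (coord_nonzero A S \<inter> coord_nonzero A T)"
proof -
  \<comment> \<open>The ratio is expanded by the coordinate \<open>T\<close>, which makes the domain
    of the fraction the intersection of both charts.\<close>
  have "homogeneous (1 + 1) (mp_var T * mp_var T)" "homogeneous (1 + 1) (mp_var S * mp_var T)"
    by (intro homogeneous_mult homogeneous_var)+
  then have Q: "fractions homogeneous A pv (coord_nonzero A S \<inter> coord_nonzero A T) (\<lambda>W. pv W T / pv W S)"
    by (rule fractionsI[of homogeneous]) (auto simp: mp_eval.hom_mult)
  interpret presented "grass_filt i" A "fractions homogeneous A pv"
    unfolding A_def by (rule presented_grass_filt)
  show ?thesis by (rule basic_reg[OF Q])
qed

lemma line_bundle_at: "line_bundle (grass_filt i) (bundle_at grass_filt pluecker_bundle i)"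
  unfolding line_bundle_def bundle_at_pluecker
proof (simp only: lbundle.select_convs, intro conjI ballI)
  show "(\<Union>S\<in>maya_inf. coord_nonzero (grass_step (Suc i)) S) = pts (grass_filt i)"
    by (simp only: coord_nonzero_cover pts_grass_filt)
qed (rule open_coord_nonzero reg_ratio | simp)+

lemma openin_ind_space:
  "openin (ztop (ind_space Xs)) U \<longleftrightarrow> U \<subseteq> (\<Union>n. pts (Xs n)) \<and> (\<forall>n. openin (ztop (Xs n)) (U \<inter> pts (Xs n)))"
proof -
  let ?P = "\<lambda>U. U \<subseteq> (\<Union>n. pts (Xs n)) \<and> (\<forall>n. openin (ztop (Xs n)) (U \<inter> pts (Xs n)))"
  have "istopology ?P"
    unfolding istopology_def
  proof (rule conjI; intro allI impI)
    fix S T assume S: "?P S" and T: "?P T"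
    have "S \<inter> T \<inter> pts (Xs n) = (S \<inter> pts (Xs n)) \<inter> (T \<inter> pts (Xs n))" for n by blast
    then show "?P (S \<inter> T)" using S T by (auto simp: openin_Int)
  next
    fix \<K> assume K: "\<forall>K\<in>\<K>. ?P K"
    have eq: "\<Union>\<K> \<inter> pts (Xs n) = (\<Union>K\<in>\<K>. K \<inter> pts (Xs n))" for n by blast
    have "openin (ztop (Xs n)) (\<Union>\<K> \<inter> pts (Xs n))" for n unfolding eq using K by (intro openin_Union) auto
    moreover have "\<Union>\<K> \<subseteq> (\<Union>n. pts (Xs n))" using K by blast
    ultimately show "?P (\<Union>\<K>)" by blast
  qed
  then show ?thesis unfolding ind_space_def by (simp add: topology_inverse')
qed

lemma pts_ind_grass: "pts (ind_space (grass_filt :: nat \<Rightarrow> ((int \<Rightarrow> 'k::field) set, 'k) kspace)) = grass_inf"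
proof
  let ?X = "ind_space (grass_filt :: nat \<Rightarrow> ((int \<Rightarrow> 'k) set, 'k) kspace)"
  have "pts ?X \<subseteq> (\<Union>n. pts (grass_filt n))"
    using openin_topspace[of "ztop ?X"] unfolding openin_ind_space by (rule conjunct1)
  then show "pts ?X \<subseteq> grass_inf" by (simp add: grass_inf_steps)
  have "grass_inf \<inter> pts (grass_filt n :: ((int \<Rightarrow> 'k) set, 'k) kspace) = pts (grass_filt n)" for n
    using grass_step_inf by auto
  then have "openin (ztop ?X) grass_inf"
    unfolding openin_ind_space by (simp add: grass_inf_steps del: pts_grass_filt) simp
  then show "grass_inf \<subseteq> pts ?X" by (rule openin_subset)
qed

text \<open>Openness and regularity on the union mean openness and regularity on each step, where
  they are \<open>open_coord_nonzero\<close> and \<open>reg_ratio\<close>.\<close>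

lemma line_bundle_pluecker:
  "line_bundle (ind_space grass_filt) (pluecker_bundle :: (int set, (int \<Rightarrow> 'k::field) set, 'k) lbundle)"
  unfolding line_bundle_def
proof (intro conjI ballI)
  let ?L = "pluecker_bundle :: (int set, (int \<Rightarrow> 'k) set, 'k) lbundle"
  show "openin (ztop (ind_space grass_filt)) (chart ?L S)" for S
    unfolding openin_ind_space using grass_inf_steps
    by (auto simp: pluecker_bundle_def coord_nonzero_Int open_coord_nonzero)
  have "grass_inf \<subseteq> (\<Union>S\<in>maya_inf. coord_nonzero grass_inf S :: (int \<Rightarrow> 'k) set set)"
  proof
    fix W :: "(int \<Rightarrow> 'k) set" assume W: "W \<in> grass_inf"
    then obtain i where "W \<in> grass_step (Suc i)" unfolding grass_inf_steps by blast
    then obtain S where "S \<in> maya_inf" "pv W S \<noteq> 0" using coord_nonzero_cover[of i] by blast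
    then show "W \<in> (\<Union>S\<in>maya_inf. coord_nonzero grass_inf S)" using W by blast
  qed
  then show "(\<Union>S\<in>idx ?L. chart ?L S) = pts (ind_space grass_filt)"
    unfolding pts_ind_grass by (auto simp: pluecker_bundle_def)
  fix S T
  let ?C = "chart ?L S \<inter> chart ?L T"
  have C: "?C \<inter> grass_step (Suc i) = coord_nonzero (grass_step (Suc i)) S \<inter> coord_nonzero (grass_step (Suc i)) T" for i
    unfolding pluecker_bundle_def using grass_step_inf[of i] by auto
  show "restr ?C (trans ?L S T) \<in> reg (ind_space grass_filt) ?C"
    unfolding ind_space_def
  proof (simp, intro conjI allI)
    show "restr ?C (restr ?C (trans ?L S T)) = restr ?C (trans ?L S T)" by (auto simp: restr_def)
    fix i
    have "restr (?C \<inter> grass_step (Suc i)) (restr ?C (trans ?L S T)) =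
        restr (?C \<inter> grass_step (Suc i)) (\<lambda>W. pv W T / pv W S)"
      by (auto simp: restr_def pluecker_bundle_def fun_eq_iff)
    then show "restr (?C \<inter> grass_step (Suc i)) (restr ?C (trans ?L S T)) \<in> reg (grass_filt i) (?C \<inter> grass_step (Suc i))"
      using reg_ratio[of i S T] unfolding C by simp
  qed
qed (auto simp: pluecker_bundle_def)


subsection \<open>Regular functions on the affine line\<close>

text \<open>Among the fractions that agree with \<open>\<phi>\<close> off a finite set, one with
  denominator of least degree is taken. A root of its denominator would be a root of its numerator,
  by comparison with the local fraction there, and could be cancelled. Over an algebraically closed
  field the denominator is therefore constant.\<close>

lemma local_fraction_poly:
  fixes \<phi> :: "'k::{alg_closed_field, field_char_0} \<Rightarrow> 'k"
  assumes loc: "\<And>t0. \<exists>A B. poly B t0 \<noteq> 0 \<and> (\<forall>t. poly B t \<noteq> 0 \<longrightarrow> \<phi> t = poly A t / poly B t)"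
  shows "\<exists>p. \<forall>t. \<phi> t = poly p t"
proof -
  \<comment> \<open>Agreement off a finite set survives the cancellation of a linear factor, which
    says nothing about the root itself.\<close>
  define R where "R A B \<longleftrightarrow> B \<noteq> 0 \<and> (\<exists>F. finite F \<and> (\<forall>t. t \<notin> F \<longrightarrow> \<phi> t * poly B t = poly A t))" for A B
  have cofin: "p = q" if "finite F" "\<And>t. t \<notin> F \<Longrightarrow> poly p t = poly q t" for p q :: "'k poly" and F
  proof (rule ccontr)
    assume "p \<noteq> q"
    then have "finite {t. poly (p - q) t = 0}" by (intro poly_roots_finite) simp
    moreover have "UNIV = F \<union> {t. poly (p - q) t = 0}" using that(2) by auto
    ultimately have "finite (UNIV :: 'k set)" using that(1) by (metis finite_Un)
    then show False using infinite_UNIV_char_0 by blast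
  qed
  have R0: "\<exists>A B. R A B"
  proof -
    obtain A B where AB: "poly B 0 \<noteq> 0" "\<forall>t. poly B t \<noteq> 0 \<longrightarrow> \<phi> t = poly A t / poly B t" using loc[of 0] by blast
    then have "B \<noteq> 0" by auto
    then show ?thesis unfolding R_def using AB(2) poly_roots_finite[of B]
      by (intro exI[of _ A] exI[of _ B] conjI exI[of _ "{t. poly B t = 0}"]) auto
  qed
  define m where "m = (LEAST m. \<exists>A B. R A B \<and> degree B = m)"
  have "\<exists>m A B. R A B \<and> degree B = m" using R0 by blast
  then have "\<exists>A B. R A B \<and> degree B = m" unfolding m_def by (rule LeastI_ex)
  then obtain A B where AB: "R A B" "degree B = m" by blast
  obtain F where F: "finite F" "\<And>t. t \<notin> F \<Longrightarrow> \<phi> t * poly B t = poly A t" using AB(1) R_def by blast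
  have least: "degree B \<le> degree B'" if "R A' B'" for A' B'
    unfolding AB(2) m_def by (rule Least_le) (use that in blast)
  \<comment> \<open>Two fractions for \<open>\<phi>\<close> agree off a finite set, hence as
    polynomials once denominators are cleared.\<close>
  have cross: "A * B' = A' * B"
    if B': "B' \<noteq> 0" "\<And>t. poly B' t \<noteq> 0 \<Longrightarrow> \<phi> t = poly A' t / poly B' t" for A' B'
  proof (rule cofin[of "F \<union> {t. poly B' t = 0}"])
    show "finite (F \<union> {t. poly B' t = 0})" using F(1) poly_roots_finite[OF B'(1)] by simp
    fix t assume "t \<notin> F \<union> {t. poly B' t = 0}"
    then have "t \<notin> F" and t': "poly B' t \<noteq> 0" by auto
    note t = F(2)[OF this(1)] t' B'(2)[OF t']
    have "poly A t * poly B' t = \<phi> t * poly B' t * poly B t" by (simp only: t(1)[symmetric] mult_ac)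
    also have "\<phi> t * poly B' t = poly A' t" using t(2,3) by simp
    finally show "poly (A * B') t = poly (A' * B) t" by simp
  qed
  have "degree B = 0"
  proof (rule ccontr)
    assume "degree B \<noteq> 0"
    then obtain z where z: "poly B z = 0" using alg_closed_imp_poly_has_root[of B] by auto
    obtain A' B' where B': "poly B' z \<noteq> 0" "\<And>t. poly B' t \<noteq> 0 \<Longrightarrow> \<phi> t = poly A' t / poly B' t" using loc[of z] by blast
    then have "B' \<noteq> 0" by auto
    from cross[OF this B'(2)] have "poly (A * B') z = poly (A' * B) z" by simp
    then have "[:- z, 1:] dvd A" "[:- z, 1:] dvd B" using z B'(1) by (simp_all add: poly_eq_0_iff_dvd[symmetric])
    then obtain A1 B1 where A1: "A = [:- z, 1:] * A1" and B1: "B = [:- z, 1:] * B1" unfolding dvd_def by blast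
    have nz: "B \<noteq> 0" using AB(1) by (simp add: R_def)
    then have B1nz: "B1 \<noteq> 0" using B1 by auto
    have "R A1 B1"
      unfolding R_def
    proof (intro conjI exI[of _ "insert z F"] allI impI)
      fix t assume t: "t \<notin> insert z F"
      then have "\<phi> t * poly B t = poly A t" using F(2) by blast
      then have "(t - z) * (\<phi> t * poly B1 t) = (t - z) * poly A1 t" unfolding A1 B1 by (simp add: algebra_simps)
      then show "\<phi> t * poly B1 t = poly A1 t" using t by simp
    qed (use B1nz F(1) in auto)
    then have "degree B \<le> degree B1" by (rule least)
    moreover have "degree B = Suc (degree B1)" unfolding B1 using B1nz by (subst degree_mult_eq) auto
    ultimately show False by simp
  qed
  then obtain b where b: "B = [:b:]" by (rule degree_eq_zeroE)
  have b0: "b \<noteq> 0" using AB(1) b by (auto simp: R_def)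
  \<comment> \<open>Equality at every point, including the exceptional ones, is recovered from the
    local fraction at \<open>t\<close>.\<close>
  have "\<phi> t = poly (smult (1 / b) A) t" for t
  proof -
    obtain A' B' where B': "poly B' t \<noteq> 0" "\<And>t. poly B' t \<noteq> 0 \<Longrightarrow> \<phi> t = poly A' t / poly B' t" using loc[of t] by blast
    then have "B' \<noteq> 0" by auto
    from cross[OF this B'(2)] have "poly (A * B') t = poly (A' * B) t" by simp
    then have "poly A t * poly B' t = (b * \<phi> t) * poly B' t"
      using B'(2)[OF B'(1)] B'(1) by (simp add: b)
    then show ?thesis using B'(1) b0 by simp
  qed
  then show ?thesis by blast
qed

text \<open>With \<open>d\<close> the degree of \<open>q\<close>, the relation reads
  \<open>t ^ d * p = t * reflect_poly q\<close>. The right side has degree at most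
  \<open>d + 1\<close>, so \<open>p\<close> has degree at most 1, and its coefficient at
  \<open>t\<close> is the value of \<open>q\<close> at 0.\<close>

lemma poly_linear_of_symmetric:
  fixes p q :: "'k::field_char_0 poly"
  assumes pq: "\<And>t. t \<noteq> 0 \<Longrightarrow> poly p t = t * poly q (1 / t)"
  shows "poly p 1 = poly p 0 + poly q 0"
proof -
  let ?d = "degree q"
  have "poly (monom 1 ?d * p - pCons 0 (reflect_poly q)) t = 0" if "t \<noteq> 0" for t
    using that pq[OF that] poly_reflect_poly_nz[OF that, of q] by (simp add: poly_monom inverse_eq_divide)
  then have "{t. poly (monom 1 ?d * p - pCons 0 (reflect_poly q)) t = 0} \<supseteq> UNIV - {0}" by blast
  moreover have "infinite (UNIV - {0 :: 'k})" using infinite_UNIV_char_0 by simp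
  ultimately have "monom 1 ?d * p - pCons 0 (reflect_poly q) = 0"
    using poly_roots_finite finite_subset by blast
  then have eq: "monom 1 ?d * p = pCons 0 (reflect_poly q)" by simp
  have c: "coeff p k = coeff (pCons 0 (reflect_poly q)) (?d + k)" for k
    unfolding eq[symmetric] by (simp add: coeff_monom_mult)
  have c1: "coeff p (Suc 0) = coeff q 0" using c[of "Suc 0"] by (simp add: coeff_reflect_poly)
  have ck: "coeff p k = 0" if k: "k > 1" for k
  proof -
    define l where "l = k - 2"
    have "k = Suc (Suc l)" using k by (simp add: l_def)
    then have "\<exists>j. ?d + k = Suc j \<and> j > ?d" by (intro exI[of _ "?d + Suc l"]) simp
    then obtain j where j: "?d + k = Suc j" "j > ?d" by blast
    show ?thesis unfolding c[of k] j(1) using j(2) by (simp add: coeff_reflect_poly)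
  qed
  have "p = [:coeff p 0, coeff q 0:]"
  proof (rule poly_eqI)
    fix k show "coeff p k = coeff [:coeff p 0, coeff q 0:] k"
      using c1 ck[of k] by (cases k; cases "k - 1") auto
  qed
  then have "poly p 1 = coeff p 0 + coeff q 0" by (metis mult_1 poly_0 poly_pCons add.right_neutral mult_zero_right)
  then show ?thesis by (simp add: poly_0_coeff_0)
qed


section \<open>Sections of the Pluecker line bundle\<close>

text \<open>The coordinate \<open>S\<close> as a section, written in the chart \<open>T\<close> as a
  ratio. For \<open>S\<close> outside the level it is the zero section, which is what restriction
  from higher levels produces.\<close>

definition psec :: "nat \<Rightarrow> int set \<Rightarrow> int set \<times> (int \<Rightarrow> 'k::field) set \<Rightarrow> 'k" where
  "psec i S = (\<lambda>(T, W). if T \<in> maya_inf \<and> W \<in> coord_nonzero (grass_step (Suc i)) T then pv W S / pv W T else 0)"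

abbreviation psections :: "nat \<Rightarrow> (int set \<times> (int \<Rightarrow> 'k::field) set \<Rightarrow> 'k) set" where
  "psections i \<equiv> sections_at grass_filt pluecker_bundle i"

lemma sections_iff:
  "s \<in> psections i \<longleftrightarrow>
    (\<forall>T W. T \<notin> maya_inf \<or> W \<notin> coord_nonzero (grass_step (Suc i)) T \<longrightarrow> s (T, W) = 0) \<and>
    (\<forall>T\<in>maya_inf. (\<lambda>W. s (T, W)) \<in> reg (grass_filt i) (coord_nonzero (grass_step (Suc i)) T)) \<and>
    (\<forall>S\<in>maya_inf. \<forall>T\<in>maya_inf. \<forall>W\<in>coord_nonzero (grass_step (Suc i)) S \<inter> coord_nonzero (grass_step (Suc i)) T.
       s (S, W) = pv W T / pv W S * s (T, W))"
  unfolding sections_at_def H0_def bundle_at_pluecker by simp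

lemma
  assumes "s \<in> psections i"
  shows section_zero: "T \<notin> maya_inf \<or> W \<notin> coord_nonzero (grass_step (Suc i)) T \<Longrightarrow> s (T, W) = 0"
    and section_reg: "T \<in> maya_inf \<Longrightarrow> (\<lambda>W. s (T, W)) \<in> reg (grass_filt i) (coord_nonzero (grass_step (Suc i)) T)"
    and section_trans: "S \<in> maya_inf \<Longrightarrow> T \<in> maya_inf \<Longrightarrow>
      W \<in> coord_nonzero (grass_step (Suc i)) S \<inter> coord_nonzero (grass_step (Suc i)) T \<Longrightarrow>
      s (S, W) = pv W T / pv W S * s (T, W)"
  using assms unfolding sections_iff by (elim conjE; simp only:; blast)+

lemma psec_section: "psec i S \<in> (psections i :: (int set \<times> (int \<Rightarrow> 'k::field) set \<Rightarrow> 'k) set)"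
  unfolding sections_iff
proof (intro conjI ballI allI impI)
  fix T assume T: "T \<in> maya_inf"
  interpret presented "grass_filt i" "grass_step (Suc i) :: (int \<Rightarrow> 'k) set set"
      "fractions homogeneous (grass_step (Suc i)) pv"
    by (rule presented_grass_filt)
  have eq: "(\<lambda>W. psec i S (T, W) :: 'k) = restr (coord_nonzero (grass_step (Suc i)) T) (\<lambda>W. pv W S / pv W T)"
    using T by (auto simp: psec_def restr_def)
  show "(\<lambda>W. psec i S (T, W) :: 'k) \<in> reg (grass_filt i) (coord_nonzero (grass_step (Suc i)) T)"
    unfolding eq by (rule basic_reg[OF fractions_coord])
qed (auto simp: psec_def)

lemma subspace_sections: "fun_vs.subspace (psections i :: (int set \<times> (int \<Rightarrow> 'k::field) set \<Rightarrow> 'k) set)"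
  unfolding fun_vs.subspace_def
proof (intro conjI ballI allI)
  interpret presented "grass_filt i" "grass_step (Suc i) :: (int \<Rightarrow> 'k) set set"
      "fractions homogeneous (grass_step (Suc i)) pv"
    by (rule presented_grass_filt)
  note kreg = kspace_reg[OF is_kspace open_coord_nonzero]
  have z: "(\<lambda>W. 0 :: 'k) \<in> reg (grass_filt i) (coord_nonzero (grass_step (Suc i)) T)" for T
    using kreg(1)[where c = 0] by (simp add: restr_def)
  show "(0 :: int set \<times> (int \<Rightarrow> 'k) set \<Rightarrow> 'k) \<in> psections i" unfolding sections_iff by (simp add: z)
  fix s :: "int set \<times> (int \<Rightarrow> 'k) set \<Rightarrow> 'k" assume s: "s \<in> psections i"
  show "s + t \<in> psections i" if t: "t \<in> psections i" for t
    unfolding sections_iff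
  proof (intro conjI ballI allI impI)
    fix S T and W :: "(int \<Rightarrow> 'k) set" assume ST: "S \<in> maya_inf" "T \<in> maya_inf"
      and W: "W \<in> coord_nonzero (grass_step (Suc i)) S \<inter> coord_nonzero (grass_step (Suc i)) T"
    show "(s + t) (S, W) = pv W T / pv W S * (s + t) (T, W)"
      unfolding plus_fun_def section_trans[OF s ST W] section_trans[OF t ST W] by (rule distrib_left[symmetric])
  next
    fix T assume T: "T \<in> maya_inf"
    show "(\<lambda>W. (s + t) (T, W)) \<in> reg (grass_filt i) (coord_nonzero (grass_step (Suc i)) T)"
      unfolding plus_fun_def by (rule kreg(2)[OF section_reg[OF s T] section_reg[OF t T]])
  qed (simp add: section_zero[OF s] section_zero[OF t])
  fix c
  have "(\<lambda>W. fscale c s (T, W) :: 'k) \<in> reg (grass_filt i) (coord_nonzero (grass_step (Suc i)) T)" if "T \<in> maya_inf" for T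
  proof -
    have "(\<lambda>W. fscale c s (T, W)) = (\<lambda>W. restr (coord_nonzero (grass_step (Suc i)) T) (\<lambda>_. c) W * s (T, W))"
    proof
      fix W show "fscale c s (T, W) = restr (coord_nonzero (grass_step (Suc i)) T) (\<lambda>_. c) W * s (T, W)"
        using section_zero[OF s, of T W]
        by (cases "W \<in> coord_nonzero (grass_step (Suc i)) T") (simp_all add: fscale_def restr_def)
    qed
    then show ?thesis using kreg(3)[OF kreg(1) section_reg[OF s that]] by simp
  qed
  then show "fscale c s \<in> psections i"
    unfolding sections_iff
  proof (intro conjI ballI allI impI)
    fix S T and W :: "(int \<Rightarrow> 'k) set" assume ST: "S \<in> maya_inf" "T \<in> maya_inf"
      and W: "W \<in> coord_nonzero (grass_step (Suc i)) S \<inter> coord_nonzero (grass_step (Suc i)) T"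
    show "fscale c s (S, W) = pv W T / pv W S * fscale c s (T, W)"
      unfolding fscale_def section_trans[OF s ST W] by (rule mult.left_commute)
  qed (simp_all add: fscale_def section_zero[OF s])
qed

text \<open>Alternating forms live on all sequences of vectors. Cutting the columns down to the box
  of level \<open>n\<close> extends functions of frames to them without changing the minors.\<close>

definition box_proj :: "nat \<Rightarrow> (nat \<Rightarrow> int \<Rightarrow> 'k::field) \<Rightarrow> nat \<Rightarrow> int \<Rightarrow> 'k" where
  "box_proj n w c = restr {- int n..<int n} (w c)"

definition frame_space :: "nat \<Rightarrow> (nat \<Rightarrow> int \<Rightarrow> 'k::field) \<Rightarrow> (int \<Rightarrow> 'k) set" where
  "frame_space n w = grass_incl n (colspan n (box_proj n w))"

text \<open>The function on frames that corresponds to a section: it is homogeneous of degree one in the vector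
  of maximal minors.\<close>

definition section_form :: "nat \<Rightarrow> (int set \<times> (int \<Rightarrow> 'k::field) set \<Rightarrow> 'k) \<Rightarrow> (nat \<Rightarrow> int \<Rightarrow> 'k) \<Rightarrow> 'k" where
  "section_form n s w = (if \<exists>S\<in>maya n. pext n w S \<noteq> 0
     then let S = (SOME S. S \<in> maya n \<and> pext n w S \<noteq> 0) in s (S, frame_space n w) * pext n w S else 0)"

lemma row_at_minor_set:
  assumes "J \<in> minor_sets m n" "r < m"
  shows "row_at J r \<in> {- int m..<int n}"
proof -
  have "J \<subseteq> {- int m..<int n}" using assms(1) by (simp add: minor_sets_def)
  moreover have "row_at J r \<in> J"
    by (rule row_at_in[OF conjunct1[OF finite_minor_set[OF assms(1)]] conjunct2[OF finite_minor_set[OF assms(1)]] assms(2)])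
  ultimately show ?thesis by blast
qed

lemma minor_box_proj: "J \<in> minor_sets n n \<Longrightarrow> minor n (box_proj n w) J = minor n w J"
proof (rule dform_cong)
  fix r c assume "J \<in> minor_sets n n" "r < n"
  then have "row_at J r \<in> {- int n..<int n}" by (rule row_at_minor_set)
  then show "box_proj n w c (row_at J r) = w c (row_at J r)" by (simp add: box_proj_def restr_def)
qed

lemma pext_box_proj: "pext n (box_proj n w) = pext n w"
proof
  fix S show "pext n (box_proj n w) S = pext n w S"
    by (cases "S \<in> maya n") (auto simp: maya_def semi_Int minor_box_proj pext_def)
qed

lemma pext_nonzero_frame:
  assumes "pext n w S \<noteq> 0"
  shows "S \<in> maya n" "frame n n (box_proj n w)"
proof -
  show S: "S \<in> maya n" using assms by (auto simp: pext_def split: if_splits)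
  then obtain J where J: "J \<in> minor_sets n n" "S = semi n J" by (auto simp: maya_def)
  have "minor n (box_proj n w) J \<noteq> 0" using assms J by (simp add: pext_semi minor_box_proj)
  moreover have "box_proj n w c \<in> coord_space {- int n..<int n}" for c
    by (auto simp: box_proj_def coord_space_def restr_def)
  ultimately show "frame n n (box_proj n w)" unfolding frame_iff_minor using J(1) by blast
qed

lemma frame_space_pv:
  assumes "pext n w S \<noteq> 0"
  shows "frame_space n w \<in> grass_step n" "\<exists>a. a \<noteq> 0 \<and> pext n w = fscale a (pv (frame_space n w))"
proof -
  note f = pext_nonzero_frame(2)[OF assms]
  show "frame_space n w \<in> grass_step n" unfolding grass_step_frame frame_space_def using f by blast
  show "\<exists>a. a \<noteq> 0 \<and> pext n w = fscale a (pv (frame_space n w))"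
    using pv_frame[OF f] by (simp add: frame_space_def pext_box_proj)
qed

lemma maya_in_inf: "S \<in> maya (Suc i) \<Longrightarrow> S \<in> maya_inf"
  by (auto simp: maya_inf_def)

text \<open>The chart chosen by \<open>SOME\<close> is immaterial: the transition function cancels
  against the change of the minor.\<close>

lemma section_form_eq:
  assumes s: "s \<in> psections i" and S: "pext (Suc i) w S \<noteq> 0"
  shows "section_form (Suc i) s w = s (S, frame_space (Suc i) w) * pext (Suc i) w S"
proof -
  let ?n = "Suc i" and ?W = "frame_space (Suc i) w"
  define T where "T = (SOME S. S \<in> maya ?n \<and> pext ?n w S \<noteq> 0)"
  have ex: "\<exists>S. S \<in> maya ?n \<and> pext ?n w S \<noteq> 0" using S pext_nonzero_frame(1)[OF S] by blast
  then have T: "T \<in> maya ?n" "pext ?n w T \<noteq> 0" unfolding T_def by (rule someI2_ex, blast)+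
  obtain a where a: "a \<noteq> 0" "pext ?n w = fscale a (pv ?W)" using frame_space_pv(2)[OF S] by blast
  have aS: "pext ?n w R = a * pv ?W R" for R unfolding a(2) by (simp add: fscale_def)
  have "?W \<in> coord_nonzero (grass_step ?n) T \<inter> coord_nonzero (grass_step ?n) S"
    using frame_space_pv(1)[OF S] S T a(1) by (simp add: aS)
  then have "s (T, ?W) = pv ?W S / pv ?W T * s (S, ?W)"
    using section_trans[OF s] T(1) pext_nonzero_frame(1)[OF S] by (blast intro: maya_in_inf)
  then have "s (T, ?W) * pext ?n w T = s (S, ?W) * pext ?n w S"
    using T(2) by (simp add: aS)
  then show ?thesis using ex by (auto simp: section_form_def T_def Let_def)
qed

text \<open>Tuples with proportional nonzero vectors of minors have the same
  \<open>frame_space\<close>, since a point is determined by its coordinates up to a scalar. The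
  section then contributes the same value, and only the factor \<open>pext\<close> scales.\<close>

lemma section_form_proportional:
  assumes s: "s \<in> psections i" and p: "\<And>S. pext (Suc i) w' S = a * pext (Suc i) w S"
  shows "section_form (Suc i) s w' = a * section_form (Suc i) s w"
proof (cases "a \<noteq> 0 \<and> (\<exists>S. pext (Suc i) w S \<noteq> 0)")
  case False
  then have "\<not> (\<exists>S\<in>maya (Suc i). pext (Suc i) w' S \<noteq> 0)" using p by auto
  moreover have "a = 0 \<or> section_form (Suc i) s w = 0" using False by (auto simp: section_form_def)
  ultimately show ?thesis by (auto simp: section_form_def)
next
  case True
  then obtain S where S: "pext (Suc i) w S \<noteq> 0" "pext (Suc i) w' S \<noteq> 0" using p by auto
  let ?W = "frame_space (Suc i) w" and ?W' = "frame_space (Suc i) w'"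
  obtain b where b: "b \<noteq> 0" "pext (Suc i) w = fscale b (pv ?W)" using frame_space_pv(2)[OF S(1)] by blast
  obtain b' where b': "b' \<noteq> 0" "pext (Suc i) w' = fscale b' (pv ?W')" using frame_space_pv(2)[OF S(2)] by blast
  have "b' * pv ?W' R = a * (b * pv ?W R)" for R
    using p[of R] unfolding b(2) b'(2) by (simp add: fscale_def)
  then have e: "pv ?W' R = a * b / b' * pv ?W R" for R using b'(1) by (simp add: field_simps)
  have "?W = ?W'"
    by (rule pv_inj[OF frame_space_pv(1)[OF S(1)] frame_space_pv(1)[OF S(2)]]) (simp add: e)
  then show ?thesis
    unfolding section_form_eq[OF s S(1)] section_form_eq[OF s S(2)] by (simp add: p)
qed

lemma pext_alt_form: "alt_form n (\<lambda>w. pext n w S)"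
  by (cases "S \<in> maya n") (simp_all add: pext_def alt_form_tminor alt_form_0)

text \<open>Every point of the line is a frame once its columns are cut to the box, so the section
  is defined along all of it and is a fraction of polynomials in \<open>t\<close> near each
  parameter value.\<close>

lemma section_form_line:
  fixes s :: "int set \<times> (int \<Rightarrow> 'k::{alg_closed_field, field_char_0}) set \<Rightarrow> 'k"
  assumes s: "s \<in> psections i" and nz: "\<And>t. \<exists>S. pext (Suc i) (w(c := x + fscale t y)) S \<noteq> 0"
  shows "\<exists>p. \<forall>t. section_form (Suc i) s (w(c := x + fscale t y)) = poly p t"
proof (rule local_fraction_poly)
  fix t0 :: 'k
  let ?n = "Suc i" and ?A = "grass_step (Suc i) :: (int \<Rightarrow> 'k) set set"
  define wt where "wt = (\<lambda>t. w(c := x + fscale t y))"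
  define Mp where "Mp = (\<lambda>d i. if d = c then [:x i, y i:] else [:w d i:])"
  have "wt t = (\<lambda>d i. poly (Mp d i) t)" for t
    by (auto simp: wt_def Mp_def fun_eq_iff fscale_def)
  then have pM: "pext ?n (wt t) S = poly (pext ?n Mp S) t" for t S
    using comm_ring_hom.hom_pext[OF comm_ring_hom_poly[of t], of ?n Mp S] by simp
  have ev: "mp_eval (pext ?n (wt t)) q = poly (mp_hom (\<lambda>c. [:c:]) (pext ?n Mp) q) t" for t q
  proof -
    have "pext ?n (wt t) = (\<lambda>S. poly (pext ?n Mp S) t)" using pM by (rule ext)
    then show ?thesis by (simp only: mp_eval_poly)
  qed
  obtain S where S: "pext ?n (wt t0) S \<noteq> 0" using nz[of t0] wt_def by auto
  have SM: "S \<in> maya_inf" using maya_in_inf pext_nonzero_frame(1)[OF S] by blast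
  let ?W = "\<lambda>t. frame_space ?n (wt t)"
  have pv_ev: "?W t \<in> ?A \<and> (\<exists>a. a \<noteq> 0 \<and> pext ?n (wt t) = fscale a (pv (?W t)))" for t
    using frame_space_pv nz[of t] unfolding wt_def by blast
  interpret presented "grass_filt i" ?A "fractions homogeneous ?A pv" by (rule presented_grass_filt)
  have W0: "?W t0 \<in> coord_nonzero ?A S"
    using pv_ev[of t0] S by (auto simp: fscale_def)
  have "(\<lambda>W. s (S, W)) \<in> reg (grass_filt i) (coord_nonzero ?A S)" by (rule section_reg[OF s SM])
  then obtain D g where D: "fractions homogeneous ?A pv D g" "?W t0 \<in> D" "D \<subseteq> coord_nonzero ?A S" "\<forall>W\<in>D. s (S, W) = g W"
    using regE[OF open_coord_nonzero _ W0] by blast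
  then obtain d p q where pq: "homogeneous d p" "homogeneous d q" "D = {W\<in>?A. mp_eval (pv W) q \<noteq> 0}"
    "\<forall>W\<in>D. g W = mp_eval (pv W) p / mp_eval (pv W) q" unfolding fractions_def by blast
  let ?P = "mp_hom (\<lambda>c. [:c:]) (pext ?n Mp) p" and ?Q = "mp_hom (\<lambda>c. [:c:]) (pext ?n Mp) q"
  have iff: "poly ?Q t \<noteq> 0 \<longleftrightarrow> ?W t \<in> D" for t
  proof -
    obtain a where "a \<noteq> 0" "pext ?n (wt t) = fscale a (pv (?W t))" using pv_ev[of t] by blast
    then show ?thesis unfolding ev[symmetric] pq(3) using pv_ev[of t] by (simp add: mp_eval_fscale[OF pq(2)])
  qed
  \<comment> \<open>The factor \<open>pext ?n Mp S\<close> comes from \<open>section_form\<close>;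
    the quotient of forms of equal degree does not change when \<open>pv\<close> is replaced by the
    minors of the frame.\<close>
  have val: "section_form ?n s (wt t) = poly (?P * pext ?n Mp S) t / poly ?Q t" if t: "poly ?Q t \<noteq> 0" for t
  proof -
    have WD: "?W t \<in> D" using t iff by blast
    obtain a where a: "a \<noteq> 0" "pext ?n (wt t) = fscale a (pv (?W t))" using pv_ev[of t] by blast
    have "pv (?W t) S \<noteq> 0" using WD D(3) by blast
    then have "pext ?n (wt t) S \<noteq> 0" unfolding a(2) using a(1) by (simp add: fscale_def)
    then have "section_form ?n s (wt t) = s (S, ?W t) * pext ?n (wt t) S" by (rule section_form_eq[OF s])
    also have "s (S, ?W t) = mp_eval (pv (?W t)) p / mp_eval (pv (?W t)) q" using D(4) pq(4) WD by simp
    also have "\<dots> = mp_eval (pext ?n (wt t)) p / mp_eval (pext ?n (wt t)) q"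
      unfolding a(2) using a(1) by (simp add: mp_eval_fscale[OF pq(1)] mp_eval_fscale[OF pq(2)])
    finally show ?thesis unfolding ev pM by simp
  qed
  show "\<exists>A B. poly B t0 \<noteq> 0 \<and> (\<forall>t. poly B t \<noteq> 0 \<longrightarrow> section_form ?n s (w(c := x + fscale t y)) = poly A t / poly B t)"
    using iff[of t0] D(2) val unfolding wt_def by blast
qed

text \<open>If \<open>u\<close> and \<open>v\<close> are independent modulo the other columns, then \<open>t \<mapsto> u + t v\<close> is an affine line of
  frames, on which the form is a polynomial; by homogeneity, its degree is at most one.\<close>

lemma alt_form_section:
  fixes s :: "int set \<times> (int \<Rightarrow> 'k::{alg_closed_field, field_char_0}) set \<Rightarrow> 'k"
  assumes s: "s \<in> psections i"
  shows "alt_form (Suc i) (section_form (Suc i) s)"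
proof (rule alt_formI)
  let ?n = "Suc i" and ?F = "section_form (Suc i) s"
  fix w w' :: "nat \<Rightarrow> int \<Rightarrow> 'k" assume "\<And>c. c < ?n \<Longrightarrow> w c = w' c"
  then have "pext ?n w' S = 1 * pext ?n w S" for S using alt_form_cong[OF pext_alt_form[of ?n S], of w w'] by simp
  then have "?F w' = 1 * ?F w" by (rule section_form_proportional[OF s])
  then show "?F w = ?F w'" by simp
next
  let ?n = "Suc i" and ?F = "section_form (Suc i) s"
  fix w :: "nat \<Rightarrow> int \<Rightarrow> 'k" and c d assume "c < ?n" "d < ?n" "c \<noteq> d" "w c = w d"
  then have "pext ?n w S = 0" for S by (rule alt_form_eq[OF pext_alt_form])
  then show "?F w = 0" by (simp add: section_form_def)
next
  let ?n = "Suc i" and ?F = "section_form (Suc i) s"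
  fix w :: "nat \<Rightarrow> int \<Rightarrow> 'k" and c a u assume "c < ?n"
  then show "?F (w(c := fscale a u)) = a * ?F (w(c := u))"
    by (intro section_form_proportional[OF s] alt_form_scale[OF pext_alt_form])
next
  let ?n = "Suc i" and ?F = "section_form (Suc i) s"
  fix w :: "nat \<Rightarrow> int \<Rightarrow> 'k" and c u v assume c: "c < ?n"
  let ?p = "\<lambda>x S. pext ?n (w(c := x)) S" and ?f = "\<lambda>x. ?F (w(c := x))"
  have p_add: "?p (x + y) S = ?p x S + ?p y S" for x y S by (rule alt_form_add[OF pext_alt_form c])
  have p_scale: "?p (fscale a x) S = a * ?p x S" for a x S by (rule alt_form_scale[OF pext_alt_form c])
  have f_scale: "?f (fscale a x) = a * ?f x" for a x
    by (intro section_form_proportional[OF s] p_scale)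
  \<comment> \<open>If one vector of minors is a multiple of the other, homogeneity alone gives
    additivity.\<close>
  have dep: "?f (x + y) = ?f x + ?f y" if "\<And>S. ?p x S = b * ?p y S" for x y b
  proof -
    have "?f x = b * ?f y" by (rule section_form_proportional[OF s that])
    moreover have "?f (x + y) = (b + 1) * ?f y"
      by (rule section_form_proportional[OF s]) (simp only: p_add that distrib_right mult_1)
    ultimately show ?thesis by (simp add: algebra_simps)
  qed
  show "?f (u + v) = ?f u + ?f v"
  proof (cases "(\<forall>t. \<exists>S. ?p (u + fscale t v) S \<noteq> 0) \<and> (\<forall>t. \<exists>S. ?p (v + fscale t u) S \<noteq> 0)")
    case True
    obtain p where p: "\<And>t. ?f (u + fscale t v) = poly p t" using section_form_line[OF s] True by blast
    obtain q where q: "\<And>t. ?f (v + fscale t u) = poly q t" using section_form_line[OF s] True by blast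
    \<comment> \<open>\<open>u + t v\<close> is \<open>t\<close> times \<open>v + (1 / t) u\<close>,
      and the form is homogeneous in column \<open>c\<close>.\<close>
    have "poly p t = t * poly q (1 / t)" if "t \<noteq> 0" for t
    proof -
      have "u + fscale t v = fscale t (v + fscale (1 / t) u)"
        using that by (simp add: fun_vs.scale_right_distrib)
      then show ?thesis using f_scale[of t "v + fscale (1 / t) u"] p[of t] q[of "1 / t"] by simp
    qed
    then have "poly p 1 = poly p 0 + poly q 0" by (rule poly_linear_of_symmetric)
    then show ?thesis using p[of 1] p[of 0] q[of 0] by simp
  next
    case False
    \<comment> \<open>A parameter at which all minors vanish makes the minors of \<open>u\<close> a
      multiple of those of \<open>v\<close>, or conversely.\<close>
    then obtain t where "(\<forall>S. ?p (u + fscale t v) S = 0) \<or> (\<forall>S. ?p (v + fscale t u) S = 0)" by blast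
    then have "(\<forall>S. ?p u S = - t * ?p v S) \<or> (\<forall>S. ?p v S = - t * ?p u S)"
      unfolding p_add p_scale by (simp add: eq_neg_iff_add_eq_0)
    then show ?thesis using dep[of u "- t" v] dep[of v "- t" u] by (auto simp: add.commute)
  qed
qed

section \<open>The coordinate sections as a basis\<close>

lemma section_expand:
  fixes s :: "int set \<times> (int \<Rightarrow> 'k::{alg_closed_field, field_char_0}) set \<Rightarrow> 'k"
  assumes s: "s \<in> psections i"
  shows "\<exists>\<kappa>. s = (\<Sum>K\<in>minor_sets (Suc i) (Suc i). fscale (\<kappa> K) (psec i (semi (Suc i) K)))"
proof (intro exI ext)
  let ?n = "Suc i" and ?F = "section_form (Suc i) s"
  \<comment> \<open>The coefficients of an alternating form in the minors are its values at the
    coordinate frames.\<close>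
  let ?k = "\<lambda>K. ?F (\<lambda>c. std_vec (row_at K c))"
  let ?A = "grass_step (Suc i) :: (int \<Rightarrow> 'k) set set"
  fix TW :: "int set \<times> (int \<Rightarrow> 'k) set"
  obtain T W where TW: "TW = (T, W)" by (cases TW)
  let ?sum = "\<Sum>K\<in>minor_sets ?n ?n. fscale (?k K) (psec i (semi ?n K))"
  have sum: "?sum (T, W) = (\<Sum>K\<in>minor_sets ?n ?n. ?k K * psec i (semi ?n K) (T, W))"
    by (simp add: sum_fun_apply fscale_def)
  show "s TW = ?sum TW"
  proof (cases "T \<in> maya_inf \<and> W \<in> coord_nonzero ?A T")
    case False
    then have "psec i S (T, W) = 0" for S unfolding psec_def by auto
    moreover have "s (T, W) = 0" using section_zero[OF s, of T W] False by blast
    ultimately show ?thesis unfolding TW sum by simp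
  next
    case True
    then obtain w where w: "frame ?n ?n w" "W = grass_incl ?n (colspan ?n w)" unfolding grass_step_frame by blast
    have wI: "\<And>c. c < ?n \<Longrightarrow> w c \<in> coord_space {- int ?n..<int ?n}" using w(1) by (simp add: frame_def)
    then have "box_proj ?n w c = w c" if "c < ?n" for c
      using that by (fastforce simp: box_proj_def restr_def coord_space_def)
    then have W: "frame_space ?n w = W" unfolding frame_space_def w(2) using colspan_cong by metis
    obtain a where a: "a \<noteq> 0" "pext ?n w = fscale a (pv W)" using pv_frame[OF w(1)] w(2) by blast
    have aS: "pext ?n w S = a * pv W S" for S unfolding a(2) by (simp add: fscale_def)
    have nzT: "pext ?n w T \<noteq> 0" using True a(1) by (simp add: aS)
    have "s (T, W) * pext ?n w T = ?F w" using section_form_eq[OF s nzT] W by simp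
    also have "\<dots> = (\<Sum>K\<in>minor_sets ?n ?n. ?k K * minor ?n w K)"
      unfolding minor_sets_msubsets by (rule alt_form_expand[OF alt_form_section[OF s]]) (use wI in auto)
    also have "\<dots> = (\<Sum>K\<in>minor_sets ?n ?n. ?k K * (psec i (semi ?n K) (T, W) * pext ?n w T))"
    proof (intro sum.cong refl arg_cong2[where f = "(*)"])
      fix K assume "K \<in> minor_sets ?n ?n"
      then have "minor ?n w K = a * pv W (semi ?n K)" using pext_semi[of K ?n w] aS[of "semi ?n K"] by simp
      then show "minor ?n w K = psec i (semi ?n K) (T, W) * pext ?n w T"
        using True unfolding psec_def aS by simp
    qed
    also have "\<dots> = ?sum (T, W) * pext ?n w T" unfolding sum by (simp add: sum_distrib_right mult.assoc)
    finally show ?thesis using nzT unfolding TW by simp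
  qed
qed

lemma sections_span:
  "psections i = fun_vs.span (psec i ` maya (Suc i) :: (int set \<times> (int \<Rightarrow> 'k::{alg_closed_field, field_char_0}) set \<Rightarrow> 'k) set)"
proof
  show "fun_vs.span (psec i ` maya (Suc i)) \<subseteq> psections i"
    by (rule fun_vs.span_minimal[OF _ subspace_sections]) (use psec_section in blast)
  show "psections i \<subseteq> fun_vs.span (psec i ` maya (Suc i) :: (int set \<times> (int \<Rightarrow> 'k) set \<Rightarrow> 'k) set)"
  proof
    fix s :: "int set \<times> (int \<Rightarrow> 'k) set \<Rightarrow> 'k" assume "s \<in> psections i"
    then obtain \<kappa> where s: "s = (\<Sum>K\<in>minor_sets (Suc i) (Suc i). fscale (\<kappa> K) (psec i (semi (Suc i) K)))"
      using section_expand by blast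
    show "s \<in> fun_vs.span (psec i ` maya (Suc i))"
      unfolding s by (intro fun_vs.span_sum fun_vs.span_scale fun_vs.span_base) (auto simp: maya_def)
  qed
qed

text \<open>Evaluation at \<open>e a\<close> is 1 at \<open>f a\<close> and 0 on the span of the
  others.\<close>

lemma independent_of_dual:
  assumes e: "\<And>a b. a \<in> M \<Longrightarrow> b \<in> M \<Longrightarrow> f a (e b) = (if a = b then 1 else 0 :: 'k::field)"
  shows "inj_on f M" "\<not> fun_vs.dependent (f ` M)"
proof -
  show inj: "inj_on f M"
  proof (rule inj_onI)
    fix a b assume ab: "a \<in> M" "b \<in> M" "f a = f b"
    have "f b (e a) = 1" unfolding ab(3)[symmetric] e[OF ab(1,1)] by simp
    then show "a = b" unfolding e[OF ab(2,1)] by (metis zero_neq_one)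
  qed
  show "\<not> fun_vs.dependent (f ` M)"
  proof
    assume "fun_vs.dependent (f ` M)"
    then obtain a where a: "a \<in> M" "f a \<in> fun_vs.span (f ` M - {f a})" by (auto simp: fun_vs.dependent_def)
    have "fun_vs.subspace {v. v (e a) = 0}" by (auto simp: fun_vs.subspace_def fscale_def)
    moreover have "v (e a) = 0" if v: "v \<in> f ` M - {f a}" for v
    proof -
      obtain b where "b \<in> M" "v = f b" using v by blast
      then show ?thesis using e[of b a] a(1) v by auto
    qed
    ultimately have "f a (e a) = 0" by (rule fun_vs.span_induct[OF a(2)])
    then show False using e a(1) by simp
  qed
qed

text \<open>The dual points are the coordinate subspaces, each taken in its own chart; the
  coordinates there are 1 at its own index and 0 at the others.\<close>

lemma psec_dual:
  "\<exists>e. \<forall>S\<in>maya (Suc i). \<forall>T\<in>maya (Suc i). psec i S (e T) = (if S = T then 1 else 0 :: 'k::field)"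
proof (intro exI[of _ "\<lambda>T. (T, grass_incl (Suc i) (colspan (Suc i) (\<lambda>c. std_vec (row_at (T \<inter> {- int (Suc i)..}) c))))"] ballI)
  let ?n = "Suc i"
  fix S T assume "S \<in> maya ?n" "T \<in> maya ?n"
  then obtain K J where K: "K \<in> minor_sets ?n ?n" "S = semi ?n K" and J: "J \<in> minor_sets ?n ?n" "T = semi ?n J"
    by (auto simp: maya_def)
  let ?w = "\<lambda>c. std_vec (row_at J c) :: int \<Rightarrow> 'k" and ?W = "grass_incl ?n (colspan ?n (\<lambda>c. std_vec (row_at J c) :: int \<Rightarrow> 'k))"
  have m: "minor ?n ?w K = (if K = J then 1 else 0)" if "K \<in> minor_sets ?n ?n" for K
    using minor_std_vec[of K ?n "{- int ?n..<int ?n}" J] that J(1) by (simp add: minor_sets_msubsets)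
  have "normal_frame ?n J ?w"
    unfolding normal_frame_def
  proof (intro conjI allI impI)
    fix c assume "c < ?n"
    then have "row_at J c \<in> {- int ?n..<int ?n}" by (rule row_at_minor_set[OF J(1)])
    then show "?w c \<in> coord_space {- int ?n..<int ?n}" by (auto simp: coord_space_def std_vec_def)
  next
    fix r c assume "r < ?n" "c < ?n"
    then show "?w c (row_at J r) = (if r = c then 1 else 0)"
      using row_at_eq_iff[of J ?n r c] finite_minor_set[OF J(1)] by (simp add: std_vec_def)
  qed
  note p = pv_normal[OF this J(1) refl]
  have "psec i S (T, ?W) = pext ?n ?w S"
    using p(1,2) p(3)[of S] maya_in_inf[OF \<open>T \<in> maya ?n\<close>] unfolding psec_def J(2) by simp
  also have "\<dots> = (if S = T then 1 else 0)"
    unfolding K(2) pext_semi[OF K(1)] m[OF K(1)] J(2)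
    using inj_onD[OF inj_on_semi _ K(1) J(1)] by auto
  finally show "psec i S (T, grass_incl ?n (colspan ?n (\<lambda>c. std_vec (row_at (T \<inter> {- int ?n..}) c)))) = (if S = T then 1 else 0 :: 'k)"
    unfolding J(2) semi_Int[OF J(1)] .
qed

lemma psec_independent:
  "inj_on (psec i :: int set \<Rightarrow> int set \<times> (int \<Rightarrow> 'k::field) set \<Rightarrow> 'k) (maya (Suc i))"
  "\<not> fun_vs.dependent (psec i ` maya (Suc i) :: (int set \<times> (int \<Rightarrow> 'k::field) set \<Rightarrow> 'k) set)"
proof -
  obtain e where e: "\<forall>S\<in>maya (Suc i). \<forall>T\<in>maya (Suc i). psec i S (e T) = (if S = T then 1 else 0 :: 'k)"
    using psec_dual by blast
  show "inj_on (psec i :: _ \<Rightarrow> _ \<Rightarrow> 'k) (maya (Suc i))"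
    by (rule independent_of_dual(1)[of _ _ e]) (use e in blast)
  show "\<not> fun_vs.dependent (psec i ` maya (Suc i) :: (int set \<times> (int \<Rightarrow> 'k::field) set \<Rightarrow> 'k) set)"
    by (rule independent_of_dual(2)[of _ _ e]) (use e in blast)
qed

lemma restrict_psec: "restrict_section (grass_step (Suc i)) (psec (Suc i) S) = psec i S"
  using grass_step_mono[of "Suc i" "Suc (Suc i)"] by (auto simp: restrict_section_def psec_def fun_eq_iff)

text \<open>Restriction sends the coordinate section of an index to the one of the same index, and
  the indices of the lower level are among those of the higher one.\<close>

lemma restrict_sections:
  "restrict_section (grass_step (Suc i)) ` psections (Suc i) =
    (psections i :: (int set \<times> (int \<Rightarrow> 'k::{alg_closed_field, field_char_0}) set \<Rightarrow> 'k) set)"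
proof -
  let ?r = "restrict_section (grass_step (Suc i)) :: (int set \<times> (int \<Rightarrow> 'k) set \<Rightarrow> 'k) \<Rightarrow> _"
  interpret r: Vector_Spaces.linear fscale fscale ?r
    by unfold_locales (auto simp: restrict_section_def fscale_def fun_eq_iff)
  have "?r ` psections (Suc i) = fun_vs.span (?r ` psec (Suc i) ` maya (Suc (Suc i)))"
    unfolding sections_span by (rule r.span_image[symmetric])
  also have "?r ` psec (Suc i) ` maya (Suc (Suc i)) = psec i ` maya (Suc (Suc i))"
    by (simp add: image_image restrict_psec)
  also have "fun_vs.span (psec i ` maya (Suc (Suc i))) =
      (psections i :: (int set \<times> (int \<Rightarrow> 'k) set \<Rightarrow> 'k) set)"
  proof
    show "fun_vs.span (psec i ` maya (Suc (Suc i))) \<subseteq>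
        (psections i :: (int set \<times> (int \<Rightarrow> 'k) set \<Rightarrow> 'k) set)"
      by (rule fun_vs.span_minimal[OF _ subspace_sections]) (use psec_section in blast)
    show "psections i \<subseteq> fun_vs.span (psec i ` maya (Suc (Suc i)) :: (int set \<times> (int \<Rightarrow> 'k) set \<Rightarrow> 'k) set)"
      unfolding sections_span by (intro fun_vs.span_mono image_mono maya_Suc)
  qed
  finally show ?thesis .
qed


section \<open>The Pluecker embedding\<close>

lemma vline_fscale:
  fixes v :: "'a \<Rightarrow> 'k::field"
  assumes "a \<noteq> 0"
  shows "vline (fscale a v) = vline v"
proof -
  have "fscale c v = fscale (c / a) (fscale a v)" for c using assms by simp
  then have "\<exists>b. fscale c v = fscale b (fscale a v)" for c by blast
  moreover have "\<exists>b. fscale c (fscale a v) = fscale b v" for c by auto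
  ultimately show ?thesis unfolding vline_def by blast
qed

lemma in_vline: "v \<in> vline v"
proof -
  have "v = fscale 1 v" by simp
  then show ?thesis unfolding vline_def by blast
qed

text \<open>Evaluation at \<open>W\<close>, rescaled by \<open>pv W S\<close> to be independent of
  the chart. At \<open>psec i T\<close> it takes the value \<open>pv W T\<close>, so it is a
  coordinate vector of the image point.\<close>

definition eval_fun :: "nat \<Rightarrow> (int \<Rightarrow> 'k::field) set \<Rightarrow> (int set \<times> (int \<Rightarrow> 'k) set \<Rightarrow> 'k) \<Rightarrow> 'k" where
  "eval_fun i W = (let S = (SOME S. S \<in> maya (Suc i) \<and> pv W S \<noteq> 0)
     in restr (psections i) (\<lambda>s. pv W S * s (S, W)))"

lemma eval_fun_eq:
  assumes T: "T \<in> maya_inf" "W \<in> coord_nonzero (grass_step (Suc i)) T"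
  shows "eval_fun i W = restr (psections i) (\<lambda>s. pv W T * s (T, W))"
proof -
  define S where "S = (SOME S. S \<in> maya (Suc i) \<and> pv W S \<noteq> 0)"
  have "\<exists>S. S \<in> maya (Suc i) \<and> pv W S \<noteq> 0" using pv_nonzero[of W "Suc i"] T(2) by blast
  then have S: "S \<in> maya (Suc i) \<and> pv W S \<noteq> 0" unfolding S_def by (rule someI_ex)
  have "pv W S * s (S, W) = pv W T * s (T, W)" if s: "s \<in> psections i" for s
  proof -
    have "s (S, W) = pv W T / pv W S * s (T, W)"
      by (rule section_trans[OF s]) (use S T maya_in_inf in auto)
    then show ?thesis using S by simp
  qed
  then show ?thesis unfolding eval_fun_def S_def[symmetric] Let_def by (auto simp: restr_def)
qed

lemma nonzero_chart:
  assumes "W \<in> grass_step (Suc i)"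
  obtains T where "T \<in> maya_inf" "W \<in> coord_nonzero (grass_step (Suc i)) T"
proof -
  obtain T where "T \<in> maya (Suc i)" "pv W T \<noteq> 0" using pv_nonzero[OF assms] by blast
  then show thesis using that[of T] assms maya_in_inf by blast
qed

lemma embedding_vline:
  assumes W: "W \<in> grass_step (Suc i)"
  shows "embedding_at grass_filt pluecker_bundle i W = vline (eval_fun i W)"
proof -
  have emb: "embedding_at grass_filt pluecker_bundle i W =
      {restr (psections i) (\<lambda>s. c * s (S, W)) | c S. S \<in> maya_inf \<and> W \<in> coord_nonzero (grass_step (Suc i)) S}"
    unfolding embedding_at_def linear_system_map_def sections_at_def[symmetric] by (simp add: bundle_at_pluecker)
  have eq: "restr (psections i) (\<lambda>s. c * s (S, W)) = fscale (c / pv W S) (eval_fun i W)"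
    if S: "S \<in> maya_inf" "W \<in> coord_nonzero (grass_step (Suc i)) S" for S c
    unfolding eval_fun_eq[OF S] using S(2) by (auto simp: restr_def fscale_def)
  show ?thesis
  proof (intro equalityI subsetI)
    fix \<phi> assume "\<phi> \<in> embedding_at grass_filt pluecker_bundle i W"
    then show "\<phi> \<in> vline (eval_fun i W)" unfolding emb vline_def using eq by blast
  next
    fix \<phi> assume "\<phi> \<in> vline (eval_fun i W)"
    then obtain c where c: "\<phi> = fscale c (eval_fun i W)" unfolding vline_def by blast
    obtain T where T: "T \<in> maya_inf" "W \<in> coord_nonzero (grass_step (Suc i)) T" by (rule nonzero_chart[OF W])
    have "\<phi> = restr (psections i) (\<lambda>s. (c * pv W T) * s (T, W))"
      unfolding eq[OF T] c using T(2) by simp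
    then show "\<phi> \<in> embedding_at grass_filt pluecker_bundle i W" unfolding emb using T by blast
  qed
qed

lemma eval_fun_psec:
  assumes W: "W \<in> grass_step (Suc i)"
  shows "eval_fun i W (psec i S) = pv W S"
proof -
  obtain T where T: "T \<in> maya_inf" "W \<in> coord_nonzero (grass_step (Suc i)) T" by (rule nonzero_chart[OF W])
  have "psec i S (T, W) = pv W S / pv W T" using T unfolding psec_def by simp
  then show ?thesis unfolding eval_fun_eq[OF T] restr_def using T(2) by (simp add: psec_section)
qed

lemma fscale_apply: "fscale c v x = c * v x"
  by (simp add: fscale_def)

lemma dual_spaceI:
  assumes V: "fun_vs.subspace V" and "\<And>v w. \<phi> (v + w) = \<phi> v + \<phi> w" "\<And>c v. \<phi> (fscale c v) = c * \<phi> v"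
  shows "restr V \<phi> \<in> dual_space V"
  unfolding dual_space_def restr_def using assms(2,3) fun_vs.subspace_add[OF V] fun_vs.subspace_scale[OF V] by simp

lemma dual_space_0:
  assumes "\<phi> \<in> dual_space V" "fun_vs.subspace V"
  shows "\<phi> 0 = 0"
proof -
  have "\<phi> (fscale 0 0) = 0 * \<phi> 0"
    using assms(1) fun_vs.subspace_0[OF assms(2)] unfolding dual_space_def by blast
  then show ?thesis by simp
qed

lemma eval_fun_dual:
  assumes W: "W \<in> grass_step (Suc i)"
  shows "eval_fun i W \<in> dual_space (psections i) - {0}"
proof -
  obtain T where T: "T \<in> maya_inf" "W \<in> coord_nonzero (grass_step (Suc i)) T" by (rule nonzero_chart[OF W])
  have "eval_fun i W (psec i T) \<noteq> 0" using eval_fun_psec[OF W] T by simp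
  moreover have "eval_fun i W \<in> dual_space (psections i)"
    unfolding eval_fun_eq[OF T]
    by (rule dual_spaceI[OF subspace_sections]) (simp_all add: fscale_apply distrib_left)
  ultimately show ?thesis by auto
qed

lemma dual_space_fscale: "\<phi> \<in> dual_space V \<Longrightarrow> fscale c \<phi> \<in> dual_space V"
  by (auto simp: dual_space_def fscale_def algebra_simps)

lemma dual_space_eqI:
  fixes \<phi> \<psi> :: "(int set \<times> (int \<Rightarrow> 'k::{alg_closed_field, field_char_0}) set \<Rightarrow> 'k) \<Rightarrow> 'k"
  assumes \<phi>: "\<phi> \<in> dual_space (psections i)" and \<psi>: "\<psi> \<in> dual_space (psections i)"
    and eq: "\<And>S. S \<in> maya (Suc i) \<Longrightarrow> \<phi> (psec i S) = \<psi> (psec i S)"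
  shows "\<phi> = \<psi>"
proof
  have ss: "fun_vs.subspace (psections i :: (int set \<times> (int \<Rightarrow> 'k) set \<Rightarrow> 'k) set)" by (rule subspace_sections)
  fix s :: "int set \<times> (int \<Rightarrow> 'k) set \<Rightarrow> 'k"
  show "\<phi> s = \<psi> s"
  proof (cases "s \<in> psections i")
    case True
    have "fun_vs.subspace {s \<in> psections i. \<phi> s = \<psi> s}"
      unfolding fun_vs.subspace_def
    proof (intro conjI ballI allI)
      show "0 \<in> {s \<in> psections i. \<phi> s = \<psi> s}"
        using fun_vs.subspace_0[OF ss] dual_space_0[OF \<phi> ss] dual_space_0[OF \<psi> ss] by simp
      fix x y c assume x: "x \<in> {s \<in> psections i. \<phi> s = \<psi> s}"
      show "x + y \<in> {s \<in> psections i. \<phi> s = \<psi> s}" if y: "y \<in> {s \<in> psections i. \<phi> s = \<psi> s}" for y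
        using x y \<phi> \<psi> fun_vs.subspace_add[OF ss] unfolding dual_space_def by auto
      show "fscale c x \<in> {s \<in> psections i. \<phi> s = \<psi> s}" for c
        using x \<phi> \<psi> fun_vs.subspace_scale[OF ss] unfolding dual_space_def by auto
    qed
    moreover have "psec i ` maya (Suc i) \<subseteq> {s \<in> psections i. \<phi> s = \<psi> s}"
      using eq psec_section by blast
    ultimately have "fun_vs.span (psec i ` maya (Suc i)) \<subseteq> {s \<in> psections i. \<phi> s = \<psi> s}"
      by (intro fun_vs.span_minimal)
    then show ?thesis using True unfolding sections_span by blast
  next
    case False
    then show ?thesis using \<phi> \<psi> by (simp add: dual_space_def)
  qed
qed

section \<open>Equations for the image and very ampleness\<close>

lemma homogeneous_det:
  assumes "\<And>c r. homogeneous 1 (M c r)"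
  shows "homogeneous n (tminor n M \<rho>)"
proof -
  have "homogeneous n (signof p * (\<Prod>k = 0..<n. mat n n (\<lambda>(r, c). M c (\<rho> r)) $$ (k, p k)))"
    if p: "p permutes {0..<n}" for p
  proof -
    have eq: "(\<Prod>k = 0..<n. mat n n (\<lambda>(r, c). M c (\<rho> r)) $$ (k, p k)) = (\<Prod>k = 0..<n. M (p k) (\<rho> k))"
      using permutes_in_image[OF p] by (intro prod.cong) auto
    have "homogeneous (\<Sum>k = 0..<n. 1) (\<Prod>k = 0..<n. M (p k) (\<rho> k))"
      by (rule homogeneous_prod) (rule assms)
    then have h: "homogeneous n (\<Prod>k = 0..<n. M (p k) (\<rho> k))" by simp
    show ?thesis
      unfolding eq using h homogeneous_uminus[OF h] by (cases "evenperm p") (simp_all add: sign_def)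
  qed
  then show ?thesis
    unfolding dform_def det_def by (auto intro!: homogeneous_sum)
qed

text \<open>The identities of \<open>minor_exchange\<close> as forms in unknowns \<open>x\<close>.
  They are not the classical quadratic relations: they say that the frame rebuilt from
  \<open>x\<close> has the minors \<open>x\<close>, up to the power of \<open>x J\<close> that
  clears denominators.\<close>

definition pluecker_relation ::
  "nat \<Rightarrow> (int set \<Rightarrow> ('v, 'k::field) mpoly) \<Rightarrow> int set \<Rightarrow> int set \<Rightarrow> ('v, 'k) mpoly" where
  "pluecker_relation n x J K =
     x J * minor n (\<lambda>c r. \<Sum>L\<in>msubsets n {- int n..<int n}.
       mp_const (tminor n (\<lambda>d. std_vec (row_at L d)) ((row_at J)(c := r))) * x L) K - x J ^ n * x K"

lemma mp_eval_pluecker_relation: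
  "mp_eval y (pluecker_relation n x J K) =
     mp_eval y (x J) * minor n (nexchange n J (\<lambda>L. mp_eval y (x L))) K - mp_eval y (x J) ^ n * mp_eval y (x K)"
proof -
  have "(\<lambda>c r. mp_eval y (\<Sum>L\<in>msubsets n {- int n..<int n}.
       mp_const (tminor n (\<lambda>d. std_vec (row_at L d)) ((row_at J)(c := r))) * x L)) = nexchange n J (\<lambda>L. mp_eval y (x L))"
    by (intro ext) (simp add: exchange_def mp_eval.hom_sum mp_eval.hom_mult)
  then show ?thesis
    unfolding pluecker_relation_def mp_eval.hom_minus mp_eval.hom_mult mp_eval.hom_power mp_eval.hom_tminor by simp
qed

lemma homogeneous_pluecker_relation:
  assumes "\<And>J. homogeneous 1 (x J)"
  shows "homogeneous (1 + n) (pluecker_relation n x J K)"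
proof -
  have "homogeneous n (x J ^ n)" using homogeneous_power[OF assms, where n = n] by simp
  then have "homogeneous (1 + n) (x J ^ n * x K)" using homogeneous_mult[OF _ assms, of n] by (simp add: add.commute)
  then show ?thesis
    unfolding pluecker_relation_def
    by (rule homogeneous_diff[rotated]) (intro homogeneous_mult assms homogeneous_det homogeneous_sum homogeneous_cmult)
qed

text \<open>The image of the embedding is cut out by the equations that the matrix reconstructed from the
  coordinates has the coordinates as its maximal minors.\<close>

lemma closed_embedding:
  fixes i :: nat
  defines "V \<equiv> psections i :: (int set \<times> (int \<Rightarrow> 'k::{alg_closed_field, field_char_0}) set \<Rightarrow> 'k) set"
  shows "closedin (ztop (proj_space (dual_space V)))
    (embedding_at grass_filt pluecker_bundle i ` grass_step (Suc i))"
proof -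
  let ?n = "Suc i" and ?P = "vline ` (dual_space V - {0})" and ?A = "grass_step (Suc i) :: (int \<Rightarrow> 'k) set set"
  let ?emb = "embedding_at grass_filt pluecker_bundle i"
  let ?x = "\<lambda>J. mp_var (psec i (semi ?n J)) :: (int set \<times> (int \<Rightarrow> 'k) set \<Rightarrow> 'k, 'k) mpoly"
  interpret Y: presented "proj_space (dual_space V)" ?P "fractions homogeneous ?P rep" by (rule presented_proj)
  have hom: "homogeneous (1 + ?n) (pluecker_relation ?n ?x J K)" for J K
    by (rule homogeneous_pluecker_relation) (rule homogeneous_var)
  have "openin (ztop (proj_space (dual_space V))) (?P - ?emb ` ?A)"
    unfolding Y.openin_iff
  proof
    fix l assume l: "l \<in> ?P - ?emb ` ?A"
    define \<phi> where "\<phi> = rep l"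
    have lP: "l \<in> ?P" using l by blast
    note l\<phi> = vline_rep(1,2)[OF lP, folded \<phi>_def]
    have "\<phi> \<in> dual_space V"
    proof -
      obtain v where "v \<in> dual_space V" "l = vline v" using lP by blast
      then show ?thesis using l\<phi>(1) dual_space_fscale by (auto simp: vline_def)
    qed
    note \<phi>V = this[unfolded V_def]
    \<comment> \<open>If all relations held at \<open>\<phi>\<close>, the frame rebuilt from its
      values would give a point of the grassmannian with image \<open>l\<close>.\<close>
    have ex: "\<exists>J\<in>minor_sets ?n ?n. \<exists>K\<in>minor_sets ?n ?n. mp_eval \<phi> (pluecker_relation ?n ?x J K) \<noteq> 0"
    proof (rule ccontr)
      assume "\<not> ?thesis"
      then have rel: "mp_eval \<phi> (pluecker_relation ?n ?x J K) = 0"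
        if "J \<in> minor_sets ?n ?n" "K \<in> minor_sets ?n ?n" for J K using that by blast
      define p where "p J = \<phi> (psec i (semi ?n J))" for J
      have "\<exists>J\<in>minor_sets ?n ?n. p J \<noteq> 0"
      proof (rule ccontr)
        assume 0: "\<not> ?thesis"
        have "\<phi> = fscale 0 \<phi>"
        proof (rule dual_space_eqI[OF \<phi>V dual_space_fscale[OF \<phi>V]])
          fix S assume "S \<in> maya ?n"
          then obtain J where "J \<in> minor_sets ?n ?n" "S = semi ?n J" by (auto simp: maya_def)
          then show "\<phi> (psec i S) = fscale 0 \<phi> (psec i S)" using 0 by (simp add: p_def fscale_def)
        qed
        then show False using l\<phi>(1) by simp
      qed
      then obtain J where J: "J \<in> minor_sets ?n ?n" "p J \<noteq> 0" by blast
      define w where "w = nexchange ?n J p"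
      have e: "p J * minor ?n w K = p J ^ ?n * p K" if "K \<in> minor_sets ?n ?n" for K
        using rel[OF J(1) that] unfolding mp_eval_pluecker_relation by (simp add: p_def[abs_def] w_def)
      \<comment> \<open>One factor \<open>p J\<close> is cancelled, and \<open>?n\<close> is
        \<open>Suc i\<close>.\<close>
      have m: "minor ?n w K = p J ^ i * p K" if "K \<in> minor_sets ?n ?n" for K
        using e[OF that] J(2) by simp
      have "w c \<in> coord_space {- int ?n..<int ?n}" if "c < ?n" for c
        unfolding w_def by (rule exchange_coord_space[OF finite_atLeastLessThan_int that])
      moreover have "minor ?n w J \<noteq> 0" using m[OF J(1)] J(2) by simp
      ultimately have fr: "frame ?n ?n w" unfolding frame_iff_minor using J(1) by blast
      define W where "W = grass_incl ?n (colspan ?n w)"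
      have WA: "W \<in> ?A" unfolding W_def grass_step_frame using fr by blast
      obtain a where a: "a \<noteq> 0" "pext ?n w = fscale a (pv W)" using pv_frame[OF fr] W_def by blast
      have WV: "eval_fun i W \<in> dual_space (psections i)" using eval_fun_dual[OF WA] by blast
      have "\<phi> = fscale (a / p J ^ i) (eval_fun i W)"
      proof (rule dual_space_eqI[OF \<phi>V dual_space_fscale[OF WV]])
        fix S assume "S \<in> maya ?n"
        then obtain K where K: "K \<in> minor_sets ?n ?n" "S = semi ?n K" by (auto simp: maya_def)
        have "pext ?n w (semi ?n K) = a * pv W (semi ?n K)" unfolding a(2) by (simp add: fscale_def)
        then have "p J ^ i * p K = a * pv W S" using m[OF K(1)] K by (simp add: pext_semi)
        then show "\<phi> (psec i S) = fscale (a / p J ^ i) (eval_fun i W) (psec i S)"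
          unfolding fscale_def eval_fun_psec[OF WA] using J(2) K(2) by (simp add: p_def field_simps)
      qed
      then have "vline \<phi> = vline (eval_fun i W)" using a(1) J(2) by (simp add: vline_fscale)
      then have "l = ?emb W" using l\<phi>(2) embedding_vline[OF WA] by simp
      then show False using l WA by blast
    qed
    then obtain J K where JK: "J \<in> minor_sets ?n ?n" "K \<in> minor_sets ?n ?n"
      "mp_eval \<phi> (pluecker_relation ?n ?x J K) \<noteq> 0" by blast
    let ?D = "{l\<in>?P. mp_eval (rep l) (pluecker_relation ?n ?x J K) \<noteq> 0}"
    \<comment> \<open>On the image the coordinates are minors of a frame up to a scalar, and
      homogeneity carries the relation over to the chosen vector of the line.\<close>
    have "mp_eval (rep (?emb W)) (pluecker_relation ?n ?x J K) = 0" if W: "W \<in> ?A" for W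
    proof -
      obtain w where w: "frame ?n ?n w" "W = grass_incl ?n (colspan ?n w)" using W unfolding grass_step_frame by blast
      obtain a where a: "a \<noteq> 0" "pext ?n w = fscale a (pv W)" using pv_frame[OF w(1)] w(2) by blast
      have pm: "fscale a (eval_fun i W) (psec i (semi ?n L)) = minor ?n w L" if "L \<in> minor_sets ?n ?n" for L
      proof -
        have "fscale a (eval_fun i W) (psec i (semi ?n L)) = fscale a (pv W) (semi ?n L)"
          by (simp add: fscale_def eval_fun_psec[OF W])
        then show ?thesis unfolding a(2)[symmetric] by (simp add: pext_semi[OF that])
      qed
      have "mp_eval (fscale a (eval_fun i W)) (pluecker_relation ?n ?x J K) = 0"
        unfolding mp_eval_pluecker_relation mp_eval_var
        using minor_exchange[of "{- int ?n..<int ?n}" ?n w "\<lambda>L. fscale a (eval_fun i W) (psec i (semi ?n L))" J K]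
          w(1) pm JK(1,2) unfolding minor_sets_msubsets frame_def by simp
      then have 0: "mp_eval (eval_fun i W) (pluecker_relation ?n ?x J K) = 0"
        using a(1) by (simp add: mp_eval_fscale[OF hom])
      have "vline (eval_fun i W) \<in> ?P" using eval_fun_dual[OF W] unfolding V_def by blast
      then have "rep (vline (eval_fun i W)) \<in> vline (eval_fun i W)" using vline_rep(1) by blast
      then obtain c where "rep (vline (eval_fun i W)) = fscale c (eval_fun i W)" by (auto simp: vline_def)
      then show ?thesis unfolding embedding_vline[OF W] using 0 by (simp add: mp_eval_fscale[OF hom])
    qed
    then have "?D \<subseteq> ?P - ?emb ` ?A" by auto
    moreover have "l \<in> ?D" using lP JK(3) by (simp add: \<phi>_def)
    moreover have "fractions homogeneous ?P rep ?D (\<lambda>_. 1)"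
      by (rule fractionsI[of homogeneous, OF hom hom refl]) simp
    ultimately show "\<exists>D g. fractions homogeneous ?P rep D g \<and> l \<in> D \<and> D \<subseteq> ?P - ?emb ` ?A" by blast
  qed
  moreover have "?emb ` ?A \<subseteq> ?P"
  proof
    fix l assume "l \<in> ?emb ` ?A"
    then obtain W where "W \<in> ?A" "l = ?emb W" by blast
    then show "l \<in> ?P" using eval_fun_dual embedding_vline unfolding V_def by blast
  qed
  ultimately show ?thesis by (simp add: closedin_def Y.pts_eq)
qed

text \<open>The values of a functional at all sections and the Pluecker coordinates are linear forms
  in each other, so both define the same fractions; closedness of the image is
  \<open>closed_embedding\<close>.\<close>

lemma very_ample_pluecker:
  "very_ample (grass_filt i) (bundle_at grass_filt
    (pluecker_bundle :: (int set, (int \<Rightarrow> 'k::{alg_closed_field, field_char_0}) set, 'k) lbundle) i)"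
  unfolding very_ample_def sections_at_def[symmetric] embedding_at_def[symmetric]
proof (intro conjI line_bundle_at)
  let ?V = "psections i :: (int set \<times> (int \<Rightarrow> 'k) set \<Rightarrow> 'k) set" and ?A = "grass_step (Suc i) :: (int \<Rightarrow> 'k) set set"
  show "finite_dim ?V"
    unfolding finite_dim_def
  proof (intro exI conjI)
    show "psec i ` maya (Suc i) \<subseteq> ?V" using psec_section by blast
    show "fun_vs.span (psec i ` maya (Suc i)) = ?V" by (rule sections_span[symmetric])
  qed (simp add: finite_maya)
  let ?P = "vline ` (dual_space ?V - {0})"
  let ?emb = "embedding_at grass_filt pluecker_bundle i :: (int \<Rightarrow> 'k) set \<Rightarrow> _"
  have im: "?emb ` ?A \<subseteq> ?P"
  proof
    fix l assume "l \<in> ?emb ` ?A"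
    then obtain W where "W \<in> ?A" "l = ?emb W" by blast
    then show "l \<in> ?P" using eval_fun_dual embedding_vline by blast
  qed
  have rep: "\<exists>c. c \<noteq> 0 \<and> rep (?emb W) = fscale c (eval_fun i W)" if W: "W \<in> ?A" for W
  proof -
    have l: "vline (eval_fun i W) \<in> ?P" using eval_fun_dual[OF W] by blast
    then have r: "rep (vline (eval_fun i W)) \<in> vline (eval_fun i W) - {0}" by (rule vline_rep(1))
    then obtain c where c: "rep (vline (eval_fun i W)) = fscale c (eval_fun i W)" unfolding vline_def by blast
    then have "c \<noteq> 0" using r by auto
    then show ?thesis unfolding embedding_vline[OF W] using c by blast
  qed
  have inj: "inj_on ?emb ?A"
  proof (rule inj_onI)
    fix W W' assume W: "W \<in> ?A" "W' \<in> ?A" and eq: "?emb W = ?emb W'"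
    have "eval_fun i W' \<in> vline (eval_fun i W)"
      using in_vline[of "eval_fun i W'"] eq embedding_vline[OF W(1)] embedding_vline[OF W(2)] by simp
    then obtain c where c: "eval_fun i W' = fscale c (eval_fun i W)" by (auto simp: vline_def)
    have "pv W' S = c * pv W S" for S
      using eval_fun_psec[OF W(2), of S] eval_fun_psec[OF W(1), of S] unfolding c by (simp add: fscale_def)
    then show "W = W'" by (intro pv_inj[OF W]) simp
  qed
  \<comment> \<open>The dual space has one coordinate for every section, not just for a basis;
    \<open>\<kappa>\<close> expresses all of them by the coordinate sections.\<close>
  have "\<forall>s. \<exists>\<kappa>. s \<in> ?V \<longrightarrow> s = (\<Sum>K\<in>minor_sets (Suc i) (Suc i). fscale (\<kappa> K) (psec i (semi (Suc i) K)))"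
    using section_expand by blast
  from choice[OF this] obtain \<kappa> where \<kappa>: "\<And>s. s \<in> ?V \<Longrightarrow>
      s = (\<Sum>K\<in>minor_sets (Suc i) (Suc i). fscale (\<kappa> s K) (psec i (semi (Suc i) K)))" by blast
  show "closed_immersion ?emb (grass_filt i) (proj_space (dual_space ?V))"
  proof (rule presented_closed_immersion[OF presented_grass_filt presented_proj inj im closed_embedding])
    fix D and g :: "(int \<Rightarrow> 'k) set \<Rightarrow> 'k"
    show "fractions homogeneous ?A pv D g \<longleftrightarrow> pullback_basic ?A ?emb (fractions homogeneous ?P rep) D g"
      unfolding pullback_fractions[OF im]
    proof
      assume "fractions homogeneous ?A pv D g"
      then show "fractions homogeneous ?A (\<lambda>W. rep (?emb W)) D g"
      proof (rule fractions_subst[rotated 2])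
        let ?L = "\<lambda>S. if S \<in> maya (Suc i) then mp_var (psec i S) else 0 :: (int set \<times> (int \<Rightarrow> 'k) set \<Rightarrow> 'k, 'k) mpoly"
        show "homogeneous 1 (?L S)" for S by simp
        fix W assume W: "W \<in> ?A"
        obtain c where c: "c \<noteq> 0" "rep (?emb W) = fscale c (eval_fun i W)" using rep[OF W] by blast
        have "pv W S = 1 / c * mp_eval (rep (?emb W)) (?L S)" for S
          using c(1) pv_outside[OF W, of S] unfolding c(2) by (simp add: fscale_def eval_fun_psec[OF W])
        then have "pv W = (\<lambda>S. 1 / c * mp_eval (rep (?emb W)) (?L S))" by (rule ext)
        moreover have "1 / c \<noteq> 0" using c(1) by simp
        ultimately show "\<exists>c. c \<noteq> 0 \<and> pv W = (\<lambda>S. c * mp_eval (rep (?emb W)) (?L S))" by blast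
      qed
    next
      assume "fractions homogeneous ?A (\<lambda>W. rep (?emb W)) D g"
      then show "fractions homogeneous ?A pv D g"
      proof (rule fractions_subst[rotated 2])
        let ?L = "\<lambda>s. if s \<in> ?V then \<Sum>K\<in>minor_sets (Suc i) (Suc i). mp_const (\<kappa> s K) * mp_var (semi (Suc i) K) else 0"
        show "homogeneous 1 (?L s)" for s
          by (cases "s \<in> ?V") (simp_all only: if_True if_False homogeneous_0 homogeneous_sum homogeneous_cmult homogeneous_var)
        fix W assume W: "W \<in> ?A"
        obtain c where c: "c \<noteq> 0" "rep (?emb W) = fscale c (eval_fun i W)" using rep[OF W] by blast
        obtain T where T: "T \<in> maya_inf" "W \<in> coord_nonzero (grass_step (Suc i)) T" by (rule nonzero_chart[OF W])
        have ev: "eval_fun i W s = mp_eval (pv W) (?L s)" for s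
        proof (cases "s \<in> ?V")
          case True
          have "s (T, W) = (\<Sum>K\<in>minor_sets (Suc i) (Suc i). \<kappa> s K * psec i (semi (Suc i) K) (T, W))"
            by (subst \<kappa>[OF True]) (simp add: sum_fun_apply fscale_def)
          also have "\<dots> = (\<Sum>K\<in>minor_sets (Suc i) (Suc i). \<kappa> s K * (pv W (semi (Suc i) K) / pv W T))"
            using T unfolding psec_def by simp
          finally have "pv W T * s (T, W) = (\<Sum>K\<in>minor_sets (Suc i) (Suc i). \<kappa> s K * pv W (semi (Suc i) K))"
            using T(2) by (simp add: sum_distrib_left)
          then show ?thesis
            unfolding eval_fun_eq[OF T] restr_def using True by (simp add: mp_eval.hom_sum mp_eval.hom_mult)
        next
          case False
          then show ?thesis unfolding eval_fun_eq[OF T] restr_def by simp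
        qed
        have "rep (?emb W) = (\<lambda>s. c * mp_eval (pv W) (?L s))" unfolding c(2) fscale_def ev ..
        then show "\<exists>c. c \<noteq> 0 \<and> rep (?emb W) = (\<lambda>s. c * mp_eval (pv W) (?L s))" using c(1) by blast
      qed
    qed
  qed
qed

lemma projective_ind_variety_grass:
  "projective_ind_variety grass_inf grass_filt
    (pluecker_bundle :: (int set, (int \<Rightarrow> 'k::{alg_closed_field, field_char_0}) set, 'k) lbundle)"
  unfolding projective_ind_variety_def
  using ind_variety_grass line_bundle_pluecker very_ample_pluecker restrict_sections by auto

text \<open>With the coordinate section at \<open>semi n J\<close> for \<open>\<sigma> J\<close>,
  the values of a functional on the image line are the Pluecker coordinates up to its
  scalar.\<close>

lemma pluecker_embedded_grass:
  "pluecker_embedded (pluecker_bundle :: (int set, (int \<Rightarrow> 'k::{alg_closed_field, field_char_0}) set, 'k) lbundle) i"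
  unfolding pluecker_embedded_def Let_def
proof (intro exI conjI ballI)
  let ?n = "Suc i" and ?\<sigma> = "\<lambda>J. psec i (semi (Suc i) J) :: int set \<times> (int \<Rightarrow> 'k) set \<Rightarrow> 'k"
  have im: "?\<sigma> ` minor_sets ?n ?n = psec i ` maya ?n" by (simp add: maya_def image_image)
  show "inj_on ?\<sigma> (minor_sets ?n ?n)"
    using comp_inj_on[OF inj_on_semi psec_independent(1)[unfolded maya_def]] by (simp add: o_def)
  show "\<not> fun_vs.dependent (?\<sigma> ` minor_sets ?n ?n)" unfolding im by (rule psec_independent)
  show "fun_vs.span (?\<sigma> ` minor_sets ?n ?n) = psections i" unfolding im by (rule sections_span[symmetric])
  fix W :: "(int \<Rightarrow> 'k) set" and \<phi>
  assume W: "W \<in> grassmannian ?n ?n" and \<phi>: "\<phi> \<in> embedding_at grass_filt pluecker_bundle i (grass_incl ?n W)"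
  obtain w where w: "frame ?n ?n w" "W = colspan ?n w" using W unfolding grassmannian_frame by blast
  have WA: "grass_incl ?n W \<in> grass_step ?n" using W by (auto simp: grass_step_def)
  obtain c where c: "\<phi> = fscale c (eval_fun i (grass_incl ?n W))"
    using \<phi> unfolding embedding_vline[OF WA] by (auto simp: vline_def)
  have "restr (minor_sets ?n ?n) (\<lambda>J. \<phi> (?\<sigma> J)) = fscale c (restr (minor_sets ?n ?n) (\<lambda>J. pv (grass_incl ?n W) (semi ?n J)))"
    unfolding c by (auto simp: restr_def fscale_def eval_fun_psec[OF WA])
  then show "restr (minor_sets ?n ?n) (\<lambda>J. \<phi> (?\<sigma> J)) \<in> pluecker ?n ?n W"
    unfolding w(2) pluecker_pv[OF w(1)] by (auto simp: vline_def)
qed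


section \<open>Quotients and polynomial rings as algebras\<close>

text \<open>The added field \<open>scal\<close> makes the algebra a different record from
  \<open>A Quot I\<close>, so the ring axioms are carried over operation by operation.\<close>

lemma cring_kalg_quot:
  assumes "cring A" "ideal I A"
  shows "cring (kalg_quot A I)"
proof -
  interpret Q: cring "A Quot I" by (rule ideal.quotient_is_cring[OF assms(2,1)])
  have sel: "carrier (kalg_quot A I) = carrier (A Quot I)" "monoid.mult (kalg_quot A I) = monoid.mult (A Quot I)"
    "one (kalg_quot A I) = one (A Quot I)" "zero (kalg_quot A I) = zero (A Quot I)" "add (kalg_quot A I) = add (A Quot I)"
    by (simp_all add: kalg_quot_def ring.defs kalg.defs FactRing_def)
  show ?thesis
  proof (rule cringI)
    show "abelian_group (kalg_quot A I)"
    proof (rule abelian_groupI, unfold sel)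
      show "\<And>x. x \<in> carrier (A Quot I) \<Longrightarrow> \<exists>y\<in>carrier (A Quot I). y \<oplus>\<^bsub>A Quot I\<^esub> x = \<zero>\<^bsub>A Quot I\<^esub>"
        using Q.l_neg Q.a_inv_closed by blast
    qed (simp_all add: Q.a_ac)
    show "Group.comm_monoid (kalg_quot A I)"
      by (rule comm_monoidI, unfold sel) (simp_all add: Q.m_ac)
  qed (unfold sel, simp add: Q.l_distr)
qed

lemma kalg_quot_sel:
  "carrier (kalg_quot A I) = {I +>\<^bsub>A\<^esub> a | a. a \<in> carrier A}"
  "scal (kalg_quot A I) c = I +>\<^bsub>A\<^esub> scal A c"
  "\<one>\<^bsub>kalg_quot A I\<^esub> = I +>\<^bsub>A\<^esub> \<one>\<^bsub>A\<^esub>"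
  "\<zero>\<^bsub>kalg_quot A I\<^esub> = I"
  by (auto simp: kalg_quot_def ring.defs kalg.defs FactRing_def A_RCOSETS_def' )

lemma kalg_quot_ops:
  assumes "ideal I A" "a \<in> carrier A" "b \<in> carrier A"
  shows "(I +>\<^bsub>A\<^esub> a) \<oplus>\<^bsub>kalg_quot A I\<^esub> (I +>\<^bsub>A\<^esub> b) = I +>\<^bsub>A\<^esub> (a \<oplus>\<^bsub>A\<^esub> b)"
    and "(I +>\<^bsub>A\<^esub> a) \<otimes>\<^bsub>kalg_quot A I\<^esub> (I +>\<^bsub>A\<^esub> b) = I +>\<^bsub>A\<^esub> (a \<otimes>\<^bsub>A\<^esub> b)"
proof -
  interpret ideal I A by fact
  show "(I +>\<^bsub>A\<^esub> a) \<oplus>\<^bsub>kalg_quot A I\<^esub> (I +>\<^bsub>A\<^esub> b) = I +>\<^bsub>A\<^esub> (a \<oplus>\<^bsub>A\<^esub> b)"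
    using a_rcos_sum[OF assms(2,3)] by (simp add: kalg_quot_def ring.defs kalg.defs FactRing_def)
  show "(I +>\<^bsub>A\<^esub> a) \<otimes>\<^bsub>kalg_quot A I\<^esub> (I +>\<^bsub>A\<^esub> b) = I +>\<^bsub>A\<^esub> (a \<otimes>\<^bsub>A\<^esub> b)"
    using rcoset_mult_add[OF assms(2,3)] by (simp add: kalg_quot_def ring.defs kalg.defs FactRing_def)
qed

lemma kalg_homI:
  assumes "\<And>x. x \<in> carrier A \<Longrightarrow> h x \<in> carrier B"
    "\<And>x y. x \<in> carrier A \<Longrightarrow> y \<in> carrier A \<Longrightarrow> h (x \<otimes>\<^bsub>A\<^esub> y) = h x \<otimes>\<^bsub>B\<^esub> h y"
    "\<And>x y. x \<in> carrier A \<Longrightarrow> y \<in> carrier A \<Longrightarrow> h (x \<oplus>\<^bsub>A\<^esub> y) = h x \<oplus>\<^bsub>B\<^esub> h y"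
    "h \<one>\<^bsub>A\<^esub> = \<one>\<^bsub>B\<^esub>" "\<And>c. h (scal A c) = scal B c"
  shows "h \<in> kalg_hom A B"
  using assms unfolding kalg_hom_def by (simp add: ring_hom_memI)

lemma
  assumes "h \<in> kalg_hom A B"
  shows kalg_hom_closed: "x \<in> carrier A \<Longrightarrow> h x \<in> carrier B"
    and kalg_hom_mult: "x \<in> carrier A \<Longrightarrow> y \<in> carrier A \<Longrightarrow> h (x \<otimes>\<^bsub>A\<^esub> y) = h x \<otimes>\<^bsub>B\<^esub> h y"
    and kalg_hom_add: "x \<in> carrier A \<Longrightarrow> y \<in> carrier A \<Longrightarrow> h (x \<oplus>\<^bsub>A\<^esub> y) = h x \<oplus>\<^bsub>B\<^esub> h y"
    and kalg_hom_one: "h \<one>\<^bsub>A\<^esub> = \<one>\<^bsub>B\<^esub>"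
    and kalg_hom_scal: "h (scal A c) = scal B c"
    and kalg_hom_ring_hom: "h \<in> Ring.ring_hom A B"
proof -
  have h: "h \<in> Ring.ring_hom A B" using assms by (simp add: kalg_hom_def)
  then show "h \<in> Ring.ring_hom A B" .
  show "x \<in> carrier A \<Longrightarrow> h x \<in> carrier B" by (rule ring_hom_closed[OF h])
  show "x \<in> carrier A \<Longrightarrow> y \<in> carrier A \<Longrightarrow> h (x \<otimes>\<^bsub>A\<^esub> y) = h x \<otimes>\<^bsub>B\<^esub> h y" by (rule ring_hom_mult[OF h])
  show "x \<in> carrier A \<Longrightarrow> y \<in> carrier A \<Longrightarrow> h (x \<oplus>\<^bsub>A\<^esub> y) = h x \<oplus>\<^bsub>B\<^esub> h y" by (rule ring_hom_add[OF h])
  show "h \<one>\<^bsub>A\<^esub> = \<one>\<^bsub>B\<^esub>" by (rule ring_hom_one[OF h])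
  show "h (scal A c) = scal B c" using assms by (simp add: kalg_hom_def)
qed

lemma kalg_hom_comp:
  assumes "h \<in> kalg_hom A B" "k \<in> kalg_hom B C"
  shows "(\<lambda>x. k (h x)) \<in> kalg_hom A C"
  by (rule kalg_homI)
    (simp_all add: kalg_hom_closed[OF assms(1)] kalg_hom_closed[OF assms(2)] kalg_hom_mult[OF assms(1)] kalg_hom_mult[OF assms(2)]
      kalg_hom_add[OF assms(1)] kalg_hom_add[OF assms(2)] kalg_hom_one[OF assms(1)] kalg_hom_one[OF assms(2)]
      kalg_hom_scal[OF assms(1)] kalg_hom_scal[OF assms(2)])

lemma kalg_hom_cong:
  assumes "h \<in> kalg_hom A B" "ring A" "\<And>c. scal A c \<in> carrier A" "\<And>x. x \<in> carrier A \<Longrightarrow> h' x = h x"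
  shows "h' \<in> kalg_hom A B"
proof -
  interpret ring A by fact
  show ?thesis
    by (rule kalg_homI)
      (simp_all add: assms(3,4) kalg_hom_closed[OF assms(1)] kalg_hom_mult[OF assms(1)] kalg_hom_add[OF assms(1)]
        kalg_hom_one[OF assms(1)] kalg_hom_scal[OF assms(1)])
qed

text \<open>The induced map on cosets; \<open>the_elem\<close> is meaningful when \<open>h\<close>
  is constant on them, as for an ideal inside its kernel.\<close>

definition quot_map :: "('a \<Rightarrow> 'b) \<Rightarrow> 'a set \<Rightarrow> 'b" where
  "quot_map h X = the_elem (h ` X)"

lemma
  assumes A: "ring A" and I: "ideal I A" and B: "ring B" and h: "h \<in> kalg_hom A B"
    and ker: "I \<subseteq> a_kernel A B h" and scal: "\<And>c. scal A c \<in> carrier A"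
  shows quot_map_coset: "a \<in> carrier A \<Longrightarrow> quot_map h (I +>\<^bsub>A\<^esub> a) = h a"
    and quot_map_mem: "X \<in> carrier (kalg_quot A I) \<Longrightarrow> x \<in> X \<Longrightarrow> quot_map h X = h x \<and> x \<in> carrier A \<and> X = I +>\<^bsub>A\<^esub> x"
    and quot_map_hom: "quot_map h \<in> kalg_hom (kalg_quot A I) B"
proof -
  interpret A: ring A by fact
  interpret B: ring B by fact
  interpret I: ideal I A by fact
  have coset: "h ` (I +>\<^bsub>A\<^esub> a) = {h a}" if a: "a \<in> carrier A" for a
  proof -
    have "h (x \<oplus>\<^bsub>A\<^esub> a) = h a" if x: "x \<in> I" for x
    proof -
      have "x \<in> carrier A" "h x = \<zero>\<^bsub>B\<^esub>" using ker x by (auto simp: a_kernel_def')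
      then show ?thesis using a kalg_hom_add[OF h] kalg_hom_closed[OF h a] by simp
    qed
    moreover have "h a \<in> h ` (I +>\<^bsub>A\<^esub> a)" using I.a_rcos_self[OF a] by (rule imageI)
    ultimately show ?thesis by (auto simp: a_r_coset_def' )
  qed
  show q: "quot_map h (I +>\<^bsub>A\<^esub> a) = h a" if "a \<in> carrier A" for a
    unfolding quot_map_def coset[OF that] by simp
  show "X \<in> carrier (kalg_quot A I) \<Longrightarrow> x \<in> X \<Longrightarrow> quot_map h X = h x \<and> x \<in> carrier A \<and> X = I +>\<^bsub>A\<^esub> x"
  proof -
    assume X: "X \<in> carrier (kalg_quot A I)" and x: "x \<in> X"
    then obtain a where a: "a \<in> carrier A" "X = I +>\<^bsub>A\<^esub> a" by (auto simp: kalg_quot_sel)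
    have xc: "x \<in> carrier A" using x a A.a_r_coset_subset_G[OF I.a_subset a(1)] by blast
    have "I +>\<^bsub>A\<^esub> a = I +>\<^bsub>A\<^esub> x"
      by (rule A.a_repr_independence[OF _ a(1) I.additive_subgroup_axioms[THEN additive_subgroup.a_subgroup]]) (use x a in simp)
    then show "quot_map h X = h x \<and> x \<in> carrier A \<and> X = I +>\<^bsub>A\<^esub> x" using q[OF xc] xc a by simp
  qed
  show "quot_map h \<in> kalg_hom (kalg_quot A I) B"
  proof (rule kalg_homI)
    fix X Y assume "X \<in> carrier (kalg_quot A I)" "Y \<in> carrier (kalg_quot A I)"
    then obtain a b where a: "a \<in> carrier A" "X = I +>\<^bsub>A\<^esub> a" and b: "b \<in> carrier A" "Y = I +>\<^bsub>A\<^esub> b" by (auto simp: kalg_quot_sel)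
    show "quot_map h (X \<otimes>\<^bsub>kalg_quot A I\<^esub> Y) = quot_map h X \<otimes>\<^bsub>B\<^esub> quot_map h Y"
      unfolding a b kalg_quot_ops[OF I a(1) b(1)] q[OF a(1)] q[OF b(1)] q[OF A.m_closed[OF a(1) b(1)]] by (rule kalg_hom_mult[OF h a(1) b(1)])
    show "quot_map h (X \<oplus>\<^bsub>kalg_quot A I\<^esub> Y) = quot_map h X \<oplus>\<^bsub>B\<^esub> quot_map h Y"
      unfolding a b kalg_quot_ops[OF I a(1) b(1)] q[OF a(1)] q[OF b(1)] q[OF A.a_closed[OF a(1) b(1)]] by (rule kalg_hom_add[OF h a(1) b(1)])
  qed (auto simp: kalg_quot_sel q scal kalg_hom_closed[OF h] kalg_hom_one[OF h] kalg_hom_scal[OF h])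
qed

section \<open>Polynomial algebras as rings\<close>

lemma poly_alg_sel [simp]:
  "carrier (poly_alg V) = {p. mp_vars p \<subseteq> V}" "monoid.mult (poly_alg V) = (*)" "one (poly_alg V) = 1"
  "zero (poly_alg V) = 0" "add (poly_alg V) = (+)" "scal (poly_alg V) = mp_const"
  by (simp_all add: poly_alg_def)

lemma mp_vars_closed:
  "mp_vars p \<subseteq> V \<Longrightarrow> mp_vars q \<subseteq> V \<Longrightarrow> mp_vars (p + q) \<subseteq> V"
  "mp_vars p \<subseteq> V \<Longrightarrow> mp_vars q \<subseteq> V \<Longrightarrow> mp_vars (p * q) \<subseteq> V"
  "mp_vars p \<subseteq> V \<Longrightarrow> mp_vars q \<subseteq> V \<Longrightarrow> mp_vars (p - q) \<subseteq> V"
  using mp_vars_add[of p q] mp_vars_mult[of p q] mp_vars_add[of p "- q"] by auto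

lemma cring_poly_alg: "cring (poly_alg V)"
proof (rule cringI)
  show "abelian_group (poly_alg V)"
  proof (rule abelian_groupI)
    fix p assume "p \<in> carrier (poly_alg V)"
    then show "\<exists>q\<in>carrier (poly_alg V). q \<oplus>\<^bsub>poly_alg V\<^esub> p = \<zero>\<^bsub>poly_alg V\<^esub>"
      by (intro bexI[of _ "- p"]) auto
  qed (auto simp: mp_vars_closed algebra_simps)
  show "Group.comm_monoid (poly_alg V)"
    by (rule comm_monoidI) (auto simp: mp_vars_closed mult.assoc mult.commute)
qed (simp add: distrib_right)

lemma a_inv_poly_alg:
  assumes "mp_vars p \<subseteq> V"
  shows "\<ominus>\<^bsub>poly_alg V\<^esub> p = - p"
proof -
  interpret cring "poly_alg V" by (rule cring_poly_alg)
  show ?thesis using minus_equality[of "- p" p] assms by simp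
qed


section \<open>The rings generated by minors\<close>

abbreviation kd :: "nat \<Rightarrow> nat \<Rightarrow> (int \<times> int, 'k::field) mpoly set" where
  "kd m n \<equiv> carrier (k_delta m n)"

lemma k_delta_sel [simp]:
  "monoid.mult (k_delta m n) = (*)" "one (k_delta m n) = 1" "zero (k_delta m n) = 0" "add (k_delta m n) = (+)"
  "scal (k_delta m n) = mp_const"
  by (simp_all add: k_delta_def matrix_alg_def)

lemma kd_carrier: "kd m n = generate_ring (matrix_alg m n) (range mp_const \<union> minor_det m ` minor_sets m n)"
  by (simp add: k_delta_def)

lemma minor_det_minor: "minor_det m J = minor m (\<lambda>c i. mp_var (i, int c - int m)) J"
  by (simp add: minor_det_def dform_def)

lemma mp_vars_tminor:
  assumes "\<And>r c. r < m \<Longrightarrow> c < m \<Longrightarrow> mp_vars (M c (\<rho> r)) \<subseteq> V"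
  shows "mp_vars (tminor m M \<rho>) \<subseteq> V"
proof -
  have prod: "mp_vars (prod f A) \<subseteq> V" if "\<And>a. a \<in> A \<Longrightarrow> mp_vars (f a) \<subseteq> V" for f and A :: "nat set"
    using that by (induction A rule: infinite_finite_induct) (simp_all add: mp_vars_closed)
  have sum: "mp_vars (sum f A) \<subseteq> V" if "\<And>a. a \<in> A \<Longrightarrow> mp_vars (f a) \<subseteq> V" for f and A :: "(nat \<Rightarrow> nat) set"
    using that by (induction A rule: infinite_finite_induct) (simp_all add: mp_vars_closed)
  have "mp_vars (signof p * (\<Prod>k = 0..<m. mat m m (\<lambda>(r, c). M c (\<rho> r)) $$ (k, p k))) \<subseteq> V"
    if p: "p permutes {0..<m}" for p
  proof -
    have eq: "(\<Prod>k = 0..<m. mat m m (\<lambda>(r, c). M c (\<rho> r)) $$ (k, p k)) = (\<Prod>k = 0..<m. M (p k) (\<rho> k))"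
      using permutes_in_image[OF p] by (intro prod.cong) auto
    have "mp_vars (\<Prod>k = 0..<m. M (p k) (\<rho> k)) \<subseteq> V"
      by (rule prod) (use assms permutes_in_image[OF p] in auto)
    then show ?thesis unfolding eq by (cases "evenperm p") (simp_all add: sign_def)
  qed
  then show ?thesis unfolding dform_def det_def by (auto intro!: sum)
qed

lemma minor_det_vars:
  assumes J: "J \<in> minor_sets m n"
  shows "mp_vars (minor_det m J) \<subseteq> {- int m..<int n} \<times> {- int m..<int n}"
  unfolding minor_det_minor
  by (rule mp_vars_tminor) (use row_at_minor_set[OF J] in auto)

lemma kd_closed:
  "mp_const c \<in> kd m n" "J \<in> minor_sets m n \<Longrightarrow> minor_det m J \<in> kd m n"
  "p \<in> kd m n \<Longrightarrow> q \<in> kd m n \<Longrightarrow> p + q \<in> kd m n" "p \<in> kd m n \<Longrightarrow> q \<in> kd m n \<Longrightarrow> p * q \<in> kd m n"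
  unfolding kd_carrier
  using generate_ring.eng_add[of p "matrix_alg m n" _ q] generate_ring.eng_mult[of p "matrix_alg m n" _ q]
  by (auto intro: generate_ring.incl simp: matrix_alg_def)

lemma kd_sum: "(\<And>i. i \<in> A \<Longrightarrow> f i \<in> kd m n) \<Longrightarrow> sum f A \<in> kd m n"
  by (induction A rule: infinite_finite_induct) (use kd_closed(1)[of 0] in \<open>auto intro: kd_closed\<close>)

lemma gens_in_matrix_alg:
  "range mp_const \<union> minor_det m ` minor_sets m n \<subseteq> carrier (matrix_alg m n)"
  using minor_det_vars unfolding matrix_alg_def by fastforce

lemma kd_vars: "p \<in> kd m n \<Longrightarrow> mp_vars p \<subseteq> {- int m..<int n} \<times> {- int m..<int n}"
proof -
  interpret cring "matrix_alg m n" unfolding matrix_alg_def by (rule cring_poly_alg)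
  assume "p \<in> kd m n"
  then have "p \<in> carrier (matrix_alg m n)"
    unfolding kd_carrier using generate_ring_in_carrier[OF gens_in_matrix_alg] by blast
  then show ?thesis by (simp add: matrix_alg_def)
qed

lemma ring_k_delta: "ring (k_delta m n)"
proof -
  interpret cring "matrix_alg m n" unfolding matrix_alg_def by (rule cring_poly_alg)
  show ?thesis unfolding k_delta_def by (rule generate_ring_is_ring[OF gens_in_matrix_alg])
qed

text \<open>Induction over the generated subring, with the inverse and the operations of
  \<open>matrix_alg\<close> translated to those of polynomials.\<close>

lemma kd_induct [consumes 1, case_names const minor uminus add mult]:
  assumes p: "p \<in> kd m n" and const: "\<And>c. P (mp_const c)" and minor: "\<And>J. J \<in> minor_sets m n \<Longrightarrow> P (minor_det m J)"
    and uminus: "\<And>p. p \<in> kd m n \<Longrightarrow> P p \<Longrightarrow> P (- p)"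
    and add: "\<And>p q. p \<in> kd m n \<Longrightarrow> q \<in> kd m n \<Longrightarrow> P p \<Longrightarrow> P q \<Longrightarrow> P (p + q)"
    and mult: "\<And>p q. p \<in> kd m n \<Longrightarrow> q \<in> kd m n \<Longrightarrow> P p \<Longrightarrow> P q \<Longrightarrow> P (p * q)"
  shows "P p"
  using p unfolding kd_carrier
proof (induction rule: generate_ring.induct)
  case one
  show ?case using const[of 1] by (simp add: matrix_alg_def)
next
  case (incl h)
  then show ?case using const minor by auto
next
  case (a_inv h)
  have h: "h \<in> kd m n" using a_inv by (simp add: kd_carrier)
  then show ?case using uminus[OF h a_inv.IH] a_inv_poly_alg[OF kd_vars[OF h]] by (simp add: matrix_alg_def)
next
  case (eng_add p q)
  then show ?case using add[of p q] by (simp add: kd_carrier matrix_alg_def)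
next
  case (eng_mult p q)
  then show ?case using mult[of p q] by (simp add: kd_carrier matrix_alg_def)
qed

text \<open>The matrix with an identity block in the rows and columns \<open>j < -m\<close>, and variables in the rows
  \<open>-m, \<dots>, n - 1\<close> and columns \<open>j \<ge> -m\<close>. Substituting its entries realizes the maps of the
  inverse system.\<close>

definition block_entry :: "nat \<Rightarrow> nat \<Rightarrow> int \<times> int \<Rightarrow> (int \<times> int, 'k::field) mpoly" where
  "block_entry m n = (\<lambda>(i, j). if j < - int m then (if i = j then 1 else 0)
     else if i \<in> {- int m..<int n} then mp_var (i, j) else 0)"

abbreviation block_subst :: "nat \<Rightarrow> nat \<Rightarrow> (int \<times> int, 'k::field) mpoly \<Rightarrow> (int \<times> int, 'k) mpoly" where
  "block_subst m n \<equiv> mp_subst (block_entry m n)"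

text \<open>Induction on \<open>m'\<close>: the first column of the larger matrix is a standard
  vector at the lowest row, so expansion along it strips one row that \<open>J'\<close> must
  contain. At the bottom, a row outside \<open>{- int m..<int n}\<close> is zero.\<close>

lemma block_minor:
  assumes "m \<le> m'" "J' \<in> minor_sets m' n'"
  shows "minor m' (\<lambda>c i. block_entry m n (i, int c - int m')) J' =
    (if {- int m'..<- int m} \<subseteq> J' \<and> J' - {- int m'..<- int m} \<subseteq> {- int m..<int n}
     then minor_det m (J' - {- int m'..<- int m}) else (0 :: (int \<times> int, 'k::field) mpoly))"
  using assms
proof (induction m' arbitrary: J' rule: dec_induct)
  case base
  have fin: "finite J'" "card J' = m" using finite_minor_set[OF base] by auto
  show ?case
  proof (cases "J' \<subseteq> {- int m..<int n}")
    case True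
    have "row_at J' r \<in> {- int m..<int n}" if "r < m" for r using row_at_in[OF fin that] True by blast
    then have "minor m (\<lambda>c i. block_entry m n (i, int c - int m)) J' = (minor_det m J' :: (int \<times> int, 'k) mpoly)"
      unfolding minor_det_minor by (intro dform_cong) (simp add: block_entry_def)
    then show ?thesis using True by simp
  next
    case False
    then obtain j where j: "j \<in> J'" "j \<notin> {- int m..<int n}" by blast
    then have "j \<in> row_at J' ` {..<m}" using bij_betw_imp_surj_on[OF row_at_bij[OF fin]] by simp
    then obtain r where r: "r < m" "row_at J' r = j" by auto
    have "minor m (\<lambda>c i. block_entry m n (i, int c - int m)) J' = (0 :: (int \<times> int, 'k) mpoly)"
      by (rule dform_zero_row[OF r(1)]) (use j(2) r(2) in \<open>auto simp: block_entry_def\<close>)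
    then show ?thesis using False by simp
  qed
next
  case (step k)
  let ?x = "- int (Suc k)" and ?e = "\<lambda>k c i. block_entry m n (i, int c - int k) :: (int \<times> int, 'k) mpoly"
  have fin: "finite J'" "card J' = Suc k" using finite_minor_set[OF step.prems] by auto
  \<comment> \<open>Column \<open>c\<close> has index \<open>c - m'\<close>, so dropping the first
    column is the same as lowering \<open>m'\<close> by one.\<close>
  have shift: "?e (Suc k) (Suc c) = ?e k c" for c by simp
  have "minor (Suc k) (?e (Suc k)) J' = (if ?x \<in> J' then minor k (\<lambda>c. ?e (Suc k) (Suc c)) (J' - {?x}) else 0)"
  proof (rule minor_Suc[OF fin])
    fix y assume "y \<in> J'"
    then show "?x \<le> y" using step.prems by (auto simp: minor_sets_def)
  next
    fix i show "?e (Suc k) 0 i = (if i = ?x then 1 else 0)" using step.hyps by (simp add: block_entry_def)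
  qed
  then have eq: "minor (Suc k) (?e (Suc k)) J' = (if ?x \<in> J' then minor k (?e k) (J' - {?x}) else 0)"
    unfolding shift .
  have top: "{?x..<- int m} = insert ?x {- int k..<- int m}" using step.hyps by auto
  show ?case
  proof (cases "?x \<in> J'")
    case False
    then show ?thesis unfolding eq top by simp
  next
    case True
    have "J' - {?x} \<in> minor_sets k n'"
    proof -
      have "J' - {?x} \<subseteq> {- int k..<int n'}"
      proof
        fix y assume y: "y \<in> J' - {?x}"
        then have "y \<in> {?x..<int n'}" using step.prems by (auto simp: minor_sets_def)
        then show "y \<in> {- int k..<int n'}" using y by auto
      qed
      then show ?thesis using fin True by (simp add: minor_sets_def)
    qed
    note IH = step.IH[OF this]
    have "J' - {?x} - {- int k..<- int m} = J' - {?x..<- int m}" unfolding top by blast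
    moreover have "{- int k..<- int m} \<subseteq> J' - {?x} \<longleftrightarrow> {?x..<- int m} \<subseteq> J'" unfolding top using True by auto
    ultimately show ?thesis unfolding eq IH using True by simp
  qed
qed

lemma block_subst_minor_det:
  "block_subst m n (minor_det m' J') = minor m' (\<lambda>c i. block_entry m n (i, int c - int m')) J'"
  unfolding minor_det_minor mp_subst.hom_tminor by simp

lemma minor_sets_split:
  assumes "m \<le> m'" "J' \<in> minor_sets m' n'" "{- int m'..<- int m} \<subseteq> J'" "J' - {- int m'..<- int m} \<subseteq> {- int m..<int n}"
  shows "J' - {- int m'..<- int m} \<in> minor_sets m n"
proof -
  have "card (J' - {- int m'..<- int m}) = m' - nat (- int m - - int m')"
    using finite_minor_set[OF assms(2)] assms(3) by (simp add: card_Diff_subset)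
  then show ?thesis using assms by (simp add: minor_sets_def)
qed

text \<open>The substitution takes the values prescribed for the transition maps on the generators,
  which shows that these maps exist.\<close>

lemma block_subst_cases:
  assumes "m \<le> m'" "J' \<in> minor_sets m' n'"
  shows "J \<in> minor_sets m n \<Longrightarrow> J' = {- int m'..<- int m} \<union> J \<Longrightarrow> block_subst m n (minor_det m' J') = minor_det m J"
    and "\<not> (\<exists>J\<in>minor_sets m n. J' = {- int m'..<- int m} \<union> J) \<Longrightarrow> block_subst m n (minor_det m' J') = 0"
proof -
  assume J: "J \<in> minor_sets m n" "J' = {- int m'..<- int m} \<union> J"
  have "J' - {- int m'..<- int m} = J" using J by (auto simp: minor_sets_def)
  then show "block_subst m n (minor_det m' J') = minor_det m J"
    unfolding block_subst_minor_det block_minor[OF assms] using J by (auto simp: minor_sets_def)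
next
  assume no: "\<not> (\<exists>J\<in>minor_sets m n. J' = {- int m'..<- int m} \<union> J)"
  show "block_subst m n (minor_det m' J') = 0"
    unfolding block_subst_minor_det block_minor[OF assms]
    using minor_sets_split[OF assms, of n] no by auto
qed

lemma block_subst_kd:
  assumes "m \<le> m'" "p \<in> kd m' n'"
  shows "block_subst m n p \<in> kd m n"
  using assms(2)
proof (induction rule: kd_induct)
  case (minor J')
  show ?case
  proof (cases "\<exists>J\<in>minor_sets m n. J' = {- int m'..<- int m} \<union> J")
    case True
    then obtain J where J: "J \<in> minor_sets m n" "J' = {- int m'..<- int m} \<union> J" by blast
    show ?thesis unfolding block_subst_cases(1)[OF assms(1) minor J] by (rule kd_closed(2)[OF J(1)])
  next
    case False
    show ?thesis unfolding block_subst_cases(2)[OF assms(1) minor False] using kd_closed(1)[of 0 m n] by simp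
  qed
next
  case (uminus p)
  have "- block_subst m n p = mp_const (- 1) * block_subst m n p" by (simp add: mp_const_uminus)
  then show ?case using uminus by (simp add: mp_subst.hom_uminus kd_closed)
qed (auto simp: kd_closed mp_subst.hom_add mp_subst.hom_mult)

lemma block_subst_hom:
  assumes "m \<le> m'"
  shows "block_subst m n \<in> kalg_hom (k_delta m' n') (k_delta m n)"
  by (rule kalg_homI) (simp_all add: block_subst_kd[OF assms] mp_subst.hom_add mp_subst.hom_mult)

lemma block_subst_id: "p \<in> kd m n \<Longrightarrow> block_subst m n p = p"
proof -
  assume "p \<in> kd m n"
  then have "block_subst m n p = mp_subst mp_var p"
    using kd_vars[of p m n] by (intro mp_subst_cong) (auto simp: block_entry_def)
  then show ?thesis by simp
qed

text \<open>Checked on each variable: the identity block grows as \<open>m\<close> decreases, and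
  entries already replaced by constants keep their values.\<close>

lemma block_subst_comp:
  assumes "m \<le> m'" "n \<le> n'"
  shows "block_subst m n (block_subst m' n' p) = block_subst m n p"
proof -
  have *: "block_subst m n (block_entry m' n' v) = block_entry m n v" for v :: "int \<times> int"
  proof -
    obtain i j where "v = (i, j)" by (cases v)
    then show ?thesis using assms by (auto simp: block_entry_def)
  qed
  have "mp_vars p \<subseteq> UNIV" by simp
  then show ?thesis
    by (induction p rule: mpoly_var_induct) (simp_all add: mp_subst.hom_add mp_subst.hom_mult *)
qed

text \<open>\<open>THE\<close> also fixes the value \<open>undefined\<close> off the carrier, hence
  the restriction of \<open>h\<close>. Existence comes from \<open>h\<close>, uniqueness from
  agreement on the listed pairs.\<close>

lemma the_kalg_hom_eq:
  assumes h: "h \<in> kalg_hom A B" and A: "ring A" "\<And>c. scal A c \<in> carrier A"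
    and r: "\<And>x y. (x, y) \<in> r \<Longrightarrow> x \<in> carrier A \<and> h x = y"
    and unique: "\<And>h' x. h' \<in> kalg_hom A B \<Longrightarrow> (\<And>x y. (x, y) \<in> r \<Longrightarrow> h' x = y) \<Longrightarrow> x \<in> carrier A \<Longrightarrow> h' x = h x"
    and x: "x \<in> carrier A"
  shows "the_kalg_hom A B r x = h x"
proof -
  have "the_kalg_hom A B r = restrict h (carrier A)"
    unfolding the_kalg_hom_def
  proof (rule the_equality)
    show "restrict h (carrier A) \<in> kalg_hom A B \<and> restrict h (carrier A) \<in> extensional (carrier A) \<and>
        (\<forall>(x, y)\<in>r. restrict h (carrier A) x = y)"
      using r kalg_hom_cong[OF h A, of "restrict h (carrier A)"] by auto
    fix h' assume h': "h' \<in> kalg_hom A B \<and> h' \<in> extensional (carrier A) \<and> (\<forall>(x, y)\<in>r. h' x = y)"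
    show "h' = restrict h (carrier A)"
    proof
      fix x
      have r': "h' x = y" if "(x, y) \<in> r" for x y using h' that by auto
      have "h' x = h x" if "x \<in> carrier A" by (rule unique[OF conjunct1[OF h'] r' that])
      moreover have "h' x = undefined" if "x \<notin> carrier A" using h' that by (simp add: extensional_def)
      ultimately show "h' x = restrict h (carrier A) x" by (cases "x \<in> carrier A") simp_all
    qed
  qed
  then show ?thesis using x by simp
qed

text \<open>The substitution is a homomorphism with the prescribed values, and it is the only one
  because constants and minors generate.\<close>

lemma delta_hom_eq:
  fixes p :: "(int \<times> int, 'k::field) mpoly"
  assumes mn: "m \<le> m'" "n \<le> n'" and p: "p \<in> kd m' n'"
  shows "delta_hom (m, n) (m', n') p = block_subst m n p"
proof -
  let ?T = "{- int m'..<- int m}"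
  let ?r = "{(minor_det m' (?T \<union> J), minor_det m J) | J. J \<in> minor_sets m n} \<union>
      {(minor_det m' J', 0) | J'. J' \<in> minor_sets m' n' \<and> \<not> (\<exists>J \<in> minor_sets m n. J' = ?T \<union> J)}
      :: ((int \<times> int, 'k) mpoly \<times> (int \<times> int, 'k) mpoly) set"
  have TJ: "?T \<union> J \<in> minor_sets m' n'" if J: "J \<in> minor_sets m n" for J
  proof -
    have "?T \<inter> J = {}" using J by (auto simp: minor_sets_def)
    then have "card (?T \<union> J) = m'"
      using finite_minor_set[OF J] mn by (simp add: card_Un_disjoint)
    then show ?thesis using J mn by (auto simp: minor_sets_def)
  qed
  have "the_kalg_hom (k_delta m' n') (k_delta m n) ?r p = block_subst m n p"
  proof (rule the_kalg_hom_eq[OF block_subst_hom[OF mn(1)] ring_k_delta _ _ _ p])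
    show "scal (k_delta m' n') c \<in> kd m' n'" for c :: 'k by (simp add: kd_closed)
    show "x \<in> kd m' n' \<and> block_subst m n x = y" if "(x, y) \<in> ?r" for x y :: "(int \<times> int, 'k) mpoly"
      using that
    proof
      assume "(x, y) \<in> {(minor_det m' (?T \<union> J), minor_det m J) | J. J \<in> minor_sets m n}"
      then obtain J where J: "J \<in> minor_sets m n" "x = minor_det m' (?T \<union> J)" "y = minor_det m J" by blast
      show ?thesis
        unfolding J(2,3) using kd_closed(2)[OF TJ[OF J(1)]] block_subst_cases(1)[OF mn(1) TJ[OF J(1)] J(1) refl] by blast
    next
      assume "(x, y) \<in> {(minor_det m' J', 0) | J'. J' \<in> minor_sets m' n' \<and> \<not> (\<exists>J \<in> minor_sets m n. J' = ?T \<union> J)}"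
      then obtain J' where J': "J' \<in> minor_sets m' n'" "\<not> (\<exists>J \<in> minor_sets m n. J' = ?T \<union> J)"
        "x = minor_det m' J'" "y = 0" by blast
      show ?thesis
        unfolding J'(3,4) using kd_closed(2)[OF J'(1)] block_subst_cases(2)[OF mn(1) J'(1,2)] by blast
    qed
    fix h' and x :: "(int \<times> int, 'k) mpoly" assume h': "h' \<in> kalg_hom (k_delta m' n') (k_delta m n)" "\<And>x y. (x, y) \<in> ?r \<Longrightarrow> h' x = y" and x: "x \<in> kd m' n'"
    from x show "h' x = block_subst m n x"
    proof (induction rule: kd_induct)
      case (const c)
      show ?case using kalg_hom_scal[OF h'(1), of c] by simp
    next
      case (minor J')
      show ?case
      proof (cases "\<exists>J\<in>minor_sets m n. J' = ?T \<union> J")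
        case True
        then obtain J where J: "J \<in> minor_sets m n" "J' = ?T \<union> J" by blast
        have "h' (minor_det m' J') = minor_det m J" by (rule h'(2)) (use J in blast)
        then show ?thesis by (simp only: block_subst_cases(1)[OF mn(1) minor J])
      next
        case False
        have "h' (minor_det m' J') = 0" by (rule h'(2)) (use minor False in blast)
        then show ?thesis by (simp only: block_subst_cases(2)[OF mn(1) minor False])
      qed
    next
      case (uminus p)
      have "- p = mp_const (- 1) * p" by (simp add: mp_const_uminus)
      then have "h' (- p) = mp_const (- 1) * h' p"
        using kalg_hom_mult[OF h'(1), of "mp_const (- 1)" p] kalg_hom_scal[OF h'(1), of "- 1"] uminus(1) by (simp add: kd_closed)
      then show ?case using uminus(2) by (simp add: mp_const_uminus mp_subst.hom_uminus)
    next
      case (add p q)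
      then show ?case using kalg_hom_add[OF h'(1) add(1,2)] by (simp add: mp_subst.hom_add)
    next
      case (mult p q)
      then show ?case using kalg_hom_mult[OF h'(1) mult(1,2)] by (simp add: mp_subst.hom_mult)
    qed
  qed
  then show ?thesis by (simp add: delta_hom_def)
qed


section \<open>The homogeneous coordinate rings of the finite levels\<close>

text \<open>Points at which evaluation is dual to the coordinate sections. They make the
  coefficients of a section plain values, hence visibly linear in the section.\<close>

definition dual_pt :: "nat \<Rightarrow> int set \<Rightarrow> int set \<times> (int \<Rightarrow> 'k::field) set" where
  "dual_pt i = (SOME e. \<forall>S\<in>maya (Suc i). \<forall>T\<in>maya (Suc i). psec i S (e T) = (if S = T then 1 else 0 :: 'k))"

definition coef :: "nat \<Rightarrow> (int set \<times> (int \<Rightarrow> 'k::field) set \<Rightarrow> 'k) \<Rightarrow> int set \<Rightarrow> 'k" where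
  "coef i s S = s (dual_pt i S)"

lemma coef_psec:
  assumes "S \<in> maya (Suc i)" "T \<in> maya (Suc i)"
  shows "coef i (psec i S) T = (if S = T then 1 else 0 :: 'k::field)"
proof -
  have "\<forall>S\<in>maya (Suc i). \<forall>T\<in>maya (Suc i). psec i S (dual_pt i T) = (if S = T then 1 else 0 :: 'k)"
    unfolding dual_pt_def by (rule someI_ex[OF psec_dual])
  then show ?thesis unfolding coef_def using assms by blast
qed

lemma coef_add: "coef i (s + t) S = coef i s S + coef i t S"
  and coef_scale: "coef i (fscale c s) S = c * coef i s S"
  by (simp_all add: coef_def fscale_def)

lemma coef_sum: "coef i (\<Sum>x\<in>A. fscale (f x) (g x)) S = (\<Sum>x\<in>A. f x * coef i (g x) S)"
  by (simp add: coef_def sum_fun_apply fscale_def)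

lemma section_coef:
  fixes s :: "int set \<times> (int \<Rightarrow> 'k::{alg_closed_field, field_char_0}) set \<Rightarrow> 'k"
  assumes s: "s \<in> psections i"
  shows "s = (\<Sum>S\<in>maya (Suc i). fscale (coef i s S) (psec i S))"
proof -
  have "s \<in> fun_vs.span (psec i ` maya (Suc i))" using s unfolding sections_span .
  moreover have "fun_vs.subspace {s :: int set \<times> (int \<Rightarrow> 'k) set \<Rightarrow> 'k. s = (\<Sum>S\<in>maya (Suc i). fscale (coef i s S) (psec i S))}"
  proof (rule fun_vs.subspaceI; (rule CollectI))
    show "(0 :: int set \<times> (int \<Rightarrow> 'k) set \<Rightarrow> 'k) = (\<Sum>S\<in>maya (Suc i). fscale (coef i 0 S) (psec i S))"
      by (simp add: coef_def)
    fix x y :: "int set \<times> (int \<Rightarrow> 'k) set \<Rightarrow> 'k" and c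
    assume x: "x \<in> {s. s = (\<Sum>S\<in>maya (Suc i). fscale (coef i s S) (psec i S))}"
    show "fscale c x = (\<Sum>S\<in>maya (Suc i). fscale (coef i (fscale c x) S) (psec i S))"
    proof -
      have "fscale c x = fscale c (\<Sum>S\<in>maya (Suc i). fscale (coef i x S) (psec i S))" using x by (intro arg_cong[where f = "fscale c"]) blast
      then show ?thesis unfolding fun_vs.scale_sum_right fun_vs.scale_scale coef_scale .
    qed
    assume y: "y \<in> {s. s = (\<Sum>S\<in>maya (Suc i). fscale (coef i s S) (psec i S))}"
    show "x + y = (\<Sum>S\<in>maya (Suc i). fscale (coef i (x + y) S) (psec i S))"
    proof -
      have "x + y = (\<Sum>S\<in>maya (Suc i). fscale (coef i x S) (psec i S)) + (\<Sum>S\<in>maya (Suc i). fscale (coef i y S) (psec i S))"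
        using x y by (intro arg_cong2[where f = "(+)"]) blast+
      then show ?thesis unfolding coef_add fun_vs.scale_left_distrib sum.distrib .
    qed
  qed
  moreover have "x = (\<Sum>S\<in>maya (Suc i). fscale (coef i x S) (psec i S))" if x: "x \<in> psec i ` maya (Suc i)" for x :: "int set \<times> (int \<Rightarrow> 'k) set \<Rightarrow> 'k"
  proof -
    obtain T where T: "T \<in> maya (Suc i)" "x = psec i T" using x by blast
    have "(\<Sum>S\<in>maya (Suc i). fscale (coef i x S) (psec i S)) = (\<Sum>S\<in>maya (Suc i). if S = T then psec i T else 0)"
      unfolding T(2) by (intro sum.cong refl) (simp add: coef_psec[OF T(1)])
    then show ?thesis using T finite_maya[of "Suc i"] by simp
  qed
  ultimately show ?thesis by (rule fun_vs.span_induct)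
qed

section \<open>Substituting minors for sections\<close>

definition mdet :: "nat \<Rightarrow> int set \<Rightarrow> (int \<times> int, 'k::field) mpoly" where
  "mdet n S = minor_det n (S \<inter> {- int n..})"

lemma mdet_semi: "J \<in> minor_sets n n \<Longrightarrow> mdet n (semi n J) = minor_det n J"
  by (simp add: mdet_def semi_Int)

lemma mdet_kd: "S \<in> maya n \<Longrightarrow> mdet n S \<in> kd n n"
  by (auto simp: maya_def mdet_semi kd_closed)

text \<open>The linear map that sends \<open>psec i S\<close> to \<open>mdet (Suc i) S\<close>; it
  is needed on all sections, because the symmetric algebra has a variable for each of them.\<close>

definition sec_det :: "nat \<Rightarrow> (int set \<times> (int \<Rightarrow> 'k::field) set \<Rightarrow> 'k) \<Rightarrow> (int \<times> int, 'k) mpoly" where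
  "sec_det i s = (\<Sum>S\<in>maya (Suc i). mp_const (coef i s S) * mdet (Suc i) S)"

abbreviation det_subst ::
  "nat \<Rightarrow> (int set \<times> (int \<Rightarrow> 'k::field) set \<Rightarrow> 'k, 'k) mpoly \<Rightarrow> (int \<times> int, 'k) mpoly" where
  "det_subst i \<equiv> mp_subst (sec_det i)"

lemma sec_det_kd: "sec_det i s \<in> kd (Suc i) (Suc i)"
  unfolding sec_det_def by (intro kd_sum kd_closed mdet_kd)

lemma sec_det_psec: "S \<in> maya (Suc i) \<Longrightarrow> sec_det i (psec i S) = mdet (Suc i) S"
proof -
  assume S: "S \<in> maya (Suc i)"
  have "sec_det i (psec i S) = (\<Sum>T\<in>maya (Suc i). if T = S then mdet (Suc i) S else 0)"
    unfolding sec_det_def using S by (intro sum.cong refl) (auto simp: coef_psec)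
  then show ?thesis using S finite_maya[of "Suc i"] by simp
qed

lemma det_subst_kd: "det_subst i p \<in> kd (Suc i) (Suc i)"
proof -
  have "mp_vars p \<subseteq> UNIV" by simp
  then show ?thesis
    by (induction p rule: mpoly_var_induct) (simp_all add: mp_subst.hom_add mp_subst.hom_mult kd_closed sec_det_kd)
qed

lemma det_subst_hom: "det_subst i \<in> kalg_hom (poly_alg V) (k_delta (Suc i) (Suc i))"
  by (rule kalg_homI) (simp_all add: det_subst_kd mp_subst.hom_add mp_subst.hom_mult)

lemma det_subst_surj:
  assumes "p \<in> kd (Suc i) (Suc i)"
  shows "\<exists>q. mp_vars q \<subseteq> psections i \<and> det_subst i q = p"
  using assms
proof (induction rule: kd_induct)
  case (const c)
  show ?case by (rule exI[of _ "mp_const c"]) simp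
next
  case (minor J)
  have "semi (Suc i) J \<in> maya (Suc i)" using minor by (simp add: maya_def)
  then show ?case
    by (intro exI[of _ "mp_var (psec i (semi (Suc i) J))"]) (simp add: psec_section sec_det_psec mdet_semi[OF minor])
next
  case (uminus p)
  then obtain q where "mp_vars q \<subseteq> psections i" "det_subst i q = p" by blast
  then show ?case by (intro exI[of _ "- q"]) (simp add: mp_subst.hom_uminus)
next
  case (add p q)
  then obtain p' q' where "mp_vars p' \<subseteq> psections i" "det_subst i p' = p" "mp_vars q' \<subseteq> psections i" "det_subst i q' = q" by blast
  then show ?case by (intro exI[of _ "p' + q'"]) (simp add: mp_subst.hom_add mp_vars_closed)
next
  case (mult p q)
  then obtain p' q' where "mp_vars p' \<subseteq> psections i" "det_subst i p' = p" "mp_vars q' \<subseteq> psections i" "det_subst i q' = q" by blast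
  then show ?case by (intro exI[of _ "p' * q'"]) (simp add: mp_subst.hom_mult mp_vars_closed)
qed

lemma mp_eval_mdet:
  assumes "S \<in> maya n"
  shows "mp_eval (\<lambda>(i, j). w (nat (j + int n)) i) (mdet n S) = pext n w S"
proof -
  obtain J where J: "J \<in> minor_sets n n" "S = semi n J" using assms by (auto simp: maya_def)
  show ?thesis
    unfolding J(2) mdet_semi[OF J(1)] pext_semi[OF J(1)] minor_det_minor mp_eval.hom_tminor
    by (rule dform_cong) simp
qed

lemma eval_fun_coef:
  fixes s :: "int set \<times> (int \<Rightarrow> 'k::{alg_closed_field, field_char_0}) set \<Rightarrow> 'k"
  assumes W: "W \<in> grass_step (Suc i)" and s: "s \<in> psections i"
  shows "eval_fun i W s = (\<Sum>S\<in>maya (Suc i). coef i s S * pv W S)"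
proof -
  obtain T where T: "T \<in> maya_inf" "W \<in> coord_nonzero (grass_step (Suc i)) T" by (rule nonzero_chart[OF W])
  have "s (T, W) = (\<Sum>S\<in>maya (Suc i). coef i s S * psec i S (T, W))"
    by (subst section_coef[OF s]) (simp add: sum_fun_apply fscale_def)
  also have "\<dots> = (\<Sum>S\<in>maya (Suc i). coef i s S * (pv W S / pv W T))"
    using T unfolding psec_def by simp
  finally have "pv W T * s (T, W) = (\<Sum>S\<in>maya (Suc i). coef i s S * pv W S)"
    using T(2) by (simp add: sum_distrib_left)
  then show ?thesis unfolding eval_fun_eq[OF T] restr_def using s by simp
qed

text \<open>Both sides evaluate \<open>p\<close>, on the left at the substituted sections, whose
  values at \<open>M\<close> are \<open>c\<close> times those of \<open>eval_fun\<close>. It links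
  vanishing on matrices with vanishing on the image.\<close>

lemma mp_eval_det_subst:
  fixes p :: "(int set \<times> (int \<Rightarrow> 'k::{alg_closed_field, field_char_0}) set \<Rightarrow> 'k, 'k) mpoly"
  assumes W: "W \<in> grass_step (Suc i)" and M: "\<And>S. S \<in> maya (Suc i) \<Longrightarrow> mp_eval M (mdet (Suc i) S) = c * pv W S"
    and p: "mp_vars p \<subseteq> psections i"
  shows "mp_eval M (det_subst i p) = mp_eval (fscale c (eval_fun i W)) p"
  unfolding mp_eval_subst
proof (rule mp_eval_cong)
  fix s assume "s \<in> mp_vars p"
  then have s: "s \<in> psections i" using p by blast
  have "mp_eval M (sec_det i s) = (\<Sum>S\<in>maya (Suc i). coef i s S * (c * pv W S))"
    unfolding sec_det_def mp_eval.hom_sum by (intro sum.cong refl) (simp add: mp_eval.hom_mult M)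
  then show "mp_eval M (sec_det i s) = fscale c (eval_fun i W) s"
    unfolding fscale_apply eval_fun_coef[OF W s] by (simp add: sum_distrib_left mult.left_commute)
qed

text \<open>Scaling one column scales all minors, so every multiple of \<open>pv W\<close>,
  including 0, is the vector of minors of some matrix.\<close>

lemma point_matrix:
  fixes W :: "(int \<Rightarrow> 'k::{alg_closed_field, field_char_0}) set"
  assumes W: "W \<in> grass_step (Suc i)"
  shows "\<exists>M. \<forall>S\<in>maya (Suc i). mp_eval M (mdet (Suc i) S) = c * pv W S"
proof -
  obtain w where w: "frame (Suc i) (Suc i) w" "W = grass_incl (Suc i) (colspan (Suc i) w)" using W unfolding grass_step_frame by blast
  obtain a where a: "a \<noteq> 0" "pext (Suc i) w = fscale a (pv W)" using pv_frame[OF w(1)] w(2) by blast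
  \<comment> \<open>The factor \<open>1 / a\<close> corrects for the choice in \<open>pv\<close>,
    and \<open>c\<close> is the wanted multiple.\<close>
  define w' where "w' = w(0 := fscale (c / a) (w 0))"
  have "pext (Suc i) w' S = c * pv W S" for S
  proof -
    have "pext (Suc i) w' S = c / a * pext (Suc i) (w(0 := w 0)) S" unfolding w'_def by (rule alt_form_scale[OF pext_alt_form]) simp
    also have "pext (Suc i) (w(0 := w 0)) S = a * pv W S" unfolding fun_upd_triv a(2) by (simp add: fscale_def)
    finally show ?thesis using a(1) by simp
  qed
  then show ?thesis using mp_eval_mdet[of _ "Suc i" w'] by (intro exI[of _ "\<lambda>(l, j). w' (nat (j + int (Suc i))) l"]) simp
qed

lemma homogeneous_0_const: "homogeneous 0 p \<Longrightarrow> p = mp_const (lkp p 0)"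
proof (rule poly_mapping_eqI)
  fix \<mu> assume p: "homogeneous 0 p"
  have "mdeg \<mu> = 0 \<Longrightarrow> \<mu> = 0" for \<mu> :: "'a \<Rightarrow>\<^sub>0 nat"
  proof (rule poly_mapping_eqI)
    fix v assume "mdeg \<mu> = 0"
    then show "lkp \<mu> v = lkp 0 v" by (cases "v \<in> supp \<mu>") (auto simp: mdeg_def in_keys_iff)
  qed
  then have "\<mu> \<noteq> 0 \<Longrightarrow> lkp p \<mu> = 0" using p unfolding homogeneous_alt by (metis in_keys_iff)
  then show "lkp p \<mu> = lkp (mp_const (lkp p 0)) \<mu>" by (cases "\<mu> = 0") (auto simp: mp_const_def lookup_single)
qed

text \<open>Checked at every matrix. If some minor is nonzero, the columns give a point, and the
  minors are a nonzero multiple of its coordinates. If all minors vanish, the value is that of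
  \<open>p\<close> at 0, which homogeneity makes 0 in positive degree.\<close>

lemma det_subst_zero_of_vanishing:
  fixes p :: "(int set \<times> (int \<Rightarrow> 'k::{alg_closed_field, field_char_0}) set \<Rightarrow> 'k, 'k) mpoly"
  assumes p: "homogeneous d p" "mp_vars p \<subseteq> psections i"
    and van: "\<And>W c. W \<in> grass_step (Suc i) \<Longrightarrow> c \<noteq> 0 \<Longrightarrow> mp_eval (fscale c (eval_fun i W)) p = 0"
  shows "det_subst i p = 0"
proof (rule mp_eval_all_0)
  fix M :: "int \<times> int \<Rightarrow> 'k"
  let ?n = "Suc i"
  define w where "w c l = M (l, int c - int ?n)" for c l
  have m: "mp_eval M (mdet ?n S) = pext ?n w S" if S: "S \<in> maya ?n" for S
  proof -
    obtain J where J: "J \<in> minor_sets ?n ?n" "S = semi ?n J" using S by (auto simp: maya_def)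
    show ?thesis
      unfolding J(2) mdet_semi[OF J(1)] pext_semi[OF J(1)] minor_det_minor mp_eval.hom_tminor
      by (rule dform_cong) (simp add: w_def)
  qed
  show "mp_eval M (det_subst i p) = 0"
  proof (cases "\<exists>S. pext ?n w S \<noteq> 0")
    case True
    then obtain S where S: "pext ?n w S \<noteq> 0" by blast
    obtain a where a: "a \<noteq> 0" "pext ?n w = fscale a (pv (frame_space ?n w))" using frame_space_pv(2)[OF S] by blast
    have "mp_eval M (det_subst i p) = mp_eval (fscale a (eval_fun i (frame_space ?n w))) p"
      by (rule mp_eval_det_subst[OF frame_space_pv(1)[OF S] _ p(2)]) (simp add: m a(2) fscale_apply)
    then show ?thesis using van[OF frame_space_pv(1)[OF S] a(1)] by simp
  next
    case False
    have "mp_eval M (sec_det i s) = 0" for s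
      unfolding sec_det_def mp_eval.hom_sum using False m by (intro sum.neutral) (simp add: mp_eval.hom_mult)
    then have 0: "mp_eval M (det_subst i p) = mp_eval (\<lambda>s. 0 * 0) p" unfolding mp_eval_subst by simp
    show ?thesis
    \<comment> \<open>Homogeneity does not kill a constant; here the vanishing at a single point is
      used, which exists because the space is not empty.\<close>
    proof (cases "d = 0")
      case True
      then have c: "p = mp_const (lkp p 0)" using homogeneous_0_const p(1) by blast
      have "pts (grass_filt i :: ((int \<Rightarrow> 'k) set, 'k) kspace) \<noteq> {}"
        using irreducible_grass_filt unfolding irreducible_top_def by blast
      then obtain W :: "(int \<Rightarrow> 'k) set" where "W \<in> grass_step ?n" by auto
      have "lkp p 0 = mp_eval (fscale 1 (eval_fun i W)) (mp_const (lkp p 0))" by simp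
      also have "\<dots> = 0" unfolding c[symmetric] using \<open>W \<in> grass_step ?n\<close> by (intro van) simp_all
      finally have "lkp p 0 = 0" .
      then have "p = 0" using c by simp
      then show ?thesis by simp
    next
      case False
      then show ?thesis unfolding 0 mp_eval_homogeneous_scale[OF p(1)] by simp
    qed
  qed
qed

abbreviation sec_ideal :: "nat \<Rightarrow> (int set \<times> (int \<Rightarrow> 'k::field) set \<Rightarrow> 'k, 'k) mpoly set" where
  "sec_ideal i \<equiv> genideal (poly_alg (psections i)) (sym_relations (psections i))"

abbreviation level_points :: "nat \<Rightarrow> ((int set \<times> (int \<Rightarrow> 'k::field) set \<Rightarrow> 'k) \<Rightarrow> 'k) set set" where
  "level_points i \<equiv> embedding_at grass_filt pluecker_bundle i ` grass_step (Suc i)"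

lemma coord_ring_at_eq:
  "coord_ring_at grass_filt pluecker_bundle i =
    kalg_quot (sym_alg (psections i)) (vanishing_ideal (psections i) (level_points i))"
  by (simp add: coord_ring_at_def coord_ring_def)

lemma sym_relations_carrier:
  "sym_relations (psections i :: (int set \<times> (int \<Rightarrow> 'k::field) set \<Rightarrow> 'k) set) \<subseteq> carrier (poly_alg (psections i))"
proof -
  let ?V = "psections i :: (int set \<times> (int \<Rightarrow> 'k) set \<Rightarrow> 'k) set"
  have ss: "fun_vs.subspace ?V" by (rule subspace_sections)
  have "mp_vars (mp_var (s + t) - mp_var s - mp_var t :: (_, 'k) mpoly) \<subseteq> ?V" if "s \<in> ?V" "t \<in> ?V" for s t
    using that fun_vs.subspace_add[OF ss] by (intro mp_vars_closed) simp_all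
  moreover have "mp_vars (mp_var (fscale c s) - mp_const c * mp_var s :: (_, 'k) mpoly) \<subseteq> ?V" if "s \<in> ?V" for c s
    using that fun_vs.subspace_scale[OF ss] by (intro mp_vars_closed) simp_all
  ultimately have "mp_vars p \<subseteq> ?V" if "p \<in> sym_relations ?V" for p
    using that unfolding sym_relations_def by (elim UnE CollectE exE conjE) simp_all
  then show ?thesis by auto
qed

lemma ideal_sec_ideal: "ideal (sec_ideal i) (poly_alg (psections i))"
proof -
  interpret cring "poly_alg (psections i)" by (rule cring_poly_alg)
  show ?thesis by (rule genideal_ideal[OF sym_relations_carrier])
qed

lemma cring_sym_alg: "cring (sym_alg (psections i))"
  unfolding sym_alg_def by (rule cring_kalg_quot[OF cring_poly_alg ideal_sec_ideal])

lemma ideal_vanishing: "ideal (vanishing_ideal (psections i) Y) (sym_alg (psections i))"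
proof -
  interpret cring "sym_alg (psections i)" by (rule cring_sym_alg)
  show ?thesis unfolding vanishing_ideal_def by (rule genideal_ideal) blast
qed

lemma ring_hom_ring_kalg: "h \<in> kalg_hom A B \<Longrightarrow> ring A \<Longrightarrow> ring B \<Longrightarrow> ring_hom_ring A B h"
  by (rule ring_hom_ringI2) (auto simp: kalg_hom_ring_hom)

text \<open>The linear relations of the symmetric algebra hold after the substitution, because the
  coefficients of a section are linear in it.\<close>

lemma sec_ideal_kernel:
  fixes i :: nat
  defines "V \<equiv> psections i :: (int set \<times> (int \<Rightarrow> 'k::{alg_closed_field, field_char_0}) set \<Rightarrow> 'k) set"
  shows "sec_ideal i \<subseteq> a_kernel (poly_alg V) (k_delta (Suc i) (Suc i)) (det_subst i)"
proof -
  interpret R: cring "poly_alg V" by (rule cring_poly_alg)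
  interpret h: ring_hom_ring "poly_alg V" "k_delta (Suc i) (Suc i)" "det_subst i"
    by (rule ring_hom_ring_kalg[OF det_subst_hom R.ring_axioms ring_k_delta])
  show ?thesis
    unfolding V_def[symmetric]
  proof (rule R.genideal_minimal[OF h.kernel_is_ideal])
    have add: "sec_det i (s + t) = sec_det i s + sec_det i t" for s t :: "int set \<times> (int \<Rightarrow> 'k) set \<Rightarrow> 'k"
      unfolding sec_det_def coef_add mp_const_add distrib_right sum.distrib ..
    have scale: "sec_det i (fscale c s) = mp_const c * sec_det i s" for c and s :: "int set \<times> (int \<Rightarrow> 'k) set \<Rightarrow> 'k"
      unfolding sec_det_def coef_scale mp_const_mult by (simp add: sum_distrib_left mult.assoc)
    have "det_subst i p = 0" if "p \<in> sym_relations V" for p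
      using that unfolding sym_relations_def
      by (auto simp: mp_subst.hom_minus mp_subst.hom_mult add scale)
    then show "sym_relations V \<subseteq> a_kernel (poly_alg V) (k_delta (Suc i) (Suc i)) (det_subst i)"
      using sym_relations_carrier[of i] unfolding V_def a_kernel_def' by auto
  qed
qed

definition sym_det :: "nat \<Rightarrow> (int set \<times> (int \<Rightarrow> 'k::field) set \<Rightarrow> 'k, 'k) mpoly set \<Rightarrow> (int \<times> int, 'k) mpoly" where
  "sym_det i = quot_map (det_subst i)"

definition coord_iso :: "nat \<Rightarrow> (int set \<times> (int \<Rightarrow> 'k::field) set \<Rightarrow> 'k, 'k) mpoly set set \<Rightarrow> (int \<times> int, 'k) mpoly" where
  "coord_iso i = quot_map (sym_det i)"

context
  fixes i :: nat and V :: "(int set \<times> (int \<Rightarrow> 'k::{alg_closed_field, field_char_0}) set \<Rightarrow> 'k) set"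
    and Y :: "((int set \<times> (int \<Rightarrow> 'k) set \<Rightarrow> 'k) \<Rightarrow> 'k) set set"
    and K :: "('k, (int \<times> int, 'k) mpoly) kalg"
  defines "V \<equiv> psections i" and "Y \<equiv> level_points i" and "K \<equiv> k_delta (Suc i) (Suc i)"
begin

lemma ring_poly_V: "ring (poly_alg V)"
  using cring_poly_alg by (rule cring.axioms(1))

lemma ring_sym_V: "ring (sym_alg V)"
  unfolding V_def using cring_sym_alg by (rule cring.axioms(1))

lemma sym_alg_quot: "sym_alg V = kalg_quot (poly_alg V) (sec_ideal i)"
  by (simp add: sym_alg_def V_def)

lemma ideal_V: "ideal (sec_ideal i) (poly_alg V)"
  unfolding V_def by (rule ideal_sec_ideal)

lemma kernel_V: "sec_ideal i \<subseteq> a_kernel (poly_alg V) (k_delta (Suc i) (Suc i)) (det_subst i)"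
  unfolding V_def by (rule sec_ideal_kernel)

lemma ideal_van: "ideal (vanishing_ideal V Y) (sym_alg V)"
  unfolding V_def by (rule ideal_vanishing)

lemmas sym_quot = quot_map_coset[OF ring_poly_V ideal_V ring_k_delta det_subst_hom kernel_V]
  quot_map_mem[OF ring_poly_V ideal_V ring_k_delta det_subst_hom kernel_V]
  quot_map_hom[OF ring_poly_V ideal_V ring_k_delta det_subst_hom kernel_V]

lemma sym_det_coset: "mp_vars p \<subseteq> V \<Longrightarrow> sym_det i (sec_ideal i +>\<^bsub>poly_alg V\<^esub> p) = det_subst i p"
  unfolding sym_det_def by (rule sym_quot(1)) simp_all

lemma sym_det_mem: "X \<in> carrier (sym_alg V) \<Longrightarrow> p \<in> X \<Longrightarrow>
    sym_det i X = det_subst i p \<and> mp_vars p \<subseteq> V \<and> X = sec_ideal i +>\<^bsub>poly_alg V\<^esub> p"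
proof -
  assume X: "X \<in> carrier (sym_alg V)" "p \<in> X"
  have p: "p \<in> carrier (poly_alg V) \<longleftrightarrow> mp_vars p \<subseteq> V" by simp
  have "quot_map (det_subst i) X = det_subst i p \<and> p \<in> carrier (poly_alg V) \<and> X = sec_ideal i +>\<^bsub>poly_alg V\<^esub> p"
    by (rule sym_quot(2)) (use X in \<open>simp_all add: sym_alg_quot\<close>)
  then show ?thesis unfolding sym_det_def p .
qed

lemma sym_det_hom: "sym_det i \<in> kalg_hom (sym_alg V) K"
  unfolding sym_det_def sym_alg_quot K_def by (rule sym_quot(3)) simp

lemma sym_alg_carrier: "X \<in> carrier (sym_alg V) \<Longrightarrow> \<exists>p. mp_vars p \<subseteq> V \<and> X = sec_ideal i +>\<^bsub>poly_alg V\<^esub> p"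
  unfolding sym_alg_quot by (auto simp: kalg_quot_sel)

lemma sym_coset_carrier: "mp_vars p \<subseteq> V \<Longrightarrow> sec_ideal i +>\<^bsub>poly_alg V\<^esub> p \<in> carrier (sym_alg V)"
  unfolding sym_alg_quot by (auto simp: kalg_quot_sel)

lemma sym_coset_self: "mp_vars p \<subseteq> V \<Longrightarrow> p \<in> sec_ideal i +>\<^bsub>poly_alg V\<^esub> p"
proof -
  interpret ideal "sec_ideal i" "poly_alg V" by (rule ideal_V)
  show "mp_vars p \<subseteq> V \<Longrightarrow> p \<in> sec_ideal i +>\<^bsub>poly_alg V\<^esub> p" by (rule a_rcos_self) simp
qed

lemma Y_points: "l \<in> Y \<longleftrightarrow> (\<exists>W\<in>grass_step (Suc i). l = vline (eval_fun i W))"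
  unfolding Y_def using embedding_vline by (auto simp: image_iff)

text \<open>The homogeneous generators are killed by \<open>det_subst_zero_of_vanishing\<close>.
  Conversely, an element that the substitution kills vanishes at all multiples of all points;
  varying the multiple separates its homogeneous parts, each of which is then a generator.\<close>

lemma vanishing_ideal_kernel: "vanishing_ideal V Y = a_kernel (sym_alg V) K (sym_det i)"
proof
  interpret S: cring "sym_alg V" unfolding V_def by (rule cring_sym_alg)
  interpret h: ring_hom_ring "sym_alg V" K "sym_det i"
    unfolding K_def by (rule ring_hom_ring_kalg[OF sym_det_hom[unfolded K_def] ring_sym_V ring_k_delta])
  have kernel: "X \<in> a_kernel (sym_alg V) K (sym_det i) \<longleftrightarrow> X \<in> carrier (sym_alg V) \<and> sym_det i X = 0" for X
    unfolding a_kernel_def' mem_Collect_eq K_def k_delta_sel ..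
  let ?G = "{A \<in> carrier (sym_alg V). (\<exists>d. \<exists>p\<in>A. homogeneous d p) \<and>
        (\<forall>l\<in>Y. \<forall>\<phi> \<in> l - {0}. \<forall>p\<in>A. mp_eval \<phi> p = 0)}"
  show "vanishing_ideal V Y \<subseteq> a_kernel (sym_alg V) K (sym_det i)"
    unfolding vanishing_ideal_def
  proof (rule S.genideal_minimal[OF h.kernel_is_ideal], rule subsetI)
    fix X assume X: "X \<in> ?G"
    then obtain d p where p: "p \<in> X" "homogeneous d p" by blast
    have XS: "X \<in> carrier (sym_alg V)" using X by blast
    note q = sym_det_mem[OF XS p(1)]
    have "det_subst i p = 0"
    proof (rule det_subst_zero_of_vanishing[OF p(2)])
      show "mp_vars p \<subseteq> psections i" using q unfolding V_def by blast
      fix W :: "(int \<Rightarrow> 'k) set" and c :: 'k assume W: "W \<in> grass_step (Suc i)" and c: "c \<noteq> 0"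
      have "fscale c (eval_fun i W) \<in> vline (eval_fun i W) - {0}"
        using c eval_fun_dual[OF W] by (auto simp: vline_def)
      moreover have "vline (eval_fun i W) \<in> Y" using W Y_points by blast
      ultimately show "mp_eval (fscale c (eval_fun i W)) p = 0" using X p(1) by blast
    qed
    then have "sym_det i X = 0" using conjunct1[OF q] by simp
    then show "X \<in> a_kernel (sym_alg V) K (sym_det i)" unfolding kernel using XS by blast
  qed
  interpret I: ideal "vanishing_ideal V Y" "sym_alg V" by (rule ideal_van)
  show "a_kernel (sym_alg V) K (sym_det i) \<subseteq> vanishing_ideal V Y"
  proof
    fix X assume "X \<in> a_kernel (sym_alg V) K (sym_det i)"
    then have X: "X \<in> carrier (sym_alg V)" "sym_det i X = 0" using kernel by auto
    then obtain p where p: "mp_vars p \<subseteq> V" "X = sec_ideal i +>\<^bsub>poly_alg V\<^esub> p" using sym_alg_carrier by blast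
    have dp: "det_subst i p = 0" using X(2) sym_det_coset[OF p(1)] p(2) by simp
    \<comment> \<open>Values at a multiple of a point depend only on the image under the
      substitution, since \<open>point_matrix\<close> realizes this multiple by a matrix.\<close>
    have ev: "mp_eval (fscale c (eval_fun i W)) q = mp_eval (fscale c (eval_fun i W)) q'"
      if W: "W \<in> grass_step (Suc i)" and qq: "mp_vars q \<subseteq> V" "mp_vars q' \<subseteq> V" "det_subst i q = det_subst i q'"
      for W :: "(int \<Rightarrow> 'k) set" and c q q'
    proof -
      obtain M where M: "\<forall>S\<in>maya (Suc i). mp_eval M (mdet (Suc i) S) = c * pv W S" using point_matrix[OF W] by blast
      show ?thesis
        using mp_eval_det_subst[OF W, of M c q] mp_eval_det_subst[OF W, of M c q'] M qq unfolding V_def by simp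
    qed
    have part: "sec_ideal i +>\<^bsub>poly_alg V\<^esub> hpart d p \<in> vanishing_ideal V Y" for d
    proof -
      have hv: "mp_vars (hpart d p) \<subseteq> V" by (rule order_trans[OF mp_vars_hpart p(1)])
      let ?X = "sec_ideal i +>\<^bsub>poly_alg V\<^esub> hpart d p"
      have "mp_eval \<phi> q = 0" if l: "l \<in> Y" "\<phi> \<in> l - {0}" and q: "q \<in> ?X" for l \<phi> q
      proof -
        obtain W where W: "W \<in> grass_step (Suc i)" "l = vline (eval_fun i W)" using l(1) Y_points by blast
        then obtain c where c: "\<phi> = fscale c (eval_fun i W)" using l(2) by (auto simp: vline_def)
        have "det_subst i q = det_subst i (hpart d p)" "mp_vars q \<subseteq> V"
          using sym_det_mem[OF sym_coset_carrier[OF hv] q] sym_det_coset[OF hv] by auto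
        then have 1: "mp_eval \<phi> q = mp_eval \<phi> (hpart d p)" unfolding c using ev[OF W(1) _ hv] by blast
        show ?thesis
        proof (cases "d \<in> mdeg ` supp p")
          case True
          \<comment> \<open>Along the multiples of \<open>\<phi>\<close> by \<open>t\<close>, the
            value of \<open>p\<close> is a polynomial in \<open>t\<close> whose coefficients are the
            values of its homogeneous parts.\<close>
          have "mp_eval \<phi> (hpart d p) = 0"
          proof (rule power_sum_eq_0[where b = "\<lambda>d. mp_eval \<phi> (hpart d p)", OF _ _ True])
            fix t
            have "(\<Sum>d\<in>mdeg ` supp p. mp_eval \<phi> (hpart d p) * t ^ d) = (\<Sum>d\<in>mdeg ` supp p. mp_eval (fscale t \<phi>) (hpart d p))"
              by (simp add: mp_eval_fscale[OF homogeneous_hpart] mult.commute)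
            also have "\<dots> = mp_eval (fscale t \<phi>) p" unfolding mp_eval.hom_sum[symmetric] sum_hpart[symmetric] ..
            also have "\<dots> = mp_eval (fscale (t * c) (eval_fun i W)) p" unfolding c by simp
            also have "\<dots> = mp_eval (fscale (t * c) (eval_fun i W)) 0" using dp by (intro ev[OF W(1) p(1)]) simp_all
            finally show "(\<Sum>d\<in>mdeg ` supp p. mp_eval \<phi> (hpart d p) * t ^ d) = 0" by simp
          qed simp
          then show ?thesis using 1 by simp
        next
          case False
          then have "hpart d p = 0" by (auto simp: hpart_def intro!: sum.neutral)
          then show ?thesis using 1 by simp
        qed
      qed
      then have "?X \<in> ?G"
        using sym_coset_carrier[OF hv] sym_coset_self[OF hv] homogeneous_hpart[of d p] by blast
      then show ?thesis unfolding vanishing_ideal_def using S.genideal_self[of ?G] by blast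
    qed
    have "sec_ideal i +>\<^bsub>poly_alg V\<^esub> (\<Sum>d\<in>D. hpart d p) \<in> vanishing_ideal V Y \<and> mp_vars (\<Sum>d\<in>D. hpart d p) \<subseteq> V"
      if "finite D" for D
      using that
    proof induction
      case empty
      have "\<zero>\<^bsub>sym_alg V\<^esub> = sec_ideal i +>\<^bsub>poly_alg V\<^esub> 0"
      proof -
        interpret J: ideal "sec_ideal i" "poly_alg V" by (rule ideal_V)
        have "sec_ideal i +>\<^bsub>poly_alg V\<^esub> \<zero>\<^bsub>poly_alg V\<^esub> = sec_ideal i" by (rule J.a_coset_add_zero[OF J.a_subset])
        then show ?thesis unfolding sym_alg_quot kalg_quot_sel by simp
      qed
      then show ?case using I.zero_closed by simp
    next
      case (insert d D)
      have hv: "mp_vars (hpart d p) \<subseteq> V" by (rule order_trans[OF mp_vars_hpart p(1)])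
      have "(sec_ideal i +>\<^bsub>poly_alg V\<^esub> hpart d p) \<oplus>\<^bsub>sym_alg V\<^esub> (sec_ideal i +>\<^bsub>poly_alg V\<^esub> (\<Sum>d\<in>D. hpart d p)) =
          sec_ideal i +>\<^bsub>poly_alg V\<^esub> (hpart d p + (\<Sum>d\<in>D. hpart d p))"
        unfolding sym_alg_quot using kalg_quot_ops(1)[OF ideal_V, of "hpart d p" "\<Sum>d\<in>D. hpart d p"] hv insert.IH by simp
      moreover have "(sec_ideal i +>\<^bsub>poly_alg V\<^esub> hpart d p) \<oplus>\<^bsub>sym_alg V\<^esub> (sec_ideal i +>\<^bsub>poly_alg V\<^esub> (\<Sum>d\<in>D. hpart d p)) \<in> vanishing_ideal V Y"
        by (rule I.a_closed[OF part]) (use insert.IH in blast)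
      ultimately show ?case using insert mp_vars_closed(1)[OF hv] by simp
    qed
    from this[of "mdeg ` supp p"] show "X \<in> vanishing_ideal V Y"
      unfolding p(2) using sum_hpart[of p] by simp
  qed
qed

lemma coord_ring_quot: "coord_ring_at grass_filt pluecker_bundle i = kalg_quot (sym_alg V) (vanishing_ideal V Y)"
  unfolding V_def Y_def by (rule coord_ring_at_eq)

lemma scal_sym: "scal (sym_alg V) c \<in> carrier (sym_alg V)"
  unfolding sym_alg_quot kalg_quot_sel by auto

lemmas coord_quot = quot_map_coset[OF ring_sym_V ideal_van ring_k_delta sym_det_hom[unfolded K_def]
    equalityD1[OF vanishing_ideal_kernel[unfolded K_def]] scal_sym]
  quot_map_hom[OF ring_sym_V ideal_van ring_k_delta sym_det_hom[unfolded K_def]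
    equalityD1[OF vanishing_ideal_kernel[unfolded K_def]] scal_sym]

lemma coord_iso_hom: "coord_iso i \<in> kalg_hom (coord_ring_at grass_filt pluecker_bundle i) K"
  unfolding coord_iso_def coord_ring_quot K_def by (rule coord_quot(2))

lemma coord_form_at_eq: "coord_form_at grass_filt pluecker_bundle i s =
    vanishing_ideal V Y +>\<^bsub>sym_alg V\<^esub> (sec_ideal i +>\<^bsub>poly_alg V\<^esub> mp_var s)"
  by (simp add: coord_form_at_def coord_form_def sym_incl_def V_def Y_def)

lemma coord_iso_form:
  assumes "s \<in> V"
  shows "coord_iso i (coord_form_at grass_filt pluecker_bundle i s) = sec_det i s"
proof -
  have v: "mp_vars (mp_var s :: (_, 'k) mpoly) \<subseteq> V" using assms by simp
  show ?thesis
    unfolding coord_form_at_eq coord_iso_def coord_quot(1)[OF sym_coset_carrier[OF v]] sym_det_coset[OF v] by simp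
qed

text \<open>Injectivity is the identification of the kernel; surjectivity holds because constants
  and minors generate the target.\<close>

lemma coord_iso_bij: "bij_betw (coord_iso i) (carrier (coord_ring_at grass_filt pluecker_bundle i)) (carrier K)"
  unfolding bij_betw_def
proof
  interpret S: cring "sym_alg V" unfolding V_def by (rule cring_sym_alg)
  interpret h: ring_hom_ring "sym_alg V" K "sym_det i"
    unfolding K_def by (rule ring_hom_ring_kalg[OF sym_det_hom[unfolded K_def] ring_sym_V ring_k_delta])
  have I: "ideal (vanishing_ideal V Y) (sym_alg V)" by (rule ideal_van)
  let ?C = "coord_ring_at grass_filt pluecker_bundle i :: ('k, (int set \<times> (int \<Rightarrow> 'k) set \<Rightarrow> 'k, 'k) mpoly set set) kalg"
  show "inj_on (coord_iso i) (carrier ?C)"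
  proof (rule inj_onI)
    fix X X' assume "X \<in> carrier ?C" "X' \<in> carrier ?C" and eq: "coord_iso i X = coord_iso i X'"
    then obtain a b where a: "a \<in> carrier (sym_alg V)" "X = vanishing_ideal V Y +>\<^bsub>sym_alg V\<^esub> a"
      and b: "b \<in> carrier (sym_alg V)" "X' = vanishing_ideal V Y +>\<^bsub>sym_alg V\<^esub> b"
      unfolding coord_ring_quot kalg_quot_sel by blast
    have "sym_det i a = sym_det i b"
      using eq unfolding coord_iso_def a(2) b(2) coord_quot(1)[OF a(1)] coord_quot(1)[OF b(1)] .
    then have "sym_det i (a \<ominus>\<^bsub>sym_alg V\<^esub> b) = \<zero>\<^bsub>K\<^esub>"
      using a(1) b(1) h.hom_closed[OF b(1)] by (simp add: S.minus_eq h.S.r_neg)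
    then have "a \<ominus>\<^bsub>sym_alg V\<^esub> b \<in> vanishing_ideal V Y"
      unfolding vanishing_ideal_kernel a_kernel_def' using a(1) b(1) by simp
    then show "X = X'" unfolding a(2) b(2) using S.quotient_eq_iff_same_a_r_cos[OF I a(1) b(1)] by simp
  qed
  show "coord_iso i ` carrier ?C = carrier K"
  proof
    show "coord_iso i ` carrier ?C \<subseteq> carrier K" using kalg_hom_closed[OF coord_iso_hom] by blast
    show "carrier K \<subseteq> coord_iso i ` carrier ?C"
    proof
      fix p assume "p \<in> carrier K"
      then obtain q where q: "mp_vars q \<subseteq> V" "det_subst i q = p" using det_subst_surj unfolding K_def V_def by blast
      let ?X = "vanishing_ideal V Y +>\<^bsub>sym_alg V\<^esub> (sec_ideal i +>\<^bsub>poly_alg V\<^esub> q)"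
      have "?X \<in> carrier ?C" unfolding coord_ring_quot kalg_quot_sel using sym_coset_carrier[OF q(1)] by blast
      moreover have "coord_iso i ?X = p"
        unfolding coord_iso_def coord_quot(1)[OF sym_coset_carrier[OF q(1)]] sym_det_coset[OF q(1)] q(2) ..
      ultimately show "p \<in> coord_iso i ` carrier ?C" by blast
    qed
  qed
qed

lemma ring_coord_ring: "ring (coord_ring_at grass_filt pluecker_bundle i :: ('k, (int set \<times> (int \<Rightarrow> 'k) set \<Rightarrow> 'k, 'k) mpoly set set) kalg)"
  unfolding coord_ring_quot V_def
  by (rule cring.axioms(1)[OF cring_kalg_quot[OF cring_sym_alg ideal_vanishing]])

lemma scal_coord_ring:
  "scal (coord_ring_at grass_filt pluecker_bundle i :: ('k, (int set \<times> (int \<Rightarrow> 'k) set \<Rightarrow> 'k, 'k) mpoly set set) kalg) c \<in> carrier (coord_ring_at grass_filt pluecker_bundle i)"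
  unfolding coord_ring_quot kalg_quot_sel using scal_sym by blast

lemma coord_form_carrier:
  assumes "s \<in> V"
  shows "coord_form_at grass_filt pluecker_bundle i s \<in> carrier (coord_ring_at grass_filt pluecker_bundle i)"
  unfolding coord_form_at_eq coord_ring_quot kalg_quot_sel using sym_coset_carrier[of "mp_var s"] assms by auto

lemma quot_proj_hom: "ideal I A \<Longrightarrow> (\<lambda>a. I +>\<^bsub>A\<^esub> a) \<in> kalg_hom A (kalg_quot A I)"
  by (rule kalg_homI) (auto simp: kalg_quot_ops kalg_quot_sel)

text \<open>Constants and the classes of sections generate the coordinate ring. This is the
  uniqueness that the description of \<open>coord_restrict\<close> requires.\<close>

lemma coord_hom_unique:
  assumes h: "h \<in> kalg_hom (coord_ring_at grass_filt pluecker_bundle i) B"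
    and h': "h' \<in> kalg_hom (coord_ring_at grass_filt pluecker_bundle i) B"
    and eq: "\<And>s. s \<in> V \<Longrightarrow> h (coord_form_at grass_filt pluecker_bundle i s) = h' (coord_form_at grass_filt pluecker_bundle i s)"
    and X: "X \<in> carrier (coord_ring_at grass_filt pluecker_bundle i)"
  shows "h X = h' X"
proof -
  let ?cl = "\<lambda>p. vanishing_ideal V Y +>\<^bsub>sym_alg V\<^esub> (sec_ideal i +>\<^bsub>poly_alg V\<^esub> p)"
  have "(\<lambda>p. sec_ideal i +>\<^bsub>poly_alg V\<^esub> p) \<in> kalg_hom (poly_alg V) (sym_alg V)"
    unfolding sym_alg_quot by (rule quot_proj_hom[OF ideal_V])
  moreover have "(\<lambda>a. vanishing_ideal V Y +>\<^bsub>sym_alg V\<^esub> a) \<in> kalg_hom (sym_alg V) (coord_ring_at grass_filt pluecker_bundle i)"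
    unfolding coord_ring_quot by (rule quot_proj_hom[OF ideal_van])
  ultimately have cl: "?cl \<in> kalg_hom (poly_alg V) (coord_ring_at grass_filt pluecker_bundle i)" by (rule kalg_hom_comp)
  note g = kalg_hom_comp[OF cl h] and g' = kalg_hom_comp[OF cl h']
  obtain p where p: "mp_vars p \<subseteq> V" "X = ?cl p"
    using X sym_alg_carrier unfolding coord_ring_quot kalg_quot_sel by blast
  have "mp_vars p \<subseteq> V \<and> h (?cl p) = h' (?cl p)"
    using p(1)
  proof (induction p rule: mpoly_var_induct)
    case (const c)
    then show ?case using kalg_hom_scal[OF g, of c] kalg_hom_scal[OF g', of c] by simp
  next
    case (var s)
    then show ?case using eq[OF var] unfolding coord_form_at_eq by simp
  next
    case (add p q)
    then show ?case using kalg_hom_add[OF g, of p q] kalg_hom_add[OF g', of p q] by (simp add: mp_vars_closed)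
  next
    case (mult p q)
    then show ?case using kalg_hom_mult[OF g, of p q] kalg_hom_mult[OF g', of p q] by (simp add: mp_vars_closed)
  qed
  then show ?thesis using p(2) by simp
qed

end


section \<open>The homogeneous coordinate ring of the union\<close>

lemma restrict_psec_le: "i \<le> j \<Longrightarrow> restrict_section (grass_step (Suc i)) (psec j S) = psec i S"
  using grass_step_mono[of "Suc i" "Suc j"] by (auto simp: restrict_section_def psec_def fun_eq_iff)

lemma psec_outside: "S \<notin> maya (Suc i) \<Longrightarrow> psec i S = 0"
  using pv_outside[of _ "Suc i" S] by (auto simp: psec_def fun_eq_iff)

lemma restrict_section_combination:
  "restrict_section Z (\<Sum>x\<in>A. fscale (f x) (g x)) = (\<Sum>x\<in>A. fscale (f x) (restrict_section Z (g x)))"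
proof
  fix y show "restrict_section Z (\<Sum>x\<in>A. fscale (f x) (g x)) y = (\<Sum>x\<in>A. fscale (f x) (restrict_section Z (g x))) y"
    by (cases y) (simp add: restrict_section_def sum_fun_apply fscale_def)
qed

text \<open>Coordinate sections restrict to those of the same index; the ones outside the level of
  \<open>i\<close> restrict to 0 and drop out of the sum.\<close>

lemma restrict_section_expand:
  fixes s :: "int set \<times> (int \<Rightarrow> 'k::{alg_closed_field, field_char_0}) set \<Rightarrow> 'k"
  assumes ij: "i \<le> j" and s: "s \<in> psections j"
  shows "restrict_section (grass_step (Suc i)) s = (\<Sum>T\<in>maya (Suc i). fscale (coef j s T) (psec i T))"
proof -
  have "restrict_section (grass_step (Suc i)) s =
      restrict_section (grass_step (Suc i)) (\<Sum>T\<in>maya (Suc j). fscale (coef j s T) (psec j T))"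
    using section_coef[OF s] by (rule arg_cong)
  also have "\<dots> = (\<Sum>T\<in>maya (Suc j). fscale (coef j s T) (psec i T))"
    unfolding restrict_section_combination restrict_psec_le[OF ij] ..
  also have "\<dots> = (\<Sum>T\<in>maya (Suc i). fscale (coef j s T) (psec i T))"
    using ij by (intro sum.mono_neutral_right finite_maya maya_mono) (auto simp: psec_outside)
  finally show ?thesis .
qed

lemma restrict_section_section:
  fixes s :: "int set \<times> (int \<Rightarrow> 'k::{alg_closed_field, field_char_0}) set \<Rightarrow> 'k"
  assumes "i \<le> j" "s \<in> psections j"
  shows "restrict_section (grass_step (Suc i)) s \<in> psections i"
  unfolding restrict_section_expand[OF assms]
  by (intro fun_vs.subspace_sum[OF subspace_sections] fun_vs.subspace_scale[OF subspace_sections] psec_section)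

lemma coef_restrict_section:
  fixes s :: "int set \<times> (int \<Rightarrow> 'k::{alg_closed_field, field_char_0}) set \<Rightarrow> 'k"
  assumes "i \<le> j" "s \<in> psections j" and S: "S \<in> maya (Suc i)"
  shows "coef i (restrict_section (grass_step (Suc i)) s) S = coef j s S"
proof -
  have "coef i (restrict_section (grass_step (Suc i)) s) S = (\<Sum>T\<in>maya (Suc i). if T = S then coef j s S else 0)"
    unfolding restrict_section_expand[OF assms(1,2)] coef_sum using S
    by (intro sum.cong refl) (auto simp: coef_psec)
  then show ?thesis using S finite_maya[of "Suc i"] by simp
qed

text \<open>In terms of semi-infinite sets the transition maps keep the index: adding the rows from
  \<open>- n'\<close> to \<open>- n - 1\<close> to \<open>J\<close> does not change the set.\<close>

lemma block_subst_mdet: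
  assumes n: "n \<le> n'" and T: "T \<in> maya n'"
  shows "block_subst n n (mdet n' T) = (if T \<in> maya n then mdet n T else (0 :: (_, 'k::field) mpoly))"
proof -
  obtain J' where J': "J' \<in> minor_sets n' n'" "T = semi n' J'" using T by (auto simp: maya_def)
  have T': "mdet n' T = (minor_det n' J' :: (_, 'k) mpoly)" unfolding J'(2) by (rule mdet_semi[OF J'(1)])
  have block: "semi n J = semi n' ({- int n'..<- int n} \<union> J)" for J
    using n by (auto simp: semi_def)
  show ?thesis
  proof (cases "T \<in> maya n")
    case True
    then obtain J where J: "J \<in> minor_sets n n" "T = semi n J" by (auto simp: maya_def)
    have "J' = T \<inter> {- int n'..}" unfolding J'(2) using J'(1) by (simp add: semi_Int)
    also have "\<dots> = {- int n'..<- int n} \<union> J" unfolding J(2) semi_def using n J(1) by (auto simp: minor_sets_def)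
    finally have "block_subst n n (minor_det n' J') = (minor_det n J :: (_, 'k) mpoly)"
      by (rule block_subst_cases(1)[OF n J'(1) J(1)])
    moreover have "mdet n T = (minor_det n J :: (_, 'k) mpoly)" unfolding J(2) by (rule mdet_semi[OF J(1)])
    ultimately show ?thesis using True T' by simp
  next
    case False
    have "\<not> (\<exists>J\<in>minor_sets n n. J' = {- int n'..<- int n} \<union> J)"
    proof
      assume "\<exists>J\<in>minor_sets n n. J' = {- int n'..<- int n} \<union> J"
      then obtain J where J: "J \<in> minor_sets n n" "J' = {- int n'..<- int n} \<union> J" by blast
      then have "T = semi n J" using J'(2) block by simp
      then show False using False J(1) by (simp add: maya_def)
    qed
    from block_subst_cases(2)[OF n J'(1) this] show ?thesis
      using False T' by simp
  qed
qed

text \<open>Restriction keeps the coefficients whose index lies in the lower level, and the block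
  substitution keeps the minors with these indices and kills the others.\<close>

lemma block_subst_sec_det:
  fixes s :: "int set \<times> (int \<Rightarrow> 'k::{alg_closed_field, field_char_0}) set \<Rightarrow> 'k"
  assumes ij: "i \<le> j" and s: "s \<in> psections j"
  shows "block_subst (Suc i) (Suc i) (sec_det j s) = sec_det i (restrict_section (grass_step (Suc i)) s)"
proof -
  have "block_subst (Suc i) (Suc i) (sec_det j s) =
      (\<Sum>T\<in>maya (Suc j). mp_const (coef j s T) * (if T \<in> maya (Suc i) then mdet (Suc i) T else 0))"
    unfolding sec_det_def mp_subst.hom_sum
    using ij by (intro sum.cong refl) (simp add: mp_subst.hom_mult block_subst_mdet)
  also have "\<dots> = (\<Sum>T\<in>maya (Suc i). mp_const (coef j s T) * (if T \<in> maya (Suc i) then mdet (Suc i) T else 0))"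
    using ij by (intro sum.mono_neutral_right finite_maya maya_mono) auto
  also have "\<dots> = sec_det i (restrict_section (grass_step (Suc i)) s)"
    unfolding sec_det_def by (intro sum.cong refl) (simp add: coef_restrict_section[OF ij s])
  finally show ?thesis .
qed

lemma kalg_hom_inv:
  assumes h: "h \<in> kalg_hom A B" and bij: "bij_betw h (carrier A) (carrier B)"
    and A: "ring A" "\<And>c. scal A c \<in> carrier A"
  shows "inv_into (carrier A) h \<in> kalg_hom B A"
proof -
  interpret ring A by fact
  have inj: "inj_on h (carrier A)" and im: "h ` carrier A = carrier B" using bij by (simp_all add: bij_betw_def)
  let ?g = "inv_into (carrier A) h"
  have g: "?g y \<in> carrier A" "h (?g y) = y" if "y \<in> carrier B" for y
    using that unfolding im[symmetric] by (simp_all add: inv_into_into f_inv_into_f)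
  note eq = inv_into_f_eq[OF inj]
  show ?thesis
  proof (rule kalg_homI)
    show "?g (x \<otimes>\<^bsub>B\<^esub> y) = ?g x \<otimes>\<^bsub>A\<^esub> ?g y" if "x \<in> carrier B" "y \<in> carrier B" for x y
      by (rule eq) (simp_all add: g that kalg_hom_mult[OF h])
    show "?g (x \<oplus>\<^bsub>B\<^esub> y) = ?g x \<oplus>\<^bsub>A\<^esub> ?g y" if "x \<in> carrier B" "y \<in> carrier B" for x y
      by (rule eq) (simp_all add: g that kalg_hom_add[OF h])
    show "?g \<one>\<^bsub>B\<^esub> = \<one>\<^bsub>A\<^esub>" by (rule eq) (simp_all add: kalg_hom_one[OF h])
    show "?g (scal B c) = scal A c" for c by (rule eq) (simp_all add: A(2) kalg_hom_scal[OF h])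
  qed (rule g(1))
qed

abbreviation level_ring ::
  "nat \<Rightarrow> ('k::field, (int set \<times> (int \<Rightarrow> 'k) set \<Rightarrow> 'k, 'k) mpoly set set) kalg" where
  "level_ring i \<equiv> coord_ring_at grass_filt pluecker_bundle i"

abbreviation level_restrict :: "nat \<Rightarrow> nat
    \<Rightarrow> (int set \<times> (int \<Rightarrow> 'k::field) set \<Rightarrow> 'k, 'k) mpoly set set \<Rightarrow> (int set \<times> (int \<Rightarrow> 'k) set \<Rightarrow> 'k, 'k) mpoly set set" where
  "level_restrict i j \<equiv> coord_restrict grass_filt pluecker_bundle i j"

text \<open>The candidate for the restriction map is the block substitution transported by the two
  isomorphisms; it has the right values on the coordinate forms, and these determine it.\<close>

lemma coord_iso_restrict:
  fixes X :: "(int set \<times> (int \<Rightarrow> 'k::{alg_closed_field, field_char_0}) set \<Rightarrow> 'k, 'k) mpoly set set"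
  assumes ij: "i \<le> j" and X: "X \<in> carrier (level_ring j)"
  shows "level_restrict i j X \<in> carrier (level_ring i)"
    and "coord_iso i (level_restrict i j X) = block_subst (Suc i) (Suc i) (coord_iso j X)"
proof -
  let ?g = "inv_into (carrier (level_ring i)) (coord_iso i) :: _ \<Rightarrow> (int set \<times> (int \<Rightarrow> 'k) set \<Rightarrow> 'k, 'k) mpoly set set"
  let ?h = "\<lambda>X. ?g (block_subst (Suc i) (Suc i) (coord_iso j X))"
  let ?r = "{(coord_form_at grass_filt pluecker_bundle j s,
      coord_form_at grass_filt pluecker_bundle i (restrict_section (pts (grass_filt i)) s)) | s.
        s \<in> (psections j :: (int set \<times> (int \<Rightarrow> 'k) set \<Rightarrow> 'k) set)}"
  have le: "Suc i \<le> Suc j" using ij by simp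
  have inj: "inj_on (coord_iso i) (carrier (level_ring i :: ('k, _) kalg))"
    and im: "coord_iso i ` carrier (level_ring i :: ('k, _) kalg) = kd (Suc i) (Suc i)"
    using coord_iso_bij[of i] by (auto simp: bij_betw_def)
  have h: "?h \<in> kalg_hom (level_ring j) (level_ring i)"
    by (rule kalg_hom_comp[OF kalg_hom_comp[OF coord_iso_hom block_subst_hom[OF le]]
          kalg_hom_inv[OF coord_iso_hom coord_iso_bij ring_coord_ring scal_coord_ring]])
  have r: "x \<in> carrier (level_ring j) \<and> ?h x = y" if xy: "(x, y) \<in> ?r" for x y
  proof -
    obtain s where s: "s \<in> psections j" "x = coord_form_at grass_filt pluecker_bundle j s"
        "y = coord_form_at grass_filt pluecker_bundle i (restrict_section (grass_step (Suc i)) s)"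
      using xy unfolding pts_grass_filt by blast
    have s': "restrict_section (grass_step (Suc i)) s \<in> psections i" by (rule restrict_section_section[OF ij s(1)])
    have "?g (sec_det i (restrict_section (grass_step (Suc i)) s)) = y"
      unfolding s(3) by (rule inv_into_f_eq[OF inj coord_form_carrier[OF s'] coord_iso_form[OF s']])
    then show ?thesis
      unfolding s(2) coord_iso_form[OF s(1)] block_subst_sec_det[OF ij s(1)] using coord_form_carrier[OF s(1)] by blast
  qed
  have eq: "level_restrict i j X = ?h X"
    unfolding coord_restrict_def
  proof (rule the_kalg_hom_eq[OF h ring_coord_ring scal_coord_ring r _ X])
    fix h' and x :: "(int set \<times> (int \<Rightarrow> 'k) set \<Rightarrow> 'k, 'k) mpoly set set"
    assume h': "h' \<in> kalg_hom (level_ring j) (level_ring i)"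
      and agree: "\<And>x y. (x, y) \<in> ?r \<Longrightarrow> h' x = y" and x: "x \<in> carrier (level_ring j)"
    show "h' x = ?h x"
    proof (rule coord_hom_unique[OF h' h _ x])
      fix s :: "int set \<times> (int \<Rightarrow> 'k) set \<Rightarrow> 'k" assume "s \<in> psections j"
      then have m: "(coord_form_at grass_filt pluecker_bundle j s,
          coord_form_at grass_filt pluecker_bundle i (restrict_section (pts (grass_filt i)) s)) \<in> ?r" by blast
      show "h' (coord_form_at grass_filt pluecker_bundle j s) = ?h (coord_form_at grass_filt pluecker_bundle j s)"
        using agree[OF m] conjunct2[OF r[OF m]] by (rule trans[OF _ sym])
    qed
  qed
  have "block_subst (Suc i) (Suc i) (coord_iso j X) \<in> coord_iso i ` carrier (level_ring i :: ('k, _) kalg)"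
    unfolding im by (rule block_subst_kd[OF le kalg_hom_closed[OF coord_iso_hom X]])
  then show "level_restrict i j X \<in> carrier (level_ring i)"
    and "coord_iso i (level_restrict i j X) = block_subst (Suc i) (Suc i) (coord_iso j X)"
    unfolding eq by (rule inv_into_into, rule f_inv_into_f)
qed

section \<open>Comparison of the two inverse limits\<close>

lemma inverse_limit_sel:
  "carrier (inverse_limit I rel A f) = {a \<in> (\<Pi>\<^sub>E i\<in>I. carrier (A i)). \<forall>i\<in>I. \<forall>j\<in>I. rel i j \<longrightarrow> f i j (a j) = a i}"
  "monoid.mult (inverse_limit I rel A f) = (\<lambda>a b. \<lambda>i\<in>I. a i \<otimes>\<^bsub>A i\<^esub> b i)"
  "one (inverse_limit I rel A f) = (\<lambda>i\<in>I. \<one>\<^bsub>A i\<^esub>)"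
  "add (inverse_limit I rel A f) = (\<lambda>a b. \<lambda>i\<in>I. a i \<oplus>\<^bsub>A i\<^esub> b i)"
  "scal (inverse_limit I rel A f) = (\<lambda>c. \<lambda>i\<in>I. scal (A i) c)"
  by (simp_all add: inverse_limit_def)

text \<open>The component at \<open>(m, n)\<close> is read off from the diagonal level
  \<open>max m n\<close>, which is filtration step \<open>max m n - 1\<close>, since step
  \<open>i\<close> has \<open>m = n = Suc i\<close>.\<close>

definition limit_iso ::
  "(nat \<Rightarrow> (int set \<times> (int \<Rightarrow> 'k::field) set \<Rightarrow> 'k, 'k) mpoly set set) \<Rightarrow> nat \<times> nat \<Rightarrow> (int \<times> int, 'k) mpoly" where
  "limit_iso a = (\<lambda>(m, n)\<in>{1..} \<times> {1..}. block_subst m n (coord_iso (max m n - 1) (a (max m n - 1))))"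

lemma limit_iso_apply:
  "1 \<le> m \<Longrightarrow> 1 \<le> n \<Longrightarrow> limit_iso a (m, n) = block_subst m n (coord_iso (max m n - 1) (a (max m n - 1)))"
  by (simp add: limit_iso_def)

lemma limit_iso_extensional: "limit_iso a \<in> extensional ({1..} \<times> {1..})"
  unfolding limit_iso_def by (rule restrict_extensional)

context
  fixes H :: "('k::{alg_closed_field, field_char_0}, nat \<Rightarrow> (int set \<times> (int \<Rightarrow> 'k) set \<Rightarrow> 'k, 'k) mpoly set set) kalg"
  defines "H \<equiv> homog_coord_ring grass_filt pluecker_bundle"
begin

lemma limit_carrier: "a \<in> carrier H \<longleftrightarrow> (\<forall>i. a i \<in> carrier (level_ring i)) \<and> (\<forall>i j. i \<le> j \<longrightarrow> level_restrict i j (a j) = a i)"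
  unfolding H_def homog_coord_ring_def inverse_limit_sel by (auto simp: PiE_def Pi_def)

lemma limit_comp:
  assumes a: "a \<in> carrier H" and ij: "i \<le> j"
  shows "block_subst (Suc i) (Suc i) (coord_iso j (a j)) = coord_iso i (a i)"
proof -
  have "a j \<in> carrier (level_ring j)" "level_restrict i j (a j) = a i" using a ij unfolding limit_carrier by blast+
  then show ?thesis using coord_iso_restrict(2)[OF ij, of "a j"] by simp
qed

text \<open>Any sufficiently late step gives the same component, because the substitutions
  compose.\<close>

lemma limit_iso_eq:
  assumes a: "a \<in> carrier H" and mn: "1 \<le> m" "1 \<le> n" "m \<le> Suc j" "n \<le> Suc j"
  shows "limit_iso a (m, n) = block_subst m n (coord_iso j (a j))"
proof -
  let ?i = "max m n - 1"
  have "limit_iso a (m, n) = block_subst m n (block_subst (Suc ?i) (Suc ?i) (coord_iso j (a j)))"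
    unfolding limit_iso_apply[OF mn(1,2)] using mn by (subst limit_comp[OF a]) auto
  also have "\<dots> = block_subst m n (coord_iso j (a j))"
    using mn by (intro block_subst_comp) auto
  finally show ?thesis .
qed

lemma level_block_hom:
  assumes "1 \<le> m" "1 \<le> n"
  shows "(\<lambda>x :: (int set \<times> (int \<Rightarrow> 'k) set \<Rightarrow> 'k, 'k) mpoly set set. block_subst m n (coord_iso (max m n - 1) x)) \<in> kalg_hom (level_ring (max m n - 1)) (k_delta m n)"
proof -
  have le: "m \<le> Suc (max m n - 1)" by simp
  show ?thesis by (rule kalg_hom_comp[OF coord_iso_hom block_subst_hom[OF le]])
qed

lemma limit_iso_carrier:
  assumes a: "a \<in> carrier H"
  shows "limit_iso a \<in> carrier k_delta_inf"
  unfolding k_delta_inf_def inverse_limit_sel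
proof (intro CollectI conjI ballI impI PiE_I)
  fix x assume "x \<in> {1::nat..} \<times> {1::nat..}"
  then obtain m n where x: "x = (m, n)" "1 \<le> m" "1 \<le> n" by auto
  have "a (max m n - 1) \<in> carrier (level_ring (max m n - 1))" using a unfolding limit_carrier by blast
  then show "limit_iso a x \<in> carrier (case x of (m, n) \<Rightarrow> k_delta m n)"
    unfolding x(1) prod.case limit_iso_apply[OF x(2,3)] by (rule kalg_hom_closed[OF level_block_hom[OF x(2,3)]])
next
  fix x assume "x \<notin> {1::nat..} \<times> {1::nat..}"
  then show "limit_iso a x = undefined" using limit_iso_extensional[of a] by (rule extensional_arb[rotated])
next
  fix x y assume "x \<in> {1::nat..} \<times> {1::nat..}" "y \<in> {1::nat..} \<times> {1::nat..}"
    and "(case x of (m, n) \<Rightarrow> \<lambda>(m', n'). m \<le> m' \<and> n \<le> n') y"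
  then obtain m n m' n' where x: "x = (m, n)" "1 \<le> m" "1 \<le> n" and y: "y = (m', n')" "1 \<le> m'" "1 \<le> n'"
    and le: "m \<le> m'" "n \<le> n'" by auto
  let ?j = "max m' n' - 1"
  have aj: "a ?j \<in> carrier (level_ring ?j)" using a unfolding limit_carrier by blast
  have "delta_hom (m, n) (m', n') (limit_iso a (m', n')) = block_subst m n (limit_iso a (m', n'))"
    by (rule delta_hom_eq[OF le]) (unfold limit_iso_apply[OF y(2,3)], rule kalg_hom_closed[OF level_block_hom[OF y(2,3)] aj])
  also have "\<dots> = block_subst m n (coord_iso ?j (a ?j))"
    unfolding limit_iso_apply[OF y(2,3)] by (rule block_subst_comp[OF le])
  also have "\<dots> = limit_iso a (m, n)"
    using le by (intro limit_iso_eq[OF a x(2,3), symmetric]) auto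
  finally show "delta_hom x y (limit_iso a y) = limit_iso a x" unfolding x y .
qed

lemma limit_iso_hom: "limit_iso \<in> kalg_hom H k_delta_inf"
proof (rule kalg_homI)
  show "limit_iso a \<in> carrier k_delta_inf" if "a \<in> carrier H" for a using that by (rule limit_iso_carrier)
  fix a b assume ab: "a \<in> carrier H" "b \<in> carrier H"
  have c: "a i \<in> carrier (level_ring i)" "b i \<in> carrier (level_ring i)" for i using ab unfolding limit_carrier by blast+
  show "limit_iso (a \<otimes>\<^bsub>H\<^esub> b) = limit_iso a \<otimes>\<^bsub>k_delta_inf\<^esub> limit_iso b"
    unfolding H_def homog_coord_ring_def k_delta_inf_def inverse_limit_sel
    by (rule extensionalityI[OF limit_iso_extensional restrict_extensional])
      (auto simp del: One_nat_def simp: limit_iso_apply kalg_hom_mult[OF level_block_hom c])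
  show "limit_iso (a \<oplus>\<^bsub>H\<^esub> b) = limit_iso a \<oplus>\<^bsub>k_delta_inf\<^esub> limit_iso b"
    unfolding H_def homog_coord_ring_def k_delta_inf_def inverse_limit_sel
    by (rule extensionalityI[OF limit_iso_extensional restrict_extensional])
      (auto simp del: One_nat_def simp: limit_iso_apply kalg_hom_add[OF level_block_hom c])
next
  show "limit_iso \<one>\<^bsub>H\<^esub> = \<one>\<^bsub>k_delta_inf\<^esub>"
    unfolding H_def homog_coord_ring_def k_delta_inf_def inverse_limit_sel
    by (rule extensionalityI[OF limit_iso_extensional restrict_extensional])
      (auto simp del: One_nat_def simp: limit_iso_apply kalg_hom_one[OF level_block_hom])
  show "limit_iso (scal H c) = scal k_delta_inf c" for c
    unfolding H_def homog_coord_ring_def k_delta_inf_def inverse_limit_sel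
    by (rule extensionalityI[OF limit_iso_extensional restrict_extensional])
      (auto simp del: One_nat_def simp: limit_iso_apply kalg_hom_scal[OF level_block_hom])
qed

lemma limit_iso_diag:
  assumes "a \<in> carrier H"
  shows "limit_iso a (Suc i, Suc i) = coord_iso i (a i)"
proof -
  have ai: "a i \<in> carrier (level_ring i)" using assms unfolding limit_carrier by blast
  have "limit_iso a (Suc i, Suc i) = block_subst (Suc i) (Suc i) (coord_iso i (a i))"
    by (rule limit_iso_eq[OF assms]) simp_all
  then show ?thesis unfolding block_subst_id[OF kalg_hom_closed[OF coord_iso_hom ai]] .
qed

text \<open>The diagonal components give back \<open>coord_iso i (a i)\<close>, whence injectivity.
  A preimage of \<open>b\<close> is built from its diagonal, and the compatibility of
  \<open>b\<close> determines the other components.\<close>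

lemma limit_iso_bij: "bij_betw limit_iso (carrier H) (carrier k_delta_inf)"
  unfolding bij_betw_def
proof
  have inj: "inj_on (coord_iso i) (carrier (level_ring i :: ('k, _) kalg))"
    and im: "coord_iso i ` carrier (level_ring i :: ('k, _) kalg) = kd (Suc i) (Suc i)" for i
    using coord_iso_bij[of i] by (auto simp: bij_betw_def)
  show "inj_on limit_iso (carrier H)"
  proof (rule inj_onI, rule ext)
    fix a b i assume ab: "a \<in> carrier H" "b \<in> carrier H" and "limit_iso a = limit_iso b"
    then have "coord_iso i (a i) = coord_iso i (b i)"
      using limit_iso_diag[OF ab(1), of i] limit_iso_diag[OF ab(2), of i] by simp
    moreover have "a i \<in> carrier (level_ring i)" "b i \<in> carrier (level_ring i)" using ab unfolding limit_carrier by blast+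
    ultimately show "a i = b i" by (rule inj_onD[OF inj])
  qed
  show "limit_iso ` carrier H = carrier k_delta_inf"
  proof (intro equalityI subsetI)
    fix b assume "b \<in> limit_iso ` carrier H"
    then show "b \<in> carrier k_delta_inf" using limit_iso_carrier by blast
  next
    fix b :: "nat \<times> nat \<Rightarrow> (int \<times> int, 'k) mpoly" assume b: "b \<in> carrier k_delta_inf"
    have bP: "b \<in> (\<Pi>\<^sub>E x\<in>{1..} \<times> {1..}. carrier (case x of (m, n) \<Rightarrow> k_delta m n))"
      using b unfolding k_delta_inf_def inverse_limit_sel by blast
    then have ext: "b \<in> extensional ({1..} \<times> {1..})" unfolding PiE_def by (rule IntD2)
    have bkd: "b (m, n) \<in> kd m n" if "1 \<le> m" "1 \<le> n" for m n
      using PiE_mem[OF bP, of "(m, n)"] that by simp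
    have comp: "block_subst m n (b (m', n')) = b (m, n)" if "1 \<le> m" "1 \<le> n" "m \<le> m'" "n \<le> n'" for m n m' n'
    proof -
      have "delta_hom (m, n) (m', n') (b (m', n')) = b (m, n)"
        using b that unfolding k_delta_inf_def inverse_limit_sel by auto
      then show ?thesis using delta_hom_eq[OF that(3,4) bkd] that by simp
    qed
    define a where "a i = inv_into (carrier (level_ring i)) (coord_iso i) (b (Suc i, Suc i))" for i
    have a: "a i \<in> carrier (level_ring i)" "coord_iso i (a i) = b (Suc i, Suc i)" for i
    proof -
      have "b (Suc i, Suc i) \<in> coord_iso i ` carrier (level_ring i)" unfolding im by (rule bkd) simp_all
      then show "a i \<in> carrier (level_ring i)" "coord_iso i (a i) = b (Suc i, Suc i)"
        unfolding a_def by (rule inv_into_into, rule f_inv_into_f)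
    qed
    have "level_restrict i j (a j) = a i" if ij: "i \<le> j" for i j
    proof (rule inj_onD[OF inj _ coord_iso_restrict(1)[OF ij a(1)] a(1)])
      show "coord_iso i (level_restrict i j (a j)) = coord_iso i (a i)"
        unfolding coord_iso_restrict(2)[OF ij a(1)] a(2) using ij by (intro comp) simp_all
    qed
    then have aH: "a \<in> carrier H" unfolding limit_carrier using a(1) by blast
    have "limit_iso a = b"
    proof (rule extensionalityI[OF limit_iso_extensional ext])
      fix x assume "x \<in> {1::nat..} \<times> {1::nat..}"
      then obtain m n where x: "x = (m, n)" "1 \<le> m" "1 \<le> n" by auto
      show "limit_iso a x = b x"
        unfolding x(1) limit_iso_apply[OF x(2,3)] a(2) using x by (intro comp) auto
    qed
    then show "b \<in> limit_iso ` carrier H" using aH by blast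
  qed
qed

lemma homog_coord_ring_grass: "kalg_isomorphic H k_delta_inf"
  unfolding kalg_isomorphic_def using limit_iso_hom limit_iso_bij by blast

end


theorem mainTheorem1:
  shows "\<exists>L :: (int set, (int \<Rightarrow> 'k::{alg_closed_field, field_char_0}) set, 'k) lbundle.
    projective_ind_variety grass_inf grass_filt L \<and>
    (\<forall>i. pluecker_embedded L i) \<and>
    kalg_isomorphic (homog_coord_ring grass_filt L) k_delta_inf"
  by (intro exI[of _ pluecker_bundle] conjI allI projective_ind_variety_grass pluecker_embedded_grass
      homog_coord_ring_grass)

end
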